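(* Let $\Bbbk$ be an algebraically closed field of characteristic $p>0$, let $Y_2$ be the Yangian of $\mathfrak{gl}_2$ over $\Bbbk$, and let $I_p:=Y_2Z_p(Y_2)_+$. Then $I_p$ is a Hopf ideal of $Y_2$. In particular, the restricted Yangian $Y_2^{[p]}=Y_2/I_p$ inherits from $Y_2$ a Hopf algebra structure.
   Context: **Yangian.** $\Bbbk$ is an algebraically closed field of characteristic $p>0$. $Y_2$ is the associative unital $\Bbbk$-algebra with generators $t_{i,j}^{(r)}$ ($1\le i,j\le 2$, $r>0$) and relations $$[t_{i,j}^{(r)},t_{k,l}^{(s)}]=\sum_{t=0}^{\min(r,s)-1}\left(t_{k,j}^{(t)}t_{i,l}^{(r+s-1-t)}-t_{k,j}^{(r+s-1-t)}t_{i,l}^{(t)}\right),\qquad t_{i,j}^{(0)}:=\delta_{i,j}.$$ Put $t_{i,j}(u)=\sum_{r\ge0}t_{i,j}^{(r)}u^{-r}\in Y_2[[u^{-1}]]$ and $T(u)=(t_{i,j}(u))_{1\le i,j\le 2}$. **Drinfeld generators.** They are defined by the Gauss factorization: $t_{1,1}(u)=d_1(u)$, $t_{1,2}(u)=d_1(u)e(u)$, $t_{2,1}(u)=f(u)d_1(u)$, $t_{2,2}(u)=f(u)d_1(u)e(u)+d_2(u)$, with $d_i(u)=\sum_{r\ge0}d_i^{(r)}u^{-r}$, $e(u)=\sum_{r>0}e^{(r)}u^{-r}$, $f(u)=\sum_{r>0}f^{(r)}u^{-r}$. **$p$-center.** Let $b_i(u)=\sum_{r\ge0}b_i^{(r)}u^{-r}:=d_i(u)d_i(u-1)\cdots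 d_i(u-p+1)$ (each $d_i(u-c)$ expanded in $u^{-1}$). The elements $b_i^{(rp)}$ ($i=1,2$, $r>0$) and $(e^{(r)})^p,(f^{(r)})^p$ ($r>0$) are central and algebraically independent; the subalgebra they generate is the $p$-center $Z_p(Y_2)$, and $Z_p(Y_2)_+$ is the ideal of $Z_p(Y_2)$ generated by these elements. **Hopf structure on $Y_2$.** Comultiplication $\Delta(t_{i,j}(u))=\sum_{k=1}^2t_{i,k}(u)\otimes t_{k,j}(u)$, antipode $S(t_{i,j}(u))=t'_{i,j}(u)$ where $t'_{i,j}(u)$ is the $(i,j)$ entry of $T(u)^{-1}$, counit $t_{i,j}(u)\mapsto\delta_{i,j}$. *)

theory Defs
  imports
    "HOL-Analysis.Cartesian_Space"
    "HOL-Algebra.Algebraic_Closure_Type"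
    "HOL-Algebra.Ideal_Product"
    "HOL-Library.Poly_Mapping"
    "HOL-Library.Numeral_Type"
    "HOL-Computational_Algebra.Formal_Power_Series"
begin

section \<open>Algebras over a field\<close>

text \<open>
  The ground field is a type \<open>'k\<close>. An associative unital algebra over it is a record of
  type \<open>('k, 'a) module\<close>, that is, a ring together with a scalar multiplication. (The
  library locale \<^locale>\<open>algebra\<close> is restricted to commutative algebras.)
\<close>

definition with_scalars :: "'a ring \<Rightarrow> ('k \<Rightarrow> 'a \<Rightarrow> 'a) \<Rightarrow> ('k, 'a) module" where
  "with_scalars R sc = ring.extend R (module.fields sc)"

definition scalars :: "('k::field, 'k) module" where
  "scalars = with_scalars ring_of_type_algebra (*)"

locale k_algebra = ring A for A :: "('k::field, 'a) module" (structure) +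
  assumes module_over_scalars: "Module.module (ring_of_type_algebra :: 'k ring) A"
    and smult_mult_left: "x \<in> carrier A \<Longrightarrow> y \<in> carrier A \<Longrightarrow> (c \<odot> x) \<otimes> y = c \<odot> (x \<otimes> y)"
    and smult_mult_right: "x \<in> carrier A \<Longrightarrow> y \<in> carrier A \<Longrightarrow> x \<otimes> (c \<odot> y) = c \<odot> (x \<otimes> y)"

definition linear_maps :: "('k, 'a) module \<Rightarrow> ('k, 'b) module \<Rightarrow> ('a \<Rightarrow> 'b) set" where
  "linear_maps A B = {h \<in> carrier A \<rightarrow> carrier B.
     (\<forall>x\<in>carrier A. \<forall>y\<in>carrier A. h (x \<oplus>\<^bsub>A\<^esub> y) = h x \<oplus>\<^bsub>B\<^esub> h y) \<and>
     (\<forall>c. \<forall>x\<in>carrier A. h (c \<odot>\<^bsub>A\<^esub> x) = c \<odot>\<^bsub>B\<^esub> h x)}"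

definition algebra_homs :: "('k, 'a) module \<Rightarrow> ('k, 'b) module \<Rightarrow> ('a \<Rightarrow> 'b) set" where
  "algebra_homs A B = ring_hom A B \<inter> linear_maps A B"

definition algebra_antihoms :: "('k, 'a) module \<Rightarrow> ('k, 'b) module \<Rightarrow> ('a \<Rightarrow> 'b) set" where
  "algebra_antihoms A B = {h \<in> linear_maps A B. h \<one>\<^bsub>A\<^esub> = \<one>\<^bsub>B\<^esub> \<and>
     (\<forall>x\<in>carrier A. \<forall>y\<in>carrier A. h (x \<otimes>\<^bsub>A\<^esub> y) = h y \<otimes>\<^bsub>B\<^esub> h x)}"

inductive_set lin_span :: "('k, 'a) module \<Rightarrow> 'a set \<Rightarrow> 'a set"
  for A :: "('k, 'a) module" and S :: "'a set" where
  span_zero: "\<zero>\<^bsub>A\<^esub> \<in> lin_span A S"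
| span_base: "x \<in> S \<Longrightarrow> x \<in> lin_span A S"
| span_add: "x \<in> lin_span A S \<Longrightarrow> y \<in> lin_span A S \<Longrightarrow> x \<oplus>\<^bsub>A\<^esub> y \<in> lin_span A S"
| span_smult: "x \<in> lin_span A S \<Longrightarrow> c \<odot>\<^bsub>A\<^esub> x \<in> lin_span A S"

inductive_set subalgebra_generated :: "('k, 'a) module \<Rightarrow> 'a set \<Rightarrow> 'a set"
  for A :: "('k, 'a) module" and S :: "'a set" where
  subalg_one: "\<one>\<^bsub>A\<^esub> \<in> subalgebra_generated A S"
| subalg_base: "x \<in> S \<Longrightarrow> x \<in> subalgebra_generated A S"
| subalg_add: "x \<in> subalgebra_generated A S \<Longrightarrow> y \<in> subalgebra_generated A S
    \<Longrightarrow> x \<oplus>\<^bsub>A\<^esub> y \<in> subalgebra_generated A S"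
| subalg_mult: "x \<in> subalgebra_generated A S \<Longrightarrow> y \<in> subalgebra_generated A S
    \<Longrightarrow> x \<otimes>\<^bsub>A\<^esub> y \<in> subalgebra_generated A S"
| subalg_smult: "x \<in> subalgebra_generated A S \<Longrightarrow> c \<odot>\<^bsub>A\<^esub> x \<in> subalgebra_generated A S"

definition quotient_algebra :: "('k, 'a) module \<Rightarrow> 'a set \<Rightarrow> ('k, 'a set) module" where
  "quotient_algebra A I =
     with_scalars (A Quot I) (\<lambda>c C. \<Union>x\<in>C. I +>\<^bsub>A\<^esub> (c \<odot>\<^bsub>A\<^esub> x))"


section \<open>Tensor products of algebras\<close>

definition monoid_algebra :: "('a, 'm) monoid_scheme \<Rightarrow> ('k::field, 'a \<Rightarrow>\<^sub>0 'k) module" where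
  "monoid_algebra M =
     \<lparr>carrier = {x. Poly_Mapping.keys x \<subseteq> carrier M},
      monoid.mult = (\<lambda>x y. \<Sum>a\<in>Poly_Mapping.keys x. \<Sum>b\<in>Poly_Mapping.keys y.
        Poly_Mapping.single (a \<otimes>\<^bsub>M\<^esub> b) (Poly_Mapping.lookup x a * Poly_Mapping.lookup y b)),
      one = Poly_Mapping.single \<one>\<^bsub>M\<^esub> 1,
      ring.zero = 0,
      add = (+),
      module.smult = (\<lambda>c. Poly_Mapping.map ((*) c))\<rparr>"

text \<open>
  \<open>A \<otimes> B\<close> is the free vector space on \<open>A \<times> B\<close> modulo the bilinearity relations. The free
  space carries the convolution product \<open>(a, b) (a', b') = (a a', b b')\<close>, for which the
  relations span an ideal.
\<close>

definition free_tensor :: "('k::field, 'a) module \<Rightarrow> ('k, 'b) module \<Rightarrow>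
    ('k, ('a \<times> 'b) \<Rightarrow>\<^sub>0 'k) module" where
  "free_tensor A B = monoid_algebra (A \<times>\<times> B)"

definition bilinearity_relations :: "('k::field, 'a) module \<Rightarrow> ('k, 'b) module \<Rightarrow>
    (('a \<times> 'b) \<Rightarrow>\<^sub>0 'k) set" where
  "bilinearity_relations A B =
     (let g = (\<lambda>a b. Poly_Mapping.single (a, b) 1) in
       {g (a \<oplus>\<^bsub>A\<^esub> a') b - g a b - g a' b | a a' b.
          a \<in> carrier A \<and> a' \<in> carrier A \<and> b \<in> carrier B} \<union>
       {g a (b \<oplus>\<^bsub>B\<^esub> b') - g a b - g a b' | a b b'.
          a \<in> carrier A \<and> b \<in> carrier B \<and> b' \<in> carrier B} \<union>
       {g (c \<odot>\<^bsub>A\<^esub> a) b - Poly_Mapping.single (a, b) c | c a b.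
          a \<in> carrier A \<and> b \<in> carrier B} \<union>
       {g a (c \<odot>\<^bsub>B\<^esub> b) - Poly_Mapping.single (a, b) c | c a b.
          a \<in> carrier A \<and> b \<in> carrier B})"

definition tensor_kernel :: "('k::field, 'a) module \<Rightarrow> ('k, 'b) module \<Rightarrow>
    (('a \<times> 'b) \<Rightarrow>\<^sub>0 'k) set" where
  "tensor_kernel A B = lin_span (free_tensor A B) (bilinearity_relations A B)"

type_synonym ('k, 'a, 'b) tensor = "(('a \<times> 'b) \<Rightarrow>\<^sub>0 'k) set"

definition tensor_algebra :: "('k::field, 'a) module \<Rightarrow> ('k, 'b) module \<Rightarrow>
    ('k, ('k, 'a, 'b) tensor) module" where
  "tensor_algebra A B = quotient_algebra (free_tensor A B) (tensor_kernel A B)"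

definition pure_tensor :: "('k::field, 'a) module \<Rightarrow> ('k, 'b) module \<Rightarrow> 'a \<Rightarrow> 'b \<Rightarrow>
    ('k, 'a, 'b) tensor" where
  "pure_tensor A B a b =
     tensor_kernel A B +>\<^bsub>free_tensor A B\<^esub> Poly_Mapping.single (a, b) 1"

text \<open>
  The linear map \<open>A \<otimes> B \<rightarrow> C\<close>, \<open>a \<otimes> b \<mapsto> \<beta> a b\<close>, induced by a bilinear map \<open>\<beta>\<close>. For bilinear
  \<open>\<beta>\<close> the value does not depend on the chosen representative of the coset \<open>\<xi>\<close>.
\<close>

definition tensor_lift :: "('k::field, 'c) module \<Rightarrow> ('a \<Rightarrow> 'b \<Rightarrow> 'c) \<Rightarrow>
    ('k, 'a, 'b) tensor \<Rightarrow> 'c" where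
  "tensor_lift C \<beta> \<xi> =
     (let x = (SOME x. x \<in> \<xi>) in
       \<Oplus>\<^bsub>C\<^esub>q\<in>Poly_Mapping.keys x. Poly_Mapping.lookup x q \<odot>\<^bsub>C\<^esub> \<beta> (fst q) (snd q))"

definition tensor_map :: "('k::field, 'c) module \<Rightarrow> ('k, 'd) module \<Rightarrow> ('a \<Rightarrow> 'c) \<Rightarrow> ('b \<Rightarrow> 'd) \<Rightarrow>
    ('k, 'a, 'b) tensor \<Rightarrow> ('k, 'c, 'd) tensor" where
  "tensor_map C D f g =
     tensor_lift (tensor_algebra C D) (\<lambda>a b. pure_tensor C D (f a) (g b))"

definition tensor_assoc :: "('k::field, 'a) module \<Rightarrow>
    ('k, ('k, 'a, 'a) tensor, 'a) tensor \<Rightarrow> ('k, 'a, ('k, 'a, 'a) tensor) tensor" where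
  "tensor_assoc A =
     (let AA = tensor_algebra A A; AAA = tensor_algebra A AA in
       tensor_lift AAA (\<lambda>\<xi> c.
         tensor_lift AAA (\<lambda>a b. pure_tensor A AA a (pure_tensor A A b c)) \<xi>))"


section \<open>Hopf algebras and Hopf ideals\<close>

locale hopf_algebra = k_algebra A for A :: "('k::field, 'a) module" (structure) +
  fixes \<Delta> :: "'a \<Rightarrow> ('k, 'a, 'a) tensor" and \<epsilon> :: "'a \<Rightarrow> 'k" and S :: "'a \<Rightarrow> 'a"
  assumes comult_hom: "\<Delta> \<in> algebra_homs A (tensor_algebra A A)"
    and counit_hom: "\<epsilon> \<in> algebra_homs A scalars"
    and antipode_linear: "S \<in> linear_maps A A"
    and coassoc: "x \<in> carrier A \<Longrightarrow>
      tensor_assoc A (tensor_map (tensor_algebra A A) A \<Delta> (\<lambda>a. a) (\<Delta> x)) =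
      tensor_map A (tensor_algebra A A) (\<lambda>a. a) \<Delta> (\<Delta> x)"
    and counit_left: "x \<in> carrier A \<Longrightarrow> tensor_lift A (\<lambda>a b. \<epsilon> a \<odot> b) (\<Delta> x) = x"
    and counit_right: "x \<in> carrier A \<Longrightarrow> tensor_lift A (\<lambda>a b. \<epsilon> b \<odot> a) (\<Delta> x) = x"
    and antipode_left: "x \<in> carrier A \<Longrightarrow> tensor_lift A (\<lambda>a b. S a \<otimes> b) (\<Delta> x) = \<epsilon> x \<odot> \<one>"
    and antipode_right: "x \<in> carrier A \<Longrightarrow> tensor_lift A (\<lambda>a b. a \<otimes> S b) (\<Delta> x) = \<epsilon> x \<odot> \<one>"

locale hopf_ideal = hopf_algebra + ideal I A for I +
  assumes comult_ideal: "x \<in> I \<Longrightarrow>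
      \<Delta> x \<in> lin_span (tensor_algebra A A)
        ({pure_tensor A A a b | a b. a \<in> I \<and> b \<in> carrier A} \<union>
         {pure_tensor A A a b | a b. a \<in> carrier A \<and> b \<in> I})"
    and counit_ideal: "x \<in> I \<Longrightarrow> \<epsilon> x = 0"
    and antipode_ideal: "x \<in> I \<Longrightarrow> S x \<in> I"

locale hopf_hom =
  source: hopf_algebra A \<Delta> \<epsilon> S + target: hopf_algebra B \<Delta>' \<epsilon>' S'
  for A :: "('k::field, 'a) module" and \<Delta> \<epsilon> S
    and B :: "('k, 'b) module" and \<Delta>' \<epsilon>' S' +
  fixes h :: "'a \<Rightarrow> 'b"
  assumes algebra_hom: "h \<in> algebra_homs A B"
    and comult_compat: "x \<in> carrier A \<Longrightarrow> \<Delta>' (h x) = tensor_map B B h h (\<Delta> x)"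
    and counit_compat: "x \<in> carrier A \<Longrightarrow> \<epsilon>' (h x) = \<epsilon> x"
    and antipode_compat: "x \<in> carrier A \<Longrightarrow> S' (h x) = h (S x)"


section \<open>The Yangian of $\mathfrak{gl}_2$\<close>

datatype 'g free_monoid = Word "'g list"

instantiation free_monoid :: (type) monoid_add
begin

definition zero_free_monoid :: "'a free_monoid" where
  "zero_free_monoid = Word []"

fun plus_free_monoid :: "'a free_monoid \<Rightarrow> 'a free_monoid \<Rightarrow> 'a free_monoid" where
  "Word v + Word w = Word (v @ w)"

instance
proof
  fix a b c :: "'a free_monoid"
  show "a + b + c = a + (b + c)" by (cases a; cases b; cases c) simp
  show "0 + a = a" by (cases a) (simp add: zero_free_monoid_def)
  show "a + 0 = a" by (cases a) (simp add: zero_free_monoid_def)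
qed

end

text \<open>
  Functions of finite support on words, with the convolution product of
  \<^theory>\<open>HOL-Library.Poly_Mapping\<close>, form the free associative algebra. The index set
  \<open>{1, 2}\<close> is the type \<^typ>\<open>2\<close>; the letter \<open>(i, j, r)\<close> stands for the generator $t_{i,j}^{(r+1)}$.
\<close>

type_synonym yangian_letter = "2 \<times> 2 \<times> nat"
type_synonym 'k yangian_free = "yangian_letter free_monoid \<Rightarrow>\<^sub>0 'k"

definition free_t :: "2 \<Rightarrow> 2 \<Rightarrow> nat \<Rightarrow> 'k::field yangian_free" where
  "free_t i j r = (case r of
     0 \<Rightarrow> (if i = j then 1 else 0)
   | Suc s \<Rightarrow> Poly_Mapping.single (Word [(i, j, s)]) 1)"

definition yangian_relators :: "'k::field yangian_free set" where
  "yangian_relators =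
     {free_t i j r * free_t k l s - free_t k l s * free_t i j r -
        (\<Sum>t<min r s. free_t k j t * free_t i l (r + s - 1 - t) -
                      free_t k j (r + s - 1 - t) * free_t i l t) | i j k l r s.
        r > 0 \<and> s > 0}"

definition yangian_ideal :: "'k::field yangian_free set" where
  "yangian_ideal = Idl\<^bsub>ring_of_type_algebra\<^esub> yangian_relators"

lemma ring_ring_of_type_algebra: "ring (ring_of_type_algebra :: 'a::ring_1 ring)"
proof -
  have "\<exists>y. x + y = 0" for x :: 'a
    using add.right_inverse by blast
  then show ?thesis
    unfolding ring_of_type_algebra_def using add.right_inverse
    by unfold_locales (auto simp: algebra_simps Units_def)
qed

lemma ideal_yangian_ideal: "ideal yangian_ideal ring_of_type_algebra"
  unfolding yangian_ideal_def
  by (rule ring.genideal_ideal[OF ring_ring_of_type_algebra])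
     (simp add: ring_of_type_algebra_def)

lemma yangian_ideal_zero: "0 \<in> yangian_ideal"
  using additive_subgroup.zero_closed[OF ideal.axioms(1)[OF ideal_yangian_ideal]]
  by (simp add: ring_of_type_algebra_def)

lemma yangian_ideal_add: "x \<in> yangian_ideal \<Longrightarrow> y \<in> yangian_ideal \<Longrightarrow> x + y \<in> yangian_ideal"
  using additive_subgroup.a_closed[OF ideal.axioms(1)[OF ideal_yangian_ideal], of x y]
  by (simp add: ring_of_type_algebra_def)

lemma yangian_ideal_mult_left: "x \<in> yangian_ideal \<Longrightarrow> a * x \<in> yangian_ideal"
  using ideal.I_l_closed[OF ideal_yangian_ideal, of x a]
  by (simp add: ring_of_type_algebra_def)

lemma yangian_ideal_mult_right: "x \<in> yangian_ideal \<Longrightarrow> x * a \<in> yangian_ideal"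
  using ideal.I_r_closed[OF ideal_yangian_ideal, of x a]
  by (simp add: ring_of_type_algebra_def)

lemma yangian_ideal_uminus: "x \<in> yangian_ideal \<Longrightarrow> - x \<in> yangian_ideal"
  using yangian_ideal_mult_left[of x "-1"] by simp

text \<open>
  The coefficient of the empty word is multiplicative and vanishes on the relators; hence
  the quotient is not the zero ring.
\<close>

lemma free_monoid_zero_eq_add_iff: "0 = v + w \<longleftrightarrow> v = 0 \<and> w = (0 :: 'g free_monoid)"
  by (cases v; cases w) (auto simp: zero_free_monoid_def)

lemma const_coeff_mult:
  fixes x y :: "'g free_monoid \<Rightarrow>\<^sub>0 'k::field"
  shows "Poly_Mapping.lookup (x * y) 0 = Poly_Mapping.lookup x 0 * Poly_Mapping.lookup y 0"
proof -
  have inner: "(\<Sum>q. Poly_Mapping.lookup y q when (0::'g free_monoid) = l + q) =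
      (Poly_Mapping.lookup y 0 when l = 0)" for l
    by (cases "l = 0") (simp_all add: free_monoid_zero_eq_add_iff)
  have "(\<Sum>l. Poly_Mapping.lookup x l * (Poly_Mapping.lookup y 0 when l = 0)) =
      (\<Sum>l. Poly_Mapping.lookup x l * Poly_Mapping.lookup y 0 when l = 0)"
    by (intro Sum_any.cong) (simp add: when_def)
  then show ?thesis
    unfolding times_poly_mapping.rep_eq prod_fun_def inner by simp
qed

lemma const_coeff_free_t: "r > 0 \<Longrightarrow> Poly_Mapping.lookup (free_t i j r) 0 = 0"
  by (cases r) (auto simp: free_t_def lookup_single zero_free_monoid_def)

lemma one_notin_yangian_ideal: "(1 :: 'k::field yangian_free) \<notin> yangian_ideal"
proof -
  define N where "N = {x :: 'k yangian_free. Poly_Mapping.lookup x 0 = 0}"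
  have "ideal N ring_of_type_algebra"
  proof (rule idealI)
    show "ring (ring_of_type_algebra :: 'k yangian_free ring)"
      by (rule ring_ring_of_type_algebra)
    interpret R: ring "ring_of_type_algebra :: 'k yangian_free ring"
      by (rule ring_ring_of_type_algebra)
    have inv: "inv\<^bsub>add_monoid ring_of_type_algebra\<^esub> x = - x" for x :: "'k yangian_free"
      using R.minus_equality[of "- x" x] by (simp add: a_inv_def ring_of_type_algebra_def)
    show "subgroup N (add_monoid ring_of_type_algebra)"
      by (rule subgroup.intro, unfold inv)
         (auto simp: N_def ring_of_type_algebra_def lookup_add)
  qed (auto simp: N_def ring_of_type_algebra_def const_coeff_mult)
  moreover have "yangian_relators \<subseteq> N"
    by (auto simp: yangian_relators_def N_def lookup_minus lookup_sum const_coeff_mult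
        const_coeff_free_t)
  ultimately have "yangian_ideal \<subseteq> N"
    unfolding yangian_ideal_def genideal_def by blast
  moreover have "1 \<notin> N"
    by (simp add: N_def lookup_one)
  ultimately show ?thesis by blast
qed

definition yangian_rel :: "'k::field yangian_free \<Rightarrow> 'k yangian_free \<Rightarrow> bool" where
  "yangian_rel x y \<longleftrightarrow> x - y \<in> yangian_ideal"

lemma equivp_yangian_rel: "equivp (yangian_rel :: 'k::field yangian_free \<Rightarrow> _)"
proof (rule equivpI)
  show "reflp (yangian_rel :: 'k yangian_free \<Rightarrow> _)"
    by (simp add: reflp_def yangian_rel_def yangian_ideal_zero)
  show "symp (yangian_rel :: 'k yangian_free \<Rightarrow> _)"
  proof (rule sympI)
    fix x y :: "'k yangian_free"
    assume "yangian_rel x y"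
    then show "yangian_rel y x"
      unfolding yangian_rel_def using yangian_ideal_uminus[of "x - y"] by simp
  qed
  show "transp (yangian_rel :: 'k yangian_free \<Rightarrow> _)"
  proof (rule transpI)
    fix x y z :: "'k yangian_free"
    assume "yangian_rel x y" "yangian_rel y z"
    then show "yangian_rel x z"
      unfolding yangian_rel_def using yangian_ideal_add[of "x - y" "y - z"] by simp
  qed
qed

quotient_type (overloaded) 'k yangian2 = "'k::field yangian_free" / yangian_rel
  by (rule equivp_yangian_rel)

instantiation yangian2 :: (field) ring_1
begin

lift_definition zero_yangian2 :: "'a yangian2" is "0" .

lift_definition one_yangian2 :: "'a yangian2" is "1" .

lift_definition plus_yangian2 :: "'a yangian2 \<Rightarrow> 'a yangian2 \<Rightarrow> 'a yangian2" is "(+)"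
proof -
  fix x x' y y' :: "'a yangian_free"
  assume "yangian_rel x x'" "yangian_rel y y'"
  then show "yangian_rel (x + y) (x' + y')"
    unfolding yangian_rel_def using yangian_ideal_add[of "x - x'" "y - y'"]
    by (simp add: algebra_simps)
qed

lift_definition uminus_yangian2 :: "'a yangian2 \<Rightarrow> 'a yangian2" is "uminus"
proof -
  fix x x' :: "'a yangian_free"
  assume "yangian_rel x x'"
  then show "yangian_rel (- x) (- x')"
    unfolding yangian_rel_def using yangian_ideal_uminus[of "x - x'"]
    by (simp add: algebra_simps)
qed

lift_definition minus_yangian2 :: "'a yangian2 \<Rightarrow> 'a yangian2 \<Rightarrow> 'a yangian2" is "(-)"
proof -
  fix x x' y y' :: "'a yangian_free"
  assume "yangian_rel x x'" "yangian_rel y y'"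
  then show "yangian_rel (x - y) (x' - y')"
    unfolding yangian_rel_def
    using yangian_ideal_add[of "x - x'" "- (y - y')"] yangian_ideal_uminus[of "y - y'"]
    by (simp add: algebra_simps)
qed

lift_definition times_yangian2 :: "'a yangian2 \<Rightarrow> 'a yangian2 \<Rightarrow> 'a yangian2" is "(*)"
proof -
  fix x x' y y' :: "'a yangian_free"
  assume "yangian_rel x x'" "yangian_rel y y'"
  then show "yangian_rel (x * y) (x' * y')"
    unfolding yangian_rel_def
    using yangian_ideal_add[of "(x - x') * y" "x' * (y - y')"]
      yangian_ideal_mult_right[of "x - x'" y] yangian_ideal_mult_left[of "y - y'" x']
    by (simp add: algebra_simps)
qed

instance
proof
  fix a b c :: "'a yangian2"
  show "a + b + c = a + (b + c)" by transfer (simp add: yangian_rel_def yangian_ideal_zero add.assoc)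
  show "a + b = b + a" by transfer (simp add: yangian_rel_def yangian_ideal_zero add.commute)
  show "0 + a = a" by transfer (simp add: yangian_rel_def yangian_ideal_zero)
  show "- a + a = 0" by transfer (simp add: yangian_rel_def yangian_ideal_zero)
  show "a - b = a + - b" by transfer (simp add: yangian_rel_def yangian_ideal_zero)
  show "a * b * c = a * (b * c)" by transfer (simp add: yangian_rel_def yangian_ideal_zero mult.assoc)
  show "1 * a = a" by transfer (simp add: yangian_rel_def yangian_ideal_zero)
  show "a * 1 = a" by transfer (simp add: yangian_rel_def yangian_ideal_zero)
  show "(a + b) * c = a * c + b * c"
    by transfer (simp add: yangian_rel_def yangian_ideal_zero distrib_right)
  show "a * (b + c) = a * b + a * c"
    by transfer (simp add: yangian_rel_def yangian_ideal_zero distrib_left)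
  show "(0::'a yangian2) \<noteq> 1"
    by transfer (use yangian_ideal_uminus one_notin_yangian_ideal in
        \<open>fastforce simp: yangian_rel_def\<close>)
qed

end

lift_definition yangian_t :: "2 \<Rightarrow> 2 \<Rightarrow> nat \<Rightarrow> 'k::field yangian2" is free_t .

lift_definition yangian_scalar :: "'k::field \<Rightarrow> 'k yangian2" is "Poly_Mapping.single 0" .

definition Y2 :: "('k::field, 'k yangian2) module" where
  "Y2 = with_scalars ring_of_type_algebra (\<lambda>c x. yangian_scalar c * x)"

text \<open>
  A series $\sum_{r \ge 0} a_r u^{-r}$ in $u^{-1}$ is represented by the formal power series
  with coefficients $a_r$; thus the variable of \<^typ>\<open>'a fps\<close> is $u^{-1}$.
\<close>

definition T_matrix :: "'k::field yangian2 fps ^ 2 ^ 2" where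
  "T_matrix = (\<chi> i j. Abs_fps (yangian_t i j))"

definition drinfeld_series ::
  "(2 \<Rightarrow> 'k::field yangian2 fps) \<times> 'k yangian2 fps \<times> 'k yangian2 fps" where
  "drinfeld_series = (THE (d, e, f).
     T_matrix $ 1 $ 1 = d 1 \<and>
     T_matrix $ 1 $ 2 = d 1 * e \<and>
     T_matrix $ 2 $ 1 = f * d 1 \<and>
     T_matrix $ 2 $ 2 = f * d 1 * e + d 2 \<and>
     fps_nth e 0 = 0 \<and> fps_nth f 0 = 0)"

definition d_series :: "2 \<Rightarrow> 'k::field yangian2 fps" where
  "d_series = fst drinfeld_series"

definition e_series :: "'k::field yangian2 fps" where
  "e_series = fst (snd drinfeld_series)"

definition f_series :: "'k::field yangian2 fps" where
  "f_series = snd (snd drinfeld_series)"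

text \<open>
  \<open>shift_series c a\<close> is $a(u - c)$ expanded in $u^{-1}$: substitute
  $(u - c)^{-1} = \sum_{n \ge 1} c^{n-1} u^{-n}$ for $u^{-1}$.
\<close>

definition shift_series :: "nat \<Rightarrow> 'a::ring_1 fps \<Rightarrow> 'a fps" where
  "shift_series c a = fps_compose a (Abs_fps (\<lambda>n. if n = 0 then 0 else of_nat c ^ (n - 1)))"

definition b_series :: "2 \<Rightarrow> 'k::field yangian2 fps" where
  "b_series i = prod_list (map (\<lambda>c. shift_series c (d_series i)) [0..<CHAR('k)])"

definition p_center_generators :: "'k::field yangian2 set" where
  "p_center_generators =
     {fps_nth (b_series i) (r * CHAR('k)) | i r. r > 0} \<union>
     {fps_nth e_series r ^ CHAR('k) | r. r > 0} \<union>
     {fps_nth f_series r ^ CHAR('k) | r. r > 0}"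

definition p_center :: "'k::field yangian2 set" where
  "p_center = subalgebra_generated Y2 p_center_generators"

definition p_center_plus :: "'k::field yangian2 set" where
  "p_center_plus = Idl\<^bsub>Y2\<lparr>carrier := p_center\<rparr>\<^esub> p_center_generators"

text \<open>
  The library's \<^const>\<open>ideal_prod\<close> is the set of finite sums of products; it makes sense for
  arbitrary subsets of a ring.
\<close>

definition I_p :: "'k::field yangian2 set" where
  "I_p = ideal_prod Y2 (carrier Y2) p_center_plus"

definition restricted_yangian :: "('k::field, 'k yangian2 set) module" where
  "restricted_yangian = quotient_algebra Y2 I_p"


section \<open>The Hopf structure of the Yangian\<close>

text \<open>
  Comultiplication, counit and antipode are determined by their values on the generators:
  the first two are algebra homomorphisms and the antipode is an anti-homomorphism.
\<close>

definition Y2_comult :: "'k::field yangian2 \<Rightarrow> ('k, 'k yangian2, 'k yangian2) tensor" where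
  "Y2_comult = (THE h. h \<in> algebra_homs Y2 (tensor_algebra Y2 Y2) \<and>
     (\<forall>i j r. h (yangian_t i j r) =
       (\<Oplus>\<^bsub>tensor_algebra Y2 Y2\<^esub>k\<in>UNIV. \<Oplus>\<^bsub>tensor_algebra Y2 Y2\<^esub>s\<in>{0..r}.
          pure_tensor Y2 Y2 (yangian_t i k s) (yangian_t k j (r - s)))))"

definition Y2_counit :: "'k::field yangian2 \<Rightarrow> 'k" where
  "Y2_counit = (THE h. h \<in> algebra_homs Y2 scalars \<and>
     (\<forall>i j r. h (yangian_t i j r) = (if i = j \<and> r = 0 then 1 else 0)))"

definition Y2_antipode :: "'k::field yangian2 \<Rightarrow> 'k yangian2" where
  "Y2_antipode = (THE h. h \<in> algebra_antihoms Y2 Y2 \<and>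
     (\<forall>i j r. h (yangian_t i j r) = fps_nth (matrix_inv T_matrix $ i $ j) r))"

end

theory Submission
  imports Defs
begin

text \<open>
  Put \<open>s\<^sub>i\<^sub>j(u) = t\<^sub>i\<^sub>j(u) t\<^sub>i\<^sub>j(u - 1) \<cdots> t\<^sub>i\<^sub>j(u - p + 1)\<close>. Each row of \<open>T(u)\<close> is a pair of series with
  \<open>x(u - 1) y(u) = y(u - 1) x(u)\<close>, and in characteristic \<open>p\<close> the middle terms of the product of the
  pencils \<open>x(u - c) + \<lambda> y(u - c)\<close>, \<open>c < p\<close>, vanish. Hence the \<open>s\<^sub>i\<^sub>j\<close> are central and group-like as a matrix,
  \<open>\<Delta>(s\<^sub>i\<^sub>j) = \<Sum>\<^sub>k s\<^sub>i\<^sub>k \<otimes> s\<^sub>k\<^sub>j\<close>. The same holds, with reversed coproduct, for the series \<open>s'\<^sub>i\<^sub>j\<close> formed from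
  the entries of \<open>T(u)\<^sup>-\<^sup>1\<close>, which satisfy the RTT relation with the opposite sign.

  On the other hand \<open>s\<^sub>1\<^sub>1 = b\<^sub>1\<close>, \<open>s\<^sub>1\<^sub>2 = b\<^sub>1 e\<^sup>p\<close>, \<open>s'\<^sub>2\<^sub>2 = b\<^sub>2\<^sup>-\<^sup>1\<close>, \<open>s'\<^sub>2\<^sub>1 = b\<^sub>2\<^sup>-\<^sup>1 (-f)\<^sup>p\<close>. Since \<open>b\<^sub>i(u)\<close> is invariant under
  \<open>u \<mapsto> u - 1\<close>, its nonconstant coefficients are integral combinations of the \<open>b\<^sub>i\<^sup>(\<^sup>r\<^sup>p\<^sup>)\<close>, and the coefficients of \<open>e(u)\<^sup>p\<close> are
  integral combinations of the \<open>(e\<^sup>(\<^sup>r\<^sup>))\<^sup>p\<close>, unitriangularly. So \<open>I\<^sub>p\<close> is the two-sided ideal generated by the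
  nonconstant coefficients of \<open>s\<^sub>1\<^sub>1\<close>, \<open>s\<^sub>1\<^sub>2\<close>, \<open>s'\<^sub>2\<^sub>2\<close>, \<open>s'\<^sub>2\<^sub>1\<close>, and these are visibly stable under the Hopf structure.
\<close>

section \<open>Formal power series with non-commuting coefficients\<close>

text \<open>The Drinfeld generators have no manageable coproduct, while entries of T(u) and of its
  inverse have matrix coproducts; hence the detour through products of entries. The first row of
  T(u) involves only d_1 and e, whereas d_2 and f turn into entries only after inversion, in the
  second row of T(u)^-1.

  Rows are used because modulo \<open>I_p\<close> the first row of (s_ij) is (1, 0) and the second
  row of (s'_ij) is (0, 1), and such a condition on one row survives matrix multiplication and
  inversion. Coproduct and antipode therefore preserve it without formulas for the remaining
  entries.

  The middle terms of the pencil product vanish because the exchange relation rewrites all words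
  with m letters y into a single one, which then occurs with coefficient p choose m.

  Centrality makes \<open>I_p\<close> two-sided; preimages of ideals under the structure maps are
  then two-sided as well, and each stability claim reduces to four series.

  Substitution into series with non-commuting coefficients is not multiplicative in general; for u -
  c it is, since (u - c)^-1 has integer coefficients in u^-1.\<close>

lemma fps_commute_of_coeffs:
  fixes a b :: "'a::semiring_0 fps"
  assumes "\<And>i j. fps_nth a i * fps_nth b j = fps_nth b j * fps_nth a i"
  shows "a * b = b * a"
proof (rule fps_ext)
  fix n
  have "(\<Sum>i=0..n. fps_nth a i * fps_nth b (n - i)) = (\<Sum>i=0..n. fps_nth b (n - i) * fps_nth a i)"
    using assms by (intro sum.cong) auto
  also have "\<dots> = (\<Sum>i=0..n. fps_nth b i * fps_nth a (n - i))"
    by (rule sum.reindex_bij_witness[of _ "\<lambda>i. n - i" "\<lambda>i. n - i"]) auto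
  finally show "fps_nth (a * b) n = fps_nth (b * a) n"
    by (simp add: fps_mult_nth)
qed

section \<open>Locally finite sums of series: the r-th term starts in degree r or later\<close>

definition fps_summable :: "(nat \<Rightarrow> 'a::zero fps) \<Rightarrow> bool" where
  "fps_summable F \<longleftrightarrow> (\<forall>r n. n < r \<longrightarrow> fps_nth (F r) n = 0)"

text \<open>Cutting the sum at r <= n makes every coefficient a finite sum; for a summable family
  nothing is lost, since later terms start above degree n.\<close>

definition fps_series :: "(nat \<Rightarrow> 'a::comm_monoid_add fps) \<Rightarrow> 'a fps" where
  "fps_series F = Abs_fps (\<lambda>n. \<Sum>r\<le>n. fps_nth (F r) n)"

lemma fps_series_nth:
  assumes "fps_summable F" "n \<le> N"
  shows "fps_nth (fps_series F) n = fps_nth (\<Sum>r\<le>N. F r) n"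
proof -
  have "(\<Sum>r\<le>n. fps_nth (F r) n) = (\<Sum>r\<le>N. fps_nth (F r) n)"
    using assms by (intro sum.mono_neutral_left) (auto simp: fps_summable_def)
  then show ?thesis
    by (simp add: fps_series_def fps_sum_nth)
qed

lemma fps_mult_nth_cong:
  fixes a b :: "'a::semiring_0 fps"
  assumes "\<And>k. k \<le> n \<Longrightarrow> fps_nth a k = fps_nth a' k" "\<And>k. k \<le> n \<Longrightarrow> fps_nth b k = fps_nth b' k"
  shows "fps_nth (a * b) n = fps_nth (a' * b') n"
  unfolding fps_mult_nth using assms by (intro sum.cong) auto

lemma fps_mult_nth_eq_0:
  fixes a b :: "'a::semiring_0 fps"
  assumes "\<And>k. k < i \<Longrightarrow> fps_nth a k = 0" "\<And>k. k < j \<Longrightarrow> fps_nth b k = 0" "n < i + j"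
  shows "fps_nth (a * b) n = 0"
  unfolding fps_mult_nth
proof (intro sum.neutral ballI)
  fix k assume "k \<in> {0..n}"
  then have "k < i \<or> n - k < j" using assms(3) by auto
  then show "fps_nth a k * fps_nth b (n - k) = 0" using assms(1,2) by auto
qed

lemma fps_summable_mult:
  fixes F :: "nat \<Rightarrow> 'a::semiring_0 fps"
  assumes "fps_summable F"
  shows "fps_summable (\<lambda>r. a * F r)" and "fps_summable (\<lambda>r. F r * a)"
  unfolding fps_summable_def
  by (intro allI impI fps_mult_nth_eq_0[of 0 _ r for r] fps_mult_nth_eq_0[of r _ 0 for r];
      use assms in \<open>simp add: fps_summable_def\<close>)+

lemma fps_series_mult_left:
  fixes F :: "nat \<Rightarrow> 'a::semiring_0 fps"
  assumes "fps_summable F"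
  shows "a * fps_series F = fps_series (\<lambda>r. a * F r)"
proof (rule fps_ext)
  fix n
  have "fps_nth (a * fps_series F) n = fps_nth (a * (\<Sum>r\<le>n. F r)) n"
    by (rule fps_mult_nth_cong) (simp_all add: fps_series_nth[OF assms])
  then show "fps_nth (a * fps_series F) n = fps_nth (fps_series (\<lambda>r. a * F r)) n"
    by (simp add: fps_series_nth[OF fps_summable_mult(1)[OF assms] order_refl] sum_distrib_left)
qed

lemma fps_series_mult_right:
  fixes F :: "nat \<Rightarrow> 'a::semiring_0 fps"
  assumes "fps_summable F"
  shows "fps_series F * a = fps_series (\<lambda>r. F r * a)"
proof (rule fps_ext)
  fix n
  have "fps_nth (fps_series F * a) n = fps_nth ((\<Sum>r\<le>n. F r) * a) n"
    by (rule fps_mult_nth_cong) (simp_all add: fps_series_nth[OF assms])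
  then show "fps_nth (fps_series F * a) n = fps_nth (fps_series (\<lambda>r. F r * a)) n"
    by (simp add: fps_series_nth[OF fps_summable_mult(2)[OF assms] order_refl] sum_distrib_right)
qed

lemma fps_series_add:
  fixes F G :: "nat \<Rightarrow> 'a::comm_monoid_add fps"
  shows "fps_series (\<lambda>r. F r + G r) = fps_series F + fps_series G"
  by (rule fps_ext) (simp add: fps_series_def sum.distrib)

lemma fps_series_diff:
  fixes F G :: "nat \<Rightarrow> 'a::ab_group_add fps"
  shows "fps_series (\<lambda>r. F r - G r) = fps_series F - fps_series G"
  by (rule fps_ext) (simp add: fps_series_def sum_subtractf)

text \<open>Splits off the term r = 0. The partial sums in degree n differ by the term
  \<open>G n * a\<close>, which vanishes there: \<open>G n\<close> starts in degree n and
  \<open>a\<close> in degree 1.\<close>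

lemma fps_series_shift:
  fixes F :: "nat \<Rightarrow> 'a::semiring_0 fps"
  assumes "fps_summable (\<lambda>r. G r)" "\<And>r. F (Suc r) = G r * a" "fps_nth a 0 = 0"
  shows "fps_series F = F 0 + fps_series G * a"
proof (rule fps_ext)
  fix n
  have s: "fps_summable (\<lambda>r. G r * a)" by (rule fps_summable_mult[OF assms(1)])
  have z: "fps_nth (G n * a) n = 0"
    using assms(1,3) by (intro fps_mult_nth_eq_0[of n _ 1]) (auto simp: fps_summable_def)
  have "fps_nth (fps_series F) n = (\<Sum>r\<le>n. fps_nth (F r) n)"
    by (simp add: fps_series_def)
  also have "\<dots> = fps_nth (F 0) n + (\<Sum>r<n. fps_nth (F (Suc r)) n)"
    by (simp add: lessThan_Suc_atMost[symmetric] sum.lessThan_Suc_shift del: sum.lessThan_Suc)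
  also have "(\<Sum>r<n. fps_nth (F (Suc r)) n) = (\<Sum>r<Suc n. fps_nth (G r * a) n)"
    using z by (simp add: assms(2))
  finally show "fps_nth (fps_series F) n = fps_nth (F 0 + fps_series G * a) n"
    unfolding fps_series_mult_right[OF assms(1)] by (simp add: fps_series_def lessThan_Suc_atMost)
qed

lemma fps_series_mult:
  fixes F G :: "nat \<Rightarrow> 'a::semiring_0 fps"
  assumes "fps_summable F" "fps_summable G"
  shows "fps_series F * fps_series G = fps_series (\<lambda>m. \<Sum>i\<le>m. F i * G (m - i))"
    and "fps_summable (\<lambda>m. \<Sum>i\<le>m. F i * G (m - i))"
proof -
  have z: "fps_nth (F i * G j) n = 0" if "n < i + j" for i j n
    using that assms by (intro fps_mult_nth_eq_0[of i _ j]) (auto simp: fps_summable_def)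
  show s: "fps_summable (\<lambda>m. \<Sum>i\<le>m. F i * G (m - i))"
    by (auto simp: fps_summable_def fps_sum_nth z)
  show "fps_series F * fps_series G = fps_series (\<lambda>m. \<Sum>i\<le>m. F i * G (m - i))"
  proof (rule fps_ext)
    fix n
    have "fps_nth (fps_series F * fps_series G) n = fps_nth ((\<Sum>i\<le>n. F i) * (\<Sum>j\<le>n. G j)) n"
      by (rule fps_mult_nth_cong) (simp_all add: fps_series_nth[OF assms(1)] fps_series_nth[OF assms(2)])
    also have "\<dots> = (\<Sum>(i, j)\<in>{..n} \<times> {..n}. fps_nth (F i * G j) n)"
      by (simp add: sum_product fps_sum_nth sum.cartesian_product case_prod_beta)
    \<comment> \<open>Pairs with i + j > n contribute nothing in degree n, so the square of indices
      shrinks to the triangle of the Cauchy product.\<close>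
    also have "\<dots> = (\<Sum>(i, j)\<in>{(i, j). i + j \<le> n}. fps_nth (F i * G j) n)"
    proof (rule sum.mono_neutral_right)
      show "\<forall>p\<in>{..n} \<times> {..n} - {(i, j). i + j \<le> n}. (case p of (i, j) \<Rightarrow> fps_nth (F i * G j) n) = 0"
      proof
        fix p assume "p \<in> {..n} \<times> {..n} - {(i, j). i + j \<le> n}"
        then have "n < fst p + snd p" by auto
        then show "(case p of (i, j) \<Rightarrow> fps_nth (F i * G j) n) = 0"
          using z by (simp add: case_prod_beta)
      qed
    qed auto
    also have "\<dots> = (\<Sum>m\<le>n. \<Sum>i\<le>m. fps_nth (F i * G (m - i)) n)"
      using sum.triangle_reindex_eq[of "\<lambda>i j. fps_nth (F i * G j) n" n] .
    finally show "fps_nth (fps_series F * fps_series G) n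
        = fps_nth (fps_series (\<lambda>m. \<Sum>i\<le>m. F i * G (m - i))) n"
      by (simp add: fps_series_def fps_sum_nth)
  qed
qed

section \<open>Substituting u - c for u over a non-commutative coefficient ring\<close>

section \<open>The shift of the spectral parameter\<close>

text \<open>The expansion of (u - c)^-1 in u^-1. An integer c makes the shifts a group under
  composition and covers the products u, u + 1, ... that belong to the sign -1 of the RTT
  relation.\<close>

definition shift_var :: "int \<Rightarrow> 'a::ring_1 fps" where
  "shift_var c = Abs_fps (\<lambda>n. if n = 0 then 0 else of_int c ^ (n - 1))"

definition shift :: "int \<Rightarrow> 'a::ring_1 fps \<Rightarrow> 'a fps" where
  "shift c a = fps_compose a (shift_var c)"

lemma shift_series_eq_shift: "shift_series c a = shift (int c) a"
proof -
  have "(of_int (int c) :: 'a) = of_nat c" by simp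
  then show ?thesis unfolding shift_series_def shift_def shift_var_def by presburger
qed

text \<open>Series with coefficients in the image of the integers are central. Shifts substitute
  only such series, which is what makes the substitution multiplicative.\<close>

definition int_fps :: "'a::ring_1 fps \<Rightarrow> bool" where
  "int_fps g \<longleftrightarrow> (\<forall>n. fps_nth g n \<in> \<int>)"

lemma Ints_commute: "x \<in> \<int> \<Longrightarrow> x * y = y * (x :: 'a::ring_1)"
  by (auto elim!: Ints_cases simp: mult_of_int_commute)

lemma int_fps_commute: "int_fps g \<Longrightarrow> g * a = a * g"
  by (rule fps_commute_of_coeffs) (simp add: int_fps_def Ints_commute)

lemma Ints_sum: "(\<And>i. i \<in> A \<Longrightarrow> f i \<in> \<int>) \<Longrightarrow> (\<Sum>i\<in>A. f i) \<in> (\<int> :: 'a::ring_1 set)"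
  by (induction A rule: infinite_finite_induct) auto

lemma int_fps_mult: "int_fps g \<Longrightarrow> int_fps h \<Longrightarrow> int_fps (g * h)"
  by (auto simp: int_fps_def fps_mult_nth intro!: Ints_sum)

lemma int_fps_one: "int_fps 1"
  by (simp add: int_fps_def)

lemma int_fps_power: "int_fps g \<Longrightarrow> int_fps (g ^ n)"
  by (induction n) (simp_all add: int_fps_mult int_fps_one)

lemma int_fps_diff: "int_fps g \<Longrightarrow> int_fps h \<Longrightarrow> int_fps (g - h)"
  by (simp add: int_fps_def)

lemma int_fps_X: "int_fps fps_X"
  by (simp add: int_fps_def fps_X_def)

lemma int_fps_shift_var: "int_fps (shift_var c)"
  by (simp add: int_fps_def shift_var_def)

lemma shift_var_nth_0 [simp]: "fps_nth (shift_var c) 0 = 0"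
  by (simp add: shift_var_def)

lemma summable_power:
  fixes g :: "'a::ring_1 fps"
  assumes "fps_nth g 0 = 0"
  shows "fps_summable (\<lambda>r. A r * g ^ r)"
  unfolding fps_summable_def
proof (intro allI impI)
  fix r n :: nat assume "n < r"
  then show "fps_nth (A r * g ^ r) n = 0"
    using startsby_zero_power_prefix[OF assms] by (intro fps_mult_nth_eq_0[of 0 _ r]) auto
qed

lemma fps_compose_eq_series: "a oo g = fps_series (\<lambda>r. fps_const (fps_nth a r) * g ^ r)"
  by (rule fps_ext) (simp add: fps_compose_nth fps_series_def atLeast0AtMost)

text \<open>Both orders of the product are normalized to the same monomials
  \<open>g ^ i * h ^ (m - i)\<close>, so that a commutator of two substituted series can be read off
  coefficient by coefficient.\<close>

lemma int_fps_compose_mult: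
  fixes a b g h :: "'a::ring_1 fps"
  assumes g: "fps_nth g 0 = 0" "int_fps g" and h: "fps_nth h 0 = 0" "int_fps h"
  shows "(a oo g) * (b oo h)
    = fps_series (\<lambda>m. \<Sum>i\<le>m. fps_const (fps_nth a i * fps_nth b (m - i)) * (g ^ i * h ^ (m - i)))"
    and "(b oo h) * (a oo g)
    = fps_series (\<lambda>m. \<Sum>i\<le>m. fps_const (fps_nth b (m - i) * fps_nth a i) * (g ^ i * h ^ (m - i)))"
proof -
  have c: "g ^ i * x = x * g ^ i" "h ^ i * x = x * h ^ i" for i x
    using int_fps_commute int_fps_power g h by blast+
  have 1: "fps_const x * g ^ i * (fps_const y * h ^ j) = fps_const (x * y) * (g ^ i * h ^ j)" for x y i j
    by (metis (no_types, lifting) c(1) fps_const_mult mult.assoc)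
  have 2: "fps_const x * h ^ i * (fps_const y * g ^ j) = fps_const (x * y) * (g ^ j * h ^ i)" for x y i j
    by (metis (no_types, lifting) c fps_const_mult mult.assoc)
  show "(a oo g) * (b oo h)
    = fps_series (\<lambda>m. \<Sum>i\<le>m. fps_const (fps_nth a i * fps_nth b (m - i)) * (g ^ i * h ^ (m - i)))"
    unfolding fps_compose_eq_series
    by (subst fps_series_mult) (simp_all add: summable_power g h 1)
  have "(b oo h) * (a oo g)
    = fps_series (\<lambda>m. \<Sum>i\<le>m. fps_const (fps_nth b i * fps_nth a (m - i)) * (g ^ (m - i) * h ^ i))"
    unfolding fps_compose_eq_series
    by (subst fps_series_mult) (simp_all add: summable_power g h 2)
  also have "(\<lambda>m. \<Sum>i\<le>m. fps_const (fps_nth b i * fps_nth a (m - i)) * (g ^ (m - i) * h ^ i))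
    = (\<lambda>m. \<Sum>i\<le>m. fps_const (fps_nth b (m - i) * fps_nth a i) * (g ^ i * h ^ (m - i)))"
  proof
    fix m
    show "(\<Sum>i\<le>m. fps_const (fps_nth b i * fps_nth a (m - i)) * (g ^ (m - i) * h ^ i))
      = (\<Sum>i\<le>m. fps_const (fps_nth b (m - i) * fps_nth a i) * (g ^ i * h ^ (m - i)))"
      by (rule sum.reindex_bij_witness[of _ "\<lambda>i. m - i" "\<lambda>i. m - i"]) auto
  qed
  finally show "(b oo h) * (a oo g)
    = fps_series (\<lambda>m. \<Sum>i\<le>m. fps_const (fps_nth b (m - i) * fps_nth a i) * (g ^ i * h ^ (m - i)))" .
qed

lemma fps_const_sum: "fps_const (\<Sum>i\<in>A. f i) = (\<Sum>i\<in>A. fps_const (f i))"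
  by (induction A rule: infinite_finite_induct) (simp_all flip: fps_const_add)

lemma shift_mult: "shift c (a * b) = shift c a * shift c b"
proof -
  have "(a * b) oo shift_var c = fps_series (\<lambda>m. \<Sum>i\<le>m.
      fps_const (fps_nth a i * fps_nth b (m - i)) * (shift_var c ^ i * shift_var c ^ (m - i)))"
    unfolding fps_compose_eq_series fps_mult_nth
    by (simp add: power_add[symmetric] sum_distrib_right[symmetric] fps_const_sum atLeast0AtMost)
  then show ?thesis
    by (simp add: shift_def int_fps_compose_mult(1) int_fps_shift_var)
qed

lemma shift_add: "shift c (a + b) = shift c a + shift c b"
  by (simp add: shift_def fps_compose_add_distrib)

lemma shift_diff: "shift c (a - b) = shift c a - shift c b"
  by (simp add: shift_def fps_compose_sub_distrib)

lemma shift_one [simp]: "shift c 1 = 1"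
  by (simp add: shift_def)

lemma shift_nth_0 [simp]: "fps_nth (shift c a) 0 = fps_nth a 0"
  by (simp add: shift_def)

lemma shift_power: "shift c (a ^ n) = shift c a ^ n"
  by (induction n) (simp_all add: shift_mult)

lemma shift_sum: "shift c (\<Sum>i\<in>A. f i) = (\<Sum>i\<in>A. shift c (f i))"
  by (simp add: shift_def fps_compose_sum_distrib)

lemma shift_const: "shift c (fps_const x) = fps_const x"
  by (rule fps_ext)
     (simp add: shift_def fps_compose_nth mult_delta_left sum.delta if_distrib[of "\<lambda>x. x * _"] cong: if_cong)

lemma shift_prod_list: "shift c (prod_list (map f xs)) = prod_list (map (\<lambda>x. shift c (f x)) xs)"
  by (induction xs) (simp_all add: shift_mult)

text \<open>Powers of the two shift variables are central, so a linear relation between commutators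
  that holds for all pairs of coefficients survives independent shifts of the two arguments.\<close>

lemma shift_commutators:
  fixes a b a' b' :: "'a::ring_1 fps"
  assumes "\<And>r s. fps_nth a r * fps_nth b s - fps_nth b s * fps_nth a r
    + fps_nth a' r * fps_nth b' s - fps_nth b' s * fps_nth a' r = 0"
  shows "shift c a * shift d b - shift d b * shift c a
    + shift c a' * shift d b' - shift d b' * shift c a' = 0"
proof -
  note m = int_fps_compose_mult[OF shift_var_nth_0 int_fps_shift_var shift_var_nth_0 int_fps_shift_var]
  have "fps_const (fps_nth a r * fps_nth b s) * x - fps_const (fps_nth b s * fps_nth a r) * x
    + fps_const (fps_nth a' r * fps_nth b' s) * x - fps_const (fps_nth b' s * fps_nth a' r) * x
    = fps_const (fps_nth a r * fps_nth b s - fps_nth b s * fps_nth a r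
    + fps_nth a' r * fps_nth b' s - fps_nth b' s * fps_nth a' r) * x" for r s x
    by (simp add: algebra_simps flip: fps_const_add fps_const_sub)
  then show ?thesis
    unfolding shift_def m(1)[of a c b d] m(1)[of a' c b' d] m(2)[of b d a c] m(2)[of b' d a' c]
      fps_series_diff[symmetric] fps_series_add[symmetric] sum_subtractf[symmetric] sum.distrib[symmetric]
    using assms by (intro fps_ext) (simp add: fps_series_def)
qed

lemma shift_commute:
  assumes "\<And>r s. fps_nth a r * fps_nth b s = fps_nth b s * fps_nth a r"
  shows "shift c a * shift d b = shift d b * shift c a"
  using shift_commutators[of a b 0 0 c d] assms by (simp add: shift_def)

text \<open>The equation (1 - c u^-1) (u - c)^-1 = u^-1 characterizes the shift variable, since the
  first factor is invertible.\<close>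

lemma shift_var_eq: "(1 - of_int c * fps_X) * shift_var c = (fps_X :: 'a::ring_1 fps)"
proof (rule fps_ext)
  fix n
  have "(1 - of_int c * fps_X) * shift_var c = shift_var c - fps_X * (fps_const (of_int c) * shift_var c :: 'a fps)"
    by (simp only: left_diff_distrib mult_1 mult_of_int_commute fps_of_int mult.assoc)
  moreover have "fps_nth (shift_var c - fps_X * (fps_const (of_int c) * shift_var c)) n = fps_nth (fps_X :: 'a fps) n"
  proof (cases n)
    case (Suc m)
    then show ?thesis by (cases m) (simp_all add: shift_var_def)
  qed simp
  ultimately show "fps_nth ((1 - of_int c * fps_X) * shift_var c) n = fps_nth (fps_X :: 'a fps) n"
    by (simp only:)
qed

lemma mult_left_cancel_unit_fps:
  fixes a b :: "'a::ring_1 fps"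
  assumes "(1 - of_int c * fps_X) * a = (1 - of_int c * fps_X) * b"
  shows "a = b"
proof -
  define g :: "'a fps" where "g = Abs_fps (\<lambda>n. of_int c ^ n)"
  have inv: "g * (1 - of_int c * fps_X) = 1"
  proof (rule fps_ext)
    fix n
    have "g * (1 - of_int c * fps_X) = g - g * fps_const (of_int c) * fps_X"
      by (simp add: fps_of_int mult.assoc right_diff_distrib)
    then show "fps_nth (g * (1 - of_int c * fps_X)) n = fps_nth 1 n"
      by (cases n) (simp_all only: fps_sub_nth fps_X_mult_right_nth, simp_all add: g_def power_commutes)
  qed
  have "g * ((1 - of_int c * fps_X) * a) = g * ((1 - of_int c * fps_X) * b)"
    by (simp only: assms)
  then show ?thesis by (simp only: mult.assoc[symmetric] inv mult_1)
qed

lemma fps_X_mult_cancel: "fps_X * a = fps_X * b \<Longrightarrow> a = (b :: 'a::ring_1 fps)"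
  by (rule fps_ext) (metis fps_X_mult_nth diff_Suc_1 nat.simps(3))

lemma shift_X: "shift c fps_X = shift_var c"
proof (rule fps_ext)
  fix n
  have "(\<Sum>i = 0..n. fps_nth fps_X i * fps_nth (shift_var c ^ i) n) = (\<Sum>i = 0..n. if i = 1 then fps_nth (shift_var c) n else 0)"
    by (intro sum.cong) (auto simp: fps_X_def)
  also have "\<dots> = fps_nth (shift_var c) n"
    by (cases n) (simp_all add: sum.delta)
  finally show "fps_nth (shift c fps_X) n = fps_nth (shift_var c :: 'a fps) n"
    by (simp add: shift_def fps_compose_nth)
qed

lemma shift_of_int: "shift c (of_int k) = of_int k"
  using shift_const[of c "of_int k"] by (simp add: fps_of_int)

lemma shift_shift: "shift c (shift d a) = shift (c + d) (a :: 'a::ring_1 fps)"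
proof -
  let ?h = "shift c (shift_var d :: 'a fps)"
  have "(1 - of_int d * shift_var c) * ?h = shift_var c"
    using arg_cong[OF shift_var_eq[of d], of "shift c"]
    by (simp add: shift_mult shift_diff shift_X shift_of_int)
  then have "(1 - of_int c * fps_X) * ((1 - of_int d * shift_var c) * ?h) = fps_X"
    by (simp add: shift_var_eq)
  moreover have "(1 - of_int c * fps_X) * ((1 - of_int d * shift_var c) * ?h)
    = (1 - of_int (c + d) * fps_X) * ?h"
  proof -
    have "(1 - of_int c * fps_X) * (1 - of_int d * shift_var c)
      = (1 - of_int c * fps_X) - of_int d * ((1 - of_int c * fps_X) * shift_var c :: 'a fps)"
      by (simp add: algebra_simps) (metis mult.assoc mult_of_int_commute)
    also have "\<dots> = 1 - of_int (c + d) * fps_X"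
      unfolding shift_var_eq by (simp add: left_diff_distrib distrib_right)
    finally show ?thesis by (simp add: mult.assoc[symmetric])
  qed
  ultimately have "(1 - of_int (c + d) * fps_X) * ?h = (1 - of_int (c + d) * fps_X) * shift_var (c + d)"
    by (simp only: shift_var_eq)
  \<comment> \<open>The shifted variable satisfies the equation that characterizes
    \<open>shift_var (c + d)\<close>.\<close>
  then have h: "?h = shift_var (c + d)" by (rule mult_left_cancel_unit_fps)
  show ?thesis
  proof (rule fps_ext)
    fix n
    \<comment> \<open>Coefficient n depends only on the terms up to r = n, so the inner series may
      be truncated to a polynomial in the shift variable, to which \<open>h\<close> applies
      termwise.\<close>
    have t: "fps_nth (shift d a) k = fps_nth (\<Sum>r\<le>n. fps_const (fps_nth a r) * shift_var d ^ r) k" if "k \<le> n" for k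
      unfolding shift_def fps_compose_eq_series
      by (rule fps_series_nth[OF summable_power that]) simp
    have "fps_nth (shift c (shift d a)) n
      = fps_nth (shift c (\<Sum>r\<le>n. fps_const (fps_nth a r) * shift_var d ^ r)) n"
      unfolding shift_def[of c] fps_compose_nth by (intro sum.cong) (simp_all add: t)
    also have "\<dots> = fps_nth (\<Sum>r\<le>n. fps_const (fps_nth a r) * shift_var (c + d) ^ r) n"
      by (simp add: shift_sum shift_mult shift_power shift_const h)
    also have "\<dots> = fps_nth (shift (c + d) a) n"
      unfolding shift_def fps_compose_eq_series
      by (rule fps_series_nth[symmetric, OF summable_power]) simp_all
    finally show "fps_nth (shift c (shift d a)) n = fps_nth (shift (c + d) a) n" .
  qed
qed

lemma shift_0 [simp]: "shift 0 a = a"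
proof -
  have "shift_var 0 = (fps_X :: 'a fps)"
    using shift_var_eq[of 0] by simp
  moreover have "fps_nth a i * fps_nth (fps_X ^ i) n = (if i = n then fps_nth a i else 0)" for i n
    by (simp add: fps_X_power_nth)
  ultimately show ?thesis
    by (intro fps_ext) (simp add: shift_def fps_compose_nth sum.delta)
qed

text \<open>The shift amount enters only through its image in the ring, so shifts are periodic
  modulo p. This makes products of commuting factors over all residues insensitive to direction and
  starting point.\<close>

lemma shift_add_char:
  assumes "of_nat p = (0 :: 'a::ring_1)"
  shows "shift (c + int p * k) a = shift c (a :: 'a fps)"
proof -
  have "of_int (c + int p * k) = (of_int c :: 'a)"
    using assms by simp
  then show ?thesis unfolding shift_def shift_var_def by presburger
qed

lemma fps_summable_add: "fps_summable F \<Longrightarrow> fps_summable G \<Longrightarrow> fps_summable (\<lambda>r. F r + G r)"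
  for F G :: "nat \<Rightarrow> 'a::comm_monoid_add fps"
  by (simp add: fps_summable_def)

lemma fps_summable_diff: "fps_summable F \<Longrightarrow> fps_summable G \<Longrightarrow> fps_summable (\<lambda>r. F r - G r)"
  for F G :: "nat \<Rightarrow> 'a::ab_group_add fps"
  by (simp add: fps_summable_def)

text \<open>
  The substitution \<open>v = u - \<kappa>\<close> in the defining relation \<open>(u - v) [x(v), y(u)] = \<kappa> (y(v) x(u) - y(u) x(v))\<close>;
  the hypothesis is the coefficient of \<open>v\<^sup>-\<^sup>r\<close> of this relation, divided by \<open>u\<close>.
\<close>

lemma shift_exchange:
  fixes x y :: "'a::ring_1 fps"
  assumes rel: "\<And>r. fps_const (fps_nth x r) * y - y * fps_const (fps_nth x r)
      = fps_X * (fps_const (fps_nth x (Suc r)) * y - y * fps_const (fps_nth x (Suc r))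
        + of_int \<kappa> * (fps_const (fps_nth y r) * x - y * fps_const (fps_nth x r)))"
    and x0: "fps_const (fps_nth x 0) * y = y * fps_const (fps_nth x 0)"
    and \<kappa>: "\<kappa> * \<kappa> = 1"
  shows "shift \<kappa> x * y = shift \<kappa> y * x"
proof -
  define v :: "'a fps" where "v = shift_var \<kappa>"
  \<comment> \<open>Commutators of y with the coefficients of x: summed against powers of v they
    give the commutator \<open>A\<close> of x(u - \<kappa>) with y(u); \<open>B\<close> is the same
    sum with the index moved by one.\<close>
  define C where "C r = fps_const (fps_nth x r) * y - y * fps_const (fps_nth x r)" for r
  define B where "B = fps_series (\<lambda>r. C (Suc r) * v ^ r)"
  have v0: "fps_nth v 0 = 0" and iv: "int_fps v" by (simp_all add: v_def int_fps_shift_var)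
  have cv: "v * a = a * v" "v ^ n * a = a * v ^ n" for a n
    using int_fps_commute[OF iv] int_fps_commute[OF int_fps_power[OF iv]] by auto
  have cX: "fps_X * a = a * fps_X" for a :: "'a fps" by (rule int_fps_commute[OF int_fps_X])
  note S = summable_power[OF v0]
  have sx: "shift \<kappa> x = fps_series (\<lambda>r. fps_const (fps_nth x r) * v ^ r)"
    and sy: "shift \<kappa> y = fps_series (\<lambda>r. fps_const (fps_nth y r) * v ^ r)"
    by (simp_all add: shift_def fps_compose_eq_series v_def)
  define A where "A = shift \<kappa> x * y - y * shift \<kappa> x"
  have r1: "fps_const c * v ^ r * a = fps_const c * a * v ^ r" for c r a
    by (metis cv(2) mult.assoc)
  have A: "A = fps_series (\<lambda>r. C r * v ^ r)"
    unfolding A_def sx C_def fps_series_mult_right[OF S] fps_series_mult_left[OF S] fps_series_diff[symmetric]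
    by (simp add: left_diff_distrib mult.assoc cv(2)[of _ y])
  have "A = C 0 * v ^ 0 + B * v"
    unfolding A B_def by (rule fps_series_shift[OF S]) (simp_all add: v0 power_Suc2 mult.assoc del: power_Suc)
  then have AB: "A = B * v" using x0 by (simp add: C_def)
  have rel': "C r * v ^ r = fps_X * (C (Suc r) * v ^ r + of_int \<kappa> * (fps_const (fps_nth y r) * v ^ r * x
      - y * (fps_const (fps_nth x r) * v ^ r)))" for r
    using rel[of r] unfolding C_def[symmetric]
    by (simp add: r1) (simp add: algebra_simps)
  have "A = fps_X * (B + of_int \<kappa> * (shift \<kappa> y * x - y * shift \<kappa> x))"
  proof -
    let ?f = "\<lambda>r. C (Suc r) * v ^ r" and ?g = "\<lambda>r. fps_const (fps_nth y r) * v ^ r * x"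
      and ?h = "\<lambda>r. y * (fps_const (fps_nth x r) * v ^ r)"
    have s: "fps_summable ?f" "fps_summable ?g" "fps_summable ?h"
      by (rule S fps_summable_mult[OF S])+
    then have "fps_summable (\<lambda>r. ?f r + of_int \<kappa> * (?g r - ?h r))"
      by (rule fps_summable_add[OF _ fps_summable_mult(1)[OF fps_summable_diff]])
    then have "A = fps_X * fps_series (\<lambda>r. ?f r + of_int \<kappa> * (?g r - ?h r))"
      unfolding A rel' by (rule fps_series_mult_left[symmetric])
    also have "fps_series (\<lambda>r. ?f r + of_int \<kappa> * (?g r - ?h r))
        = B + of_int \<kappa> * (fps_series ?g - fps_series ?h)"
      using s by (simp add: fps_series_add fps_series_diff fps_series_mult_left[symmetric] fps_summable_diff B_def)
    finally show ?thesis
      unfolding sx sy fps_series_mult_right[OF S] fps_series_mult_left[OF S] .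
  qed
  define D where "D = shift \<kappa> y * x - y * shift \<kappa> x"
  have "A = fps_X * (B + of_int \<kappa> * D)"
    unfolding D_def by fact
  \<comment> \<open>Multiplying by v replaces the unknown \<open>B\<close> by \<open>A\<close>,
    leaving one linear equation between \<open>A\<close> and \<open>D\<close>.\<close>
  then have "A * v = fps_X * (A + of_int \<kappa> * (D * v))"
    by (simp add: AB distrib_right mult.assoc)
  \<comment> \<open>The factor 1 - \<kappa> u^-1 turns v into u^-1; afterwards both sides carry a
    factor u^-1 that can be cancelled.\<close>
  then have "(1 - of_int \<kappa> * fps_X) * (v * A) = fps_X * ((1 - of_int \<kappa> * fps_X) * A + of_int \<kappa> * ((1 - of_int \<kappa> * fps_X) * (v * D)))"
  proof -
    assume *: "A * v = fps_X * (A + of_int \<kappa> * (D * v))"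
    let ?q = "1 - of_int \<kappa> * fps_X :: 'a fps"
    have "int_fps ?q"
      by (intro int_fps_diff int_fps_mult int_fps_one int_fps_X) (simp add: int_fps_def flip: fps_of_int)
    then have cq: "?q * a = a * ?q" for a by (rule int_fps_commute)
    have "?q * (v * A) = ?q * (fps_X * (A + of_int \<kappa> * (v * D)))"
      using * by (simp only: cv)
    also have "\<dots> = fps_X * (?q * (A + of_int \<kappa> * (v * D)))"
      by (metis cX mult.assoc)
    also have "?q * (A + of_int \<kappa> * (v * D)) = ?q * A + of_int \<kappa> * (?q * (v * D))"
      unfolding distrib_left by (metis mult_of_int_commute mult.assoc)
    finally show ?thesis .
  qed
  then have "fps_X * A = fps_X * ((1 - of_int \<kappa> * fps_X) * A + of_int \<kappa> * (fps_X * D))"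
    by (simp add: mult.assoc[symmetric] shift_var_eq v_def)
  then have "A = (1 - of_int \<kappa> * fps_X) * A + of_int \<kappa> * (fps_X * D)"
    by (rule fps_X_mult_cancel)
  then have "of_int \<kappa> * (fps_X * A) = of_int \<kappa> * (fps_X * D)"
    by (simp add: left_diff_distrib mult.assoc)
  then have "fps_X * (of_int \<kappa> * A) = fps_X * (of_int \<kappa> * D)"
    by (metis mult_of_int_commute mult.assoc)
  then have "of_int \<kappa> * A = of_int \<kappa> * D" by (rule fps_X_mult_cancel)
  then have "of_int (\<kappa> * \<kappa>) * A = of_int (\<kappa> * \<kappa>) * D" by (simp add: mult.assoc)
  then show ?thesis by (simp add: \<kappa> A_def D_def)
qed

text \<open>Membership in an ideal and commutation with a fixed element are both closed under
  differences. Stating the coefficient arguments for additive subgroups lets them serve the ideal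
  and the centrality claims alike.\<close>

definition additive_set :: "'a::ab_group_add set \<Rightarrow> bool" where
  "additive_set J \<longleftrightarrow> 0 \<in> J \<and> (\<forall>x\<in>J. \<forall>y\<in>J. x - y \<in> J)"

lemma additive_set_zero: "additive_set J \<Longrightarrow> 0 \<in> J"
  by (simp add: additive_set_def)

lemma additive_set_diff: "additive_set J \<Longrightarrow> x \<in> J \<Longrightarrow> y \<in> J \<Longrightarrow> x - y \<in> J"
  by (simp add: additive_set_def)

lemma additive_set_uminus: "additive_set J \<Longrightarrow> x \<in> J \<Longrightarrow> - x \<in> J"
  unfolding additive_set_def by (metis diff_0)

lemma additive_set_add: "additive_set J \<Longrightarrow> x \<in> J \<Longrightarrow> y \<in> J \<Longrightarrow> x + y \<in> J"
  using additive_set_diff[of J x "- y"] additive_set_uminus[of J y] by simp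

lemma additive_set_sum: "additive_set J \<Longrightarrow> (\<And>i. i \<in> A \<Longrightarrow> f i \<in> J) \<Longrightarrow> (\<Sum>i\<in>A. f i) \<in> J"
  by (induction A rule: infinite_finite_induct) (auto intro: additive_set_zero additive_set_add)

lemma additive_set_of_nat: "additive_set J \<Longrightarrow> x \<in> J \<Longrightarrow> of_nat n * x \<in> J" for x :: "'a::ring_1"
  by (induction n) (auto simp: distrib_right intro: additive_set_zero additive_set_add)

lemma additive_set_Ints: "additive_set J \<Longrightarrow> k \<in> \<int> \<Longrightarrow> x \<in> J \<Longrightarrow> k * x \<in> J" for x :: "'a::ring_1"
proof (elim Ints_cases)
  fix z assume "additive_set J" "x \<in> J" "k = of_int z"
  then show "k * x \<in> J"
    by (cases z rule: int_cases2) (auto intro: additive_set_of_nat additive_set_uminus)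
qed

text \<open>By Bezout n has an integer inverse modulo p, and additive subgroups are closed under
  integer multiples.\<close>

lemma additive_set_cancel:
  fixes x :: "'a::ring_1"
  assumes J: "additive_set J" and p: "of_nat p = (0::'a)" "prime p" "\<not> p dvd n" and x: "of_nat n * x \<in> J"
  shows "x \<in> J"
proof -
  have "coprime (int n) (int p)"
    using p prime_imp_coprime[of p n] by (simp add: coprime_commute)
  then obtain a b where ab: "a * int n + b * int p = 1"
    by (metis bezout_int coprime_imp_gcd_eq_1)
  have "x = of_int (a * int n + b * int p) * x" by (simp add: ab)
  also have "\<dots> = of_int a * (of_nat n * x)" using p(1) by (simp add: mult.assoc)
  finally show ?thesis using additive_set_Ints[OF J _ x, of "of_int a"] by simp
qed

text \<open>The two lowest coefficients of (u - 1)^-n = u^-n + n u^(-n-1) + ...; the second one is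
  the source of the factor n in the recursion for shift-invariant series.\<close>

lemma shift_var_1_power_nth:
  "fps_nth (shift_var 1 ^ n :: 'a::ring_1 fps) n = 1 \<and> fps_nth (shift_var 1 ^ n :: 'a fps) (Suc n) = of_nat n"
proof (induction n)
  case (Suc n)
  have "shift_var 1 ^ Suc n = (fps_X + fps_X * shift_var 1) * (shift_var 1 ^ n :: 'a fps)"
    using shift_var_eq[of 1, where 'a='a] by (simp add: algebra_simps)
  then have e: "shift_var 1 ^ Suc n = fps_X * shift_var 1 ^ n + fps_X * (shift_var 1 ^ Suc n :: 'a fps)"
    by (simp add: distrib_right mult.assoc)
  have z: "fps_nth (shift_var 1 ^ Suc n :: 'a fps) n = 0"
    using startsby_zero_power_prefix[of "shift_var 1 :: 'a fps" "Suc n"] by simp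
  have 1: "fps_nth (shift_var 1 ^ Suc n :: 'a fps) (Suc n) = 1"
    by (subst e) (use Suc z in simp)
  moreover have "fps_nth (shift_var 1 ^ Suc n :: 'a fps) (Suc (Suc n)) = of_nat (Suc n)"
    by (subst e) (use Suc 1 in \<open>simp add: add.commute\<close>)
  ultimately show ?case by blast
qed simp

text \<open>Comparing coefficients of \<open>u\<^sup>-\<^sup>n\<^sup>-\<^sup>1\<close> in \<open>a(u - 1) = a(u)\<close> expresses \<open>n a\<^sub>n\<close> through lower coefficients.\<close>

lemma shift_invariant_coeffs:
  fixes a :: "'a::ring_1 fps"
  assumes inv: "shift 1 a = a" and p: "of_nat p = (0::'a)" "prime p" and J: "additive_set J"
    and mult: "\<And>r. r > 0 \<Longrightarrow> fps_nth a (r * p) \<in> J" and "n > 0"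
  shows "fps_nth a n \<in> J"
  using \<open>n > 0\<close>
proof (induction n rule: less_induct)
  case (less n)
  show ?case
  proof (cases "p dvd n")
    case True
    then show ?thesis using mult[of "n div p"] less.prems by (auto elim!: dvdE)
  next
    case False
    let ?g = "shift_var 1 :: 'a fps"
    have "(\<Sum>i\<le>Suc n. fps_nth a i * fps_nth (?g ^ i) (Suc n)) = fps_nth a (Suc n)"
      using arg_cong[OF inv, of "\<lambda>a. fps_nth a (Suc n)"] by (simp add: shift_def fps_compose_nth atLeast0AtMost)
    \<comment> \<open>The term i = n + 1 cancels against the right-hand side, and the term i = n
      carries the factor n.\<close>
    then have "(\<Sum>i<n. fps_nth a i * fps_nth (?g ^ i) (Suc n)) + fps_nth a n * of_nat n = 0"
      using shift_var_1_power_nth[of n, where 'a='a] shift_var_1_power_nth[of "Suc n", where 'a='a]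
      by (simp add: lessThan_Suc_atMost[symmetric] del: power_Suc)
    then have "of_nat n * fps_nth a n = - (\<Sum>i<n. fps_nth a i * fps_nth (?g ^ i) (Suc n))"
      by (simp add: mult_of_nat_commute eq_neg_iff_add_eq_0 add.commute)
    moreover have "fps_nth a i * fps_nth (?g ^ i) (Suc n) \<in> J" if "i < n" for i
    proof (cases "i = 0")
      case False
      have k: "fps_nth (?g ^ i) (Suc n) \<in> \<int>"
        using int_fps_power[OF int_fps_shift_var] by (auto simp: int_fps_def)
      show ?thesis
        unfolding Ints_commute[OF k, symmetric]
        by (rule additive_set_Ints[OF J k]) (use less that False in auto)
    qed (simp add: additive_set_zero[OF J])
    ultimately have "of_nat n * fps_nth a n \<in> J"
      using J by (auto intro!: additive_set_uminus additive_set_sum)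
    then show ?thesis by (rule additive_set_cancel[OF J p False])
  qed
qed

section \<open>Words in two letters under exchange relations, and the binomial cancellation in
  characteristic p\<close>

section \<open>Products of exchangeable sequences\<close>

lemma prod_list_commute:
  fixes x :: "'a::monoid_mult"
  assumes "\<And>y. y \<in> set ys \<Longrightarrow> x * y = y * x"
  shows "x * prod_list ys = prod_list ys * x"
  using assms
proof (induction ys)
  case (Cons y ys)
  then have "x * prod_list ys = prod_list ys * x" "x * y = y * x" by auto
  then show ?case by (simp add: mult.assoc) (metis mult.assoc)
qed simp

lemma prod_list_rev:
  fixes xs :: "'a::monoid_mult list"
  assumes "\<And>x y. x \<in> set xs \<Longrightarrow> y \<in> set xs \<Longrightarrow> x * y = y * x"
  shows "prod_list (rev xs) = prod_list xs"
  using assms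
proof (induction xs)
  case (Cons x xs)
  then show ?case using prod_list_commute[of xs x] by simp
qed simp

text \<open>The parameter \<lambda> of the pencil is modelled by \<open>fps_X\<close>: coefficient m
  of a product of pencils collects all words with m letters y.\<close>

definition pencil :: "(nat \<Rightarrow> 'a::ring_1) \<Rightarrow> (nat \<Rightarrow> 'a) \<Rightarrow> nat \<Rightarrow> 'a fps" where
  "pencil x y c = fps_const (x c) + fps_X * fps_const (y c)"

definition pencil_prod :: "(nat \<Rightarrow> 'a::ring_1) \<Rightarrow> (nat \<Rightarrow> 'a) \<Rightarrow> nat \<Rightarrow> 'a fps" where
  "pencil_prod x y n = prod_list (map (pencil x y) [0..<n])"

lemma pencil_prod_Suc: "pencil_prod x y (Suc n) = pencil_prod x y n * pencil x y n"
  by (simp add: pencil_prod_def)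

lemma pencil_prod_nth_0: "fps_nth (pencil_prod x y n) 0 = prod_list (map x [0..<n])"
  by (induction n) (simp add: pencil_prod_def, simp add: pencil_prod_Suc pencil_def)

lemma pencil_prod_nth_Suc:
  "fps_nth (pencil_prod x y (Suc n)) m
    = fps_nth (pencil_prod x y n) m * x n + (if m = 0 then 0 else fps_nth (pencil_prod x y n) (m - 1) * y n)"
proof -
  have "pencil_prod x y n * pencil x y n = pencil_prod x y n * fps_const (x n) + fps_X * (pencil_prod x y n * fps_const (y n))"
    unfolding pencil_def distrib_left using int_fps_commute[OF int_fps_X, of "pencil_prod x y n"]
    by (metis mult.assoc)
  then show ?thesis by (simp add: pencil_prod_Suc)
qed

lemma pencil_prod_nth_large: "n < m \<Longrightarrow> fps_nth (pencil_prod x y n) m = 0"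
proof (induction n arbitrary: m)
  case 0
  then show ?case by (simp add: pencil_prod_def)
next
  case (Suc n)
  then show ?case by (simp add: pencil_prod_nth_Suc)
qed

text \<open>
  In the applications \<open>x\<close> and \<open>y\<close> are the shifts of two entries of a row of the matrix \<open>T(u)\<close>.
  The pencil \<open>x + \<lambda> y\<close> consists of commuting elements, so its product can be read backwards,
  where all the words with the same number of letters \<open>y\<close> agree.
\<close>

locale exchangeable =
  fixes x y :: "nat \<Rightarrow> 'a::ring_1"
  assumes exchange: "x (Suc c) * y c = y (Suc c) * x c"
    and commute_x: "x c * x d = x d * x c"
    and commute_y: "y c * y d = y d * y c"
    and commute_xy: "x c * y d - y d * x c + (y c * x d - x d * y c) = 0"
begin

text \<open>\<open>commute_xy\<close> is exactly the vanishing of the \<lambda>-linear part of the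
  commutator.\<close>

lemma pencil_commute: "pencil x y c * pencil x y d = pencil x y d * pencil x y c"
proof -
  have X: "fps_X * a = a * fps_X" for a :: "'a fps" by (rule int_fps_commute[OF int_fps_X])
  have 1: "fps_const a * (fps_X * fps_const b) = fps_X * fps_const (a * b)"
    and 2: "fps_X * fps_const a * (fps_X * fps_const b) = fps_X * fps_X * fps_const (a * b)"
    and 3: "fps_X * fps_const a * fps_const b = fps_X * fps_const (a * b)" for a b :: 'a
    by (metis X fps_const_mult mult.assoc)+
  have "x c * y d + y c * x d = x d * y c + y d * x c"
    using commute_xy[of c d] by (simp add: algebra_simps)
  then have "fps_X * fps_const (x c * y d) + fps_X * fps_const (y c * x d)
    = fps_X * fps_const (x d * y c) + fps_X * fps_const (y d * x c)"
    by (simp add: distrib_left[symmetric])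
  then show ?thesis
    unfolding pencil_def distrib_left distrib_right 1 2 3
    by (simp add: commute_x[of c d] commute_y[of c d] add_ac)
qed

definition rev_prod :: "(nat \<Rightarrow> 'a) \<Rightarrow> nat \<Rightarrow> nat \<Rightarrow> 'a" where
  "rev_prod f i j = prod_list (map f (rev [i..<j]))"

lemma rev_prod_Suc: "i \<le> j \<Longrightarrow> rev_prod f i (Suc j) = f j * rev_prod f i j"
  by (simp add: rev_prod_def)

lemma rev_prod_self [simp]: "rev_prod f i i = 1"
  by (simp add: rev_prod_def)

text \<open>A letter x pushed to the right through a descending block of y takes over the lowest
  index and raises the indices of the block by one.\<close>

lemma exchange_rev_prod: "i \<le> j \<Longrightarrow> x j * rev_prod y i j = rev_prod y (Suc i) (Suc j) * x i"
proof (induction j rule: dec_induct)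
  case (step j)
  have "x (Suc j) * rev_prod y i (Suc j) = x (Suc j) * y j * rev_prod y i j"
    using step by (simp add: rev_prod_Suc mult.assoc)
  also have "\<dots> = y (Suc j) * (rev_prod y (Suc i) (Suc j) * x i)"
    by (simp add: exchange mult.assoc step.IH)
  finally show ?case using step by (simp add: rev_prod_Suc mult.assoc)
qed simp

text \<open>Read in descending order, every word with m letters y is brought by the exchange
  relation into the same form, all y first; there are n choose m such words. The product may be
  reversed beforehand because the pencils commute.\<close>

lemma pencil_prod_nth:
  "m \<le> n \<Longrightarrow> fps_nth (pencil_prod x y n) m
    = of_nat (n choose m) * (rev_prod y (n - m) n * rev_prod x 0 (n - m))"
proof -
  define W where "W n = prod_list (map (pencil x y) (rev [0..<n]))" for n
  have W: "W n = pencil_prod x y n" for n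
    unfolding W_def pencil_prod_def rev_map[symmetric]
    by (rule prod_list_rev) (auto simp: pencil_commute)
  have W_Suc: "fps_nth (W (Suc n)) m = x n * fps_nth (W n) m + (if m = 0 then 0 else y n * fps_nth (W n) (m - 1))" for n m
    by (simp add: W_def pencil_def distrib_right mult.assoc)
  have pull: "a * (of_nat k * b) = of_nat k * (a * b)" for a b :: 'a and k
    by (metis mult.assoc mult_of_nat_commute)
  have "m \<le> n \<Longrightarrow> fps_nth (W n) m
    = of_nat (n choose m) * (rev_prod y (n - m) n * rev_prod x 0 (n - m))"
  proof (induction n arbitrary: m)
    case 0
    then show ?case by (simp add: W_def)
  next
    case (Suc n)
    have 1: "x n * fps_nth (W n) m = of_nat (n choose m) * (rev_prod y (Suc n - m) (Suc n) * rev_prod x 0 (Suc n - m))"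
    proof (cases "m \<le> n")
      case True
      then have "x n * fps_nth (W n) m = of_nat (n choose m) * (x n * rev_prod y (n - m) n * rev_prod x 0 (n - m))"
        by (simp only: Suc.IH[OF True] pull mult.assoc)
      also have "\<dots> = of_nat (n choose m) * (rev_prod y (Suc (n - m)) (Suc n) * (x (n - m) * rev_prod x 0 (n - m)))"
        by (simp add: exchange_rev_prod mult.assoc)
      finally show ?thesis using True by (simp add: Suc_diff_le rev_prod_Suc)
    next
      case False
      then show ?thesis using pencil_prod_nth_large[of n m x y] by (simp add: W binomial_eq_0)
    qed
    show ?case
    proof (cases m)
      case 0
      then show ?thesis using 1 by (simp add: W_Suc)
    next
      case (Suc k)
      then have k: "k \<le> n" using Suc.prems by simp
      have "y n * fps_nth (W n) k = of_nat (n choose k) * (y n * rev_prod y (n - k) n * rev_prod x 0 (n - k))"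
        by (simp only: Suc.IH[OF k] pull mult.assoc)
      also have "\<dots> = of_nat (n choose k) * (rev_prod y (n - k) (Suc n) * rev_prod x 0 (n - k))"
        by (simp add: rev_prod_Suc)
      finally show ?thesis using 1 by (simp add: W_Suc Suc distrib_right)
    qed
  qed
  then show "m \<le> n \<Longrightarrow> ?thesis" by (simp add: W)
qed

lemma of_nat_choose_eq_0:
  assumes "of_nat p = (0::'a)" "prime p" "0 < m" "m < p"
  shows "of_nat (p choose m) = (0::'a)"
proof -
  have "p dvd (p choose m)" using assms by (intro dvd_choose_prime) auto
  then show ?thesis using assms(1) by (auto elim!: dvdE)
qed

lemma pencil_prod_middle:
  assumes "of_nat p = (0::'a)" "prime p" "0 < m" "m < p"
  shows "fps_nth (pencil_prod x y p) m = 0"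
  using assms by (simp add: pencil_prod_nth of_nat_choose_eq_0)

lemma pencil_prod_last: "fps_nth (pencil_prod x y n) n = prod_list (map y [0..<n])"
proof -
  have "prod_list (rev (map y [0..<n])) = prod_list (map y [0..<n])"
    by (rule prod_list_rev) (auto simp: commute_y)
  then show ?thesis by (simp add: pencil_prod_nth rev_prod_def rev_map)
qed

text \<open>Here x, y are shifts of two entries of a row, and \<xi>, \<eta> those of a column of a
  second matrix commuting with the first. Words in the second leg depend only on the number m of
  letters \<eta>, so the expanded product groups into pencil coefficients of the first leg, of which
  only m = 0 and m = p survive.\<close>

lemma prod_sum_two_legs:
  fixes \<xi> \<eta> :: "nat \<Rightarrow> 'a"
  assumes exch: "\<And>c. \<xi> c * \<eta> (Suc c) = \<eta> c * \<xi> (Suc c)"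
    and comm: "\<And>c d. x c * \<xi> d = \<xi> d * x c" "\<And>c d. x c * \<eta> d = \<eta> d * x c"
      "\<And>c d. y c * \<xi> d = \<xi> d * y c" "\<And>c d. y c * \<eta> d = \<eta> d * y c"
    and p: "of_nat p = (0::'a)" "prime p"
  shows "prod_list (map (\<lambda>c. x c * \<xi> c + y c * \<eta> c) [0..<p])
    = prod_list (map x [0..<p]) * prod_list (map \<xi> [0..<p])
    + prod_list (map y [0..<p]) * prod_list (map \<eta> [0..<p])"
proof -
  define Q where "Q f i j = prod_list (map f [i..<j])" for f :: "nat \<Rightarrow> 'a" and i j
  \<comment> \<open>Normal form of the words with m letters \<eta>: all \<xi> first, indices
    increasing.\<close>
  define R where "R n m = Q \<xi> 0 (n - m) * Q \<eta> (n - m) n" for n m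
  have Q_Suc: "Q f i (Suc j) = Q f i j * f j" if "i \<le> j" for f i j
    using that by (simp add: Q_def)
  have Q_self: "Q f i i = 1" for f i by (simp add: Q_def)
  have move: "Q \<eta> i j * \<xi> j = \<xi> i * Q \<eta> (Suc i) (Suc j)" if "i \<le> j" for i j
    using that
  proof (induction j rule: dec_induct)
    case (step j)
    have "Q \<eta> i (Suc j) * \<xi> (Suc j) = Q \<eta> i j * (\<eta> j * \<xi> (Suc j))"
      using step by (simp add: Q_Suc mult.assoc)
    also have "\<dots> = \<xi> i * Q \<eta> (Suc i) (Suc j) * \<eta> (Suc j)"
      by (simp add: exch[symmetric] mult.assoc[symmetric] step.IH)
    finally show ?case using step by (simp add: Q_Suc mult.assoc)
  qed (simp add: Q_self)
  have R\<xi>: "R n m * \<xi> n = R (Suc n) m" if "m \<le> n" for n m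
    using that move[of "n - m" n] by (simp add: R_def mult.assoc Suc_diff_le Q_Suc)
  have R\<eta>: "R n m * \<eta> n = R (Suc n) (Suc m)" if "m \<le> n" for n m
    using that by (simp add: R_def mult.assoc Q_Suc)
  have Rx: "R n m * x n = x n * R n m" and Ry: "R n m * y n = y n * R n m" for n m
  proof -
    have "a * R n m = R n m * a" if "\<And>d. a * \<xi> d = \<xi> d * a" "\<And>d. a * \<eta> d = \<eta> d * a" for a
    proof -
      have "a * Q \<xi> 0 (n - m) = Q \<xi> 0 (n - m) * a" "a * Q \<eta> (n - m) n = Q \<eta> (n - m) n * a"
        unfolding Q_def by (rule prod_list_commute; use that in auto)+
      then show ?thesis unfolding R_def by (metis mult.assoc)
    qed
    then show "R n m * x n = x n * R n m" "R n m * y n = y n * R n m"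
      using comm by simp_all
  qed
  let ?Z = "\<lambda>n m. fps_nth (pencil_prod x y n) m"
  have "prod_list (map (\<lambda>c. x c * \<xi> c + y c * \<eta> c) [0..<n]) = (\<Sum>m\<le>n. ?Z n m * R n m)" for n
  proof (induction n)
    case 0
    then show ?case by (simp add: pencil_prod_def R_def Q_def)
  next
    case (Suc n)
    have "prod_list (map (\<lambda>c. x c * \<xi> c + y c * \<eta> c) [0..<Suc n])
      = (\<Sum>m\<le>n. ?Z n m * R n m * (x n * \<xi> n + y n * \<eta> n))"
      by (simp add: Suc sum_distrib_right)
    also have "\<dots> = (\<Sum>m\<le>n. ?Z n m * x n * R (Suc n) m + ?Z n m * y n * R (Suc n) (Suc m))"
    proof (intro sum.cong refl)
      fix m assume "m \<in> {..n}"
      then have m: "m \<le> n" by simp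
      have "R n m * (x n * \<xi> n) = x n * R (Suc n) m"
        by (metis R\<xi>[OF m] Rx mult.assoc)
      moreover have "R n m * (y n * \<eta> n) = y n * R (Suc n) (Suc m)"
        by (metis R\<eta>[OF m] Ry mult.assoc)
      ultimately show "?Z n m * R n m * (x n * \<xi> n + y n * \<eta> n)
        = ?Z n m * x n * R (Suc n) m + ?Z n m * y n * R (Suc n) (Suc m)"
        by (simp add: distrib_left mult.assoc)
    qed
    also have "\<dots> = (\<Sum>m\<le>Suc n. ?Z n m * x n * R (Suc n) m) + (\<Sum>m\<le>n. ?Z n m * y n * R (Suc n) (Suc m))"
      by (simp add: sum.distrib pencil_prod_nth_large)
    also have "(\<Sum>m\<le>n. ?Z n m * y n * R (Suc n) (Suc m))
      = (\<Sum>m\<le>Suc n. if m = 0 then 0 else ?Z n (m - 1) * y n * R (Suc n) m)"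
      unfolding sum.atMost_Suc_shift[of _ n] by simp
    also have "(\<Sum>m\<le>Suc n. ?Z n m * x n * R (Suc n) m) + \<dots> = (\<Sum>m\<le>Suc n. ?Z (Suc n) m * R (Suc n) m)"
      unfolding sum.distrib[symmetric] pencil_prod_nth_Suc by (intro sum.cong) (auto simp: distrib_right)
    finally show ?case .
  qed
  then have "prod_list (map (\<lambda>c. x c * \<xi> c + y c * \<eta> c) [0..<p]) = (\<Sum>m\<le>p. ?Z p m * R p m)" .
  also have "\<dots> = (\<Sum>m\<in>{0, p}. ?Z p m * R p m)"
    using p by (intro sum.mono_neutral_right) (auto simp: pencil_prod_middle)
  also have "\<dots> = ?Z p 0 * R p 0 + ?Z p p * R p p"
    using p(2) by (simp add: prime_gt_0_nat)
  finally show ?thesis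
    by (simp add: pencil_prod_nth_0 pencil_prod_last R_def Q_def)
qed

end

section \<open>Passing between the p-th power of a series and the p-th powers of its
  coefficients\<close>

section \<open>Powers of the series of root vectors\<close>

lemma central_prod_list:
  fixes z :: "'a::monoid_mult"
  assumes "\<And>y. y \<in> set ys \<Longrightarrow> y * z = z * y"
  shows "prod_list ys * z = z * prod_list ys"
  by (rule prod_list_commute[symmetric]) (simp add: assms)

text \<open>The model is \<open>e = 1/x\<close>, \<open>a = - \<zeta> d/dx\<close>; there \<open>e - a\<close> is conjugate to \<open>- a\<close> by a power of \<open>x\<close>.\<close>

lemma power_diff_derivation:
  fixes e a \<zeta> :: "'a::ring_1"
  assumes ae: "a * e = e * a + \<zeta> * (e * e)" and \<zeta>: "\<And>x. \<zeta> * x = x * \<zeta>"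
  shows "(e - a) ^ n = (\<Sum>k\<le>n. of_nat (n choose k) *
    (prod_list (map (\<lambda>i. 1 - of_nat i * \<zeta>) [0..<k]) * (e ^ k * (- a) ^ (n - k))))"
proof -
  define c where "c k = prod_list (map (\<lambda>i. 1 - of_nat i * \<zeta>) [0..<k])" for k
  have cen: "(1 - of_nat i * \<zeta>) * x = x * (1 - of_nat i * \<zeta>)" for i x
    unfolding left_diff_distrib right_diff_distrib mult_1 mult_1_right
    by (metis \<zeta> mult.assoc mult_of_nat_commute)
  have c: "c k * x = x * c k" for k x
    unfolding c_def by (rule central_prod_list) (auto simp: cen)
  have c_Suc: "c (Suc k) = c k * (1 - of_nat k * \<zeta>)" for k
    by (simp add: c_def)
  define b where "b = - a"
  have be: "b * e = e * b - \<zeta> * (e * e)" using ae by (simp add: b_def)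
  \<comment> \<open>Moving b past e^k costs k copies of \<zeta> e^(k+1); these produce the factors 1
    - k \<zeta>.\<close>
  have bek: "b * e ^ k = e ^ k * b - of_nat k * \<zeta> * e ^ Suc k" for k
  proof (induction k)
    case (Suc k)
    have "b * e ^ Suc k = b * e ^ k * e" by (simp add: power_commutes mult.assoc)
    also have "\<dots> = e ^ k * (b * e) - of_nat k * \<zeta> * e ^ Suc (Suc k)"
      unfolding Suc by (simp add: algebra_simps power_commutes)
    also have "e ^ k * (b * e) = e ^ Suc k * b - e ^ k * (\<zeta> * (e * e))"
      unfolding be by (simp add: right_diff_distrib mult.assoc[symmetric] power_commutes)
    also have "e ^ k * (\<zeta> * (e * e)) = \<zeta> * e ^ Suc (Suc k)"
      by (metis \<zeta> mult.assoc power_Suc2)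
    finally show ?case by (simp add: algebra_simps)
  qed simp
  have "(e + b) ^ n = (\<Sum>k\<le>n. of_nat (n choose k) * (c k * (e ^ k * b ^ (n - k))))"
  proof (induction n)
    case 0
    then show ?case by (simp add: c_def)
  next
    case (Suc n)
    have step: "(e + b) * (of_nat m * (c k * (e ^ k * x)))
      = of_nat m * (c (Suc k) * (e ^ Suc k * x)) + of_nat m * (c k * (e ^ k * (b * x)))" for m k x
    proof -
      have "(e + b) * (of_nat m * z) = of_nat m * ((e + b) * z)" "(e + b) * (c k * z) = c k * ((e + b) * z)" for z
        by (metis mult.assoc mult_of_nat_commute, metis mult.assoc c)
      then have "(e + b) * (of_nat m * (c k * (e ^ k * x))) = of_nat m * (c k * ((e + b) * e ^ k * x))"
        by (simp only: mult.assoc)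
      also have "(e + b) * e ^ k = (1 - of_nat k * \<zeta>) * e ^ Suc k + e ^ k * b"
        by (simp add: distrib_right bek left_diff_distrib)
      finally show ?thesis by (simp add: c_Suc distrib_left distrib_right mult.assoc)
    qed
    have "(e + b) ^ Suc n = (\<Sum>k\<le>n. (e + b) * (of_nat (n choose k) * (c k * (e ^ k * b ^ (n - k)))))"
      by (simp add: Suc sum_distrib_left)
    also have "\<dots> = (\<Sum>k\<le>n. of_nat (n choose k) * (c (Suc k) * (e ^ Suc k * b ^ (n - k))))
      + (\<Sum>k\<le>n. of_nat (n choose k) * (c k * (e ^ k * (b * b ^ (n - k)))))"
      unfolding step sum.distrib ..
    also have "(\<Sum>k\<le>n. of_nat (n choose k) * (c (Suc k) * (e ^ Suc k * b ^ (n - k))))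
      = (\<Sum>k\<le>Suc n. of_nat (if k = 0 then 0 else n choose (k - 1)) * (c k * (e ^ k * b ^ (Suc n - k))))"
      unfolding sum.atMost_Suc_shift[of _ n] by simp
    also have "(\<Sum>k\<le>n. of_nat (n choose k) * (c k * (e ^ k * (b * b ^ (n - k)))))
      = (\<Sum>k\<le>Suc n. of_nat (n choose k) * (c k * (e ^ k * b ^ (Suc n - k))))"
      by (simp add: Suc_diff_le binomial_eq_0)
    also have "(\<Sum>k\<le>Suc n. of_nat (if k = 0 then 0 else n choose (k - 1)) * (c k * (e ^ k * b ^ (Suc n - k))))
        + \<dots> = (\<Sum>k\<le>Suc n. of_nat (Suc n choose k) * (c k * (e ^ k * b ^ (Suc n - k))))"
      unfolding sum.distrib[symmetric]
      by (intro sum.cong refl, rename_tac k, case_tac k) (simp_all add: distrib_right)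
    finally show ?case .
  qed
  then show ?thesis by (simp add: b_def c_def)
qed

lemma power_prime_diff_derivation:
  fixes e a \<zeta> :: "'a::ring_1"
  assumes "a * e = e * a + \<zeta> * (e * e)" "\<And>x. \<zeta> * x = x * \<zeta>" and p: "of_nat p = (0::'a)" "prime p"
  shows "(e - a) ^ p = prod_list (map (\<lambda>i. 1 - of_nat i * \<zeta>) [0..<p]) * e ^ p + (- a) ^ p"
proof -
  have 0: "of_nat (p choose k) = (0::'a)" if "0 < k" "k < p" for k
  proof -
    have "p dvd (p choose k)" using that p by (intro dvd_choose_prime) auto
    then show ?thesis using p(1) by (auto elim!: dvdE)
  qed
  have "(e - a) ^ p = (\<Sum>k\<in>{0, p}. of_nat (p choose k) *
    (prod_list (map (\<lambda>i. 1 - of_nat i * \<zeta>) [0..<k]) * (e ^ k * (- a) ^ (p - k))))"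
    unfolding power_diff_derivation[OF assms(1,2)]
    by (intro sum.mono_neutral_right) (auto simp: 0)
  then show ?thesis using prime_gt_0_nat[OF p(2)] by (simp add: add.commute)
qed

text \<open>What the series e and f have in common: if E_k(u) is the tail of e(u) after k
  coefficients, moved back to start at u^-1, then [e^(k+1), E_k(u)] = s E_k(u)^2. The integer s will
  be the sign of the RTT relation.\<close>

locale root_series =
  fixes e :: "nat \<Rightarrow> 'a::ring_1" and s :: int and p :: nat
  assumes char: "of_nat p = (0::'a)" and prime: "prime p"
    and bracket: "fps_const (e (Suc k)) * Abs_fps (\<lambda>n. if n = 0 then 0 else e (n + k))
        - Abs_fps (\<lambda>n. if n = 0 then 0 else e (n + k)) * fps_const (e (Suc k))
      = of_int s * (Abs_fps (\<lambda>n. if n = 0 then 0 else e (n + k)) * Abs_fps (\<lambda>n. if n = 0 then 0 else e (n + k)))"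
begin

definition tail_series :: "nat \<Rightarrow> 'a fps" where
  "tail_series k = Abs_fps (\<lambda>n. if n = 0 then 0 else e (n + k))"

lemma tail_series_Suc: "tail_series k - fps_X * fps_const (e (Suc k)) = fps_X * tail_series (Suc k)"
proof (rule fps_ext)
  fix n
  show "fps_nth (tail_series k - fps_X * fps_const (e (Suc k))) n = fps_nth (fps_X * tail_series (Suc k)) n"
    by (cases n; cases "n - 1") (simp_all add: tail_series_def)
qed

lemma X_mult_power: "(fps_X * a) ^ n = fps_X ^ n * (a ^ n :: 'a fps)"
proof (induction n)
  case (Suc n)
  have "fps_X * a * (fps_X ^ n * a ^ n) = fps_X * (a * fps_X ^ n) * a ^ n"
    by (simp only: mult.assoc)
  also have "a * fps_X ^ n = fps_X ^ n * a"
    by (rule int_fps_commute[symmetric, OF int_fps_power[OF int_fps_X]])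
  finally show ?case by (simp add: Suc mult.assoc)
qed simp

text \<open>In characteristic p this is 1 - (s u^-1)^(p-1): invertible with integer coefficients, so
  it can be divided out inside an additive subgroup.\<close>

definition lead_factor :: "'a fps" where
  "lead_factor = prod_list (map (\<lambda>i. 1 - of_nat i * (of_int s * fps_X)) [0..<p])"

lemma lead_factor: "int_fps lead_factor" "fps_nth lead_factor 0 = 1"
proof -
  have i: "int_fps (1 - of_nat i * (of_int s * fps_X) :: 'a fps)" for i
    by (intro int_fps_diff int_fps_mult int_fps_one int_fps_X)
       (simp_all add: int_fps_def flip: fps_of_int fps_of_nat)
  have "int_fps (prod_list (map (\<lambda>i. 1 - of_nat i * (of_int s * fps_X)) is) :: 'a fps)
    \<and> fps_nth (prod_list (map (\<lambda>i. 1 - of_nat i * (of_int s * fps_X)) is) :: 'a fps) 0 = 1" for "is"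
    by (induction "is") (use i in \<open>simp_all add: int_fps_one int_fps_mult\<close>)
  then show "int_fps lead_factor" "fps_nth lead_factor 0 = 1"
    by (simp_all add: lead_factor_def)
qed

text \<open>The p-th power of u^-1 E_(k+1) = E_k - u^-1 e^(k+1), by
  \<open>power_prime_diff_derivation\<close> with \<zeta> = s u^-1. It isolates the p-th power of a
  single coefficient.\<close>

lemma tail_series_power:
  "fps_X ^ p * tail_series (Suc k) ^ p
    = lead_factor * tail_series k ^ p + fps_X ^ p * fps_const ((- e (Suc k)) ^ p)"
proof -
  let ?a = "fps_X * fps_const (e (Suc k))" and ?E = "tail_series k"
  have X: "fps_X * b = b * fps_X" "of_int s * b = b * of_int s" for b :: "'a fps"
    by (simp_all add: int_fps_commute[OF int_fps_X] mult_of_int_commute)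
  have "?a * ?E = fps_X * (?E * fps_const (e (Suc k)) + of_int s * (?E * ?E))"
    using bracket[of k, folded tail_series_def] by (simp add: mult.assoc diff_eq_eq add.commute)
  also have "\<dots> = ?E * ?a + of_int s * fps_X * (?E * ?E)"
    unfolding distrib_left by (metis X mult.assoc)
  finally have 1: "?a * ?E = ?E * ?a + of_int s * fps_X * (?E * ?E)" .
  have 2: "of_int s * fps_X * b = b * (of_int s * fps_X)" for b :: "'a fps"
    by (metis X mult.assoc)
  have 3: "of_nat p = (0 :: 'a fps)"
    using char by (simp flip: fps_of_nat)
  have 4: "(- ?a) ^ p = fps_X ^ p * fps_const ((- e (Suc k)) ^ p)"
  proof -
    have "- ?a = fps_X * fps_const (- e (Suc k))"
      by (simp flip: fps_const_neg)
    then show ?thesis by (simp add: X_mult_power fps_const_power)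
  qed
  show ?thesis
    using power_prime_diff_derivation[OF 1 2 3 prime]
    unfolding tail_series_Suc X_mult_power[of "tail_series (Suc k)"] 4 lead_factor_def .
qed

text \<open>Up to integer combinations of lower coefficients, coefficient n of E_k^p is coefficient
  n - p of E_(k+1)^p, corrected for n = p by the p-th power of e^(k+1). Climbing from k = 0 gives
  one direction, induction on the degree for all k at once gives the other.\<close>

lemma power_coeffs_iff:
  assumes J: "additive_set J"
  shows "(\<forall>n. fps_nth (tail_series 0 ^ p) n \<in> J) \<longleftrightarrow> (\<forall>r>0. e r ^ p \<in> J)"
proof -
  have p0: "p > 0" using prime by (simp add: prime_gt_0_nat)
  have low: "fps_nth (tail_series k ^ p) n = 0" if "n < p" for k n
    using startsby_zero_power_prefix[of "tail_series k" p] that by (simp add: tail_series_def)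
  have lead: "fps_nth (lead_factor * tail_series k ^ p) n
    = (if n < p then 0 else fps_nth (tail_series (Suc k) ^ p) (n - p))
      - (if n = p then (- e (Suc k)) ^ p else 0)" for k n
    using arg_cong[OF tail_series_power[of k], of "\<lambda>a. fps_nth a n"]
    by (auto simp: fps_X_power_mult_nth algebra_simps)
  have sgn: "(- x) ^ p \<in> J \<longleftrightarrow> x ^ p \<in> J" for x
    using additive_set_uminus[OF J, of "x ^ p"] additive_set_uminus[OF J, of "- (x ^ p)"]
    by (cases "even p") auto
  have prod: "fps_nth (lead_factor * a) n \<in> J" if "\<And>k. k \<le> n \<Longrightarrow> fps_nth a k \<in> J" for a n
    unfolding fps_mult_nth using that lead_factor(1)
    by (auto intro!: additive_set_sum[OF J] additive_set_Ints[OF J] simp: int_fps_def)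
  have eq: "fps_nth (tail_series k ^ p) n = fps_nth (lead_factor * tail_series k ^ p) n
    - (\<Sum>i<n. fps_nth lead_factor (n - i) * fps_nth (tail_series k ^ p) i)" for k n
  proof -
    have "fps_nth (lead_factor * tail_series k ^ p) n
      = (\<Sum>i\<le>n. fps_nth lead_factor (n - i) * fps_nth (tail_series k ^ p) i)"
      unfolding fps_mult_nth atLeast0AtMost
      by (rule sum.reindex_bij_witness[of _ "\<lambda>i. n - i" "\<lambda>i. n - i"]) auto
    then show ?thesis
      by (simp add: lessThan_Suc_atMost[symmetric] lead_factor)
  qed
  show ?thesis
  proof (intro iffI allI impI)
    fix r :: nat
    assume E0: "\<forall>n. fps_nth (tail_series 0 ^ p) n \<in> J" and "r > 0"
    \<comment> \<open>In degree p the next tail contributes its constant coefficient, which is 0;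
      only the p-th power remains.\<close>
    have top: "(- e (Suc k)) ^ p \<in> J" if "\<forall>n. fps_nth (tail_series k ^ p) n \<in> J" for k
    proof -
      have "fps_nth (lead_factor * tail_series k ^ p) p \<in> J" using prod that by blast
      then have "- ((- e (Suc k)) ^ p) \<in> J" using lead[of k p] low[OF p0] by simp
      then show ?thesis using additive_set_uminus[OF J] by fastforce
    qed
    have "\<forall>n. fps_nth (tail_series k ^ p) n \<in> J" for k
    proof (induction k)
      case (Suc k)
      show ?case
      proof
        fix n
        have "fps_nth (tail_series (Suc k) ^ p) n = fps_nth (lead_factor * tail_series k ^ p) (n + p)
          + (if n = 0 then (- e (Suc k)) ^ p else 0)"
          using lead[of k "n + p"] by simp
        moreover have "fps_nth (lead_factor * tail_series k ^ p) (n + p) \<in> J" using prod Suc by blast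
        ultimately show "fps_nth (tail_series (Suc k) ^ p) n \<in> J"
          using top[OF Suc] additive_set_add[OF J] additive_set_zero[OF J] by auto
      qed
    qed (rule E0)
    then have "(- e (Suc (r - 1))) ^ p \<in> J" by (rule top)
    then show "e r ^ p \<in> J" using \<open>r > 0\<close> sgn by simp
  next
    fix n
    assume e: "\<forall>r>0. e r ^ p \<in> J"
    have "fps_nth (tail_series k ^ p) n \<in> J" for k
    proof (induction n arbitrary: k rule: less_induct)
      case (less n)
      have "fps_nth (lead_factor * tail_series k ^ p) n \<in> J"
        unfolding lead using less.IH e p0 sgn[of "e (Suc k)"]
        by (auto intro!: additive_set_diff[OF J] additive_set_zero[OF J])
      moreover have "(\<Sum>i<n. fps_nth lead_factor (n - i) * fps_nth (tail_series k ^ p) i) \<in> J"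
        using less.IH lead_factor(1) by (intro additive_set_sum[OF J] additive_set_Ints[OF J]) (auto simp: int_fps_def)
      ultimately show ?case unfolding eq[of k n] by (rule additive_set_diff[OF J])
    qed
    then show "fps_nth (tail_series 0 ^ p) n \<in> J" .
  qed
qed

end

section \<open>The RTT relation: symmetries, coefficient forms, products and inverses\<close>

section \<open>Families satisfying the RTT relation\<close>

text \<open>
  The relation \<open>(u - v) [t\<^sub>i\<^sub>j(u), t\<^sub>k\<^sub>l(v)] = \<kappa> (t\<^sub>k\<^sub>j(u) t\<^sub>i\<^sub>l(v) - t\<^sub>k\<^sub>j(v) t\<^sub>i\<^sub>l(u))\<close>. The sign \<open>\<kappa>\<close> makes room for
  the transposed and the inverse matrix, which satisfy the relation with \<open>\<kappa> = -1\<close>.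
\<close>

locale rtt =
  fixes \<kappa> :: int and t :: "2 \<Rightarrow> 2 \<Rightarrow> nat \<Rightarrow> 'a::ring_1"
  assumes sign: "\<kappa> * \<kappa> = 1"
    and t_0: "t i j 0 = (if i = j then 1 else 0)"
    and rel: "t i j (Suc r) * t k l s - t k l s * t i j (Suc r)
        - (t i j r * t k l (Suc s) - t k l (Suc s) * t i j r)
      = of_int \<kappa> * (t k j r * t i l s - t k j s * t i l r)"
begin

lemma sign_mult: "of_int \<kappa> * (of_int \<kappa> * x) = (x :: 'a)"
proof -
  have "of_int \<kappa> * (of_int \<kappa> * x) = of_int (\<kappa> * \<kappa>) * x" by (simp add: mult.assoc)
  then show ?thesis by (simp add: sign)
qed

lemma sign_cancel: "of_int \<kappa> * x = of_int \<kappa> * y \<Longrightarrow> x = (y :: 'a)"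
  by (metis sign_mult)

text \<open>Antisymmetry of the bracket: the relation for the pair (k,j), (i,l) has the same left
  side when read with the factors exchanged, so the two right sides agree, and \<kappa> can be
  cancelled.\<close>

lemma commutator_swap:
  "t i j r * t k l s - t k l s * t i j r = t i j s * t k l r - t k l r * t i j s"
proof -
  have "of_int \<kappa> * (t i j r * t k l s - t i j s * t k l r)
    = of_int \<kappa> * (t k l s * t i j r - t k l r * t i j s)"
    unfolding rel[of k j r i l s, symmetric] rel[of i l s k j r, symmetric] by simp
  then show ?thesis using sign_cancel by (fastforce simp: algebra_simps)
qed

lemma rel': "t i j (Suc r) * t k l s - t k l s * t i j (Suc r)
        - (t i j r * t k l (Suc s) - t k l (Suc s) * t i j r)
      = of_int \<kappa> * (t i l s * t k j r - t i l r * t k j s)"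
proof -
  have "t k j r * t i l s - t k j s * t i l r = t i l s * t k j r - t i l r * t k j s"
    using commutator_swap[of k j r i l s] by (simp add: algebra_simps)
  then show ?thesis using rel[of i j r k l s] by simp
qed

lemma bracket_0: "t i j 0 * x = x * t i j 0"
  by (simp add: t_0)

text \<open>The case r = 0 of the relation: the elements \<open>t i j 1\<close> act on the
  generators as gl_2 does, up to \<kappa>.\<close>

lemma bracket_1: "t i j 1 * t k l s - t k l s * t i j 1
  = of_int \<kappa> * ((if k = j then t i l s else 0) - (if i = l then t k j s else 0))"
  using rel[of i j 0 k l s] bracket_0[of i j "t k l (Suc s)"]
  unfolding t_0[of k j] t_0[of i l] by auto

lemma commute_entry: "t i j r * t i j s = t i j s * t i j r"
proof (induction r arbitrary: s)
  case 0
  then show ?case by (rule bracket_0)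
next
  case (Suc r)
  then show ?case using rel[of i j r i j s] by (simp add: Suc)
qed

text \<open>Transposition interchanges \<open>rel\<close> and \<open>rel'\<close> at the cost of the
  sign. Every statement about rows thereby yields one about columns.\<close>

lemma rtt_transpose: "rtt (- \<kappa>) (\<lambda>i j. t j i)"
proof
  show "- \<kappa> * - \<kappa> = 1" by (simp add: sign)
  show "t j i 0 = (if i = j then 1 else 0)" for i j by (simp add: t_0 eq_commute)
  show "t j i (Suc r) * t l k s - t l k s * t j i (Suc r) - (t j i r * t l k (Suc s) - t l k (Suc s) * t j i r)
    = of_int (- \<kappa>) * (t j k r * t l i s - t j k s * t l i r)" for i j r k l s
    using rel'[of j i r l k s] by (simp add: algebra_simps)
qed

text \<open>Telescoping in r and in s gives the same bracket as sums of length r and s; the shorter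
  of them is the form used to present the Yangian.\<close>

lemma commutator_sum:
  assumes "r > 0" "s > 0"
  shows "t i j r * t k l s - t k l s * t i j r = of_int \<kappa> *
    (\<Sum>q<min r s. t k j q * t i l (r + s - 1 - q) - t k j (r + s - 1 - q) * t i l q)"
proof -
  have 1: "t i j r * t k l s - t k l s * t i j r = of_int \<kappa> *
    (\<Sum>q<r. t k j q * t i l (r + s - 1 - q) - t k j (r + s - 1 - q) * t i l q)" for r s
  proof (induction r arbitrary: s)
    case 0
    then show ?case by (simp add: bracket_0)
  next
    case (Suc r)
    have "t i j (Suc r) * t k l s - t k l s * t i j (Suc r)
      = of_int \<kappa> * (\<Sum>q<r. t k j q * t i l (r + Suc s - 1 - q) - t k j (r + Suc s - 1 - q) * t i l q)
      + of_int \<kappa> * (t k j r * t i l s - t k j s * t i l r)"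
      using rel[of i j r k l s] Suc[of "Suc s"] by (simp add: algebra_simps)
    then show ?case by (simp add: distrib_left)
  qed
  have 2: "t i j r * t k l s - t k l s * t i j r = of_int \<kappa> *
    (\<Sum>q<s. t k j q * t i l (r + s - 1 - q) - t k j (r + s - 1 - q) * t i l q)" for r s
  proof (induction s arbitrary: r)
    case 0
    then show ?case by (simp add: bracket_0)
  next
    case (Suc s)
    have "t i j r * t k l (Suc s) - t k l (Suc s) * t i j r
      = of_int \<kappa> * (\<Sum>q<s. t k j q * t i l (Suc r + s - 1 - q) - t k j (Suc r + s - 1 - q) * t i l q)
      + of_int \<kappa> * (t k j s * t i l r - t k j r * t i l s)"
      using rel[of i j r k l s] Suc[of "Suc r"] by (simp add: algebra_simps)
    then show ?case by (simp add: distrib_left)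
  qed
  show ?thesis using 1[of r s] 2[of r s] by (cases "r \<le> s") (simp_all add: min_def)
qed

end

lemma rtt_one_of_commutator_sum:
  fixes t :: "2 \<Rightarrow> 2 \<Rightarrow> nat \<Rightarrow> 'a::ring_1"
  assumes t_0: "\<And>i j. t i j 0 = (if i = j then 1 else 0)"
    and sum: "\<And>i j k l r s. r > 0 \<Longrightarrow> s > 0 \<Longrightarrow> t i j r * t k l s - t k l s * t i j r =
      (\<Sum>q<min r s. t k j q * t i l (r + s - 1 - q) - t k j (r + s - 1 - q) * t i l q)"
  shows "rtt 1 t"
proof
  fix i j r k l s
  let ?f = "\<lambda>q. t k j q * t i l (r + s - q) - t k j (r + s - q) * t i l q"
  have "t i j r * t k l s - t k l s * t i j r =
      (\<Sum>q<min r s. t k j q * t i l (r + s - 1 - q) - t k j (r + s - 1 - q) * t i l q)" for r s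
    using sum[of r s i j k l] by (cases "r = 0 \<or> s = 0") (auto simp: t_0)
  then have "t i j (Suc r) * t k l s - t k l s * t i j (Suc r) = (\<Sum>q<min (Suc r) s. ?f q)"
    and "t i j r * t k l (Suc s) - t k l (Suc s) * t i j r = (\<Sum>q<min r (Suc s). ?f q)"
    by simp_all
  \<comment> \<open>The two sums share their summand and their lengths differ by at most
    one.\<close>
  moreover consider "r < s" | "r = s" | "s < r" by linarith
  then have "(\<Sum>q<min (Suc r) s. ?f q) - (\<Sum>q<min r (Suc s). ?f q) = t k j r * t i l s - t k j s * t i l r"
  proof cases
    case 3
    then have "min (Suc r) s = s" "min r (Suc s) = Suc s" by auto
    then show ?thesis by simp
  qed (simp_all add: min_def)
  ultimately show "t i j (Suc r) * t k l s - t k l s * t i j (Suc r)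
        - (t i j r * t k l (Suc s) - t k l (Suc s) * t i j r)
      = of_int 1 * (t k j r * t i l s - t k j s * t i l r)" by simp
qed (simp_all add: t_0)

subsection \<open>The relation between series in two variables\<close>

text \<open>A series in \<open>u\<close> (outer) and \<open>v\<close> (inner) is an element of \<^typ>\<open>'a fps fps\<close>.\<close>

definition in_u :: "'a::zero fps \<Rightarrow> 'a fps fps" where
  "in_u a = Abs_fps (\<lambda>n. fps_const (fps_nth a n))"

definition in_v :: "'a::zero fps \<Rightarrow> 'a fps fps" where
  "in_v a = fps_const a"

text \<open>This is (u - v) u^-1 v^-1. Multiplying the RTT relation by u^-1 v^-1 keeps it among
  power series: \<open>diff_uv\<close> takes the place of u - v, and \<open>prod_uv\<close> appears
  on the other side.\<close>

definition diff_uv :: "'a::ring_1 fps fps" where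
  "diff_uv = in_v fps_X - in_u fps_X"

definition prod_uv :: "'a::ring_1 fps fps" where
  "prod_uv = in_u fps_X * in_v fps_X"

lemma in_u_X: "in_u fps_X = (fps_X :: 'a::ring_1 fps fps)"
  by (rule fps_ext) (simp add: in_u_def fps_X_def)

lemma in_u_mult: "in_u (a * b) = in_u a * in_u (b :: 'a::ring_1 fps)"
  by (rule fps_ext) (simp add: in_u_def fps_mult_nth fps_const_sum[symmetric])

lemma in_v_mult: "in_v (a * b) = in_v a * in_v (b :: 'a::ring_1 fps)"
  by (simp add: in_v_def)

lemma in_u_add: "in_u (a + b) = in_u a + in_u (b :: 'a::ring_1 fps)"
  by (rule fps_ext) (simp add: in_u_def)

lemma in_v_add: "in_v (a + b) = in_v a + in_v (b :: 'a::ring_1 fps)"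
  by (simp add: in_v_def)

lemma in_u_0_1 [simp]: "in_u 0 = (0 :: 'a::ring_1 fps fps)" "in_u 1 = (1 :: 'a fps fps)"
  by (rule fps_ext; simp add: in_u_def)+

lemma in_v_0_1 [simp]: "in_v 0 = (0 :: 'a::ring_1 fps fps)" "in_v 1 = (1 :: 'a fps fps)"
  by (simp_all add: in_v_def)

lemma in_u_in_v_nth:
  fixes a b :: "'a::ring_1 fps"
  shows "fps_nth (fps_nth (in_u a * in_v b) m) n = fps_nth a m * fps_nth b n"
    and "fps_nth (fps_nth (in_v b * in_u a) m) n = fps_nth b n * fps_nth a m"
  by (simp_all add: in_u_def in_v_def)

lemma central_uv:
  fixes F :: "'a::ring_1 fps fps"
  shows "diff_uv * F = F * diff_uv" "prod_uv * F = F * prod_uv"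
proof -
  have u: "in_u fps_X * F = F * in_u fps_X" for F :: "'a fps fps"
    unfolding in_u_X by (rule int_fps_commute[OF int_fps_X])
  have v: "in_v fps_X * F = F * in_v fps_X" for F :: "'a fps fps"
    unfolding in_v_def by (rule fps_ext) (simp add: int_fps_commute[OF int_fps_X])
  show "diff_uv * F = F * diff_uv"
    by (simp add: diff_uv_def left_diff_distrib right_diff_distrib u[of F] v[of F])
  show "prod_uv * F = F * prod_uv"
    unfolding prod_uv_def by (metis u v mult.assoc)
qed

lemma diff_uv_nth: "fps_nth (fps_nth (diff_uv * F) m) n =
  (if n = 0 then 0 else fps_nth (fps_nth F m) (n - 1)) - (if m = 0 then 0 else fps_nth (fps_nth F (m - 1)) n)"
  unfolding diff_uv_def in_u_X by (simp add: left_diff_distrib in_v_def)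

lemma prod_uv_nth: "fps_nth (fps_nth (prod_uv * F) m) n =
  (if n = 0 \<or> m = 0 then 0 else fps_nth (fps_nth F (m - 1)) (n - 1))"
  unfolding prod_uv_def in_u_X by (simp add: mult.assoc in_v_def)

text \<open>The hypotheses say that F has no coefficients with m = 0 or n = 0; there the index shift
  of \<open>diff_uv\<close> would leave unmatched terms.\<close>

lemma diff_eq_prod_uv_iff:
  fixes F G :: "'a::ring_1 fps fps"
  assumes "\<And>n. fps_nth (fps_nth F 0) n = 0" "\<And>m. fps_nth (fps_nth F m) 0 = 0"
  shows "diff_uv * F = prod_uv * G \<longleftrightarrow>
    (\<forall>m n. fps_nth (fps_nth F (Suc m)) n - fps_nth (fps_nth F m) (Suc n) = fps_nth (fps_nth G m) n)"
    (is "?L \<longleftrightarrow> ?R")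
proof
  assume L: ?L
  show ?R
  proof (intro allI)
    fix m n
    show "fps_nth (fps_nth F (Suc m)) n - fps_nth (fps_nth F m) (Suc n) = fps_nth (fps_nth G m) n"
      using arg_cong[OF L, of "\<lambda>a. fps_nth (fps_nth a (Suc m)) (Suc n)"]
      by (simp add: diff_uv_nth prod_uv_nth)
  qed
next
  assume R: ?R
  show ?L
  proof (intro fps_ext)
    fix m n
    show "fps_nth (fps_nth (diff_uv * F) m) n = fps_nth (fps_nth (prod_uv * G) m) n"
      using R assms by (cases m; cases n) (simp_all add: diff_uv_nth prod_uv_nth del: fps_mult_nth_0)
  qed
qed

definition bracket :: "'a::ring \<Rightarrow> 'a \<Rightarrow> 'a" where
  "bracket x y = x * y - y * x"

lemma rtt_iff_series:
  fixes t :: "2 \<Rightarrow> 2 \<Rightarrow> nat \<Rightarrow> 'a::ring_1"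
  assumes "\<kappa> * \<kappa> = 1" and t_0: "\<And>i j. t i j 0 = (if i = j then 1 else 0)"
  defines "T \<equiv> \<lambda>i j. Abs_fps (t i j)"
  shows "rtt \<kappa> t \<longleftrightarrow> (\<forall>i j k l. diff_uv * bracket (in_u (T i j)) (in_v (T k l))
    = prod_uv * (of_int \<kappa> * (in_u (T k j) * in_v (T i l) - in_v (T k j) * in_u (T i l))))"
proof -
  have coeff: "fps_nth (fps_nth (of_int \<kappa> * (F :: 'a fps fps)) m) n = of_int \<kappa> * fps_nth (fps_nth F m) n" for F m n
    by (simp flip: fps_of_int)
  have "fps_nth (fps_nth (bracket (in_u (T i j)) (in_v (T k l))) 0) n = 0"
    and "fps_nth (fps_nth (bracket (in_u (T i j)) (in_v (T k l))) m) 0 = 0" for i j k l m n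
    by (simp_all add: bracket_def in_u_in_v_nth T_def t_0 del: fps_mult_nth_0)
  note iff = diff_eq_prod_uv_iff[OF this]
  show ?thesis
    unfolding iff coeff rtt_def using assms(1) t_0
    by (auto simp: bracket_def in_u_in_v_nth T_def)
qed

text \<open>The standard argument behind the matrix coproduct: entries of the two factors commute,
  so the relations for a and for b can be applied one after the other inside the product.\<close>

lemma rtt_product:
  fixes a b :: "2 \<Rightarrow> 2 \<Rightarrow> nat \<Rightarrow> 'a::ring_1"
  assumes a: "rtt \<kappa> a" and b: "rtt \<kappa> b"
    and comm: "\<And>i j r k l s. a i j r * b k l s = b k l s * a i j r"
  shows "rtt \<kappa> (\<lambda>i j r. \<Sum>k\<in>UNIV. \<Sum>s\<le>r. a i k s * b k j (r - s))"
proof -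
  define A where "A i j = Abs_fps (a i j)" for i j
  define B where "B i j = Abs_fps (b i j)" for i j
  define C where "C i j = A i 1 * B 1 j + A i 2 * B 2 j" for i j
  let ?c = "\<lambda>i j r. \<Sum>k\<in>UNIV. \<Sum>s\<le>r. a i k s * b k j (r - s)"
  have C: "Abs_fps (?c i j) = C i j" for i j
    by (rule fps_ext) (simp add: C_def A_def B_def fps_mult_nth atLeast0AtMost UNIV_2)
  interpret a: rtt \<kappa> a by (rule a)
  interpret b: rtt \<kappa> b by (rule b)
  have c0: "?c i j 0 = (if i = j then 1 else 0)" for i j
    using exhaust_2[of i] exhaust_2[of j] by (auto simp: UNIV_2 a.t_0 b.t_0)
  note rel_a = rtt_iff_series[of \<kappa> a, OF a.sign a.t_0, THEN iffD1, OF a, rule_format, folded A_def]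
  note rel_b = rtt_iff_series[of \<kappa> b, OF b.sign b.t_0, THEN iffD1, OF b, rule_format, folded B_def]
  define K :: "'a fps fps" where "K = prod_uv * of_int \<kappa>"
  have ra: "diff_uv * (in_u (A i m) * in_v (A k n)) = diff_uv * (in_v (A k n) * in_u (A i m))
      + K * (in_u (A k m) * in_v (A i n) - in_v (A k m) * in_u (A i n))" for i m k n
    using rel_a[of i m k n] by (simp add: bracket_def K_def algebra_simps)
  have rb: "diff_uv * (in_u (B i m) * in_v (B k n)) = diff_uv * (in_v (B k n) * in_u (B i m))
      + K * (in_u (B k m) * in_v (B i n) - in_v (B k m) * in_u (B i n))" for i m k n
    using rel_b[of i m k n] by (simp add: bracket_def K_def algebra_simps)
  have K: "K * F = F * K" for F
    unfolding K_def by (metis central_uv(2) mult.assoc mult_of_int_commute)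
  note D = central_uv(1)
  have AB: "in_u (B k l) * in_v (A i j) = in_v (A i j) * in_u (B k l)"
    "in_v (B k l) * in_u (A i j) = in_u (A i j) * in_v (B k l)"
    "in_u (B k l) * in_u (A i j) = in_u (A i j) * in_u (B k l)"
    "in_v (B k l) * in_v (A i j) = in_v (A i j) * in_v (B k l)" for i j k l
  proof -
    have "A i j * B k l = B k l * A i j" by (rule fps_commute_of_coeffs) (simp add: A_def B_def comm)
    then show "in_u (B k l) * in_u (A i j) = in_u (A i j) * in_u (B k l)"
      "in_v (B k l) * in_v (A i j) = in_v (A i j) * in_v (B k l)"
      by (metis in_u_mult, metis in_v_mult)
    show "in_u (B k l) * in_v (A i j) = in_v (A i j) * in_u (B k l)"
      "in_v (B k l) * in_u (A i j) = in_u (A i j) * in_v (B k l)"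
      by (intro fps_ext; simp add: in_u_in_v_nth A_def B_def comm)+
  qed
  \<comment> \<open>Summed over m and n, the second and third terms on the right cancel after
    interchanging m and n; the outer two assemble into entries of the product matrix.\<close>
  have expand: "diff_uv * (in_u (A i m) * in_u (B m j) * (in_v (A k n) * in_v (B n l))
        - in_v (A k n) * in_v (B n l) * (in_u (A i m) * in_u (B m j)))
    = K * (in_u (A k m) * in_v (A i n) * (in_u (B m j) * in_v (B n l))
        - in_v (A k m) * in_u (A i n) * (in_u (B m j) * in_v (B n l))
        + in_v (A k n) * in_u (A i m) * (in_u (B n j) * in_v (B m l))
        - in_v (A k n) * in_u (A i m) * (in_v (B n j) * in_u (B m l)))" for i m j k n l
  proof -
    have "in_u (A i m) * in_u (B m j) * (in_v (A k n) * in_v (B n l))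
        = in_u (A i m) * in_v (A k n) * (in_u (B m j) * in_v (B n l))"
      by (metis AB(1) mult.assoc)
    moreover have "in_v (A k n) * in_v (B n l) * (in_u (A i m) * in_u (B m j))
        = in_v (A k n) * in_u (A i m) * (in_v (B n l) * in_u (B m j))"
      by (metis AB(2) mult.assoc)
    moreover have "diff_uv * (in_u (A i m) * in_v (A k n) * (in_u (B m j) * in_v (B n l)))
      = diff_uv * (in_v (A k n) * in_u (A i m)) * (in_u (B m j) * in_v (B n l))
      + K * (in_u (A k m) * in_v (A i n) - in_v (A k m) * in_u (A i n)) * (in_u (B m j) * in_v (B n l))"
      unfolding mult.assoc[symmetric, of diff_uv] ra[unfolded mult.assoc[symmetric]]
      by (simp only: distrib_right mult.assoc)
    moreover have "diff_uv * (in_v (A k n) * in_u (A i m)) * (in_u (B m j) * in_v (B n l))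
      = in_v (A k n) * in_u (A i m) * (diff_uv * (in_v (B n l) * in_u (B m j)))
      + K * (in_v (A k n) * in_u (A i m) * (in_u (B n j) * in_v (B m l) - in_v (B n j) * in_u (B m l)))"
    proof -
      have d: "diff_uv * z * x = z * (diff_uv * x)" for z x by (metis D mult.assoc)
      have k: "z * (K * x) = K * (z * x)" for z x by (metis K mult.assoc)
      show ?thesis unfolding d[of "in_v _ * in_u _"] rb distrib_left k[of "in_v _ * in_u _"] ..
    qed
    moreover have "diff_uv * (in_v (A k n) * in_u (A i m) * (in_v (B n l) * in_u (B m j)))
      = in_v (A k n) * in_u (A i m) * (diff_uv * (in_v (B n l) * in_u (B m j)))"
      by (metis D mult.assoc)
    ultimately show ?thesis
      by (simp add: right_diff_distrib left_diff_distrib distrib_left mult.assoc)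
  qed
  have "diff_uv * bracket (in_u (C i j)) (in_v (C k l))
    = K * (in_u (C k j) * in_v (C i l) - in_v (C k j) * in_u (C i l))" for i j k l
  proof -
    have e: "bracket (in_u (C i j)) (in_v (C k l))
      = (\<Sum>m\<in>{1, 2}. \<Sum>n\<in>{1, 2}. in_u (A i m) * in_u (B m j) * (in_v (A k n) * in_v (B n l))
        - in_v (A k n) * in_v (B n l) * (in_u (A i m) * in_u (B m j)))"
      by (simp add: bracket_def C_def in_u_add in_v_add in_u_mult in_v_mult distrib_left distrib_right)
    have r1: "in_u (A k m) * in_u (B m j) * (in_v (A i n) * in_v (B n l))
        = in_u (A k m) * in_v (A i n) * (in_u (B m j) * in_v (B n l))" for m n
      by (metis AB(1) mult.assoc)
    have r2: "in_v (A k m) * in_v (B m j) * (in_u (A i n) * in_u (B n l))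
        = in_v (A k m) * in_u (A i n) * (in_v (B m j) * in_u (B n l))" for m n
      by (metis AB(2) mult.assoc)
    show ?thesis
      unfolding e sum_distrib_left expand
      by (simp add: C_def in_u_add in_v_add in_u_mult in_v_mult distrib_left distrib_right
          right_diff_distrib r1 r2)
  qed
  then show ?thesis
    by (subst rtt_iff_series[of \<kappa> ?c, OF a.sign c0]) (simp_all only: C, simp add: K_def mult.assoc)
qed

text \<open>Bracketing with a fixed element is a derivation, so multiplying the brackets of the
  entries of a matrix by its inverse on both sides gives minus the brackets of the inverse entries.
  This is done first in the variable u, then in v.\<close>

lemma rtt_inverse:
  fixes t t' :: "2 \<Rightarrow> 2 \<Rightarrow> nat \<Rightarrow> 'a::ring_1"
  assumes t: "rtt \<kappa> t"
    and inv: "\<And>i j. (\<Sum>k\<in>UNIV. Abs_fps (t' i k) * Abs_fps (t k j)) = (if i = j then 1 else 0)"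
      "\<And>i j. (\<Sum>k\<in>UNIV. Abs_fps (t i k) * Abs_fps (t' k j)) = (if i = j then 1 else 0)"
  shows "rtt (- \<kappa>) t'"
proof -
  interpret rtt \<kappa> t by (rule t)
  define T where "T i j = Abs_fps (t i j)" for i j
  define T' where "T' i j = Abs_fps (t' i j)" for i j
  have t'0: "t' i j 0 = (if i = j then 1 else 0)" for i j
    using arg_cong[OF inv(1)[of i j], of "\<lambda>a. fps_nth a 0"] by (simp add: fps_sum_nth t_0 if_distrib[of "\<lambda>x. _ * x"] sum.delta' cong: if_cong)
  note R = rtt_iff_series[of \<kappa> t, OF sign t_0, THEN iffD1, OF t, rule_format, folded T_def]
  define K :: "'a fps fps" where "K = prod_uv * of_int \<kappa>"
  have K: "K * F = F * K" for F
    unfolding K_def by (metis central_uv(2) mult.assoc mult_of_int_commute)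
  note D = central_uv(1)
  define a where "a i j = in_u (T i j)" for i j
  define a' where "a' i j = in_u (T' i j)" for i j
  define b where "b i j = in_v (T i j)" for i j
  define b' where "b' i j = in_v (T' i j)" for i j
  have u: "(\<Sum>k\<in>UNIV. in_u (f k) * in_u (g k)) = in_u (\<Sum>k\<in>UNIV. f k * g k)"
    and v: "(\<Sum>k\<in>UNIV. in_v (f k) * in_v (g k)) = in_v (\<Sum>k\<in>UNIV. f k * g k)" for f g :: "2 \<Rightarrow> 'a fps"
    by (simp_all add: UNIV_2 in_u_add in_u_mult in_v_add in_v_mult)
  have ia: "(\<Sum>k\<in>UNIV. a' i k * a k j) = (if i = j then 1 else 0)" "(\<Sum>k\<in>UNIV. a i k * a' k j) = (if i = j then 1 else 0)"
    and ib: "(\<Sum>k\<in>UNIV. b' i k * b k j) = (if i = j then 1 else 0)" "(\<Sum>k\<in>UNIV. b i k * b' k j) = (if i = j then 1 else 0)" for i j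
    by (simp_all add: a_def a'_def b_def b'_def u v T_def T'_def inv)
  have conj: "(\<Sum>i\<in>UNIV. \<Sum>j\<in>UNIV. m' x i * bracket (m i j) z * m' j y) = - bracket (m' x y) z"
    if m: "\<And>i j. (\<Sum>k\<in>UNIV. m' i k * m k j) = (if i = j then 1 else 0)" "\<And>i j. (\<Sum>k\<in>UNIV. m i k * m' k j) = (if i = j then 1 else 0)"
    for m m' :: "2 \<Rightarrow> 2 \<Rightarrow> 'a fps fps" and x y z
  proof -
    have "(\<Sum>i\<in>UNIV. \<Sum>j\<in>UNIV. m' x i * bracket (m i j) z * m' j y)
      = (\<Sum>i\<in>UNIV. \<Sum>j\<in>UNIV. m' x i * m i j * (z * m' j y)) - (\<Sum>i\<in>UNIV. \<Sum>j\<in>UNIV. m' x i * z * (m i j * m' j y))"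
      by (simp add: bracket_def left_diff_distrib right_diff_distrib sum_subtractf mult.assoc)
    also have "(\<Sum>i\<in>UNIV. \<Sum>j\<in>UNIV. m' x i * m i j * (z * m' j y)) = (\<Sum>j\<in>UNIV. (\<Sum>i\<in>UNIV. m' x i * m i j) * (z * m' j y))"
      by (subst sum.swap) (simp add: sum_distrib_right)
    also have "\<dots> = z * m' x y" by (simp add: m if_distrib[of "\<lambda>x. x * _"] sum.delta cong: if_cong)
    also have "(\<Sum>i\<in>UNIV. \<Sum>j\<in>UNIV. m' x i * z * (m i j * m' j y)) = m' x y * z"
      by (simp add: sum_distrib_left[symmetric] m if_distrib[of "\<lambda>x. _ * x"] sum.delta' cong: if_cong)
    finally show ?thesis by (simp add: bracket_def)
  qed
  have rel_ab: "diff_uv * bracket (a i j) (b k l) = K * (b i l * a k j - a i l * b k j)" for i j k l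
  proof -
    have "in_u (T k j) * in_v (T i l) - in_v (T k j) * in_u (T i l)
      = in_v (T i l) * in_u (T k j) - in_u (T i l) * in_v (T k j)"
    proof (intro fps_ext)
      fix m n
      show "fps_nth (fps_nth (in_u (T k j) * in_v (T i l) - in_v (T k j) * in_u (T i l)) m) n
        = fps_nth (fps_nth (in_v (T i l) * in_u (T k j) - in_u (T i l) * in_v (T k j)) m) n"
        using commutator_swap[of k j m i l n] by (simp add: in_u_in_v_nth T_def algebra_simps)
    qed
    then show ?thesis using R[of i j k l] by (simp add: a_def b_def K_def mult.assoc)
  qed
  have dc: "diff_uv * (x * z * y) = x * (diff_uv * z) * y" "K * (x * z * y) = x * (K * z) * y" for x y z
    by (metis D mult.assoc, metis K mult.assoc)
  \<comment> \<open>Inverse entries in u against original entries in v: each term on the right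
    contains one product of mutually inverse matrices in u, which collapses to a Kronecker
    delta.\<close>
  have rel_a'b: "diff_uv * bracket (a' x y) (b k l)
      = K * ((if x = l then 1 else 0) * (\<Sum>j\<in>UNIV. b k j * a' j y) - (\<Sum>i\<in>UNIV. a' x i * b i l) * (if k = y then 1 else 0))"
    for x y k l
  proof -
    have "diff_uv * bracket (a' x y) (b k l)
      = - (\<Sum>i\<in>UNIV. \<Sum>j\<in>UNIV. a' x i * (diff_uv * bracket (a i j) (b k l)) * a' j y)"
      unfolding dc(1)[symmetric] sum_distrib_left[symmetric] conj[OF ia] by simp
    also have "\<dots> = K * ((\<Sum>i\<in>UNIV. \<Sum>j\<in>UNIV. a' x i * a i l * (b k j * a' j y))
        - (\<Sum>i\<in>UNIV. \<Sum>j\<in>UNIV. a' x i * b i l * (a k j * a' j y)))"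
      unfolding rel_ab dc(2)[symmetric]
      by (simp add: right_diff_distrib left_diff_distrib sum_subtractf mult.assoc sum_distrib_left)
    also have "(\<Sum>i\<in>UNIV. \<Sum>j\<in>UNIV. a' x i * a i l * (b k j * a' j y)) = (if x = l then 1 else 0) * (\<Sum>j\<in>UNIV. b k j * a' j y)"
      unfolding sum_distrib_left[symmetric] sum_distrib_right[symmetric] ia ..
    also have "(\<Sum>i\<in>UNIV. \<Sum>j\<in>UNIV. a' x i * b i l * (a k j * a' j y)) = (\<Sum>i\<in>UNIV. a' x i * b i l) * (if k = y then 1 else 0)"
      unfolding sum_distrib_left[symmetric] sum_distrib_right[symmetric] ia ..
    finally show ?thesis .
  qed
  have sum_assoc: "(\<Sum>l\<in>UNIV. (\<Sum>i\<in>UNIV. f i * g i l) * h l) = (\<Sum>i\<in>UNIV. f i * (\<Sum>l\<in>UNIV. g i l * h l))"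
    for f h :: "2 \<Rightarrow> 'a fps fps" and g :: "2 \<Rightarrow> 2 \<Rightarrow> 'a fps fps"
    by (simp only: sum_distrib_left sum_distrib_right mult.assoc) (rule sum.swap)
  have "diff_uv * bracket (a' x y) (b' z w) = K * (b' z y * a' x w - a' z y * b' x w)" for x y z w
  proof -
    have neg: "bracket p q = - bracket q p" for p q :: "'a fps fps" by (simp add: bracket_def)
    have "diff_uv * bracket (a' x y) (b' z w)
      = - (\<Sum>k\<in>UNIV. \<Sum>l\<in>UNIV. b' z k * (diff_uv * bracket (a' x y) (b k l)) * b' l w)"
      unfolding dc(1)[symmetric] sum_distrib_left[symmetric] neg[of "a' x y"] by (simp add: conj[OF ib] sum_negf)
    also have "\<dots> = K * ((\<Sum>k\<in>UNIV. \<Sum>l\<in>UNIV. b' z k * (\<Sum>i\<in>UNIV. a' x i * b i l) * (if k = y then 1 else 0) * b' l w)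
        - (\<Sum>k\<in>UNIV. \<Sum>l\<in>UNIV. b' z k * (if x = l then 1 else 0) * (\<Sum>j\<in>UNIV. b k j * a' j y) * b' l w))"
      unfolding rel_a'b dc(2)[symmetric] sum_distrib_left[symmetric] sum_subtractf[symmetric]
      by (simp add: right_diff_distrib left_diff_distrib sum_subtractf mult.assoc)
    also have "(\<Sum>k\<in>UNIV. \<Sum>l\<in>UNIV. b' z k * (\<Sum>i\<in>UNIV. a' x i * b i l) * (if k = y then 1 else 0) * b' l w) = b' z y * a' x w"
    proof -
      have "(\<Sum>k\<in>UNIV. \<Sum>l\<in>UNIV. b' z k * (\<Sum>i\<in>UNIV. a' x i * b i l) * (if k = y then 1 else 0) * b' l w)
        = (\<Sum>k\<in>UNIV. if k = y then b' z k * (\<Sum>l\<in>UNIV. (\<Sum>i\<in>UNIV. a' x i * b i l) * b' l w) else 0)"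
        by (intro sum.cong) (auto simp: sum_distrib_left[where f = "\<lambda>l. (\<Sum>i\<in>UNIV. a' x i * b i l) * b' l w"] mult.assoc)
      also have "\<dots> = b' z y * (\<Sum>i\<in>UNIV. a' x i * (\<Sum>l\<in>UNIV. b i l * b' l w))"
        by (simp add: sum.delta sum_assoc)
      finally show ?thesis by (simp add: ib if_distrib[of "\<lambda>x. _ * x"] sum.delta' cong: if_cong)
    qed
    also have "(\<Sum>k\<in>UNIV. \<Sum>l\<in>UNIV. b' z k * (if x = l then 1 else 0) * (\<Sum>j\<in>UNIV. b k j * a' j y) * b' l w) = a' z y * b' x w"
    proof -
      have "(\<Sum>k\<in>UNIV. \<Sum>l\<in>UNIV. b' z k * (if x = l then 1 else 0) * (\<Sum>j\<in>UNIV. b k j * a' j y) * b' l w)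
        = (\<Sum>k\<in>UNIV. \<Sum>l\<in>UNIV. if x = l then b' z k * (\<Sum>j\<in>UNIV. b k j * a' j y) * b' l w else 0)"
        by (intro sum.cong) auto
      also have "\<dots> = (\<Sum>j\<in>UNIV. (\<Sum>k\<in>UNIV. b' z k * b k j) * a' j y) * b' x w"
        by (simp add: sum.delta' sum_assoc sum_distrib_right[symmetric])
      finally show ?thesis by (simp add: ib if_distrib[of "\<lambda>x. x * _"] sum.delta cong: if_cong)
    qed
    finally show ?thesis .
  qed
  then show ?thesis
    by (subst rtt_iff_series) (simp_all add: sign t'0 a'_def b'_def T'_def K_def mult.assoc algebra_simps)
qed

definition series :: "(2 \<Rightarrow> 2 \<Rightarrow> nat \<Rightarrow> 'a) \<Rightarrow> 2 \<Rightarrow> 2 \<Rightarrow> 'a fps" where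
  "series t i j = Abs_fps (t i j)"

lemma series_nth [simp]: "fps_nth (series t i j) r = t i j r"
  by (simp add: series_def)

lemma fps_unit_inverse:
  fixes a :: "'a::ring_1 fps"
  assumes "fps_nth a 0 = 1"
  obtains b where "b * a = 1" "a * b = 1" "fps_nth b 0 = 1"
proof -
  let ?l = "fps_left_inverse a 1" and ?r = "fps_right_inverse a 1"
  have l: "?l * a = 1" and r: "a * ?r = 1"
    using assms by (simp_all add: fps_left_inverse fps_right_inverse)
  have "?l = ?l * (a * ?r)" by (simp add: r)
  also have "\<dots> = ?r" by (simp add: mult.assoc[symmetric] l)
  finally show thesis using that[of ?l] l r by simp
qed

section \<open>Exchange rules for rows and columns, and the commutators of a root series\<close>

context rtt
begin

text \<open>One variable stays a series while the other is taken coefficientwise: the form that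
  \<open>shift_exchange\<close> expects.\<close>

lemma series_rel:
  "fps_const (t i j r) * series t k l - series t k l * fps_const (t i j r)
    = fps_X * (fps_const (t i j (Suc r)) * series t k l - series t k l * fps_const (t i j (Suc r))
      + of_int \<kappa> * (fps_const (t i l r) * series t k j - series t i l * fps_const (t k j r)))"
proof (rule fps_ext)
  fix n
  show "fps_nth (fps_const (t i j r) * series t k l - series t k l * fps_const (t i j r)) n
    = fps_nth (fps_X * (fps_const (t i j (Suc r)) * series t k l - series t k l * fps_const (t i j (Suc r))
      + of_int \<kappa> * (fps_const (t i l r) * series t k j - series t i l * fps_const (t k j r)))) n"
  proof (cases n)
    case 0
    then show ?thesis by (simp add: bracket_0)
  next
    case (Suc m)
    then show ?thesis using rel'[of i j r k l m]
      by (simp add: algebra_simps flip: fps_of_int)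
  qed
qed

text \<open>At u - v = \<kappa> the commutator on the left and the right-hand side of the relation
  share a term, which cancels.\<close>

lemma row_exchange: "shift \<kappa> (series t i j) * series t i l = shift \<kappa> (series t i l) * series t i j"
proof (rule shift_exchange[OF _ _ sign])
  show "fps_const (fps_nth (series t i j) r) * series t i l - series t i l * fps_const (fps_nth (series t i j) r)
    = fps_X * (fps_const (fps_nth (series t i j) (Suc r)) * series t i l
        - series t i l * fps_const (fps_nth (series t i j) (Suc r))
      + of_int \<kappa> * (fps_const (fps_nth (series t i l) r) * series t i j
        - series t i l * fps_const (fps_nth (series t i j) r)))" for r
    using series_rel[of i j r i l] by simp
  show "fps_const (fps_nth (series t i j) 0) * series t i l = series t i l * fps_const (fps_nth (series t i j) 0)"
    by (simp add: t_0)
qed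

lemma shift_entry_commute: "shift c (series t i j) * shift d (series t i j) = shift d (series t i j) * shift c (series t i j)"
  by (rule shift_commute) (simp add: commute_entry)

lemma exchangeable_row:
  "exchangeable (\<lambda>c. shift (\<kappa> * int c) (series t i j)) (\<lambda>c. shift (\<kappa> * int c) (series t i l))"
proof
  fix c d
  have "shift (\<kappa> * int c) (shift \<kappa> (series t i j) * series t i l) = shift (\<kappa> * int c) (shift \<kappa> (series t i l) * series t i j)"
    by (simp only: row_exchange)
  then show "shift (\<kappa> * int (Suc c)) (series t i j) * shift (\<kappa> * int c) (series t i l)
    = shift (\<kappa> * int (Suc c)) (series t i l) * shift (\<kappa> * int c) (series t i j)"
    by (simp add: shift_mult shift_shift distrib_left add.commute)
  show "shift (\<kappa> * int c) (series t i j) * shift (\<kappa> * int d) (series t i l)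
      - shift (\<kappa> * int d) (series t i l) * shift (\<kappa> * int c) (series t i j)
      + (shift (\<kappa> * int c) (series t i l) * shift (\<kappa> * int d) (series t i j)
      - shift (\<kappa> * int d) (series t i j) * shift (\<kappa> * int c) (series t i l)) = 0"
    using shift_commutators[of "series t i j" "series t i l" "series t i l" "series t i j" "\<kappa> * int c" "\<kappa> * int d"]
      commutator_swap[of i j _ i l] by (simp add: algebra_simps)
qed (rule shift_entry_commute)+

lemma series_transpose: "series (\<lambda>i j. t j i) i j = series t j i"
  by (simp add: series_def)

text \<open>Transposition reverses \<kappa> and with it the order of the shifts; this is the rule
  for the second leg in \<open>prod_sum_two_legs\<close>.\<close>

lemma column_exchange:
  "shift (\<kappa> * int c) (series t i j) * shift (\<kappa> * int (Suc c)) (series t k j)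
    = shift (\<kappa> * int c) (series t k j) * shift (\<kappa> * int (Suc c)) (series t i j)"
proof -
  have "shift (\<kappa> * int (Suc c)) (shift (- \<kappa>) (series t i j) * series t k j)
    = shift (\<kappa> * int (Suc c)) (shift (- \<kappa>) (series t k j) * series t i j)"
    using rtt.row_exchange[OF rtt_transpose, of j i k] unfolding series_transpose by simp
  then show ?thesis by (simp add: shift_mult shift_shift distrib_left)
qed

lemma series_rel_uv:
  "diff_uv * bracket (in_u (series t i j)) (in_v (series t k l)) = prod_uv * (of_int \<kappa> *
    (in_u (series t k j) * in_v (series t i l) - in_v (series t k j) * in_u (series t i l)))"
  using rtt_iff_series[of \<kappa> t, OF sign t_0] rtt_axioms unfolding series_def by blast

lemma series_rel_uv':
  "diff_uv * bracket (in_u (series t i j)) (in_v (series t k l)) = prod_uv * (of_int \<kappa> *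
    (in_v (series t i l) * in_u (series t k j) - in_u (series t i l) * in_v (series t k j)))"
proof -
  have "in_u (series t k j) * in_v (series t i l) - in_v (series t k j) * in_u (series t i l)
    = in_v (series t i l) * in_u (series t k j) - in_u (series t i l) * in_v (series t k j)"
  proof (intro fps_ext)
    fix m n
    show "fps_nth (fps_nth (in_u (series t k j) * in_v (series t i l) - in_v (series t k j) * in_u (series t i l)) m) n
      = fps_nth (fps_nth (in_v (series t i l) * in_u (series t k j) - in_u (series t i l) * in_v (series t k j)) m) n"
      using commutator_swap[of k j m i l n] by (simp add: in_u_in_v_nth algebra_simps del: fps_mult_nth_0)
  qed
  then show ?thesis using series_rel_uv[of i j k l] by simp
qed

text \<open>The Drinfeld relation (u - v) [e(u), e(v)] = \<kappa> (e(v) - e(u))^2. The product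
  t_ij(u) t_ij(v) is symmetric in u and v; moving the diagonal entries to the left on both sides and
  cancelling them leaves a relation for e alone.\<close>

lemma off_diagonal_commutator:
  assumes y: "series t i j = series t i i * e"
  shows "diff_uv * bracket (in_u e) (in_v e)
    = prod_uv * (of_int \<kappa> * ((in_v e - in_u e) * (in_v e - in_u e)))"
proof -
  let ?ux = "in_u (series t i i)" and ?vx = "in_v (series t i i)" and ?ue = "in_u e" and ?ve = "in_v e"
  define K :: "'a fps fps" where "K = prod_uv * of_int \<kappa>"
  have K: "F * (K * G) = K * (F * G)" for F G
    unfolding K_def by (metis central_uv(2) mult.assoc mult_of_int_commute)
  have D: "F * (diff_uv * G) = diff_uv * (F * G)" for F G
    by (metis central_uv(1) mult.assoc)
  have uy: "in_u (series t i j) = ?ux * ?ue" and vy: "in_v (series t i j) = ?vx * ?ve"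
    by (simp_all add: y in_u_mult in_v_mult)
  obtain b where b: "b * series t i i = 1"
    using fps_unit_inverse[of "series t i i"] by (auto simp: t_0)
  have cu: "F = G" if "?ux * F = ?ux * G" for F G
    using arg_cong[OF that, of "\<lambda>x. in_u b * x"] b by (simp add: mult.assoc[symmetric] in_u_mult[symmetric])
  have cv: "F = G" if "?vx * F = ?vx * G" for F G
    using arg_cong[OF that, of "\<lambda>x. in_v b * x"] b by (simp add: mult.assoc[symmetric] in_v_mult[symmetric])
  have uv: "in_u (series t k l) * in_v (series t k l) = in_v (series t k l) * in_u (series t k l)" for k l
    by (intro fps_ext) (simp add: in_u_in_v_nth commute_entry del: fps_mult_nth_0)
  have uvl: "?ux * (?vx * F) = ?vx * (?ux * F)" for F
    by (simp only: mult.assoc[symmetric] uv)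
  \<comment> \<open>The bracket of t_ii(u) with e(v): it comes from the bracket with t_ij(v) =
    t_ii(v) e(v) by cancelling t_ii(v).\<close>
  have A1: "diff_uv * (?ux * ?ve) - diff_uv * (?ve * ?ux) = K * (?ux * (?ve - ?ue))"
  proof (rule cv)
    have "?vx * (?ux * ?ve - ?ve * ?ux) = bracket ?ux (?vx * ?ve)"
      by (simp add: bracket_def right_diff_distrib mult.assoc[symmetric] uv)
    then have "?vx * (diff_uv * (?ux * ?ve) - diff_uv * (?ve * ?ux)) = diff_uv * bracket ?ux (?vx * ?ve)"
      unfolding right_diff_distrib[symmetric] D by (simp only:)
    also have "\<dots> = K * (?ux * (?vx * ?ve) - ?vx * (?ux * ?ue))"
      using series_rel_uv[of i i i j] by (simp add: uy vy K_def mult.assoc)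
    also have "\<dots> = ?vx * (K * (?ux * (?ve - ?ue)))"
      by (simp only: K right_diff_distrib uvl)
    finally show "?vx * (diff_uv * (?ux * ?ve) - diff_uv * (?ve * ?ux)) = ?vx * (K * (?ux * (?ve - ?ue)))" .
  qed
  have A2: "diff_uv * (?ue * ?vx) - diff_uv * (?vx * ?ue) = K * (?vx * (?ue - ?ve))"
  proof (rule cu)
    have "?ux * (?ue * ?vx - ?vx * ?ue) = bracket (?ux * ?ue) ?vx"
      by (simp add: bracket_def right_diff_distrib mult.assoc[symmetric] uv)
    then have "?ux * (diff_uv * (?ue * ?vx) - diff_uv * (?vx * ?ue)) = diff_uv * bracket (?ux * ?ue) ?vx"
      unfolding right_diff_distrib[symmetric] D by (simp only:)
    also have "\<dots> = K * (?vx * (?ux * ?ue) - ?ux * (?vx * ?ve))"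
      using series_rel_uv'[of i j i i] by (simp add: uy vy K_def mult.assoc)
    also have "\<dots> = ?ux * (K * (?vx * (?ue - ?ve)))"
      by (simp only: K right_diff_distrib uvl)
    finally show "?ux * (diff_uv * (?ue * ?vx) - diff_uv * (?vx * ?ue)) = ?ux * (K * (?vx * (?ue - ?ve)))" .
  qed
  \<comment> \<open>The commuting product of the two off-diagonal entries, written through the
    factorization in both orders.\<close>
  have "?ux * (?ue * ?vx) * ?ve = ?vx * (?ve * ?ux) * ?ue"
    using uv[of i j] unfolding uy vy by (simp add: mult.assoc)
  then have q: "?ux * (diff_uv * (?ue * ?vx)) * ?ve = ?vx * (diff_uv * (?ve * ?ux)) * ?ue"
    by (simp add: D mult.assoc)
  have q1: "diff_uv * (?ue * ?vx) = ?vx * (diff_uv * ?ue + K * (?ue - ?ve))"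
    using A2 by (simp add: distrib_left D K algebra_simps)
  have q2: "diff_uv * (?ve * ?ux) = ?ux * (diff_uv * ?ve - K * (?ve - ?ue))"
    using A1 by (simp add: right_diff_distrib D K algebra_simps)
  have "?ux * (?vx * ((diff_uv * ?ue + K * (?ue - ?ve)) * ?ve)) = ?ux * (?vx * ((diff_uv * ?ve - K * (?ve - ?ue)) * ?ue))"
    using q unfolding q1 q2 by (simp only: mult.assoc uvl)
  then have "(diff_uv * ?ue + K * (?ue - ?ve)) * ?ve = (diff_uv * ?ve - K * (?ve - ?ue)) * ?ue"
    using cu cv by blast
  then have "diff_uv * bracket ?ue ?ve = K * ((?ve - ?ue) * (?ve - ?ue))"
    by (simp add: bracket_def algebra_simps)
  then show ?thesis by (simp add: K_def mult.assoc)
qed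

text \<open>The squares e(u)^2 and e(v)^2 involve one variable each, hence the terms present only
  for m = 0 or n = 0.\<close>

lemma root_commutators:
  assumes y: "series t i j = series t i i * e" and e0: "fps_nth e 0 = 0"
  shows "fps_nth e (Suc m) * fps_nth e n - fps_nth e n * fps_nth e (Suc m)
      - (fps_nth e m * fps_nth e (Suc n) - fps_nth e (Suc n) * fps_nth e m)
    = of_int \<kappa> * ((if m = 0 then fps_nth (e * e) n else 0) + (if n = 0 then fps_nth (e * e) m else 0)
      - fps_nth e n * fps_nth e m - fps_nth e m * fps_nth e n)"
proof -
  have uu: "fps_nth (fps_nth (in_u e * in_u e) m) n = (if n = 0 then fps_nth (e * e) m else 0)"
    unfolding in_u_mult[symmetric] by (simp add: in_u_def)
  have vv: "fps_nth (fps_nth (in_v e * in_v e) m) n = (if m = 0 then fps_nth (e * e) n else 0)"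
    unfolding in_v_mult[symmetric] by (simp add: in_v_def)
  have "fps_nth (fps_nth (bracket (in_u e) (in_v e)) 0) n = 0"
    "fps_nth (fps_nth (bracket (in_u e) (in_v e)) m) 0 = 0" for m n
    by (simp_all add: bracket_def in_u_in_v_nth e0 del: fps_mult_nth_0)
  then have "fps_nth (fps_nth (bracket (in_u e) (in_v e)) (Suc m)) n - fps_nth (fps_nth (bracket (in_u e) (in_v e)) m) (Suc n)
    = fps_nth (fps_nth (of_int \<kappa> * ((in_v e - in_u e) * (in_v e - in_u e))) m) n"
    using off_diagonal_commutator[OF y] diff_eq_prod_uv_iff by blast
  moreover have "of_int \<kappa> = (fps_const (fps_const (of_int \<kappa>)) :: 'a fps fps)" by (simp add: fps_of_int)
  ultimately show ?thesis
    unfolding bracket_def left_diff_distrib right_diff_distrib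
    by (simp add: in_u_in_v_nth uu vv algebra_simps del: fps_mult_nth_0 fps_of_int)
qed

text \<open>Induction on k: raising k by one moves a unit of degree from one coefficient to the
  other, and the anticommutator that arises is the difference between the squares of consecutive
  tails.\<close>

lemma root_bracket:
  assumes y: "series t i j = series t i i * e" and e0: "fps_nth e 0 = 0"
  defines "E \<equiv> \<lambda>k. Abs_fps (\<lambda>n. if n = 0 then 0 else fps_nth e (n + k))"
  shows "fps_const (fps_nth e (Suc k)) * E k - E k * fps_const (fps_nth e (Suc k)) = of_int \<kappa> * (E k * E k)"
proof -
  let ?c = "\<lambda>m n. fps_nth e m * fps_nth e n - fps_nth e n * fps_nth e m"
  have E0: "E 0 = e" by (rule fps_ext) (simp add: E_def e0)
  have E_Suc: "E k = fps_X * (fps_const (fps_nth e (Suc k)) + E (Suc k))" for k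
  proof (rule fps_ext)
    fix n
    show "fps_nth (E k) n = fps_nth (fps_X * (fps_const (fps_nth e (Suc k)) + E (Suc k))) n"
      by (cases n; cases "n - 1") (simp_all add: E_def)
  qed
  have sq: "fps_nth (E k * E k) (Suc (Suc n)) = fps_nth (E (Suc k) * E (Suc k)) n
      + fps_nth e (Suc k) * fps_nth e (n + Suc k) + fps_nth e (n + Suc k) * fps_nth e (Suc k)" if "n > 0" for k n
  proof -
    let ?F = "fps_const (fps_nth e (Suc k)) + E (Suc k)"
    have "E k * E k = fps_X * (fps_X * (?F * ?F))"
      unfolding E_Suc[of k] by (metis int_fps_commute[OF int_fps_X] mult.assoc)
    then have "fps_nth (E k * E k) (Suc (Suc n)) = fps_nth (?F * ?F) n" by simp
    then show ?thesis using that by (simp add: distrib_left distrib_right E_def add_ac)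
  qed
  have main: "n > 0 \<Longrightarrow> ?c (Suc k) (n + k) = of_int \<kappa> * fps_nth (E k * E k) n" for n k
  proof (induction k arbitrary: n)
    case 0
    then show ?case using root_commutators[OF y e0, of 0 n] by (simp add: E0 e0)
  next
    case (Suc k)
    have "?c (Suc (Suc k)) (n + Suc k) - ?c (Suc k) (Suc (Suc n) + k)
      = - (of_int \<kappa> * (fps_nth e (Suc k) * fps_nth e (n + Suc k) + fps_nth e (n + Suc k) * fps_nth e (Suc k)))"
      using root_commutators[OF y e0, of "Suc k" "n + Suc k"] by (simp add: algebra_simps)
    then show ?case using Suc.IH[of "Suc (Suc n)"] sq[OF Suc.prems, of k] by (simp add: algebra_simps)
  qed
  show ?thesis
  proof (rule fps_ext)
    fix n
    show "fps_nth (fps_const (fps_nth e (Suc k)) * E k - E k * fps_const (fps_nth e (Suc k))) n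
      = fps_nth (of_int \<kappa> * (E k * E k)) n"
    proof (cases "n = 0")
      case False
      then show ?thesis using main[of n k] by (simp add: E_def flip: fps_of_int)
    qed (simp add: E_def flip: fps_of_int)
  qed
qed

end

section \<open>The series s_ij: shift invariance, centrality, factorization,
  multiplicativity\<close>

section \<open>Shifted products in characteristic \<open>p\<close>\<close>

definition shift_prod :: "int \<Rightarrow> nat \<Rightarrow> 'a::ring_1 fps \<Rightarrow> 'a fps" where
  "shift_prod \<kappa> n a = prod_list (map (\<lambda>c. shift (\<kappa> * int c) a) [0..<n])"

lemma shift_prod_nth_0: "fps_nth (shift_prod \<kappa> n a) 0 = fps_nth a 0 ^ n"
  by (induction n) (simp_all add: shift_prod_def power_commutes)

lemma prod_list_reflect:
  fixes g :: "nat \<Rightarrow> 'a::monoid_mult"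
  assumes "g p = g 0" "\<And>c d. g c * g d = g d * g c"
  shows "prod_list (map (\<lambda>c. g (p - c)) [0..<p]) = prod_list (map g [0..<p])"
proof (cases p)
  case (Suc q)
  have "map (\<lambda>c. g (p - c)) [1..<p] = rev (map g [1..<p])"
    by (rule nth_equalityI) (simp_all add: rev_nth Suc Suc_diff_Suc del: upt_Suc)
  then have "prod_list (map (\<lambda>c. g (p - c)) [1..<p]) = prod_list (map g [1..<p])"
    using assms(2) by (auto intro!: prod_list_rev simp del: rev_map)
  moreover have "[0..<p] = 0 # [1..<p]" using Suc by (simp add: upt_conv_Cons)
  ultimately show ?thesis using assms(1) by simp
qed simp

text \<open>Modulo p the shifts by -\<kappa> c and \<kappa> (p - c) agree, so both products consist
  of the same commuting factors.\<close>

lemma shift_prod_uminus: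
  fixes a :: "'a::ring_1 fps"
  assumes char: "of_nat p = (0::'a)" and comm: "\<And>r s. fps_nth a r * fps_nth a s = fps_nth a s * fps_nth a r"
  shows "shift_prod (- \<kappa>) p a = shift_prod \<kappa> p a"
proof -
  have "shift (- \<kappa> * int c) a = shift (\<kappa> * int (p - c)) a" if "c < p" for c
    using shift_add_char[OF char, of "- \<kappa> * int c" \<kappa> a] that by (simp add: of_nat_diff algebra_simps)
  then have "shift_prod (- \<kappa>) p a = prod_list (map (\<lambda>c. shift (\<kappa> * int (p - c)) a) [0..<p])"
    unfolding shift_prod_def by (intro arg_cong[of _ _ prod_list] map_cong) auto
  also have "\<dots> = shift_prod \<kappa> p a"
    unfolding shift_prod_def using shift_add_char[OF char, of 0 \<kappa> a] comm
    by (intro prod_list_reflect[where g = "\<lambda>c. shift (\<kappa> * int c) a"] shift_commute) (simp_all add: mult.commute)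
  finally show ?thesis .
qed

text \<open>The shift permutes the commuting factors cyclically, because the factor for c = p is the
  one for c = 0.\<close>

lemma shift_shift_prod:
  fixes a :: "'a::ring_1 fps"
  assumes char: "of_nat p = (0::'a)" and comm: "\<And>r s. fps_nth a r * fps_nth a s = fps_nth a s * fps_nth a r"
  shows "shift 1 (shift_prod 1 p a) = shift_prod 1 p a"
proof (cases p)
  case (Suc q)
  have "shift 1 (shift_prod 1 p a) = prod_list (map (\<lambda>c. shift (int (Suc c)) a) [0..<p])"
    by (simp add: shift_prod_def shift_prod_list shift_shift add.commute)
  also have "\<dots> = prod_list (map (\<lambda>c. shift (int (Suc c)) a) [0..<q]) * shift (int p) a"
    by (simp add: Suc)
  also have "shift (int p) a = shift 0 a"
    using shift_add_char[OF char, of 0 1 a] by simp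
  also have "prod_list (map (\<lambda>c. shift (int (Suc c)) a) [0..<q]) * shift 0 a
    = shift 0 a * prod_list (map (\<lambda>c. shift (int (Suc c)) a) [0..<q])"
    by (rule prod_list_commute[symmetric]) (auto intro!: shift_commute comm simp del: shift_0)
  also have "\<dots> = shift_prod 1 p a"
    by (simp add: shift_prod_def Suc upt_conv_Cons map_Suc_upt[symmetric] comp_def del: upt_Suc)
  finally show ?thesis .
qed (simp add: shift_prod_def)

text \<open>Leibniz rule: bracketing with a replaces one factor at a time, and the words with one
  replaced letter sum to the linear coefficient of a pencil product.\<close>

lemma bracket_prod_pencil:
  fixes x :: "nat \<Rightarrow> 'a::ring_1"
  assumes "\<And>c. a * x c - x c * a = k * (w c - w' c)" and k: "\<And>z. k * z = z * k"
  shows "a * prod_list (map x [0..<n]) - prod_list (map x [0..<n]) * a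
    = k * (fps_nth (pencil_prod x w n) 1 - fps_nth (pencil_prod x w' n) 1)"
proof (induction n)
  case 0
  then show ?case by (simp add: pencil_prod_def)
next
  case (Suc n)
  let ?P = "prod_list (map x [0..<n])"
  have "a * (?P * x n) - ?P * x n * a = (a * ?P - ?P * a) * x n + ?P * (a * x n - x n * a)"
    by (simp add: algebra_simps)
  also have "\<dots> = k * ((fps_nth (pencil_prod x w n) 1 - fps_nth (pencil_prod x w' n) 1) * x n + ?P * (w n - w' n))"
  proof -
    have "?P * (k * z) = k * (?P * z)" for z by (metis k mult.assoc)
    then show ?thesis by (simp only: Suc assms(1) distrib_left mult.assoc)
  qed
  finally show ?case by (simp add: pencil_prod_nth_Suc pencil_prod_nth_0 algebra_simps)
qed

text \<open>The induction step of \<open>row_commute\<close>, freed from series: q is u^-1, k the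
  sign, n the number of factors, Y their product, w its derivative, y and x the next factors; D and
  c are brackets with a = t_il^(r), primed ones those with t_il^(r+1), and b = t_ij^(r).\<close>

lemma row_commute_step:
  fixes q :: "'a::ring_1"
  assumes D: "D = q * (D' + k * (b * w - n * (Y * a)))"
    and c: "c = q * (k * (n * c) + c' + k * (b * x - y * a))"
    and bY: "b * Y = Y * b" and c_eq: "c = a * y - y * a"
    and central: "\<And>z. q * z = z * q" "\<And>z. k * z = z * k" "\<And>z. n * z = z * n"
  shows "D * y + Y * c = q * (D' * y + Y * c' + k * (b * (w * y + Y * x) - (1 + n) * (Y * y * a)))"
proof -
  have pull: "Y * (q * z) = q * (Y * z)" "Y * (k * z) = k * (Y * z)" "Y * (n * z) = n * (Y * z)" for z
    using central by (metis mult.assoc)+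
  have bY': "b * (Y * z) = Y * (b * z)" for z
    by (simp only: mult.assoc[symmetric] bY)
  have "D * y + Y * c = q * ((D' + k * (b * w - n * (Y * a))) * y
      + Y * (k * (n * c) + c' + k * (b * x - y * a)))"
    by (subst D, subst c) (simp only: pull mult.assoc distrib_left distrib_right)
  also have "(D' + k * (b * w - n * (Y * a))) * y + Y * (k * (n * c) + c' + k * (b * x - y * a))
    = D' * y + Y * c' + k * (b * (w * y + Y * x) - (1 + n) * (Y * y * a))"
    unfolding c_eq
    by (simp add: pull bY' distrib_left distrib_right left_diff_distrib right_diff_distrib mult.assoc)
  finally show ?thesis .
qed

locale rtt_char = rtt \<kappa> t for \<kappa> and t :: "2 \<Rightarrow> 2 \<Rightarrow> nat \<Rightarrow> 'a::ring_1" +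
  fixes p :: nat
  assumes char: "of_nat p = (0 :: 'a)" and prime: "prime p"
begin

lemma sign_fps: "of_int \<kappa> * (of_int \<kappa> * x) = (x :: 'a fps)"
proof -
  have "of_int \<kappa> * (of_int \<kappa> * x) = of_int (\<kappa> * \<kappa>) * x" by (simp add: mult.assoc)
  then show ?thesis by (simp add: sign)
qed

lemma char_fps: "of_nat p = (0 :: 'a fps)"
  using char by (simp flip: fps_of_nat)

lemma rtt_char_transpose: "rtt_char (- \<kappa>) (\<lambda>i j. t j i) p"
  by (intro rtt_char.intro rtt_transpose rtt_char_axioms.intro char prime)

definition S :: "2 \<Rightarrow> 2 \<Rightarrow> 'a fps" where
  "S i j = shift_prod \<kappa> p (series t i j)"

lemma S_nth_0: "fps_nth (S i j) 0 = (if i = j then 1 else 0)"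
  using prime_gt_0_nat[OF prime] by (simp add: S_def shift_prod_nth_0 t_0 zero_power)

lemma S_eq_shift_prod_1: "S i j = shift_prod 1 p (series t i j)"
proof -
  have "\<kappa> = 1 \<or> \<kappa> = - 1" using sign by (simp add: zmult_eq_1_iff)
  then show ?thesis
    using shift_prod_uminus[OF char, of "series t i j" 1] commute_entry by (auto simp: S_def)
qed

lemma S_transpose: "rtt_char.S (- \<kappa>) (\<lambda>i j. t j i) p i j = S j i"
  using rtt_char.S_eq_shift_prod_1[OF rtt_char_transpose, of i j]
  by (simp add: S_eq_shift_prod_1 series_transpose)

text \<open>The derivative of s_ij in the direction of t_il, that is, the instance m = 1 of the
  vanishing middle terms.\<close>

lemma row_derivative: "fps_nth (pencil_prod (\<lambda>c. shift (\<kappa> * int c) (series t i j)) (\<lambda>c. shift (\<kappa> * int c) (series t i l)) p) 1 = 0"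
  by (rule exchangeable.pencil_prod_middle[OF exchangeable_row char_fps prime])
     (use prime_gt_1_nat[OF prime] in auto)

lemma column_derivative:
  "fps_nth (pencil_prod (\<lambda>c. shift (\<kappa> * int c) (series t i j)) (\<lambda>c. shift (\<kappa> * int c) (series t k j)) p) 1 = 0"
proof -
  interpret tr: rtt_char "- \<kappa>" "\<lambda>i j. t j i" p by (rule rtt_char_transpose)
  let ?x = "\<lambda>c. shift (- \<kappa> * int c) (series t i j)" and ?y = "\<lambda>c. shift (- \<kappa> * int c) (series t k j)"
  interpret exchangeable ?x ?y
    using tr.exchangeable_row[of j i k] by (simp only: series_transpose)
  let ?x' = "\<lambda>c. shift (\<kappa> * int c) (series t i j)" and ?y' = "\<lambda>c. shift (\<kappa> * int c) (series t k j)"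
  \<comment> \<open>The transposed row comes with shifts of the opposite sign; modulo p these are
    the same factors indexed by p - c.\<close>
  have s: "shift (\<kappa> * int c) a = shift (- \<kappa> * int (p - c)) (a :: 'a fps)" if "c < p" for c a
    using shift_add_char[OF char, of "\<kappa> * int c" "- \<kappa>" a] that by (simp add: of_nat_diff algebra_simps)
  have "pencil_prod ?x' ?y' p = prod_list (map (\<lambda>c. pencil ?x ?y (p - c)) [0..<p])"
    unfolding pencil_prod_def
    by (intro arg_cong[of _ _ prod_list] map_cong refl) (simp only: pencil_def s set_upt atLeastLessThan_iff)
  also have "\<dots> = pencil_prod ?x ?y p"
    unfolding pencil_prod_def
  proof (rule prod_list_reflect[OF _ pencil_commute])
    have "shift (- \<kappa> * int p) a = shift (- \<kappa> * int 0) (a :: 'a fps)" for a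
      using shift_add_char[OF char, of 0 "- \<kappa>" a] by (simp add: mult.commute)
    then show "pencil ?x ?y p = pencil ?x ?y 0" by (simp only: pencil_def)
  qed
  finally show ?thesis
    using tr.row_derivative[of j i k] by (simp only: series_transpose)
qed

text \<open>Bracketing with t_il^(r) equals u^-1 times bracketing with t_il^(r+1), up to a
  correction made of the derivative \<open>W\<close> and the number of factors. After p factors the
  correction is 0, so the bracket is divisible by every power of u^-1.\<close>

lemma row_commute: "fps_const (t i l r) * S i j = S i j * fps_const (t i l r)"
proof -
  let ?y = "\<lambda>c. shift (\<kappa> * int c) (series t i j)" and ?x = "\<lambda>c. shift (\<kappa> * int c) (series t i l)"
  define Y where "Y n = prod_list (map ?y [0..<n])" for n
  define W where "W n = fps_nth (pencil_prod ?y ?x n) 1" for n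
  define C where "C r a = fps_const (t i l r) * a - a * fps_const (t i l r)" for r a
  have Y_Suc: "Y (Suc n) = Y n * ?y n" for n by (simp add: Y_def)
  have W_Suc: "W (Suc n) = W n * ?y n + Y n * ?x n" for n
    by (simp add: W_def pencil_prod_nth_Suc pencil_prod_nth_0 Y_def)
  have C_mult: "C r (a * b) = C r a * b + a * C r b" for r a b
    by (simp add: C_def algebra_simps)
  \<comment> \<open>The shifted relation carries the factor (u - \<kappa> n)^-1; clearing it brings
    the bracket itself back on the right, with coefficient \<kappa> n.\<close>
  have step: "C r (?y n) = fps_X * (of_int (\<kappa> * int n) * C r (?y n) + C (Suc r) (?y n)
      + of_int \<kappa> * (fps_const (t i j r) * ?x n - ?y n * fps_const (t i l r)))" for r n
  proof -
    let ?k = "\<kappa> * int n"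
    let ?B = "C (Suc r) (?y n) + of_int \<kappa> * (fps_const (t i j r) * ?x n - ?y n * fps_const (t i l r))"
    have "C r (?y n) = shift_var ?k * ?B"
      using arg_cong[OF series_rel[of i l r i j], of "shift ?k"]
      by (simp add: shift_mult shift_diff shift_add shift_X shift_const shift_of_int C_def)
    then have "(1 - of_int ?k * fps_X) * C r (?y n) = fps_X * ?B"
      by (simp only: mult.assoc[symmetric] shift_var_eq)
    then have "C r (?y n) = of_int ?k * fps_X * C r (?y n) + fps_X * ?B"
      by (simp add: left_diff_distrib diff_eq_eq add.commute)
    moreover have "of_int ?k * fps_X * C r (?y n) = fps_X * (of_int ?k * C r (?y n))"
      by (metis mult.assoc mult_of_int_commute)
    ultimately show ?thesis by (simp only: distrib_left[symmetric] add.assoc)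
  qed
  have yY: "fps_const (t i j r) * Y n = Y n * fps_const (t i j r)" for r n
    unfolding Y_def
  proof (rule prod_list_commute)
    fix y assume "y \<in> set (map ?y [0..<n])"
    then show "fps_const (t i j r) * y = y * fps_const (t i j r)"
      using shift_commute[of "fps_const (t i j r)" "series t i j" 0]
      by (auto simp: commute_entry t_0)
  qed
  have main: "C r (Y n) = fps_X * (C (Suc r) (Y n)
      + of_int \<kappa> * (fps_const (t i j r) * W n - of_nat n * (Y n * fps_const (t i l r))))" for r n
  proof (induction n)
    case 0
    then show ?case by (simp add: C_def Y_def W_def pencil_prod_def)
  next
    case (Suc n)
    have "C r (?y n) = fps_X * (of_int \<kappa> * (of_nat n * C r (?y n)) + C (Suc r) (?y n)
      + of_int \<kappa> * (fps_const (t i j r) * ?x n - ?y n * fps_const (t i l r)))"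
      by (subst step) (simp add: mult.assoc)
    from row_commute_step[OF Suc this yY _ int_fps_commute[OF int_fps_X] mult_of_int_commute mult_of_nat_commute]
    show ?case by (simp add: C_def[of r "?y n"] Y_Suc W_Suc C_mult)
  qed
  have W0: "W p = 0" unfolding W_def by (rule row_derivative)
  have "fps_nth (C r (Y p)) n = 0" for n r
  proof (induction n arbitrary: r)
    case 0
    then show ?case by (subst main) simp
  next
    case (Suc n)
    then show ?case by (subst main) (simp add: W0 char_fps)
  qed
  then have "C r (Y p) = 0" by (intro fps_ext) simp
  then show ?thesis by (simp add: C_def Y_def S_def shift_prod_def)
qed

lemma column_commute: "fps_const (t k j r) * S i j = S i j * fps_const (t k j r)"
  using rtt_char.row_commute[OF rtt_char_transpose, where i = j and l = k and r = r and j = i]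
  by (simp only: S_transpose)

text \<open>Row i and column j are settled. What remains is the opposite corner of the 2 x 2 matrix,
  which is reached through commutators of elements that already commute with s_ij.\<close>

lemma S_central: "fps_const (t k l r) * S i j = S i j * fps_const (t k l r)"
proof -
  have other: "a = b" if "a \<noteq> c" "b \<noteq> c" for a b c :: 2
    using that exhaust_2[of a] exhaust_2[of b] exhaust_2[of c] by auto
  have com: "fps_const (x * y - y * x) * z = z * fps_const (x * y - y * x)"
    if "fps_const x * z = z * fps_const x" "fps_const y * z = z * fps_const y" for x y :: 'a and z
  proof -
    have "fps_const x * fps_const y * z = z * (fps_const x * fps_const y)"
      "fps_const y * fps_const x * z = z * (fps_const y * fps_const x)"
      using that by (metis mult.assoc)+
    then have "(fps_const x * fps_const y - fps_const y * fps_const x) * z = z * (fps_const x * fps_const y - fps_const y * fps_const x)"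
      by (simp only: left_diff_distrib right_diff_distrib)
    then show ?thesis by simp
  qed
  have cancel: "fps_const d * z = z * fps_const d"
    if "fps_const (of_int \<kappa> * d) * z = z * fps_const (of_int \<kappa> * d)" for d :: 'a and z
  proof -
    have k: "fps_const (of_int \<kappa> * d) = of_int \<kappa> * fps_const d" by (simp flip: fps_of_int)
    have "of_int \<kappa> * (fps_const d * z) = of_int \<kappa> * fps_const d * z" by (simp only: mult.assoc)
    also have "\<dots> = z * of_int \<kappa> * fps_const d" using that by (simp only: k mult.assoc)
    also have "\<dots> = of_int \<kappa> * (z * fps_const d)"
      by (simp only: mult_of_int_commute[of \<kappa> z, symmetric] mult.assoc)
    finally show ?thesis by (metis sign_fps)
  qed
  consider "k = i" | "l = j" | "k \<noteq> i" "l \<noteq> j" "i = j" | "k \<noteq> i" "l \<noteq> j" "i \<noteq> j" by blast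
  then show ?thesis
  proof cases
    case 1
    then show ?thesis using row_commute by simp
  next
    case 2
    then show ?thesis using column_commute by simp
  next
    case 3
    then have l: "l = k" using other[of l j k] by simp
    \<comment> \<open>For s_ii: [t_ki^(1), t_ik^(r)] is \<kappa> times t_kk^(r) - t_ii^(r), and t_ii
      lies in row i.\<close>
    have "fps_const (of_int \<kappa> * (t k k r - t i i r)) * S i j = S i j * fps_const (of_int \<kappa> * (t k k r - t i i r))"
      using com[OF column_commute[of k i 1 i] row_commute[of i k r i]] bracket_1[of k i i k r] 3 by simp
    then have "fps_const (t k k r - t i i r) * S i j = S i j * fps_const (t k k r - t i i r)"
      by (rule cancel)
    then show ?thesis using row_commute[of i i r j] 3 l
      by (simp add: left_diff_distrib right_diff_distrib flip: fps_const_sub)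
  next
    case 4
    then have kl: "k = j" "l = i" using other[of k i j] other[of l j i] by auto
    \<comment> \<open>For i different from j: t_ji^(1) differentiates t_ij(u) into a difference of
      diagonal entries, one in the same column and one in the same row, and both derivatives of s_ij
      vanish.\<close>
    have b: "fps_const (t j i 1) * shift c (series t i j) - shift c (series t i j) * fps_const (t j i 1)
      = of_int \<kappa> * (shift c (series t j j) - shift c (series t i i))" for c
    proof -
      have "fps_const (t j i 1) * series t i j - series t i j * fps_const (t j i 1)
        = of_int \<kappa> * (series t j j - series t i i)"
        by (rule fps_ext) (use bracket_1[of j i i j] in \<open>simp flip: fps_of_int\<close>)
      from arg_cong[OF this, of "shift c"] show ?thesis
        by (simp add: shift_mult shift_diff shift_const shift_of_int)
    qed
    have 1: "fps_const (t j i 1) * S i j = S i j * fps_const (t j i 1)"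
      using bracket_prod_pencil[OF b mult_of_int_commute, of "\<lambda>c. \<kappa> * int c" p]
      unfolding row_derivative[of i j i] column_derivative[of i j j] S_def shift_prod_def by simp
    \<comment> \<open>The higher t_ji^(r) are, up to sign, commutators of t_ji^(1) with
      t_ii^(r).\<close>
    have "fps_const (of_int \<kappa> * t j i r) * S i j = S i j * fps_const (of_int \<kappa> * t j i r)"
      using com[OF 1 row_commute[of i i r j]] bracket_1[of j i i i r] 4 by simp
    then have "fps_const (t j i r) * S i j = S i j * fps_const (t j i r)" by (rule cancel)
    then show ?thesis using kl by simp
  qed
qed

text \<open>Cancelling t_ii in the row exchange gives t_ii(u) e(u) = e(u - \<kappa>) t_ii(u). In the
  descending product every factor e moves right through the remaining t_ii and thereby loses its
  shift.\<close>

lemma S_eq_mult_power: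
  assumes y: "series t i j = series t i i * e"
  shows "S i j = S i i * e ^ p"
proof -
  let ?x = "\<lambda>c. shift (\<kappa> * int c) (series t i i)" and ?y = "\<lambda>c. shift (\<kappa> * int c) (series t i j)"
    and ?e = "\<lambda>c. shift (\<kappa> * int c) e"
  obtain b where b: "b * series t i i = 1"
    using fps_unit_inverse[of "series t i i"] by (auto simp: t_0)
  have "shift \<kappa> (series t i i) * (series t i i * e) = shift \<kappa> (series t i i) * (shift \<kappa> e * series t i i)"
    using row_exchange[of i i j] by (simp add: y shift_mult mult.assoc)
  from arg_cong[OF this, of "\<lambda>a. shift \<kappa> b * a"]
  have "series t i i * e = shift \<kappa> e * series t i i"
    by (simp add: mult.assoc[symmetric] shift_mult[symmetric] b)
  from arg_cong[OF this, of "shift (\<kappa> * int c)" for c]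
  have ex: "?x c * ?e c = ?e (Suc c) * ?x c" for c
    by (simp add: shift_mult shift_shift distrib_left add.commute)
  have rev_S: "S i k = prod_list (map (\<lambda>c. shift (\<kappa> * int c) (series t i k)) (rev [0..<p]))" for k
    unfolding S_def shift_prod_def rev_map[symmetric]
    by (rule prod_list_rev[symmetric]) (auto simp: shift_entry_commute)
  have e: "?e n * prod_list (map ?x (rev [0..<n])) = prod_list (map ?x (rev [0..<n])) * e" for n
  proof (induction n)
    case (Suc n)
    have "?e (Suc n) * (?x n * prod_list (map ?x (rev [0..<n]))) = ?x n * (?e n * prod_list (map ?x (rev [0..<n])))"
      by (simp only: mult.assoc[symmetric] ex)
    then show ?case by (simp add: Suc mult.assoc del: of_nat_Suc)
  qed simp
  have "prod_list (map ?y (rev [0..<n])) = prod_list (map ?x (rev [0..<n])) * e ^ n" for n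
  proof (induction n)
    case (Suc n)
    have "?y n = ?x n * ?e n" by (simp add: y shift_mult)
    then have "?y n * (prod_list (map ?x (rev [0..<n])) * e ^ n) = ?x n * (?e n * prod_list (map ?x (rev [0..<n]))) * e ^ n"
      by (simp add: mult.assoc)
    then show ?case by (simp add: Suc e mult.assoc)
  qed simp
  then show ?thesis by (simp only: rev_S)
qed

lemma root_power_coeffs_iff:
  assumes y: "series t i j = series t i i * e" and e0: "fps_nth e 0 = 0" and J: "additive_set J"
  shows "(\<forall>n. fps_nth (e ^ p) n \<in> J) \<longleftrightarrow> (\<forall>r>0. fps_nth e r ^ p \<in> J)"
proof -
  interpret root_series "fps_nth e" \<kappa> p
    by unfold_locales (use char prime root_bracket[OF y e0] in auto)
  have "tail_series 0 = e" by (rule fps_ext) (simp add: tail_series_def e0)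
  then show ?thesis using power_coeffs_iff[OF J] by simp
qed

end

text \<open>Taking shifted products of entries is compatible with matrix multiplication: a row of a
  and a column of b are the two legs of \<open>prod_sum_two_legs\<close>.\<close>

lemma S_product:
  fixes a b :: "2 \<Rightarrow> 2 \<Rightarrow> nat \<Rightarrow> 'a::ring_1"
  assumes a: "rtt_char \<kappa> a p" and b: "rtt_char \<kappa> b p"
    and comm: "\<And>i j r k l s. a i j r * b k l s = b k l s * a i j r"
    and c: "\<And>i j. series c i j = series a i 1 * series b 1 j + series a i 2 * series b 2 j"
  shows "shift_prod \<kappa> p (series c i j) = rtt_char.S \<kappa> a p i 1 * rtt_char.S \<kappa> b p 1 j
    + rtt_char.S \<kappa> a p i 2 * rtt_char.S \<kappa> b p 2 j"
proof -
  interpret a: rtt_char \<kappa> a p by (rule a)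
  interpret b: rtt_char \<kappa> b p by (rule b)
  interpret exchangeable "\<lambda>c. shift (\<kappa> * int c) (series a i 1)" "\<lambda>c. shift (\<kappa> * int c) (series a i 2)"
    by (rule a.exchangeable_row)
  have ab: "shift m (series a i k) * shift n (series b l j) = shift n (series b l j) * shift m (series a i k)" for m n k l
    by (rule shift_commute) (simp add: comm)
  have "shift_prod \<kappa> p (series c i j) = prod_list (map (\<lambda>c. shift (\<kappa> * int c) (series a i 1) * shift (\<kappa> * int c) (series b 1 j)
      + shift (\<kappa> * int c) (series a i 2) * shift (\<kappa> * int c) (series b 2 j)) [0..<p])"
    by (simp add: shift_prod_def c shift_add shift_mult)
  also have "\<dots> = a.S i 1 * b.S 1 j + a.S i 2 * b.S 2 j"
    unfolding a.S_def b.S_def shift_prod_def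
    by (rule prod_sum_two_legs) (rule b.column_exchange ab a.char_fps a.prime)+
  finally show ?thesis .
qed

section \<open>Carrier-based algebras and their quotients by two-sided ideals\<close>

section \<open>Algebras over a field and their quotients\<close>

context k_algebra
begin

sublocale scal: module "ring_of_type_algebra :: 'k ring" A
  by (rule module_over_scalars)

lemma smult_cl [simp, intro]: "x \<in> carrier A \<Longrightarrow> c \<odot> x \<in> carrier A"
  using scal.smult_closed[of c x] by (simp add: ring_of_type_algebra_def)

lemma smult_add: "x \<in> carrier A \<Longrightarrow> y \<in> carrier A \<Longrightarrow> c \<odot> (x \<oplus> y) = c \<odot> x \<oplus> c \<odot> y"
  using scal.smult_r_distr[of c x y] by (simp add: ring_of_type_algebra_def)

lemma add_smult: "x \<in> carrier A \<Longrightarrow> (c + d) \<odot> x = c \<odot> x \<oplus> d \<odot> x"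
  using scal.smult_l_distr[of c d x] by (simp add: ring_of_type_algebra_def)

lemma smult_smult: "x \<in> carrier A \<Longrightarrow> c \<odot> (d \<odot> x) = (c * d) \<odot> x"
  using scal.smult_assoc1[of c d x] by (simp add: ring_of_type_algebra_def)

lemma one_smult [simp]: "x \<in> carrier A \<Longrightarrow> 1 \<odot> x = x"
  using scal.smult_one[of x] by (simp add: ring_of_type_algebra_def)

lemma zero_smult [simp]: "x \<in> carrier A \<Longrightarrow> 0 \<odot> x = \<zero>"
  using add_smult[of x 0 0] by (metis add.r_cancel_one smult_cl add.r_cancel_one' add_0)

lemma smult_zero [simp]: "c \<odot> \<zero> = \<zero>"
  using smult_smult[of \<zero> c 0] by simp

lemma minus_one_smult: "x \<in> carrier A \<Longrightarrow> (- 1) \<odot> x = \<ominus> x"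
  using add_smult[of x "- 1" 1] by (intro minus_equality[symmetric]) simp_all

lemma minus_eq_smult: "x \<in> carrier A \<Longrightarrow> y \<in> carrier A \<Longrightarrow> x \<ominus> y = x \<oplus> (- 1) \<odot> y"
  by (simp add: minus_one_smult a_minus_def)

end

lemma k_algebraI:
  fixes A :: "('k::field, 'a) module" (structure)
  assumes closed: "\<zero> \<in> carrier A" "\<one> \<in> carrier A"
      "\<And>x y. x \<in> carrier A \<Longrightarrow> y \<in> carrier A \<Longrightarrow> x \<oplus> y \<in> carrier A"
      "\<And>x y. x \<in> carrier A \<Longrightarrow> y \<in> carrier A \<Longrightarrow> x \<otimes> y \<in> carrier A"
      "\<And>c x. x \<in> carrier A \<Longrightarrow> c \<odot> x \<in> carrier A"
    and add: "\<And>x y z. x \<in> carrier A \<Longrightarrow> y \<in> carrier A \<Longrightarrow> z \<in> carrier A \<Longrightarrow> x \<oplus> y \<oplus> z = x \<oplus> (y \<oplus> z)"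
      "\<And>x y. x \<in> carrier A \<Longrightarrow> y \<in> carrier A \<Longrightarrow> x \<oplus> y = y \<oplus> x"
      "\<And>x. x \<in> carrier A \<Longrightarrow> \<zero> \<oplus> x = x"
    and mult: "\<And>x y z. x \<in> carrier A \<Longrightarrow> y \<in> carrier A \<Longrightarrow> z \<in> carrier A \<Longrightarrow> x \<otimes> y \<otimes> z = x \<otimes> (y \<otimes> z)"
      "\<And>x. x \<in> carrier A \<Longrightarrow> \<one> \<otimes> x = x" "\<And>x. x \<in> carrier A \<Longrightarrow> x \<otimes> \<one> = x"
      "\<And>x y z. x \<in> carrier A \<Longrightarrow> y \<in> carrier A \<Longrightarrow> z \<in> carrier A \<Longrightarrow> (x \<oplus> y) \<otimes> z = x \<otimes> z \<oplus> y \<otimes> z"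
      "\<And>x y z. x \<in> carrier A \<Longrightarrow> y \<in> carrier A \<Longrightarrow> z \<in> carrier A \<Longrightarrow> z \<otimes> (x \<oplus> y) = z \<otimes> x \<oplus> z \<otimes> y"
    and smult: "\<And>c x y. x \<in> carrier A \<Longrightarrow> y \<in> carrier A \<Longrightarrow> c \<odot> (x \<oplus> y) = c \<odot> x \<oplus> c \<odot> y"
      "\<And>c d x. x \<in> carrier A \<Longrightarrow> (c + d) \<odot> x = c \<odot> x \<oplus> d \<odot> x"
      "\<And>c d x. x \<in> carrier A \<Longrightarrow> c \<odot> (d \<odot> x) = (c * d) \<odot> x"
      "\<And>x. x \<in> carrier A \<Longrightarrow> 1 \<odot> x = x" "\<And>x. x \<in> carrier A \<Longrightarrow> 0 \<odot> x = \<zero>"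
      "\<And>c x y. x \<in> carrier A \<Longrightarrow> y \<in> carrier A \<Longrightarrow> (c \<odot> x) \<otimes> y = c \<odot> (x \<otimes> y)"
      "\<And>c x y. x \<in> carrier A \<Longrightarrow> y \<in> carrier A \<Longrightarrow> x \<otimes> (c \<odot> y) = c \<odot> (x \<otimes> y)"
  shows "k_algebra A"
proof -
  have neg: "(- 1) \<odot> x \<oplus> x = \<zero>" if "x \<in> carrier A" for x
    using smult(2)[OF that, of "- 1" 1] smult(4,5)[OF that] by simp
  have ab: "abelian_group A"
  proof (rule abelian_groupI)
    fix x y assume "x \<in> carrier A" "y \<in> carrier A"
    then show "x \<oplus> y = y \<oplus> x" by (rule add(2))
  next
    fix x assume "x \<in> carrier A"
    then show "\<exists>y\<in>carrier A. y \<oplus> x = \<zero>" using neg closed(5) by blast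
  qed (simp_all add: closed add(1,3))
  have ring: "ring A"
    by (rule ringI[OF ab monoidI]) (simp_all add: closed mult)
  have "Module.module (ring_of_type_algebra :: 'k ring) A"
  proof (rule moduleI[OF _ ab])
    show "cring (ring_of_type_algebra :: 'k ring)" by (rule cring_from_type_algebra)
  qed (simp_all add: ring_of_type_algebra_def closed smult)
  then show ?thesis
    by (intro k_algebra.intro ring k_algebra_axioms.intro) (use smult in auto)
qed

lemma with_scalars_simps [simp]:
  "carrier (with_scalars R sc) = carrier R" "monoid.mult (with_scalars R sc) = monoid.mult R"
  "one (with_scalars R sc) = one R" "add (with_scalars R sc) = add R"
  "ring.zero (with_scalars R sc) = ring.zero R" "module.smult (with_scalars R sc) = sc"
  by (simp_all add: with_scalars_def ring.defs module.defs)

lemma type_algebra_simps [simp]: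
  "carrier (ring_of_type_algebra :: 'a::ring_1 ring) = UNIV"
  "monoid.mult (ring_of_type_algebra :: 'a ring) = (*)" "one (ring_of_type_algebra :: 'a ring) = 1"
  "ring.zero (ring_of_type_algebra :: 'a ring) = 0" "add (ring_of_type_algebra :: 'a ring) = (+)"
  by (simp_all add: ring_of_type_algebra_def)

lemma k_algebra_scalars: "k_algebra scalars"
  by (rule k_algebraI) (simp_all add: scalars_def algebra_simps)

lemma k_algebra_with_scalars:
  fixes sc :: "'k::field \<Rightarrow> 'a::ring_1"
  assumes "\<And>c d. sc (c + d) = sc c + sc d" "\<And>c d. sc (c * d) = sc c * sc d" "sc 1 = 1"
    and "\<And>c x. sc c * x = x * sc c"
  shows "k_algebra (with_scalars ring_of_type_algebra (\<lambda>c x. sc c * x))"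
proof -
  have 0: "sc 0 = 0" using assms(1)[of 0 0] by simp
  have c: "x * (sc c * y) = sc c * (x * y)" for x y c by (metis assms(4) mult.assoc)
  show ?thesis
    by (rule k_algebraI) (simp_all add: 0 assms(1-3) distrib_left distrib_right mult.assoc add.assoc add.commute, rule c)
qed

locale algebra_quotient = k_algebra A + ideal I A for A :: "('k::field, 'a) module" (structure) and I
begin

abbreviation proj :: "'a \<Rightarrow> 'a set" where "proj x \<equiv> I +> x"
abbreviation Q :: "('k, 'a set) module" where "Q \<equiv> quotient_algebra A I"

text \<open>Scalars act through multiples of the unit, so ring ideals are subspaces.\<close>

lemma smult_ideal: "x \<in> I \<Longrightarrow> c \<odot> x \<in> I"
  using smult_mult_left[of \<one> x c] I_l_closed[of x "c \<odot> \<one>"] by (simp add: a_Hcarr)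

lemma proj_eq_iff: "x \<in> carrier A \<Longrightarrow> y \<in> carrier A \<Longrightarrow> proj x = proj y \<longleftrightarrow> x \<ominus> y \<in> I"
  by (rule quotient_eq_iff_same_a_r_cos[OF is_ideal, symmetric])

lemma proj_self: "x \<in> carrier A \<Longrightarrow> x \<in> proj x"
  by (rule a_rcos_self)

lemma mem_proj: "x \<in> carrier A \<Longrightarrow> y \<in> proj x \<Longrightarrow> y \<in> carrier A \<and> proj y = proj x"
proof -
  assume x: "x \<in> carrier A" and "y \<in> proj x"
  then obtain h where h: "h \<in> I" "y = h \<oplus> x" by (auto simp: a_r_coset_def')
  moreover have "h \<oplus> x \<ominus> x = h" using h x by (simp add: a_Hcarr a_minus_def a_assoc r_neg)
  ultimately show ?thesis using x proj_eq_iff[of y x] by (simp add: a_Hcarr)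
qed

lemma carrier_Q: "carrier Q = proj ` carrier A"
  by (auto simp: quotient_algebra_def FactRing_def A_RCOSETS_def' image_def)

lemma proj_closed: "x \<in> carrier A \<Longrightarrow> proj x \<in> carrier Q"
  by (simp add: carrier_Q)

lemma proj_smult: "x \<in> carrier A \<Longrightarrow> c \<odot>\<^bsub>Q\<^esub> proj x = proj (c \<odot> x)"
proof -
  assume x: "x \<in> carrier A"
  have "proj (c \<odot> y) = proj (c \<odot> x)" if "y \<in> proj x" for y
  proof -
    have y: "y \<in> carrier A" "y \<ominus> x \<in> I"
      using mem_proj[OF x that] proj_eq_iff[of y x] x by auto
    have "c \<odot> y \<ominus> c \<odot> x = c \<odot> (y \<ominus> x)"
      using x y by (simp add: minus_eq_smult smult_add smult_smult)
    then show ?thesis using proj_eq_iff[of "c \<odot> y" "c \<odot> x"] x y smult_ideal by simp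
  qed
  then have "(\<Union>y\<in>proj x. proj (c \<odot> y)) = (\<Union>y\<in>proj x. proj (c \<odot> x))"
    by (intro SUP_cong) simp_all
  moreover have "proj x \<noteq> {}" using proj_self[OF x] by blast
  ultimately show ?thesis by (simp add: quotient_algebra_def)
qed

lemma proj_add: "x \<in> carrier A \<Longrightarrow> y \<in> carrier A \<Longrightarrow> proj x \<oplus>\<^bsub>Q\<^esub> proj y = proj (x \<oplus> y)"
  by (simp add: quotient_algebra_def FactRing_def a_rcos_sum)

lemma proj_mult: "x \<in> carrier A \<Longrightarrow> y \<in> carrier A \<Longrightarrow> proj x \<otimes>\<^bsub>Q\<^esub> proj y = proj (x \<otimes> y)"
  by (simp add: quotient_algebra_def FactRing_def rcoset_mult_add)

lemma proj_one: "\<one>\<^bsub>Q\<^esub> = proj \<one>"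
  by (simp add: quotient_algebra_def FactRing_def)

lemma proj_zero: "\<zero>\<^bsub>Q\<^esub> = proj \<zero>"
  by (simp add: quotient_algebra_def FactRing_def a_subset)

lemma proj_eq_zero: "x \<in> I \<Longrightarrow> proj x = \<zero>\<^bsub>Q\<^esub>"
  using proj_eq_iff[of x \<zero>] a_Hcarr[of x] by (simp add: proj_zero minus_eq)

lemma k_algebra_Q: "k_algebra Q"
proof (rule k_algebraI)
  show "x \<oplus>\<^bsub>Q\<^esub> y = y \<oplus>\<^bsub>Q\<^esub> x" if "x \<in> carrier Q" "y \<in> carrier Q" for x y
    using that by (auto simp: carrier_Q proj_add a_comm)
  show "\<zero>\<^bsub>Q\<^esub> \<in> carrier Q" "\<one>\<^bsub>Q\<^esub> \<in> carrier Q"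
    by (simp_all add: proj_zero proj_one proj_closed)
qed (auto simp: proj_smult proj_add proj_mult proj_one proj_zero carrier_Q smult_add add_smult smult_smult
    smult_mult_left smult_mult_right l_distr r_distr a_assoc m_assoc)

lemma proj_hom: "proj \<in> algebra_homs A Q"
  unfolding algebra_homs_def linear_maps_def ring_hom_def
  by (auto simp: proj_smult proj_add proj_mult proj_one proj_closed)

end

section \<open>The convolution algebra of a monoid\<close>

section \<open>Monoid algebras\<close>

lemma poly_mapping_carrier_induct [consumes 1, case_names zero add]:
  fixes x :: "'a \<Rightarrow>\<^sub>0 'k::comm_monoid_add"
  assumes "Poly_Mapping.keys x \<subseteq> K" and zero: "P 0"
    and step: "\<And>a c x. a \<in> K \<Longrightarrow> Poly_Mapping.keys x \<subseteq> K \<Longrightarrow> P x \<Longrightarrow> P (Poly_Mapping.single a c + x)"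
  shows "P x"
proof -
  have s: "Poly_Mapping.keys (\<Sum>a\<in>F. Poly_Mapping.single a (Poly_Mapping.lookup x a)) \<subseteq> F" if "finite F" for F
    using that by (auto simp: in_keys_iff lookup_sum lookup_single when_def sum.delta' split: if_splits)
  have "finite F \<Longrightarrow> F \<subseteq> K \<Longrightarrow> P (\<Sum>a\<in>F. Poly_Mapping.single a (Poly_Mapping.lookup x a))" for F
  proof (induction F rule: finite_induct)
    case (insert a F)
    then show ?case using s[of F] by (auto intro!: step)
  qed (use zero in simp)
  moreover have "(\<Sum>a\<in>Poly_Mapping.keys x. Poly_Mapping.single a (Poly_Mapping.lookup x a)) = x"
    by (rule poly_mapping_eqI) (simp add: lookup_sum lookup_single when_def sum.delta' in_keys_iff)
  ultimately show ?thesis using assms(1) by (metis finite_keys)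
qed

lemma keys_smult: "Poly_Mapping.keys (Poly_Mapping.map ((*) c) x) \<subseteq> Poly_Mapping.keys (x :: 'a \<Rightarrow>\<^sub>0 'k::field)"
  by (auto simp: in_keys_iff Poly_Mapping.map.rep_eq when_def split: if_splits)

lemma lookup_smult: "Poly_Mapping.lookup (Poly_Mapping.map ((*) c) x) a = c * Poly_Mapping.lookup (x :: 'a \<Rightarrow>\<^sub>0 'k::field) a"
  by (simp add: Poly_Mapping.map.rep_eq when_def)

lemma smult_poly_add: "Poly_Mapping.map ((*) c) (x + y) = Poly_Mapping.map ((*) c) x + Poly_Mapping.map ((*) c) (y :: 'a \<Rightarrow>\<^sub>0 'k::field)"
  by (rule poly_mapping_eqI) (simp add: lookup_smult lookup_add distrib_left)

lemma smult_poly_diff: "Poly_Mapping.map ((*) c) (x - y) = Poly_Mapping.map ((*) c) x - Poly_Mapping.map ((*) c) (y :: 'a \<Rightarrow>\<^sub>0 'k::field)"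
  by (rule poly_mapping_eqI) (simp add: lookup_smult lookup_minus right_diff_distrib)

lemma smult_poly_zero [simp]: "Poly_Mapping.map ((*) c) 0 = (0 :: 'a \<Rightarrow>\<^sub>0 'k::field)"
  by (rule poly_mapping_eqI) (simp add: lookup_smult)

lemma keys_add_subset: "Poly_Mapping.keys x \<subseteq> K \<Longrightarrow> Poly_Mapping.keys y \<subseteq> K \<Longrightarrow> Poly_Mapping.keys (x + y) \<subseteq> K"
  using keys_add[of x y] by blast

lemma smult_poly_single: "Poly_Mapping.map ((*) c) (Poly_Mapping.single a d) = Poly_Mapping.single a (c * d :: 'k::field)"
  by (rule poly_mapping_eqI) (simp add: lookup_smult lookup_single when_def)

context
  fixes M :: "('a, 'm) monoid_scheme" (structure)
  assumes M: "monoid M"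
begin

interpretation monoid M by (rule M)

definition conv :: "('a \<Rightarrow>\<^sub>0 'k::field) \<Rightarrow> ('a \<Rightarrow>\<^sub>0 'k) \<Rightarrow> ('a \<Rightarrow>\<^sub>0 'k)" where
  "conv = monoid.mult (monoid_algebra M)"

text \<open>Summing over arbitrary finite supersets of the supports avoids the effect of
  cancellation on the support of a sum.\<close>

lemma conv_eq:
  assumes "finite K" "finite L" "Poly_Mapping.keys x \<subseteq> K" "Poly_Mapping.keys y \<subseteq> L"
  shows "conv x y = (\<Sum>a\<in>K. \<Sum>b\<in>L. Poly_Mapping.single (a \<otimes> b) (Poly_Mapping.lookup x a * Poly_Mapping.lookup y b))"
proof -
  have "conv x y = (\<Sum>a\<in>Poly_Mapping.keys x. \<Sum>b\<in>Poly_Mapping.keys y.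
      Poly_Mapping.single (a \<otimes> b) (Poly_Mapping.lookup x a * Poly_Mapping.lookup y b))"
    by (simp add: conv_def monoid_algebra_def)
  also have "\<dots> = (\<Sum>a\<in>Poly_Mapping.keys x. \<Sum>b\<in>L. Poly_Mapping.single (a \<otimes> b) (Poly_Mapping.lookup x a * Poly_Mapping.lookup y b))"
    using assms by (intro sum.cong sum.mono_neutral_left) (auto simp: in_keys_iff)
  also have "\<dots> = (\<Sum>a\<in>K. \<Sum>b\<in>L. Poly_Mapping.single (a \<otimes> b) (Poly_Mapping.lookup x a * Poly_Mapping.lookup y b))"
    using assms by (intro sum.mono_neutral_left) (auto simp: in_keys_iff)
  finally show ?thesis .
qed

lemma conv_add_left: "conv (x + x') y = conv x y + conv x' y"
proof -
  let ?K = "Poly_Mapping.keys x \<union> Poly_Mapping.keys x'" and ?L = "Poly_Mapping.keys y"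
  have "Poly_Mapping.keys (x + x') \<subseteq> ?K" by (rule keys_add)
  then show ?thesis
    by (simp add: conv_eq[of ?K ?L] lookup_add distrib_right single_add sum.distrib)
qed

lemma conv_add_right: "conv x (y + y') = conv x y + conv x y'"
proof -
  let ?K = "Poly_Mapping.keys x" and ?L = "Poly_Mapping.keys y \<union> Poly_Mapping.keys y'"
  have "Poly_Mapping.keys (y + y') \<subseteq> ?L" by (rule keys_add)
  then show ?thesis
    by (simp add: conv_eq[of ?K ?L] lookup_add distrib_left single_add sum.distrib)
qed

lemma conv_single: "conv (Poly_Mapping.single a c) (Poly_Mapping.single b d) = Poly_Mapping.single (a \<otimes> b) (c * d)"
  by (simp add: conv_eq[of "{a}" "{b}"])

lemma conv_zero: "conv 0 y = 0" "conv x 0 = 0"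
  using conv_eq[of "{}" "Poly_Mapping.keys y" 0 y] conv_eq[of "Poly_Mapping.keys x" "{}" x 0] by simp_all

lemma conv_smult:
  "conv (Poly_Mapping.map ((*) c) x) y = Poly_Mapping.map ((*) c) (conv x y)"
  "conv x (Poly_Mapping.map ((*) c) y) = Poly_Mapping.map ((*) c) (conv x y)"
proof -
  have s: "Poly_Mapping.map ((*) c) (\<Sum>i\<in>F. f i) = (\<Sum>i\<in>F. Poly_Mapping.map ((*) c) (f i))"
    for F and f :: "'d \<Rightarrow> 'a \<Rightarrow>\<^sub>0 'e::field" and c
    by (induction F rule: infinite_finite_induct) (simp_all add: smult_poly_add)
  note e = conv_eq[of "Poly_Mapping.keys x" "Poly_Mapping.keys y"]
  show "conv (Poly_Mapping.map ((*) c) x) y = Poly_Mapping.map ((*) c) (conv x y)"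
    by (simp add: e keys_smult s smult_poly_single lookup_smult mult.assoc)
  show "conv x (Poly_Mapping.map ((*) c) y) = Poly_Mapping.map ((*) c) (conv x y)"
    by (simp add: e keys_smult s smult_poly_single lookup_smult mult.left_commute)
qed

lemma conv_closed:
  assumes "Poly_Mapping.keys x \<subseteq> carrier M" "Poly_Mapping.keys y \<subseteq> carrier M"
  shows "Poly_Mapping.keys (conv x y) \<subseteq> carrier M"
  using assms
proof (induction x rule: poly_mapping_carrier_induct)
  case (add a c x)
  have "Poly_Mapping.keys (conv (Poly_Mapping.single a c) y) \<subseteq> carrier M"
    using add.prems
  proof (induction y rule: poly_mapping_carrier_induct)
    case (add b d y)
    then show ?case using \<open>a \<in> carrier M\<close>
      by (simp add: conv_add_right conv_single keys_add_subset)
  qed (simp add: conv_zero)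
  then show ?case using add
    by (simp add: conv_add_left keys_add_subset)
qed (simp add: conv_zero)

lemma conv_assoc:
  assumes "Poly_Mapping.keys x \<subseteq> carrier M" "Poly_Mapping.keys y \<subseteq> carrier M" "Poly_Mapping.keys z \<subseteq> carrier M"
  shows "conv (conv x y) z = conv x (conv y z)"
  using assms
proof (induction x rule: poly_mapping_carrier_induct)
  case (add a c x)
  from add.prems have "conv (conv (Poly_Mapping.single a c) y) z = conv (Poly_Mapping.single a c) (conv y z)"
  proof (induction y rule: poly_mapping_carrier_induct)
    case y: (add b d y)
    from y.prems have "conv (conv (Poly_Mapping.single a c) (Poly_Mapping.single b d)) z
      = conv (Poly_Mapping.single a c) (conv (Poly_Mapping.single b d) z)"
    proof (induction z rule: poly_mapping_carrier_induct)
      case (add e f z)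
      then show ?case using \<open>a \<in> carrier M\<close> \<open>b \<in> carrier M\<close>
        by (simp add: conv_add_right conv_single m_assoc mult.assoc)
    qed (simp add: conv_zero)
    then show ?case using y by (simp add: conv_add_right conv_add_left)
  qed (simp add: conv_zero)
  then show ?case using add by (simp add: conv_add_left)
qed (simp add: conv_zero)

lemma conv_one:
  assumes "Poly_Mapping.keys x \<subseteq> carrier M"
  shows "conv (Poly_Mapping.single \<one> 1) x = x" "conv x (Poly_Mapping.single \<one> 1) = x"
  using assms by (induction x rule: poly_mapping_carrier_induct)
    (simp_all add: conv_zero conv_add_left conv_add_right conv_single)

lemma monoid_algebra_simps:
  "carrier (monoid_algebra M) = {x. Poly_Mapping.keys x \<subseteq> carrier M}"
  "x \<otimes>\<^bsub>monoid_algebra M\<^esub> y = conv x y" "\<one>\<^bsub>monoid_algebra M\<^esub> = Poly_Mapping.single \<one> 1"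
  "\<zero>\<^bsub>monoid_algebra M\<^esub> = 0" "add (monoid_algebra M) = (+)"
  "module.smult (monoid_algebra M) = (\<lambda>c. Poly_Mapping.map ((*) c))"
  by (simp_all add: conv_def monoid_algebra_def)

lemma k_algebra_monoid_algebra: "k_algebra (monoid_algebra M :: ('k::field, 'a \<Rightarrow>\<^sub>0 'k) module)"
proof (rule k_algebraI, unfold monoid_algebra_simps)
  show "x + y \<in> {x. Poly_Mapping.keys x \<subseteq> carrier M}"
    if "x \<in> {x. Poly_Mapping.keys x \<subseteq> carrier M}" "y \<in> {x. Poly_Mapping.keys x \<subseteq> carrier M}" for x y :: "'a \<Rightarrow>\<^sub>0 'k"
    using that keys_add[of x y] by auto
  show "Poly_Mapping.map ((*) (c + d)) x = Poly_Mapping.map ((*) c) x + Poly_Mapping.map ((*) d) x" for c d and x :: "'a \<Rightarrow>\<^sub>0 'k"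
    by (rule poly_mapping_eqI) (simp add: lookup_smult lookup_add distrib_right)
  show "Poly_Mapping.map ((*) c) (Poly_Mapping.map ((*) d) x) = Poly_Mapping.map ((*) (c * d)) x" for c d and x :: "'a \<Rightarrow>\<^sub>0 'k"
    by (rule poly_mapping_eqI) (simp add: lookup_smult mult.assoc)
  show "Poly_Mapping.map ((*) 1) x = x" "Poly_Mapping.map ((*) 0) x = 0" for x :: "'a \<Rightarrow>\<^sub>0 'k"
    by (rule poly_mapping_eqI, simp add: lookup_smult)+
  show "conv x y \<in> {x. Poly_Mapping.keys x \<subseteq> carrier M}"
    if "x \<in> {x. Poly_Mapping.keys x \<subseteq> carrier M}" "y \<in> {x. Poly_Mapping.keys x \<subseteq> carrier M}" for x y :: "'a \<Rightarrow>\<^sub>0 'k"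
    using that conv_closed[of x y] by simp
  show "Poly_Mapping.map ((*) c) x \<in> {x. Poly_Mapping.keys x \<subseteq> carrier M}"
    if "x \<in> {x. Poly_Mapping.keys x \<subseteq> carrier M}" for c and x :: "'a \<Rightarrow>\<^sub>0 'k"
    using that keys_smult[of c x] by blast
qed (auto simp: conv_assoc conv_one conv_add_left conv_add_right conv_smult smult_poly_add add.assoc add.commute)

end

section \<open>The tensor product of algebras and its universal property\<close>

section \<open>Tensor products of algebras\<close>

lemma linear_mapsD:
  assumes "h \<in> linear_maps A B"
  shows "x \<in> carrier A \<Longrightarrow> h x \<in> carrier B"
    "x \<in> carrier A \<Longrightarrow> y \<in> carrier A \<Longrightarrow> h (x \<oplus>\<^bsub>A\<^esub> y) = h x \<oplus>\<^bsub>B\<^esub> h y"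
    "x \<in> carrier A \<Longrightarrow> h (c \<odot>\<^bsub>A\<^esub> x) = c \<odot>\<^bsub>B\<^esub> h x"
  using assms by (auto simp: linear_maps_def)

lemma linear_mapsI:
  assumes "\<And>x. x \<in> carrier A \<Longrightarrow> h x \<in> carrier B"
    "\<And>x y. x \<in> carrier A \<Longrightarrow> y \<in> carrier A \<Longrightarrow> h (x \<oplus>\<^bsub>A\<^esub> y) = h x \<oplus>\<^bsub>B\<^esub> h y"
    "\<And>c x. x \<in> carrier A \<Longrightarrow> h (c \<odot>\<^bsub>A\<^esub> x) = c \<odot>\<^bsub>B\<^esub> h x"
  shows "h \<in> linear_maps A B"
  using assms by (auto simp: linear_maps_def)

lemma linear_maps_zero:
  assumes "k_algebra A" "k_algebra B" "h \<in> linear_maps A B"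
  shows "h \<zero>\<^bsub>A\<^esub> = \<zero>\<^bsub>B\<^esub>"
proof -
  interpret A: k_algebra A by fact
  interpret B: k_algebra B by fact
  show ?thesis using linear_mapsD(3)[OF assms(3), of "\<zero>\<^bsub>A\<^esub>" 0] linear_mapsD(1)[OF assms(3), of "\<zero>\<^bsub>A\<^esub>"] by simp
qed

lemma algebra_homsD:
  assumes "h \<in> algebra_homs A B"
  shows "h \<in> linear_maps A B" "x \<in> carrier A \<Longrightarrow> y \<in> carrier A \<Longrightarrow> h (x \<otimes>\<^bsub>A\<^esub> y) = h x \<otimes>\<^bsub>B\<^esub> h y"
    "h \<one>\<^bsub>A\<^esub> = \<one>\<^bsub>B\<^esub>"
  using assms by (auto simp: algebra_homs_def ring_hom_def)

lemma algebra_homsI: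
  assumes "h \<in> linear_maps A B" "\<And>x y. x \<in> carrier A \<Longrightarrow> y \<in> carrier A \<Longrightarrow> h (x \<otimes>\<^bsub>A\<^esub> y) = h x \<otimes>\<^bsub>B\<^esub> h y"
    "h \<one>\<^bsub>A\<^esub> = \<one>\<^bsub>B\<^esub>"
  shows "h \<in> algebra_homs A B"
  using assms by (auto simp: algebra_homs_def ring_hom_def linear_maps_def)

lemma linear_maps_comp:
  "f \<in> linear_maps A B \<Longrightarrow> g \<in> linear_maps B C \<Longrightarrow> (\<lambda>x. g (f x)) \<in> linear_maps A C"
  by (rule linear_mapsI) (simp_all add: linear_mapsD)

lemma algebra_homs_comp:
  assumes f: "f \<in> algebra_homs A B" and g: "g \<in> algebra_homs B C"
  shows "(\<lambda>x. g (f x)) \<in> algebra_homs A C"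
proof (rule algebra_homsI)
  show "(\<lambda>x. g (f x)) \<in> linear_maps A C"
    by (rule linear_maps_comp[OF algebra_homsD(1)[OF f] algebra_homsD(1)[OF g]])
qed (simp_all add: algebra_homsD(2,3)[OF f] algebra_homsD(2,3)[OF g] linear_mapsD(1)[OF algebra_homsD(1)[OF f]])

lemma algebra_homs_id: "(\<lambda>x. x) \<in> algebra_homs A A"
  by (rule algebra_homsI) (auto simp: linear_maps_def)

definition bilinear :: "('k, 'a) module \<Rightarrow> ('k, 'b) module \<Rightarrow> ('k, 'c) module \<Rightarrow> ('a \<Rightarrow> 'b \<Rightarrow> 'c) \<Rightarrow> bool" where
  "bilinear A B C \<beta> \<longleftrightarrow> (\<forall>a\<in>carrier A. \<beta> a \<in> linear_maps B C) \<and> (\<forall>b\<in>carrier B. (\<lambda>a. \<beta> a b) \<in> linear_maps A C)"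

lemma bilinearI:
  assumes "\<And>a b. a \<in> carrier A \<Longrightarrow> b \<in> carrier B \<Longrightarrow> \<beta> a b \<in> carrier C"
    "\<And>a a' b. a \<in> carrier A \<Longrightarrow> a' \<in> carrier A \<Longrightarrow> b \<in> carrier B \<Longrightarrow> \<beta> (a \<oplus>\<^bsub>A\<^esub> a') b = \<beta> a b \<oplus>\<^bsub>C\<^esub> \<beta> a' b"
    "\<And>a b b'. a \<in> carrier A \<Longrightarrow> b \<in> carrier B \<Longrightarrow> b' \<in> carrier B \<Longrightarrow> \<beta> a (b \<oplus>\<^bsub>B\<^esub> b') = \<beta> a b \<oplus>\<^bsub>C\<^esub> \<beta> a b'"
    "\<And>c a b. a \<in> carrier A \<Longrightarrow> b \<in> carrier B \<Longrightarrow> \<beta> (c \<odot>\<^bsub>A\<^esub> a) b = c \<odot>\<^bsub>C\<^esub> \<beta> a b"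
    "\<And>c a b. a \<in> carrier A \<Longrightarrow> b \<in> carrier B \<Longrightarrow> \<beta> a (c \<odot>\<^bsub>B\<^esub> b) = c \<odot>\<^bsub>C\<^esub> \<beta> a b"
  shows "bilinear A B C \<beta>"
  using assms by (auto simp: bilinear_def intro!: linear_mapsI)

lemma bilinearD:
  assumes "bilinear A B C \<beta>" "a \<in> carrier A" "b \<in> carrier B"
  shows "\<beta> a b \<in> carrier C"
    "a' \<in> carrier A \<Longrightarrow> \<beta> (a \<oplus>\<^bsub>A\<^esub> a') b = \<beta> a b \<oplus>\<^bsub>C\<^esub> \<beta> a' b"
    "b' \<in> carrier B \<Longrightarrow> \<beta> a (b \<oplus>\<^bsub>B\<^esub> b') = \<beta> a b \<oplus>\<^bsub>C\<^esub> \<beta> a b'"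
    "\<beta> (c \<odot>\<^bsub>A\<^esub> a) b = c \<odot>\<^bsub>C\<^esub> \<beta> a b"
    "\<beta> a (c \<odot>\<^bsub>B\<^esub> b) = c \<odot>\<^bsub>C\<^esub> \<beta> a b"
  using assms unfolding bilinear_def by (auto dest: linear_mapsD)

definition linear_extension :: "('k::field, 'c) module \<Rightarrow> ('a \<Rightarrow> 'b \<Rightarrow> 'c) \<Rightarrow> (('a \<times> 'b) \<Rightarrow>\<^sub>0 'k) \<Rightarrow> 'c" where
  "linear_extension C \<beta> x =
    (\<Oplus>\<^bsub>C\<^esub>q\<in>Poly_Mapping.keys x. Poly_Mapping.lookup x q \<odot>\<^bsub>C\<^esub> \<beta> (fst q) (snd q))"

locale tensor_product = A: k_algebra A + B: k_algebra B
  for A :: "('k::field, 'a) module" and B :: "('k, 'b) module"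
begin

lemma monoid_AB: "monoid (A \<times>\<times> B)"
  by (rule DirProd_monoid) (rule A.monoid_axioms B.monoid_axioms)+

lemma free_simps:
  "carrier (free_tensor A B) = {x. Poly_Mapping.keys x \<subseteq> carrier A \<times> carrier B}"
  "x \<otimes>\<^bsub>free_tensor A B\<^esub> y = conv (A \<times>\<times> B) x y"
  "\<one>\<^bsub>free_tensor A B\<^esub> = Poly_Mapping.single (\<one>\<^bsub>A\<^esub>, \<one>\<^bsub>B\<^esub>) 1"
  "\<zero>\<^bsub>free_tensor A B\<^esub> = 0" "add (free_tensor A B) = (+)"
  "module.smult (free_tensor A B) = (\<lambda>c. Poly_Mapping.map ((*) c))"
  by (simp_all add: free_tensor_def monoid_algebra_simps[OF monoid_AB])

lemmas free_conv = conv_add_left[OF monoid_AB] conv_add_right[OF monoid_AB] conv_zero[OF monoid_AB]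
lemmas free_single = conv_single[OF monoid_AB]

lemma k_algebra_free: "k_algebra (free_tensor A B)"
  unfolding free_tensor_def by (rule k_algebra_monoid_algebra[OF monoid_AB])

interpretation free: k_algebra "free_tensor A B" by (rule k_algebra_free)

abbreviation g :: "'a \<Rightarrow> 'b \<Rightarrow> ('a \<times> 'b) \<Rightarrow>\<^sub>0 'k" where "g a b \<equiv> Poly_Mapping.single (a, b) 1"
abbreviation R :: "(('a \<times> 'b) \<Rightarrow>\<^sub>0 'k) set" where "R \<equiv> bilinearity_relations A B"
abbreviation K :: "(('a \<times> 'b) \<Rightarrow>\<^sub>0 'k) set" where "K \<equiv> tensor_kernel A B"

lemma relations_induct [consumes 1, case_names add_left add_right smult_left smult_right]:
  assumes "x \<in> R"
    and "\<And>a a' b. a \<in> carrier A \<Longrightarrow> a' \<in> carrier A \<Longrightarrow> b \<in> carrier B \<Longrightarrow> P (g (a \<oplus>\<^bsub>A\<^esub> a') b - g a b - g a' b)"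
    and "\<And>a b b'. a \<in> carrier A \<Longrightarrow> b \<in> carrier B \<Longrightarrow> b' \<in> carrier B \<Longrightarrow> P (g a (b \<oplus>\<^bsub>B\<^esub> b') - g a b - g a b')"
    and "\<And>c a b. a \<in> carrier A \<Longrightarrow> b \<in> carrier B \<Longrightarrow> P (g (c \<odot>\<^bsub>A\<^esub> a) b - Poly_Mapping.single (a, b) c)"
    and "\<And>c a b. a \<in> carrier A \<Longrightarrow> b \<in> carrier B \<Longrightarrow> P (g a (c \<odot>\<^bsub>B\<^esub> b) - Poly_Mapping.single (a, b) c)"
  shows "P x"
  using assms(1) unfolding bilinearity_relations_def Let_def
  by - (elim UnE CollectE exE conjE; simp only:; rule assms(2-5); assumption)

lemma relationsI:
  "a \<in> carrier A \<Longrightarrow> a' \<in> carrier A \<Longrightarrow> b \<in> carrier B \<Longrightarrow> g (a \<oplus>\<^bsub>A\<^esub> a') b - g a b - g a' b \<in> R"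
  "a \<in> carrier A \<Longrightarrow> b \<in> carrier B \<Longrightarrow> b' \<in> carrier B \<Longrightarrow> g a (b \<oplus>\<^bsub>B\<^esub> b') - g a b - g a b' \<in> R"
  "a \<in> carrier A \<Longrightarrow> b \<in> carrier B \<Longrightarrow> g (c \<odot>\<^bsub>A\<^esub> a) b - Poly_Mapping.single (a, b) c \<in> R"
  "a \<in> carrier A \<Longrightarrow> b \<in> carrier B \<Longrightarrow> g a (c \<odot>\<^bsub>B\<^esub> b) - Poly_Mapping.single (a, b) c \<in> R"
  unfolding bilinearity_relations_def Let_def by blast+

lemma minus_poly_eq: "x - y = x + Poly_Mapping.map ((*) (- 1)) (y :: ('a \<times> 'b) \<Rightarrow>\<^sub>0 'k)"
  by (rule poly_mapping_eqI) (simp add: lookup_add lookup_minus lookup_smult)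

lemma free_diff_closed:
  "x \<in> carrier (free_tensor A B) \<Longrightarrow> y \<in> carrier (free_tensor A B) \<Longrightarrow> x - y \<in> carrier (free_tensor A B)"
  using keys_diff[of x y] by (auto simp: free_simps)

lemma single_closed: "a \<in> carrier A \<Longrightarrow> b \<in> carrier B \<Longrightarrow> Poly_Mapping.single (a, b) c \<in> carrier (free_tensor A B)"
  by (simp add: free_simps)

lemma relations_closed: "x \<in> R \<Longrightarrow> x \<in> carrier (free_tensor A B)"
  by (induction rule: relations_induct) (intro free_diff_closed single_closed; simp)+

lemma kernel_closed: "x \<in> K \<Longrightarrow> x \<in> carrier (free_tensor A B)"
  unfolding tensor_kernel_def
  by (induction rule: lin_span.induct)
     (simp_all add: relations_closed)

lemma kernel_intros:
  "x \<in> R \<Longrightarrow> x \<in> K" "0 \<in> K" "x \<in> K \<Longrightarrow> y \<in> K \<Longrightarrow> x + y \<in> K" "x \<in> K \<Longrightarrow> Poly_Mapping.map ((*) c) x \<in> K"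
  unfolding tensor_kernel_def
  by (rule lin_span.intros[where A = "free_tensor A B" and S = R, unfolded free_simps(4-6)]; assumption)+

text \<open>The product of a bilinearity relation with a basis element is a scalar multiple of a
  relation of the same kind; this makes the kernel an ideal.\<close>

lemma relations_mult:
  assumes x: "x \<in> R" and ab: "a \<in> carrier A" "b \<in> carrier B"
  shows "conv (A \<times>\<times> B) (Poly_Mapping.single (a, b) c) x \<in> K" "conv (A \<times>\<times> B) x (Poly_Mapping.single (a, b) c) \<in> K"
proof -
  have diff: "conv (A \<times>\<times> B) z (x - y) = conv (A \<times>\<times> B) z x - conv (A \<times>\<times> B) z y"
    "conv (A \<times>\<times> B) (x - y) z = conv (A \<times>\<times> B) x z - conv (A \<times>\<times> B) y z" for x y z :: "('a \<times> 'b) \<Rightarrow>\<^sub>0 'k"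
    using conv_add_right[OF monoid_AB, of z "x - y" y] conv_add_left[OF monoid_AB, of "x - y" y z] by simp_all
  have s: "Poly_Mapping.single q c = Poly_Mapping.map ((*) c) (Poly_Mapping.single q 1)" for q :: "'a \<times> 'b"
    by (simp add: smult_poly_single)
  have s': "Poly_Mapping.single q (c * d) = Poly_Mapping.map ((*) c) (Poly_Mapping.single q d)" for q :: "'a \<times> 'b" and d
    by (simp add: smult_poly_single)
  note K = kernel_intros(4)[OF kernel_intros(1)]
  note e = diff free_single s s' smult_poly_diff[symmetric]
  show "conv (A \<times>\<times> B) (Poly_Mapping.single (a, b) c) x \<in> K"
    using x
  proof (induction rule: relations_induct)
    case (add_left a1 a2 b1)
    then show ?case using ab K[OF relationsI(1)[of "a \<otimes>\<^bsub>A\<^esub> a1" "a \<otimes>\<^bsub>A\<^esub> a2" "b \<otimes>\<^bsub>B\<^esub> b1"], of c]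
      by (simp add: diff free_single smult_poly_diff smult_poly_single A.r_distr)
  next
    case (add_right a1 b1 b2)
    then show ?case using ab K[OF relationsI(2)[of "a \<otimes>\<^bsub>A\<^esub> a1" "b \<otimes>\<^bsub>B\<^esub> b1" "b \<otimes>\<^bsub>B\<^esub> b2"], of c]
      by (simp add: diff free_single smult_poly_diff smult_poly_single B.r_distr)
  next
    case (smult_left d a1 b1)
    then show ?case using ab K[OF relationsI(3)[of "a \<otimes>\<^bsub>A\<^esub> a1" "b \<otimes>\<^bsub>B\<^esub> b1" d], of c]
      by (simp add: diff free_single smult_poly_diff smult_poly_single A.smult_mult_right)
  next
    case (smult_right d a1 b1)
    then show ?case using ab K[OF relationsI(4)[of "a \<otimes>\<^bsub>A\<^esub> a1" "b \<otimes>\<^bsub>B\<^esub> b1" d], of c]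
      by (simp add: diff free_single smult_poly_diff smult_poly_single B.smult_mult_right)
  qed
  show "conv (A \<times>\<times> B) x (Poly_Mapping.single (a, b) c) \<in> K"
    using x
  proof (induction rule: relations_induct)
    case (add_left a1 a2 b1)
    then show ?case using ab K[OF relationsI(1)[of "a1 \<otimes>\<^bsub>A\<^esub> a" "a2 \<otimes>\<^bsub>A\<^esub> a" "b1 \<otimes>\<^bsub>B\<^esub> b"], of c]
      by (simp add: diff free_single smult_poly_diff smult_poly_single A.l_distr)
  next
    case (add_right a1 b1 b2)
    then show ?case using ab K[OF relationsI(2)[of "a1 \<otimes>\<^bsub>A\<^esub> a" "b1 \<otimes>\<^bsub>B\<^esub> b" "b2 \<otimes>\<^bsub>B\<^esub> b"], of c]
      by (simp add: diff free_single smult_poly_diff smult_poly_single B.l_distr)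
  next
    case (smult_left d a1 b1)
    then show ?case using ab K[OF relationsI(3)[of "a1 \<otimes>\<^bsub>A\<^esub> a" "b1 \<otimes>\<^bsub>B\<^esub> b" d], of c]
      by (simp add: diff free_single smult_poly_diff smult_poly_single A.smult_mult_left mult.commute)
  next
    case (smult_right d a1 b1)
    then show ?case using ab K[OF relationsI(4)[of "a1 \<otimes>\<^bsub>A\<^esub> a" "b1 \<otimes>\<^bsub>B\<^esub> b" d], of c]
      by (simp add: diff free_single smult_poly_diff smult_poly_single B.smult_mult_left mult.commute)
  qed
qed

lemma kernel_mult:
  assumes "x \<in> K" and z: "z \<in> carrier (free_tensor A B)"
  shows "conv (A \<times>\<times> B) z x \<in> K" "conv (A \<times>\<times> B) x z \<in> K"
proof -
  have R: "x \<in> R \<Longrightarrow> conv (A \<times>\<times> B) z x \<in> K \<and> conv (A \<times>\<times> B) x z \<in> K" for x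
    using z unfolding free_simps mem_Collect_eq
  proof (induction z rule: poly_mapping_carrier_induct)
    case (add q c z)
    then have "fst q \<in> carrier A" "snd q \<in> carrier B" by auto
    then show ?case using relations_mult[of x "fst q" "snd q" c] add
      by (simp add: free_conv kernel_intros(3))
  qed (simp add: free_conv kernel_intros)
  have "x \<in> lin_span (free_tensor A B) R \<Longrightarrow> conv (A \<times>\<times> B) z x \<in> K \<and> conv (A \<times>\<times> B) x z \<in> K"
  proof (induction rule: lin_span.induct)
    case (span_base x)
    then show ?case by (rule R)
  qed (simp_all add: free_simps free_conv conv_smult[OF monoid_AB] kernel_intros(2-4))
  then show "conv (A \<times>\<times> B) z x \<in> K" "conv (A \<times>\<times> B) x z \<in> K"
    using assms(1) by (auto simp: tensor_kernel_def)
qed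

lemma ideal_kernel: "ideal K (free_tensor A B)"
proof (rule idealI[OF free.ring_axioms])
  show "subgroup K (add_monoid (free_tensor A B))"
  proof (rule free.add.subgroupI)
    show "\<ominus>\<^bsub>free_tensor A B\<^esub> x \<in> K" if "x \<in> K" for x
      using kernel_intros(4)[OF that, of "- 1"] free.minus_one_smult[OF kernel_closed[OF that]] by (simp add: free_simps)
    show "K \<subseteq> carrier (free_tensor A B)" by (blast intro: kernel_closed)
    show "K \<noteq> {}" using kernel_intros(2) by blast
    show "x \<oplus>\<^bsub>free_tensor A B\<^esub> y \<in> K" if "x \<in> K" "y \<in> K" for x y
      using kernel_intros(3)[OF that] by (simp add: free_simps)
  qed
qed (simp_all add: free_simps(2) kernel_mult)

sublocale quot: algebra_quotient "free_tensor A B" "tensor_kernel A B"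
  by (intro algebra_quotient.intro k_algebra_free ideal_kernel)

abbreviation T :: "('k, ('k, 'a, 'b) tensor) module" where "T \<equiv> tensor_algebra A B"
abbreviation pure :: "'a \<Rightarrow> 'b \<Rightarrow> ('k, 'a, 'b) tensor" where "pure \<equiv> pure_tensor A B"

lemma T_eq: "T = quot.Q"
  by (simp add: tensor_algebra_def)

sublocale T: k_algebra "tensor_algebra A B"
  unfolding T_eq by (rule quot.k_algebra_Q)

lemma pure_closed [simp, intro]: "a \<in> carrier A \<Longrightarrow> b \<in> carrier B \<Longrightarrow> pure a b \<in> carrier T"
  by (simp add: pure_tensor_def T_eq quot.proj_closed single_closed)

lemma pure_smult_eq: "a \<in> carrier A \<Longrightarrow> b \<in> carrier B \<Longrightarrow> c \<odot>\<^bsub>T\<^esub> pure a b = quot.proj (Poly_Mapping.single (a, b) c)"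
  by (simp add: pure_tensor_def T_eq quot.proj_smult single_closed) (simp add: free_simps smult_poly_single)

lemma proj_eq_of_relation:
  assumes "x - y \<in> R" "x \<in> carrier (free_tensor A B)" "y \<in> carrier (free_tensor A B)"
  shows "quot.proj x = quot.proj y"
  using assms quot.proj_eq_iff[of x y] kernel_intros(1)[of "x - y"]
  by (simp add: free.minus_eq_smult) (simp add: free_simps minus_poly_eq)

lemma pure_add_left:
  assumes "a \<in> carrier A" "a' \<in> carrier A" "b \<in> carrier B"
  shows "pure (a \<oplus>\<^bsub>A\<^esub> a') b = pure a b \<oplus>\<^bsub>T\<^esub> pure a' b"
proof -
  have c: "g a b \<in> carrier (free_tensor A B)" "g a' b \<in> carrier (free_tensor A B)"
    "g (a \<oplus>\<^bsub>A\<^esub> a') b \<in> carrier (free_tensor A B)"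
    using assms by (auto intro: single_closed)
  have "pure a b \<oplus>\<^bsub>T\<^esub> pure a' b = quot.proj (g a b + g a' b)"
    using quot.proj_add[OF c(1,2)] by (simp add: pure_tensor_def T_eq free_simps(5))
  moreover have "quot.proj (g (a \<oplus>\<^bsub>A\<^esub> a') b) = quot.proj (g a b + g a' b)"
    using relationsI(1)[OF assms] free.a_closed[OF c(1,2)] c(3)
    by (intro proj_eq_of_relation) (simp_all add: diff_diff_eq free_simps(5))
  ultimately show ?thesis by (simp add: pure_tensor_def)
qed

lemma pure_add_right:
  assumes "a \<in> carrier A" "b \<in> carrier B" "b' \<in> carrier B"
  shows "pure a (b \<oplus>\<^bsub>B\<^esub> b') = pure a b \<oplus>\<^bsub>T\<^esub> pure a b'"
proof -
  have c: "g a b \<in> carrier (free_tensor A B)" "g a b' \<in> carrier (free_tensor A B)"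
    "g a (b \<oplus>\<^bsub>B\<^esub> b') \<in> carrier (free_tensor A B)"
    using assms by (auto intro: single_closed)
  have "pure a b \<oplus>\<^bsub>T\<^esub> pure a b' = quot.proj (g a b + g a b')"
    using quot.proj_add[OF c(1,2)] by (simp add: pure_tensor_def T_eq free_simps(5))
  moreover have "quot.proj (g a (b \<oplus>\<^bsub>B\<^esub> b')) = quot.proj (g a b + g a b')"
    using relationsI(2)[OF assms] free.a_closed[OF c(1,2)] c(3)
    by (intro proj_eq_of_relation) (simp_all add: diff_diff_eq free_simps(5))
  ultimately show ?thesis by (simp add: pure_tensor_def)
qed

lemma pure_smult:
  assumes "a \<in> carrier A" "b \<in> carrier B"
  shows "pure (c \<odot>\<^bsub>A\<^esub> a) b = c \<odot>\<^bsub>T\<^esub> pure a b" "pure a (c \<odot>\<^bsub>B\<^esub> b) = c \<odot>\<^bsub>T\<^esub> pure a b"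
  using assms unfolding pure_smult_eq[OF assms] unfolding pure_tensor_def
  by (intro proj_eq_of_relation relationsI single_closed; simp)+

lemma bilinear_pure: "bilinear A B T pure"
  by (rule bilinearI) (auto simp: pure_add_left pure_add_right pure_smult)

lemma pure_mult:
  assumes "a \<in> carrier A" "b \<in> carrier B" "a' \<in> carrier A" "b' \<in> carrier B"
  shows "pure a b \<otimes>\<^bsub>T\<^esub> pure a' b' = pure (a \<otimes>\<^bsub>A\<^esub> a') (b \<otimes>\<^bsub>B\<^esub> b')"
  using quot.proj_mult[OF single_closed[OF assms(1,2), of 1] single_closed[OF assms(3,4), of 1]]
  by (simp add: pure_tensor_def T_eq free_simps(2) free_single)

lemma T_one: "\<one>\<^bsub>T\<^esub> = pure \<one>\<^bsub>A\<^esub> \<one>\<^bsub>B\<^esub>"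
  by (simp add: T_eq quot.proj_one pure_tensor_def free_simps(3))

lemma pure_zero: "a \<in> carrier A \<Longrightarrow> pure a \<zero>\<^bsub>B\<^esub> = \<zero>\<^bsub>T\<^esub>" "b \<in> carrier B \<Longrightarrow> pure \<zero>\<^bsub>A\<^esub> b = \<zero>\<^bsub>T\<^esub>"
  using pure_smult(2)[of a "\<zero>\<^bsub>B\<^esub>" 0] pure_smult(1)[of "\<zero>\<^bsub>A\<^esub>" b 0] by simp_all

text \<open>Scalars are absorbed into the first factor, so sums of pure tensors exhaust the tensor
  product.\<close>

lemma tensor_induct [consumes 1, case_names pure add]:
  assumes "\<xi> \<in> carrier T" and pure: "\<And>a b. a \<in> carrier A \<Longrightarrow> b \<in> carrier B \<Longrightarrow> P (pure a b)"
    and add: "\<And>x y. x \<in> carrier T \<Longrightarrow> y \<in> carrier T \<Longrightarrow> P x \<Longrightarrow> P y \<Longrightarrow> P (x \<oplus>\<^bsub>T\<^esub> y)"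
  shows "P \<xi>"
proof -
  obtain x where x: "x \<in> carrier (free_tensor A B)" "\<xi> = quot.proj x"
    using assms(1) by (auto simp: T_eq quot.carrier_Q)
  have "P (quot.proj x)"
    using x(1) unfolding free_simps(1) mem_Collect_eq
  proof (induction x rule: poly_mapping_carrier_induct)
    case zero
    have "P (pure \<zero>\<^bsub>A\<^esub> \<zero>\<^bsub>B\<^esub>)" by (rule pure) auto
    then show ?case using pure_zero(1)[of "\<zero>\<^bsub>A\<^esub>"] by (simp add: T_eq quot.proj_zero free_simps(4))
  next
    case (add q c x)
    obtain a b where q: "q = (a, b)" "a \<in> carrier A" "b \<in> carrier B" using add(1) by (cases q) auto
    have x: "x \<in> carrier (free_tensor A B)" using add(2) by (simp add: free_simps)
    have "quot.proj (Poly_Mapping.single q c + x) = pure (c \<odot>\<^bsub>A\<^esub> a) b \<oplus>\<^bsub>T\<^esub> quot.proj x"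
      using quot.proj_add[OF single_closed[OF q(2,3)] x] q
      by (simp add: pure_smult pure_smult_eq T_eq[symmetric] free_simps(5))
    then show ?case using q x add(3) quot.proj_closed[OF x] by (simp add: T_eq[symmetric] assms(2,3))
  qed
  then show ?thesis by (simp add: x)
qed

lemma tensor_ext:
  assumes "f \<in> linear_maps T C" "h \<in> linear_maps T C"
    and "\<And>a b. a \<in> carrier A \<Longrightarrow> b \<in> carrier B \<Longrightarrow> f (pure a b) = h (pure a b)"
    and "\<xi> \<in> carrier T"
  shows "f \<xi> = h \<xi>"
  using assms(4) by (induction rule: tensor_induct) (simp_all add: assms(3) linear_mapsD[OF assms(1)] linear_mapsD[OF assms(2)])

end

locale tensor_bilinear = tensor_product A B + C: k_algebra C
  for A :: "('k::field, 'a) module" and B :: "('k, 'b) module" and C :: "('k, 'c) module" +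
  fixes \<beta> :: "'a \<Rightarrow> 'b \<Rightarrow> 'c"
  assumes bilinear: "bilinear A B C \<beta>"
begin

lemma \<beta>_closed: "q \<in> carrier A \<times> carrier B \<Longrightarrow> \<beta> (fst q) (snd q) \<in> carrier C"
  using bilinearD(1)[OF bilinear, of "fst q" "snd q"] by auto

lemma linear_extension_eq:
  assumes "finite L" "Poly_Mapping.keys x \<subseteq> L" "L \<subseteq> carrier A \<times> carrier B"
  shows "linear_extension C \<beta> x = (\<Oplus>\<^bsub>C\<^esub>q\<in>L. Poly_Mapping.lookup x q \<odot>\<^bsub>C\<^esub> \<beta> (fst q) (snd q))"
  unfolding linear_extension_def
  using assms \<beta>_closed by (intro C.add.finprod_mono_neutral_cong_left) (auto simp: in_keys_iff)

lemma linear_extension_add: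
  assumes "x \<in> carrier (free_tensor A B)" "y \<in> carrier (free_tensor A B)"
  shows "linear_extension C \<beta> (x + y) = linear_extension C \<beta> x \<oplus>\<^bsub>C\<^esub> linear_extension C \<beta> y"
proof -
  let ?L = "Poly_Mapping.keys x \<union> Poly_Mapping.keys y"
  have L: "?L \<subseteq> carrier A \<times> carrier B" using assms by (simp add: free_simps)
  then have b: "\<beta> (fst q) (snd q) \<in> carrier C" if "q \<in> ?L" for q using that \<beta>_closed by blast
  have "linear_extension C \<beta> (x + y) = (\<Oplus>\<^bsub>C\<^esub>q\<in>?L. Poly_Mapping.lookup x q \<odot>\<^bsub>C\<^esub> \<beta> (fst q) (snd q)
      \<oplus>\<^bsub>C\<^esub> Poly_Mapping.lookup y q \<odot>\<^bsub>C\<^esub> \<beta> (fst q) (snd q))"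
    unfolding linear_extension_eq[of ?L "x + y", OF _ keys_add L, simplified]
    using b by (intro C.finsum_cong') (auto simp: lookup_add C.add_smult)
  also have "\<dots> = linear_extension C \<beta> x \<oplus>\<^bsub>C\<^esub> linear_extension C \<beta> y"
    using b L by (subst C.finsum_addf) (auto simp: linear_extension_eq[of ?L])
  finally show ?thesis .
qed

lemma linear_extension_smult:
  assumes "x \<in> carrier (free_tensor A B)"
  shows "linear_extension C \<beta> (Poly_Mapping.map ((*) c) x) = c \<odot>\<^bsub>C\<^esub> linear_extension C \<beta> x"
proof -
  let ?L = "Poly_Mapping.keys x"
  have L: "?L \<subseteq> carrier A \<times> carrier B" using assms by (simp add: free_simps)
  then have b: "\<beta> (fst q) (snd q) \<in> carrier C" if "q \<in> ?L" for q using that \<beta>_closed by blast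
  have "linear_extension C \<beta> (Poly_Mapping.map ((*) c) x)
      = (\<Oplus>\<^bsub>C\<^esub>q\<in>?L. c \<odot>\<^bsub>C\<^esub> (Poly_Mapping.lookup x q \<odot>\<^bsub>C\<^esub> \<beta> (fst q) (snd q)))"
    unfolding linear_extension_eq[of ?L "Poly_Mapping.map ((*) c) x", OF _ keys_smult L, simplified]
    using b by (intro C.finsum_cong') (auto simp: lookup_smult C.smult_smult)
  also have "\<dots> = c \<odot>\<^bsub>C\<^esub> linear_extension C \<beta> x"
    unfolding linear_extension_def using b
    by (intro C.scal.finsum_smult_ldistr[symmetric]) auto
  finally show ?thesis .
qed

lemma linear_extension_single:
  "a \<in> carrier A \<Longrightarrow> b \<in> carrier B \<Longrightarrow> linear_extension C \<beta> (Poly_Mapping.single (a, b) c) = c \<odot>\<^bsub>C\<^esub> \<beta> a b"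
  by (subst linear_extension_eq[of "{(a, b)}"]) (auto simp: bilinearD[OF bilinear] C.finsum_insert)

lemma linear_extension_linear: "linear_extension C \<beta> \<in> linear_maps (free_tensor A B) C"
proof (rule linear_mapsI)
  show "linear_extension C \<beta> x \<in> carrier C" if "x \<in> carrier (free_tensor A B)" for x
    using that \<beta>_closed unfolding linear_extension_def by (intro C.finsum_closed) (auto simp: free_simps)
qed (simp_all add: linear_extension_add linear_extension_smult free_simps(5,6))

lemma linear_extension_kernel: "x \<in> K \<Longrightarrow> linear_extension C \<beta> x = \<zero>\<^bsub>C\<^esub>"
proof -
  note lin = linear_mapsD[OF linear_extension_linear]
  have diff: "linear_extension C \<beta> (x - y) = linear_extension C \<beta> x \<ominus>\<^bsub>C\<^esub> linear_extension C \<beta> y"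
    if "x \<in> carrier (free_tensor A B)" "y \<in> carrier (free_tensor A B)" for x y
    using lin(2)[OF free_diff_closed[OF that] that(2)] lin(1)[OF free_diff_closed[OF that]] lin(1)[OF that(1)] lin(1)[OF that(2)]
    by (simp add: free_simps(5) C.minus_eq C.a_assoc C.r_neg)
  have cancel: "x \<oplus>\<^bsub>C\<^esub> y \<ominus>\<^bsub>C\<^esub> x \<ominus>\<^bsub>C\<^esub> y = \<zero>\<^bsub>C\<^esub>" "x \<ominus>\<^bsub>C\<^esub> x = \<zero>\<^bsub>C\<^esub>"
    if "x \<in> carrier C" "y \<in> carrier C" for x y
    using that C.a_comm[of x y] by (simp_all add: C.minus_eq C.a_assoc C.r_neg)
  have R: "x \<in> R \<Longrightarrow> linear_extension C \<beta> x = \<zero>\<^bsub>C\<^esub>" for x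
    by (induction rule: relations_induct)
       (simp_all add: diff free_diff_closed single_closed linear_extension_single bilinearD[OF bilinear] cancel)
  have "x \<in> K \<Longrightarrow> x \<in> carrier (free_tensor A B) \<and> linear_extension C \<beta> x = \<zero>\<^bsub>C\<^esub>"
    unfolding tensor_kernel_def
  proof (induction rule: lin_span.induct)
    case span_zero
    have "linear_extension C \<beta> 0 = \<zero>\<^bsub>C\<^esub>" by (simp add: linear_extension_def)
    then show ?case by (simp add: free_simps)
  next
    case (span_base x)
    then show ?case using R relations_closed by simp
  next
    case (span_add x y)
    then show ?case using lin(2)[of x y] quot.a_closed[of x y] by simp
  next
    case (span_smult x c)
    then show ?case using lin(3)[of x c] quot.smult_cl[of x c] by simp
  qed
  then show "x \<in> K \<Longrightarrow> linear_extension C \<beta> x = \<zero>\<^bsub>C\<^esub>" by blast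
qed

lemma tensor_lift_proj:
  assumes x: "x \<in> carrier (free_tensor A B)"
  shows "tensor_lift C \<beta> (quot.proj x) = linear_extension C \<beta> x"
proof -
  \<comment> \<open>\<open>tensor_lift\<close> evaluates at a chosen representative; any two differ
    by an element of the kernel, on which the linear extension vanishes.\<close>
  define y where "y = (SOME y. y \<in> quot.proj x)"
  have "y \<in> quot.proj x" unfolding y_def using quot.proj_self[OF x] by (rule someI)
  then have y: "y \<in> carrier (free_tensor A B)" "quot.proj y = quot.proj x"
    using quot.mem_proj[OF x] by auto
  note lin = linear_mapsD[OF linear_extension_linear]
  have k: "y - x \<in> K"
    using quot.proj_eq_iff[OF y(1) x] y x by (simp add: quot.minus_eq_smult) (simp add: free_simps minus_poly_eq)
  have "linear_extension C \<beta> y = linear_extension C \<beta> (y - x) \<oplus>\<^bsub>C\<^esub> linear_extension C \<beta> x"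
    using lin(2)[OF free_diff_closed[OF y(1) x] x] by (simp add: free_simps(5))
  then have "linear_extension C \<beta> y = linear_extension C \<beta> x"
    using linear_extension_kernel[OF k] lin(1)[OF x] by simp
  then show ?thesis by (simp add: tensor_lift_def linear_extension_def Let_def y_def)
qed

lemma tensor_lift_linear: "tensor_lift C \<beta> \<in> linear_maps T C"
proof (rule linear_mapsI)
  note lin = linear_mapsD[OF linear_extension_linear]
  show "tensor_lift C \<beta> \<xi> \<in> carrier C" if "\<xi> \<in> carrier T" for \<xi>
    using that lin(1) by (auto simp: T_eq quot.carrier_Q tensor_lift_proj)
  show "tensor_lift C \<beta> (\<xi> \<oplus>\<^bsub>T\<^esub> \<eta>) = tensor_lift C \<beta> \<xi> \<oplus>\<^bsub>C\<^esub> tensor_lift C \<beta> \<eta>"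
    if "\<xi> \<in> carrier T" "\<eta> \<in> carrier T" for \<xi> \<eta>
    using that lin(2) by (auto simp: T_eq quot.carrier_Q tensor_lift_proj quot.proj_add)
  show "tensor_lift C \<beta> (c \<odot>\<^bsub>T\<^esub> \<xi>) = c \<odot>\<^bsub>C\<^esub> tensor_lift C \<beta> \<xi>" if "\<xi> \<in> carrier T" for c \<xi>
    using that lin(3) by (auto simp: T_eq quot.carrier_Q tensor_lift_proj quot.proj_smult)
qed

lemma tensor_lift_pure: "a \<in> carrier A \<Longrightarrow> b \<in> carrier B \<Longrightarrow> tensor_lift C \<beta> (pure a b) = \<beta> a b"
  unfolding pure_tensor_def
  by (simp add: tensor_lift_proj single_closed linear_extension_single bilinearD[OF bilinear])

lemma tensor_lift_hom:
  assumes "\<And>a a' b b'. a \<in> carrier A \<Longrightarrow> a' \<in> carrier A \<Longrightarrow> b \<in> carrier B \<Longrightarrow> b' \<in> carrier B \<Longrightarrow>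
      \<beta> (a \<otimes>\<^bsub>A\<^esub> a') (b \<otimes>\<^bsub>B\<^esub> b') = \<beta> a b \<otimes>\<^bsub>C\<^esub> \<beta> a' b'"
    and "\<beta> \<one>\<^bsub>A\<^esub> \<one>\<^bsub>B\<^esub> = \<one>\<^bsub>C\<^esub>"
  shows "tensor_lift C \<beta> \<in> algebra_homs T C"
proof (rule algebra_homsI[OF tensor_lift_linear])
  note lin = linear_mapsD[OF tensor_lift_linear]
  show "tensor_lift C \<beta> \<one>\<^bsub>T\<^esub> = \<one>\<^bsub>C\<^esub>" by (simp add: T_one tensor_lift_pure assms(2))
  show "tensor_lift C \<beta> (\<xi> \<otimes>\<^bsub>T\<^esub> \<eta>) = tensor_lift C \<beta> \<xi> \<otimes>\<^bsub>C\<^esub> tensor_lift C \<beta> \<eta>"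
    if "\<xi> \<in> carrier T" "\<eta> \<in> carrier T" for \<xi> \<eta>
    using that
  proof (induction \<xi> rule: tensor_induct)
    case p: (pure a b)
    show ?case using p(3)
    proof (induction \<eta> rule: tensor_induct)
      case (pure a' b')
      then show ?case using p by (simp add: pure_mult tensor_lift_pure assms(1))
    next
      case (add x y)
      then show ?case using p by (simp add: T.r_distr lin C.r_distr)
    qed
  next
    case (add x y)
    then show ?case by (simp add: T.l_distr lin C.l_distr)
  qed
qed

end

lemma tensor_lift:
  assumes "k_algebra A" "k_algebra B" "k_algebra C" "bilinear A B C \<beta>"
  shows "tensor_lift C \<beta> \<in> linear_maps (tensor_algebra A B) C"
    and "a \<in> carrier A \<Longrightarrow> b \<in> carrier B \<Longrightarrow> tensor_lift C \<beta> (pure_tensor A B a b) = \<beta> a b"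
proof -
  interpret tensor_bilinear A B C \<beta>
    by (intro tensor_bilinear.intro tensor_product.intro tensor_bilinear_axioms.intro assms)
  show "tensor_lift C \<beta> \<in> linear_maps (tensor_algebra A B) C" by (rule tensor_lift_linear)
  show "a \<in> carrier A \<Longrightarrow> b \<in> carrier B \<Longrightarrow> tensor_lift C \<beta> (pure_tensor A B a b) = \<beta> a b"
    by (rule tensor_lift_pure)
qed

lemma tensor_lift_algebra_hom:
  assumes "k_algebra A" "k_algebra B" "k_algebra C" "bilinear A B C \<beta>"
    and "\<And>a a' b b'. a \<in> carrier A \<Longrightarrow> a' \<in> carrier A \<Longrightarrow> b \<in> carrier B \<Longrightarrow> b' \<in> carrier B \<Longrightarrow>
      \<beta> (a \<otimes>\<^bsub>A\<^esub> a') (b \<otimes>\<^bsub>B\<^esub> b') = \<beta> a b \<otimes>\<^bsub>C\<^esub> \<beta> a' b'"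
    and "\<beta> \<one>\<^bsub>A\<^esub> \<one>\<^bsub>B\<^esub> = \<one>\<^bsub>C\<^esub>"
  shows "tensor_lift C \<beta> \<in> algebra_homs (tensor_algebra A B) C"
proof -
  interpret tensor_bilinear A B C \<beta>
    by (intro tensor_bilinear.intro tensor_product.intro tensor_bilinear_axioms.intro assms(1-4))
  show ?thesis by (rule tensor_lift_hom[OF assms(5,6)])
qed

lemma k_algebra_tensor: "k_algebra A \<Longrightarrow> k_algebra B \<Longrightarrow> k_algebra (tensor_algebra A B)"
proof -
  assume "k_algebra A" "k_algebra B"
  then interpret tensor_product A B by (rule tensor_product.intro)
  show ?thesis by (rule T.k_algebra_axioms)
qed

lemma tensor_map:
  assumes k: "k_algebra A" "k_algebra B" "k_algebra C" "k_algebra D"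
    and f: "f \<in> linear_maps A C" and g: "g \<in> linear_maps B D"
  shows "tensor_map C D f g \<in> linear_maps (tensor_algebra A B) (tensor_algebra C D)"
    and "a \<in> carrier A \<Longrightarrow> b \<in> carrier B \<Longrightarrow>
      tensor_map C D f g (pure_tensor A B a b) = pure_tensor C D (f a) (g b)"
proof -
  interpret CD: tensor_product C D by (intro tensor_product.intro k)
  have "bilinear A B (tensor_algebra C D) (\<lambda>a b. pure_tensor C D (f a) (g b))"
    by (rule bilinearI)
       (simp_all add: linear_mapsD[OF f] linear_mapsD[OF g] CD.pure_add_left CD.pure_add_right CD.pure_smult)
  from tensor_lift[OF k(1,2) k_algebra_tensor[OF k(3,4)] this]
  show "tensor_map C D f g \<in> linear_maps (tensor_algebra A B) (tensor_algebra C D)"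
    "a \<in> carrier A \<Longrightarrow> b \<in> carrier B \<Longrightarrow>
      tensor_map C D f g (pure_tensor A B a b) = pure_tensor C D (f a) (g b)"
    by (simp_all add: tensor_map_def)
qed

lemma tensor_map_hom:
  assumes k: "k_algebra A" "k_algebra B" "k_algebra C" "k_algebra D"
    and f: "f \<in> algebra_homs A C" and g: "g \<in> algebra_homs B D"
  shows "tensor_map C D f g \<in> algebra_homs (tensor_algebra A B) (tensor_algebra C D)"
proof -
  interpret CD: tensor_product C D by (intro tensor_product.intro k)
  note lf = algebra_homsD[OF f] and lg = algebra_homsD[OF g]
  note f' = linear_mapsD[OF lf(1)] and g' = linear_mapsD[OF lg(1)]
  have b: "bilinear A B (tensor_algebra C D) (\<lambda>a b. pure_tensor C D (f a) (g b))"
    by (rule bilinearI) (simp_all add: f' g' CD.pure_add_left CD.pure_add_right CD.pure_smult)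
  show ?thesis unfolding tensor_map_def
    by (rule tensor_lift_algebra_hom[OF k(1,2) k_algebra_tensor[OF k(3,4)] b])
       (simp_all add: f' g' lf(2,3) lg(2,3) CD.pure_mult CD.T_one)
qed

lemma tensor_assoc:
  assumes k: "k_algebra A"
  shows "tensor_assoc A \<in> algebra_homs (tensor_algebra (tensor_algebra A A) A) (tensor_algebra A (tensor_algebra A A))"
    and "a \<in> carrier A \<Longrightarrow> b \<in> carrier A \<Longrightarrow> c \<in> carrier A \<Longrightarrow>
      tensor_assoc A (pure_tensor (tensor_algebra A A) A (pure_tensor A A a b) c)
        = pure_tensor A (tensor_algebra A A) a (pure_tensor A A b c)"
proof -
  interpret AA: tensor_product A A by (intro tensor_product.intro k)
  interpret AAA: tensor_product A "tensor_algebra A A" by (intro tensor_product.intro k AA.T.k_algebra_axioms)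
  let ?AAA = "tensor_algebra A (tensor_algebra A A)"
  define \<beta> where "\<beta> = (\<lambda>\<xi> c. tensor_lift ?AAA (\<lambda>a b. AAA.pure a (AA.pure b c)) \<xi>)"
  have bil: "bilinear A A ?AAA (\<lambda>a b. AAA.pure a (AA.pure b c))" if "c \<in> carrier A" for c
    using that by (intro bilinearI)
      (simp_all add: AA.pure_add_left AAA.pure_add_left AAA.pure_add_right AAA.pure_smult AA.pure_smult)
  have lin: "(\<lambda>\<xi>. \<beta> \<xi> c) \<in> linear_maps (tensor_algebra A A) ?AAA" if "c \<in> carrier A" for c
    using tensor_lift(1)[OF k k AAA.T.k_algebra_axioms bil[OF that]] unfolding \<beta>_def .
  note l = linear_mapsD[OF lin]
  have val: "\<beta> (AA.pure a b) c = AAA.pure a (AA.pure b c)"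
    if "a \<in> carrier A" "b \<in> carrier A" "c \<in> carrier A" for a b c
    unfolding \<beta>_def by (rule tensor_lift(2)[OF k k AAA.T.k_algebra_axioms bil[OF that(3)] that(1,2)])
  \<comment> \<open>The inner lift is linear in \<xi> for fixed c by construction; linearity in c is
    checked on pure tensors and extended by induction on \<xi>.\<close>
  have "\<beta> \<xi> (c \<oplus>\<^bsub>A\<^esub> c') = \<beta> \<xi> c \<oplus>\<^bsub>?AAA\<^esub> \<beta> \<xi> c'"
    if "\<xi> \<in> carrier (tensor_algebra A A)" "c \<in> carrier A" "c' \<in> carrier A" for \<xi> c c'
    using that
  proof (induction \<xi> rule: AA.tensor_induct)
    case (pure a b)
    then show ?case by (simp add: val AA.pure_add_right AAA.pure_add_right)
  next
    case (add x y)
    then show ?case using l(1) by (simp add: l(2) AAA.T.a_ac)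
  qed
  moreover have "\<beta> \<xi> (d \<odot>\<^bsub>A\<^esub> c) = d \<odot>\<^bsub>?AAA\<^esub> \<beta> \<xi> c"
    if "\<xi> \<in> carrier (tensor_algebra A A)" "c \<in> carrier A" for \<xi> c d
    using that
  proof (induction \<xi> rule: AA.tensor_induct)
    case (pure a b)
    then show ?case by (simp add: val AA.pure_smult AAA.pure_smult)
  next
    case (add x y)
    then show ?case using l(1) by (simp add: l(2) AAA.T.smult_add)
  qed
  ultimately have bil\<beta>: "bilinear (tensor_algebra A A) A ?AAA \<beta>"
    by (intro bilinearI) (simp_all add: l)
  have mult: "\<beta> (\<xi> \<otimes>\<^bsub>tensor_algebra A A\<^esub> \<eta>) (c \<otimes>\<^bsub>A\<^esub> d) = \<beta> \<xi> c \<otimes>\<^bsub>?AAA\<^esub> \<beta> \<eta> d"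
    if "\<xi> \<in> carrier (tensor_algebra A A)" "\<eta> \<in> carrier (tensor_algebra A A)" "c \<in> carrier A" "d \<in> carrier A" for \<xi> \<eta> c d
    using that
  proof (induction \<xi> rule: AA.tensor_induct)
    case p: (pure a b)
    show ?case using p(3)
    proof (induction \<eta> rule: AA.tensor_induct)
      case (pure a' b')
      then show ?case using p by (simp add: val AA.pure_mult AAA.pure_mult)
    next
      case (add x y)
      then show ?case using p l(1) by (simp add: AA.T.r_distr l(2) AAA.T.r_distr)
    qed
  next
    case (add x y)
    then show ?case using l(1) by (simp add: AA.T.l_distr l(2) AAA.T.l_distr)
  qed
  have e: "tensor_assoc A = tensor_lift ?AAA \<beta>"
    by (simp add: tensor_assoc_def \<beta>_def Let_def)
  show "tensor_assoc A \<in> algebra_homs (tensor_algebra (tensor_algebra A A) A) ?AAA"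
    unfolding e
    by (rule tensor_lift_algebra_hom[OF AA.T.k_algebra_axioms k AAA.T.k_algebra_axioms bil\<beta>])
       (simp_all add: mult AA.T_one val AAA.T_one)
  show "tensor_assoc A (pure_tensor (tensor_algebra A A) A (AA.pure a b) c) = AAA.pure a (AA.pure b c)"
    if "a \<in> carrier A" "b \<in> carrier A" "c \<in> carrier A"
    unfolding e using that
    by (subst tensor_lift(2)[OF AA.T.k_algebra_axioms k AAA.T.k_algebra_axioms bil\<beta>]) (simp_all add: val)
qed

lemma tensor_ext:
  assumes "k_algebra A" "k_algebra B" "f \<in> linear_maps (tensor_algebra A B) C" "h \<in> linear_maps (tensor_algebra A B) C"
    and "\<And>a b. a \<in> carrier A \<Longrightarrow> b \<in> carrier B \<Longrightarrow> f (pure_tensor A B a b) = h (pure_tensor A B a b)"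
    and "\<xi> \<in> carrier (tensor_algebra A B)"
  shows "f \<xi> = h \<xi>"
  using tensor_product.tensor_ext[OF tensor_product.intro[OF assms(1,2)] assms(3-6)] .

lemma linear_pure:
  assumes "k_algebra A" "k_algebra B"
  shows "b \<in> carrier B \<Longrightarrow> (\<lambda>a. pure_tensor A B a b) \<in> linear_maps A (tensor_algebra A B)"
    "a \<in> carrier A \<Longrightarrow> (\<lambda>b. pure_tensor A B a b) \<in> linear_maps B (tensor_algebra A B)"
  using tensor_product.bilinear_pure[OF tensor_product.intro[OF assms]] by (auto simp: bilinear_def)

lemma tensor_ext3:
  assumes k: "k_algebra A" "k_algebra B" "k_algebra D"
    and f: "f \<in> linear_maps (tensor_algebra (tensor_algebra A B) D) C"
    and h: "h \<in> linear_maps (tensor_algebra (tensor_algebra A B) D) C"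
    and eq: "\<And>a b d. a \<in> carrier A \<Longrightarrow> b \<in> carrier B \<Longrightarrow> d \<in> carrier D \<Longrightarrow>
      f (pure_tensor (tensor_algebra A B) D (pure_tensor A B a b) d) = h (pure_tensor (tensor_algebra A B) D (pure_tensor A B a b) d)"
    and \<xi>: "\<xi> \<in> carrier (tensor_algebra (tensor_algebra A B) D)"
  shows "f \<xi> = h \<xi>"
proof (rule tensor_ext[OF k_algebra_tensor[OF k(1,2)] k(3) f h _ \<xi>])
  fix \<eta> d assume \<eta>: "\<eta> \<in> carrier (tensor_algebra A B)" and d: "d \<in> carrier D"
  note p = linear_pure(1)[OF k_algebra_tensor[OF k(1,2)] k(3) d]
  show "f (pure_tensor (tensor_algebra A B) D \<eta> d) = h (pure_tensor (tensor_algebra A B) D \<eta> d)"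
    using eq d by (intro tensor_ext[OF k(1,2) linear_maps_comp[OF p f] linear_maps_comp[OF p h] _ \<eta>]) auto
qed

section \<open>Hopf structure on a quotient by a Hopf ideal\<close>

section \<open>The quotient of a Hopf algebra by a Hopf ideal\<close>

text \<open>The value at a chosen representative, which is independent of the choice as soon as h is
  linear and vanishes on the ideal.\<close>

definition descend :: "('a \<Rightarrow> 'b) \<Rightarrow> 'a set \<Rightarrow> 'b" where
  "descend h U = h (SOME x. x \<in> U)"

context algebra_quotient
begin

lemma descend_proj:
  assumes B: "k_algebra B" and h: "h \<in> linear_maps A B" and I: "\<And>x. x \<in> I \<Longrightarrow> h x = \<zero>\<^bsub>B\<^esub>"
    and x: "x \<in> carrier A"
  shows "descend h (proj x) = h x"
proof -
  interpret B: k_algebra B by (rule B)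
  define y where "y = (SOME y. y \<in> proj x)"
  have "y \<in> proj x" unfolding y_def using proj_self[OF x] by (rule someI)
  then have y: "y \<in> carrier A" "proj y = proj x" using mem_proj[OF x] by auto
  then have i: "y \<ominus> x \<in> I" using proj_eq_iff[of y x] x by simp
  have "y = (y \<ominus> x) \<oplus> x" using x y by (simp add: minus_eq a_assoc l_neg)
  then have "h y = h (y \<ominus> x) \<oplus>\<^bsub>B\<^esub> h x"
    using linear_mapsD(2)[OF h, of "y \<ominus> x" x] x y by simp
  then show ?thesis
    using I[OF i] linear_mapsD(1)[OF h x] by (simp add: descend_def y_def)
qed

lemma descend_linear:
  assumes "k_algebra B" "h \<in> linear_maps A B" "\<And>x. x \<in> I \<Longrightarrow> h x = \<zero>\<^bsub>B\<^esub>"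
  shows "descend h \<in> linear_maps Q B"
proof (rule linear_mapsI)
  note d = descend_proj[OF assms] and h = linear_mapsD[OF assms(2)]
  show "descend h U \<in> carrier B" if "U \<in> carrier Q" for U
    using that by (auto simp: carrier_Q d h)
  show "descend h (U \<oplus>\<^bsub>Q\<^esub> Y) = descend h U \<oplus>\<^bsub>B\<^esub> descend h Y" if "U \<in> carrier Q" "Y \<in> carrier Q" for U Y
    using that by (auto simp: carrier_Q d h proj_add)
  show "descend h (c \<odot>\<^bsub>Q\<^esub> U) = c \<odot>\<^bsub>B\<^esub> descend h U" if "U \<in> carrier Q" for c U
    using that by (auto simp: carrier_Q d h proj_smult)
qed

lemma descend_hom:
  assumes "k_algebra B" "h \<in> algebra_homs A B" "\<And>x. x \<in> I \<Longrightarrow> h x = \<zero>\<^bsub>B\<^esub>"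
  shows "descend h \<in> algebra_homs Q B"
proof (rule algebra_homsI)
  note h = algebra_homsD[OF assms(2)]
  note d = descend_proj[OF assms(1) h(1) assms(3)]
  show "descend h \<in> linear_maps Q B" by (rule descend_linear[OF assms(1) h(1) assms(3)])
  show "descend h (U \<otimes>\<^bsub>Q\<^esub> Y) = descend h U \<otimes>\<^bsub>B\<^esub> descend h Y" if "U \<in> carrier Q" "Y \<in> carrier Q" for U Y
    using that by (auto simp: carrier_Q d h(2) proj_mult)
  show "descend h \<one>\<^bsub>Q\<^esub> = \<one>\<^bsub>B\<^esub>" using d[of \<one>] h(3) by (simp add: proj_one)
qed

end

context hopf_ideal
begin

sublocale quot: algebra_quotient A I
  by (intro algebra_quotient.intro k_algebra_axioms ideal_axioms)

definition quotient_comult where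
  "quotient_comult = descend (\<lambda>x. tensor_map quot.Q quot.Q quot.proj quot.proj (\<Delta> x))"

definition quotient_counit where
  "quotient_counit = descend \<epsilon>"

definition quotient_antipode where
  "quotient_antipode = descend (\<lambda>x. quot.proj (S x))"

text \<open>Every structure map followed by the projection kills I and therefore descends. Each
  axiom for the quotient is the image of the one for A under a naturality identity verified on pure
  tensors.\<close>

lemma quotient_hopf:
  "hopf_algebra quot.Q quotient_comult quotient_counit quotient_antipode \<and>
   hopf_hom A \<Delta> \<epsilon> S quot.Q quotient_comult quotient_counit quotient_antipode quot.proj"
proof -
  let ?Q = "quot.Q" and ?\<pi> = "quot.proj"
  let ?AA = "tensor_algebra A A" and ?QQ = "tensor_algebra quot.Q quot.Q"
  let ?m = "tensor_map ?Q ?Q ?\<pi> ?\<pi>"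
  note kA = k_algebra_axioms and kQ = quot.k_algebra_Q
  note kAA = k_algebra_tensor[OF kA kA] and kQQ = k_algebra_tensor[OF kQ kQ]
  interpret AA: tensor_product A A by (intro tensor_product.intro kA)
  interpret QQ: tensor_product ?Q ?Q by (intro tensor_product.intro kQ)
  note \<pi>h = quot.proj_hom
  note \<pi>l = algebra_homsD(1)[OF \<pi>h]
  note \<pi> = linear_mapsD[OF \<pi>l]
  note mh = tensor_map_hom[OF kA kA kQ kQ \<pi>h \<pi>h]
  note ml = algebra_homsD(1)[OF mh]
  note mp = tensor_map(2)[OF kA kA kQ kQ \<pi>l \<pi>l]
  note \<Delta>l = algebra_homsD(1)[OF comult_hom] and \<epsilon>l = algebra_homsD(1)[OF counit_hom]
  note \<Delta>c = linear_mapsD(1)[OF \<Delta>l]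
  note Sl = antipode_linear
  note m\<Delta> = algebra_homs_comp[OF comult_hom mh]
  \<comment> \<open>The square of the projection annihilates the span of I (x) A and A (x)
    I.\<close>
  have kill: "?m (\<Delta> x) = \<zero>\<^bsub>?QQ\<^esub>" if "x \<in> I" for x
  proof -
    have "\<xi> \<in> carrier ?AA \<and> ?m \<xi> = \<zero>\<^bsub>?QQ\<^esub>" if "\<xi> \<in> lin_span ?AA
        ({pure_tensor A A a b | a b. a \<in> I \<and> b \<in> carrier A} \<union>
         {pure_tensor A A a b | a b. a \<in> carrier A \<and> b \<in> I})" for \<xi>
      using that
    proof (induction rule: lin_span.induct)
      case span_zero
      then show ?case using linear_maps_zero[OF kAA kQQ ml] by simp
    next
      case (span_base \<xi>)
      then consider a b where "\<xi> = AA.pure a b" "a \<in> I" "b \<in> carrier A"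
        | a b where "\<xi> = AA.pure a b" "a \<in> carrier A" "b \<in> I" by blast
      then show ?case
      proof cases
        case 1
        then show ?thesis using mp[of a b] QQ.pure_zero(2)[of "?\<pi> b"] \<pi>(1)
          by (simp add: quot.proj_eq_zero a_Hcarr)
      next
        case 2
        then show ?thesis using mp[of a b] QQ.pure_zero(1)[of "?\<pi> a"] \<pi>(1)
          by (simp add: quot.proj_eq_zero a_Hcarr)
      qed
    next
      case (span_add x y)
      then show ?case using linear_mapsD(2)[OF ml, of x y] by simp
    next
      case (span_smult x c)
      then show ?case using linear_mapsD(3)[OF ml, of x c] by simp
    qed
    then show ?thesis using comult_ideal[OF that] by blast
  qed
  have killS: "?\<pi> (S x) = \<zero>\<^bsub>?Q\<^esub>" if "x \<in> I" for x
    by (rule quot.proj_eq_zero[OF antipode_ideal[OF that]])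
  have kill\<epsilon>: "\<epsilon> x = \<zero>\<^bsub>scalars\<^esub>" if "x \<in> I" for x
    using counit_ideal[OF that] by (simp add: scalars_def)
  have \<Delta>'h: "quotient_comult \<in> algebra_homs ?Q ?QQ"
    unfolding quotient_comult_def by (rule quot.descend_hom[OF kQQ m\<Delta> kill])
  have \<Delta>': "quotient_comult (?\<pi> x) = ?m (\<Delta> x)" if "x \<in> carrier A" for x
    unfolding quotient_comult_def by (rule quot.descend_proj[OF kQQ algebra_homsD(1)[OF m\<Delta>] kill that])
  have \<epsilon>'h: "quotient_counit \<in> algebra_homs ?Q scalars"
    unfolding quotient_counit_def by (rule quot.descend_hom[OF k_algebra_scalars counit_hom kill\<epsilon>])
  have \<epsilon>': "quotient_counit (?\<pi> x) = \<epsilon> x" if "x \<in> carrier A" for x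
    unfolding quotient_counit_def by (rule quot.descend_proj[OF k_algebra_scalars \<epsilon>l kill\<epsilon> that])
  note \<pi>S = linear_maps_comp[OF Sl \<pi>l]
  have S'l: "quotient_antipode \<in> linear_maps ?Q ?Q"
    unfolding quotient_antipode_def by (rule quot.descend_linear[OF kQ \<pi>S killS])
  have S': "quotient_antipode (?\<pi> x) = ?\<pi> (S x)" if "x \<in> carrier A" for x
    unfolding quotient_antipode_def by (rule quot.descend_proj[OF kQ \<pi>S killS that])
  note \<Delta>'l = algebra_homsD(1)[OF \<Delta>'h]
  \<comment> \<open>Common form of the two counit and the two antipode axioms: contracting the
    projected tensor is projecting the contracted one.\<close>
  have lift: "tensor_lift ?Q \<beta>' (?m \<xi>) = ?\<pi> (tensor_lift A \<beta> \<xi>)"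
    if "bilinear A A A \<beta>" "bilinear ?Q ?Q ?Q \<beta>'" "\<xi> \<in> carrier ?AA"
      "\<And>a b. a \<in> carrier A \<Longrightarrow> b \<in> carrier A \<Longrightarrow> \<beta>' (?\<pi> a) (?\<pi> b) = ?\<pi> (\<beta> a b)" for \<beta> \<beta>' \<xi>
  proof (rule tensor_ext[OF kA kA _ _ _ that(3)])
    note b = tensor_lift(2)[OF kA kA kA that(1)] tensor_lift(2)[OF kQ kQ kQ that(2)] that(4)
    show "(\<lambda>\<xi>. tensor_lift ?Q \<beta>' (?m \<xi>)) \<in> linear_maps ?AA ?Q"
      by (rule linear_maps_comp[OF ml tensor_lift(1)[OF kQ kQ kQ that(2)]])
    show "(\<lambda>\<xi>. ?\<pi> (tensor_lift A \<beta> \<xi>)) \<in> linear_maps ?AA ?Q"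
      by (rule linear_maps_comp[OF tensor_lift(1)[OF kA kA kA that(1)] \<pi>l])
    show "tensor_lift ?Q \<beta>' (?m (AA.pure a b)) = ?\<pi> (tensor_lift A \<beta> (AA.pure a b))"
      if "a \<in> carrier A" "b \<in> carrier A" for a b
      using that by (simp add: mp b \<pi>(1))
  qed
  interpret Q: k_algebra ?Q by (rule kQ)
  have bil_counit: "bilinear B B B (\<lambda>a b. e a \<odot>\<^bsub>B\<^esub> b)" "bilinear B B B (\<lambda>a b. e b \<odot>\<^bsub>B\<^esub> a)"
    "bilinear B B B (\<lambda>a b. s a \<otimes>\<^bsub>B\<^esub> b)" "bilinear B B B (\<lambda>a b. a \<otimes>\<^bsub>B\<^esub> s b)"
    if "k_algebra B" "e \<in> linear_maps B scalars" "s \<in> linear_maps B B" for B :: "('b, 'z) module" and e s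
  proof -
    interpret B: k_algebra B by (rule that)
    note e = linear_mapsD[OF that(2), unfolded scalars_def, simplified] and s = linear_mapsD[OF that(3)]
    show "bilinear B B B (\<lambda>a b. e a \<odot>\<^bsub>B\<^esub> b)" "bilinear B B B (\<lambda>a b. e b \<odot>\<^bsub>B\<^esub> a)"
      by (rule bilinearI; simp add: e B.smult_add B.add_smult B.smult_smult mult.commute)+
    show "bilinear B B B (\<lambda>a b. s a \<otimes>\<^bsub>B\<^esub> b)" "bilinear B B B (\<lambda>a b. a \<otimes>\<^bsub>B\<^esub> s b)"
      by (rule bilinearI; simp add: s B.l_distr B.r_distr B.smult_mult_left B.smult_mult_right)+
  qed
  note bA = bil_counit[OF kA \<epsilon>l Sl] and bQ = bil_counit[OF kQ algebra_homsD(1)[OF \<epsilon>'h] S'l]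
  have hopf: "hopf_algebra ?Q quotient_comult quotient_counit quotient_antipode"
  proof (intro hopf_algebra.intro kQ hopf_algebra_axioms.intro \<Delta>'h \<epsilon>'h S'l)
    fix U assume "U \<in> carrier ?Q"
    then obtain x where U: "U = ?\<pi> x" and x: "x \<in> carrier A" by (auto simp: quot.carrier_Q)
    show "tensor_lift ?Q (\<lambda>a b. quotient_counit a \<odot>\<^bsub>?Q\<^esub> b) (quotient_comult U) = U"
      using lift[OF bA(1) bQ(1) \<Delta>c[OF x]] by (simp add: U \<Delta>' x \<epsilon>' quot.proj_smult counit_left)
    show "tensor_lift ?Q (\<lambda>a b. quotient_counit b \<odot>\<^bsub>?Q\<^esub> a) (quotient_comult U) = U"
      using lift[OF bA(2) bQ(2) \<Delta>c[OF x]] by (simp add: U \<Delta>' x \<epsilon>' quot.proj_smult counit_right)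
    show "tensor_lift ?Q (\<lambda>a b. quotient_antipode a \<otimes>\<^bsub>?Q\<^esub> b) (quotient_comult U) = quotient_counit U \<odot>\<^bsub>?Q\<^esub> \<one>\<^bsub>?Q\<^esub>"
      using lift[OF bA(3) bQ(3) \<Delta>c[OF x]] linear_mapsD(1)[OF Sl]
      by (simp add: U \<Delta>' x \<epsilon>' S' quot.proj_mult quot.proj_smult antipode_left quot.proj_one)
    show "tensor_lift ?Q (\<lambda>a b. a \<otimes>\<^bsub>?Q\<^esub> quotient_antipode b) (quotient_comult U) = quotient_counit U \<odot>\<^bsub>?Q\<^esub> \<one>\<^bsub>?Q\<^esub>"
      using lift[OF bA(4) bQ(4) \<Delta>c[OF x]] linear_mapsD(1)[OF Sl]
      by (simp add: U \<Delta>' x \<epsilon>' S' quot.proj_mult quot.proj_smult antipode_right quot.proj_one)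
    note idA = algebra_homsD(1)[OF algebra_homs_id, of A] and idQ = algebra_homsD(1)[OF algebra_homs_id, of ?Q]
    note L1 = tensor_map[OF kA kA kAA kA \<Delta>l idA] and L2 = tensor_map[OF kQ kQ kQQ kQ \<Delta>'l idQ]
    note R1 = tensor_map[OF kA kA kA kAA idA \<Delta>l] and R2 = tensor_map[OF kQ kQ kQ kQQ idQ \<Delta>'l]
    note M1 = tensor_map[OF kAA kA kQQ kQ ml \<pi>l] and M2 = tensor_map[OF kA kAA kQ kQQ \<pi>l ml]
    note a1 = tensor_assoc[OF kA] and a2 = tensor_assoc[OF kQ]
    note a1l = algebra_homsD(1)[OF a1(1)] and a2l = algebra_homsD(1)[OF a2(1)]
    \<comment> \<open>Compatibility of the projection with the comultiplication on either leg and
      with the associator; together they carry coassociativity over.\<close>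
    have left: "tensor_map ?QQ ?Q quotient_comult (\<lambda>a. a) (?m \<xi>)
      = tensor_map ?QQ ?Q ?m ?\<pi> (tensor_map ?AA A \<Delta> (\<lambda>a. a) \<xi>)" if "\<xi> \<in> carrier ?AA" for \<xi>
      by (rule tensor_ext[OF kA kA linear_maps_comp[OF ml L2(1)] linear_maps_comp[OF L1(1) M1(1)] _ that])
         (simp add: mp L2(2) L1(2) M1(2) \<pi>(1) \<Delta>c \<Delta>')
    have right: "tensor_map ?Q ?QQ (\<lambda>a. a) quotient_comult (?m \<xi>)
      = tensor_map ?Q ?QQ ?\<pi> ?m (tensor_map A ?AA (\<lambda>a. a) \<Delta> \<xi>)" if "\<xi> \<in> carrier ?AA" for \<xi>
      by (rule tensor_ext[OF kA kA linear_maps_comp[OF ml R2(1)] linear_maps_comp[OF R1(1) M2(1)] _ that])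
         (simp add: mp R2(2) R1(2) M2(2) \<pi>(1) \<Delta>c \<Delta>')
    have assoc: "tensor_assoc ?Q (tensor_map ?QQ ?Q ?m ?\<pi> \<zeta>) = tensor_map ?Q ?QQ ?\<pi> ?m (tensor_assoc A \<zeta>)"
      if "\<zeta> \<in> carrier (tensor_algebra ?AA A)" for \<zeta>
      by (rule tensor_ext3[OF kA kA kA linear_maps_comp[OF M1(1) a2l] linear_maps_comp[OF a1l M2(1)] _ that])
         (simp add: M1(2) M2(2) mp a1(2) a2(2) \<pi>(1))
    show "tensor_assoc ?Q (tensor_map ?QQ ?Q quotient_comult (\<lambda>a. a) (quotient_comult U))
      = tensor_map ?Q ?QQ (\<lambda>a. a) quotient_comult (quotient_comult U)"
      using coassoc[OF x] linear_mapsD(1)[OF L1(1) \<Delta>c[OF x]]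
      by (simp add: U \<Delta>' x left right \<Delta>c assoc)
  qed
  have "hopf_hom A \<Delta> \<epsilon> S ?Q quotient_comult quotient_counit quotient_antipode ?\<pi>"
    by (intro hopf_hom.intro hopf_algebra_axioms hopf hopf_hom_axioms.intro \<pi>h \<Delta>' \<epsilon>' S')
  with hopf show ?thesis by blast
qed

end

section \<open>Homomorphisms and anti-homomorphisms out of the Yangian from the values on
  generators\<close>

section \<open>Universal property of the Yangian\<close>

lemma poly_mapping_single_induct [case_names zero add]:
  fixes x :: "'a \<Rightarrow>\<^sub>0 'k::comm_monoid_add"
  assumes "P 0" "\<And>a c x. P x \<Longrightarrow> P (Poly_Mapping.single a c + x)"
  shows "P x"
  using subset_UNIV assms by (rule poly_mapping_carrier_induct)

lemma abs_yangian_eq_0_iff: "abs_yangian2 x = 0 \<longleftrightarrow> x \<in> yangian_ideal"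
  unfolding zero_yangian2.abs_eq yangian2.abs_eq_iff by (simp add: yangian_rel_def)

lemma abs_yangian_add: "abs_yangian2 (x + y) = abs_yangian2 x + abs_yangian2 y"
  by (simp add: plus_yangian2.abs_eq)

lemma abs_yangian_mult: "abs_yangian2 (x * y) = abs_yangian2 x * abs_yangian2 y"
  by (simp add: times_yangian2.abs_eq)

lemma abs_yangian_diff: "abs_yangian2 (x - y) = abs_yangian2 x - abs_yangian2 y"
  by (simp add: minus_yangian2.abs_eq)

lemma abs_yangian_sum: "abs_yangian2 (\<Sum>i\<in>K. f i) = (\<Sum>i\<in>K. abs_yangian2 (f i))"
  by (induction K rule: infinite_finite_induct) (simp_all add: abs_yangian_add zero_yangian2.abs_eq[symmetric])

lemma abs_free_t: "abs_yangian2 (free_t i j r) = yangian_t i j r"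
  by (simp add: yangian_t.abs_eq)

lemma abs_single_0: "abs_yangian2 (Poly_Mapping.single 0 c) = yangian_scalar c"
  by (simp add: yangian_scalar.abs_eq)

lemma yangian_t_0: "yangian_t i j 0 = (if i = j then 1 else 0 :: 'k::field yangian2)"
  unfolding abs_free_t[symmetric] by (simp add: free_t_def one_yangian2.abs_eq zero_yangian2.abs_eq)

lemma relators_subset_ideal: "yangian_relators \<subseteq> (yangian_ideal :: 'k::field yangian_free set)"
  unfolding yangian_ideal_def
  by (rule ring.genideal_self[OF ring_ring_of_type_algebra]) simp

lemma yangian_commutator_sum:
  assumes "r > 0" "s > 0"
  shows "yangian_t i j r * yangian_t k l s - yangian_t k l s * yangian_t i j r =
    (\<Sum>q<min r s. yangian_t k j q * yangian_t i l (r + s - 1 - q) - yangian_t k j (r + s - 1 - q) * yangian_t i l q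
      :: 'k::field yangian2)"
proof -
  have "free_t i j r * free_t k l s - free_t k l s * free_t i j r -
        (\<Sum>t<min r s. free_t k j t * free_t i l (r + s - 1 - t) -
                      free_t k j (r + s - 1 - t) * free_t i l t) \<in> (yangian_ideal :: 'k yangian_free set)"
    using relators_subset_ideal assms unfolding yangian_relators_def by blast
  then show ?thesis
    unfolding abs_yangian_eq_0_iff[symmetric]
    by (simp add: abs_yangian_diff abs_yangian_mult abs_yangian_sum abs_free_t)
qed

lemma rtt_yangian: "rtt 1 (yangian_t :: 2 \<Rightarrow> 2 \<Rightarrow> nat \<Rightarrow> 'k::field yangian2)"
  by (rule rtt_one_of_commutator_sum) (simp_all add: yangian_t_0 yangian_commutator_sum)

lemma yangian_scalar_add: "yangian_scalar (c + d) = yangian_scalar c + yangian_scalar d"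
  unfolding abs_single_0[symmetric] by (simp add: single_add abs_yangian_add)

lemma yangian_scalar_mult: "yangian_scalar (c * d) = yangian_scalar c * yangian_scalar d"
  unfolding abs_single_0[symmetric] abs_yangian_mult[symmetric] by (simp add: mult_single)

lemma yangian_scalar_one [simp]: "yangian_scalar 1 = 1"
  unfolding abs_single_0[symmetric] one_yangian2.abs_eq by simp

lemma yangian_scalar_zero [simp]: "yangian_scalar 0 = 0"
  unfolding abs_single_0[symmetric] zero_yangian2.abs_eq by simp

lemma yangian_scalar_commute: "yangian_scalar c * x = x * yangian_scalar c"
proof -
  have "Poly_Mapping.single 0 c * f = f * Poly_Mapping.single 0 c" for f :: "'a yangian_free"
  proof (induction f rule: poly_mapping_single_induct)
    case (add w d f)
    then show ?case by (simp add: distrib_left distrib_right mult_single mult.commute)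
  qed simp_all
  then have "abs_yangian2 (Poly_Mapping.single 0 c) * abs_yangian2 f = abs_yangian2 f * abs_yangian2 (Poly_Mapping.single 0 c)" for f
    unfolding abs_yangian_mult[symmetric] by simp
  then show ?thesis unfolding abs_single_0 by (induction x rule: yangian2.abs_induct) simp
qed

lemma yangian_induct [case_names scalar gen add mult]:
  fixes x :: "'k::field yangian2"
  assumes scalar: "\<And>c. P (yangian_scalar c)" and gen: "\<And>i j r. P (yangian_t i j r)"
    and add: "\<And>x y. P x \<Longrightarrow> P y \<Longrightarrow> P (x + y)" and mult: "\<And>x y. P x \<Longrightarrow> P y \<Longrightarrow> P (x * y)"
  shows "P x"
proof -
  have word: "P (abs_yangian2 (Poly_Mapping.single (Word ws) c))" for ws and c :: 'k
  proof (induction ws)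
    case Nil
    then show ?case using scalar[of c] by (simp add: abs_single_0[symmetric] zero_free_monoid_def)
  next
    case (Cons g ws)
    obtain i j r where g: "g = (i, j, r)" by (cases g)
    have "Poly_Mapping.single (Word (g # ws)) c = free_t i j (Suc r) * Poly_Mapping.single (Word ws) c"
      by (simp add: free_t_def mult_single g)
    then show ?case using mult[OF gen Cons] by (simp add: abs_yangian_mult abs_free_t)
  qed
  have "P (abs_yangian2 f)" for f :: "'k yangian_free"
  proof (induction f rule: poly_mapping_single_induct)
    case (add w d f)
    then show ?case using word[of "case w of Word ws \<Rightarrow> ws" d] assms(3)
      by (cases w) (simp add: abs_yangian_add)
  qed (use scalar[of 0] in \<open>simp add: zero_yangian2.abs_eq[symmetric]\<close>)
  then show ?thesis by (induction x rule: yangian2.abs_induct) simp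
qed

text \<open>Taking for \<open>mul\<close> the opposite multiplication yields anti-homomorphisms.\<close>

lemma yangian_universal:
  fixes sc :: "'k::field \<Rightarrow> 'b::ring_1" and \<tau> :: "2 \<Rightarrow> 2 \<Rightarrow> nat \<Rightarrow> 'b" and mul :: "'b \<Rightarrow> 'b \<Rightarrow> 'b"
  assumes mul_add: "\<And>x y z. mul (x + y) z = mul x z + mul y z" "\<And>x y z. mul z (x + y) = mul z x + mul z y"
    and mul_assoc: "\<And>x y z. mul (mul x y) z = mul x (mul y z)" and mul_one: "\<And>x. mul 1 x = x" "\<And>x. mul x 1 = x"
    and mul_sc: "\<And>c x y. mul (sc c * x) y = sc c * mul x y" "\<And>c x y. mul x (sc c * y) = sc c * mul x y"
    and sc: "\<And>c d. sc (c + d) = sc c + sc d" "\<And>c d. sc (c * d) = sc c * sc d" "sc 1 = 1"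
    and \<tau>0: "\<And>i j. \<tau> i j 0 = (if i = j then 1 else 0)"
    and rel: "\<And>i j k l r s. r > 0 \<Longrightarrow> s > 0 \<Longrightarrow> mul (\<tau> i j r) (\<tau> k l s) - mul (\<tau> k l s) (\<tau> i j r) =
      (\<Sum>q<min r s. mul (\<tau> k j q) (\<tau> i l (r + s - 1 - q)) - mul (\<tau> k j (r + s - 1 - q)) (\<tau> i l q))"
  obtains h :: "'k yangian2 \<Rightarrow> 'b" where "\<And>x y. h (x + y) = h x + h y" "\<And>x y. h (x * y) = mul (h x) (h y)"
    "\<And>c. h (yangian_scalar c) = sc c" "\<And>i j r. h (yangian_t i j r) = \<tau> i j r"
proof -
  \<comment> \<open>Words are evaluated as iterated products for \<open>mul\<close>; the linear
    extension respects products, and its kernel is an ideal containing the relators.\<close>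
  define \<phi>' where "\<phi>' ws = foldr (\<lambda>(i, j, r). mul (\<tau> i j (Suc r))) ws 1" for ws
  define \<phi> where "\<phi> w = (case w of Word ws \<Rightarrow> \<phi>' ws)" for w
  have \<phi>'_append: "\<phi>' (v @ w) = mul (\<phi>' v) (\<phi>' w)" for v w
    by (induction v) (auto simp: \<phi>'_def mul_one mul_assoc)
  have \<phi>_add: "\<phi> (v + w) = mul (\<phi> v) (\<phi> w)" for v w
    by (cases v; cases w) (simp add: \<phi>_def \<phi>'_append)
  have \<phi>_0: "\<phi> 0 = 1" by (simp add: \<phi>_def \<phi>'_def zero_free_monoid_def)
  have sc0: "sc 0 = 0" using sc(1)[of 0 0] by simp
  have mul0: "mul 0 x = 0" "mul x 0 = 0" for x
    using mul_add(1)[of 0 0 x] mul_add(2)[of x 0 0] by simp_all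
  define H where "H f = (\<Sum>w\<in>Poly_Mapping.keys f. sc (Poly_Mapping.lookup f w) * \<phi> w)" for f :: "'k yangian_free"
  have H_eq: "H f = (\<Sum>w\<in>F. sc (Poly_Mapping.lookup f w) * \<phi> w)" if "finite F" "Poly_Mapping.keys f \<subseteq> F" for f F
    unfolding H_def using that by (intro sum.mono_neutral_left) (auto simp: in_keys_iff sc0)
  have H_add: "H (f + g) = H f + H g" for f g
  proof -
    have "Poly_Mapping.keys (f + g) \<subseteq> Poly_Mapping.keys f \<union> Poly_Mapping.keys g" by (rule keys_add)
    then show ?thesis
      using H_eq[of "Poly_Mapping.keys f \<union> Poly_Mapping.keys g"]
      by (simp add: lookup_add sc distrib_right sum.distrib)
  qed
  have H_single: "H (Poly_Mapping.single w c) = sc c * \<phi> w" for w c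
    using H_eq[of "{w}" "Poly_Mapping.single w c"] by simp
  have H_0: "H 0 = 0" by (simp add: H_def)
  have H_mult: "H (f * g) = mul (H f) (H g)" for f g
  proof (induction f rule: poly_mapping_single_induct)
    case (add w c f)
    have "H (Poly_Mapping.single w c * g) = mul (H (Poly_Mapping.single w c)) (H g)"
    proof (induction g rule: poly_mapping_single_induct)
      case (add v d g)
      have "mul (sc c * \<phi> w) (sc d * \<phi> v) = sc (c * d) * mul (\<phi> w) (\<phi> v)"
        by (simp add: mul_sc sc mult.assoc)
           (metis mul_sc(1) mul_sc(2) mult.commute sc(2) mult.assoc)
      then show ?case
        using add by (simp add: distrib_left H_add mult_single H_single \<phi>_add mul_add)
    qed (simp_all add: H_0 mul0)
    then show ?case using add by (simp add: distrib_right H_add mul_add)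
  qed (simp_all add: H_0 mul0)
  have H_diff: "H (f - g) = H f - H g" for f g
    using H_add[of "f - g" g] by (simp add: eq_diff_eq)
  have H_sum: "H (\<Sum>i\<in>K. f i) = (\<Sum>i\<in>K. H (f i))" for f :: "nat \<Rightarrow> _" and K
    by (induction K rule: infinite_finite_induct) (simp_all add: H_0 H_add)
  have H_one: "H 1 = 1"
    using H_single[of 0 1] by (simp add: sc \<phi>_0)
  have H_t: "H (free_t i j r) = \<tau> i j r" for i j r
    by (cases r) (simp_all add: free_t_def H_single \<phi>_def \<phi>'_def sc mul_one H_one H_0 \<tau>0)
  have "ideal {f. H f = 0} (ring_of_type_algebra :: 'k yangian_free ring)"
  proof (rule idealI)
    interpret R: ring "ring_of_type_algebra :: 'k yangian_free ring"
      by (rule ring_ring_of_type_algebra)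
    show "ring (ring_of_type_algebra :: 'k yangian_free ring)" by (rule R.ring_axioms)
    have inv: "inv\<^bsub>add_monoid ring_of_type_algebra\<^esub> x = - x" for x :: "'k yangian_free"
      using R.minus_equality[of "- x" x] by (simp add: a_inv_def)
    have "H (- f) = - H f" for f using H_diff[of 0 f] by (simp add: H_0)
    then show "subgroup {f. H f = 0} (add_monoid ring_of_type_algebra)"
      by (intro subgroup.intro, unfold inv) (auto simp: H_add H_0)
  qed (auto simp: H_mult mul0)
  moreover have "yangian_relators \<subseteq> {f. H f = 0}"
    by (auto simp: yangian_relators_def H_diff H_mult H_sum H_t rel)
  ultimately have kernel: "f \<in> yangian_ideal \<Longrightarrow> H f = 0" for f
    unfolding yangian_ideal_def genideal_def by blast
  \<comment> \<open>Evaluation at a chosen representative; \<open>kernel\<close> makes it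
    independent of the choice.\<close>
  define h where "h x = H (rep_yangian2 x)" for x
  have h: "h (abs_yangian2 f) = H f" for f
  proof -
    have "abs_yangian2 (rep_yangian2 (abs_yangian2 f)) = abs_yangian2 f"
      by (rule Quotient3_abs_rep[OF Quotient3_yangian2])
    then have "rep_yangian2 (abs_yangian2 f) - f \<in> yangian_ideal"
      by (simp add: yangian2.abs_eq_iff yangian_rel_def)
    from kernel[OF this] show ?thesis by (simp add: h_def H_diff)
  qed
  show thesis
  proof (rule that[of h])
    show "h (x + y) = h x + h y" for x y
      by (induction x rule: yangian2.abs_induct, induction y rule: yangian2.abs_induct)
         (simp add: abs_yangian_add[symmetric] h H_add)
    show "h (x * y) = mul (h x) (h y)" for x y
      by (induction x rule: yangian2.abs_induct, induction y rule: yangian2.abs_induct)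
         (simp add: abs_yangian_mult[symmetric] h H_mult)
    show "h (yangian_scalar c) = sc c" for c
      by (simp add: abs_single_0[symmetric] h H_single \<phi>_0)
    show "h (yangian_t i j r) = \<tau> i j r" for i j r
      by (simp add: abs_free_t[symmetric] h H_t)
  qed
qed

lemma Y2_simps [simp]:
  "carrier Y2 = UNIV" "x \<otimes>\<^bsub>Y2\<^esub> y = x * y" "\<one>\<^bsub>Y2\<^esub> = 1" "\<zero>\<^bsub>Y2\<^esub> = 0" "x \<oplus>\<^bsub>Y2\<^esub> y = x + y"
  "c \<odot>\<^bsub>Y2\<^esub> x = yangian_scalar c * x"
  by (simp_all add: Y2_def)

lemma k_algebra_Y2: "k_algebra Y2"
  unfolding Y2_def
  by (rule k_algebra_with_scalars)
     (rule yangian_scalar_add yangian_scalar_mult yangian_scalar_one yangian_scalar_commute)+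

lemma yangian_hom_ext:
  assumes B: "k_algebra B" and f: "f \<in> algebra_homs Y2 B" and h: "h \<in> algebra_homs Y2 B"
    and eq: "\<And>i j r. f (yangian_t i j r) = h (yangian_t i j r)"
  shows "f = h"
proof
  interpret B: k_algebra B by (rule B)
  note f' = algebra_homsD[OF f] linear_mapsD[OF algebra_homsD(1)[OF f]]
  note h' = algebra_homsD[OF h] linear_mapsD[OF algebra_homsD(1)[OF h]]
  fix x
  show "f x = h x"
  proof (induction x rule: yangian_induct)
    case (scalar c)
    then show ?case using f'(6)[of 1 c] h'(6)[of 1 c] f'(3) h'(3) by simp
  next
    case (add x y)
    then show ?case using f'(5)[of x y] h'(5)[of x y] by simp
  next
    case (mult x y)
    then show ?case using f'(2)[of x y] h'(2)[of x y] by simp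
  qed (rule eq)
qed

lemma yangian_antihom_ext:
  assumes f: "f \<in> algebra_antihoms Y2 Y2" and h: "h \<in> algebra_antihoms Y2 Y2"
    and eq: "\<And>i j r. f (yangian_t i j r) = h (yangian_t i j r)"
  shows "f = h"
proof
  have f': "f 1 = 1" "f (x + y) = f x + f y" "f (yangian_scalar c * x) = yangian_scalar c * f x" "f (x * y) = f y * f x"
    and h': "h 1 = 1" "h (x + y) = h x + h y" "h (yangian_scalar c * x) = yangian_scalar c * h x" "h (x * y) = h y * h x"
    for x y c using f h by (auto simp: algebra_antihoms_def linear_maps_def)
  fix x
  show "f x = h x"
  proof (induction x rule: yangian_induct)
    case (scalar c)
    then show ?case using f'(3)[of c 1] h'(3)[of c 1] f'(1) h'(1) by simp
  qed (simp_all add: f'(2,4) h'(2,4) eq)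
qed

lemma scalars_simps [simp]:
  "carrier scalars = UNIV" "x \<otimes>\<^bsub>scalars\<^esub> y = x * y" "\<one>\<^bsub>scalars\<^esub> = 1" "\<zero>\<^bsub>scalars\<^esub> = 0" "x \<oplus>\<^bsub>scalars\<^esub> y = x + y"
  "c \<odot>\<^bsub>scalars\<^esub> x = c * x"
  by (simp_all add: scalars_def)

text \<open>The definite description is resolved by \<open>yangian_universal\<close> for existence
  and by the values on generators for uniqueness. Antipode and comultiplication follow the same
  pattern.\<close>

lemma Y2_counit:
  "(Y2_counit :: 'k::field yangian2 \<Rightarrow> 'k) \<in> algebra_homs Y2 scalars"
  "Y2_counit (yangian_t i j r) = (if i = j \<and> r = 0 then 1 else 0 :: 'k)"
proof -
  let ?P = "\<lambda>h :: 'k yangian2 \<Rightarrow> 'k. h \<in> algebra_homs Y2 scalars \<and>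
    (\<forall>i j r. h (yangian_t i j r) = (if i = j \<and> r = 0 then 1 else 0))"
  obtain h :: "'k yangian2 \<Rightarrow> 'k" where h: "\<And>x y. h (x + y) = h x + h y" "\<And>x y. h (x * y) = h x * h y"
    "\<And>c. h (yangian_scalar c) = c" "\<And>i j r. h (yangian_t i j r) = (if i = j \<and> r = 0 then 1 else 0)"
    by (rule yangian_universal[of "(*)" "\<lambda>c. c" "\<lambda>i j r. if i = j \<and> r = 0 then 1 else 0"])
       (auto simp: algebra_simps intro!: sum.neutral)
  have "h 1 = 1" using h(3)[of 1] by simp
  then have P: "?P h" using h by (auto intro!: algebra_homsI linear_mapsI)
  have "h' = h''" if "?P h'" "?P h''" for h' h''
    using that by (intro yangian_hom_ext[OF k_algebra_scalars]) auto
  from theI[where P = ?P, OF P this[OF _ P]] have "?P Y2_counit" unfolding Y2_counit_def .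
  then show "(Y2_counit :: 'k yangian2 \<Rightarrow> 'k) \<in> algebra_homs Y2 scalars"
    "Y2_counit (yangian_t i j r) = (if i = j \<and> r = 0 then 1 else 0 :: 'k)"
    by auto
qed

lemma counit_simps:
  "Y2_counit (x + y) = Y2_counit x + Y2_counit y" "Y2_counit (x * y) = Y2_counit x * Y2_counit y"
  "Y2_counit 1 = (1 :: 'k)" "Y2_counit (yangian_scalar c) = c" "Y2_counit (yangian_scalar c * x) = c * Y2_counit x"
  for x y :: "'k::field yangian2"
proof -
  note h = algebra_homsD[OF Y2_counit(1)]
  note l = linear_mapsD[OF h(1)]
  show "Y2_counit (x + y) = Y2_counit x + Y2_counit y" "Y2_counit (x * y) = Y2_counit x * Y2_counit y"
    "Y2_counit 1 = (1 :: 'k)" "Y2_counit (yangian_scalar c * x) = c * Y2_counit x"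
    using l(2)[of x y] h(2)[of x y] h(3) l(3)[of x c] by simp_all
  then show "Y2_counit (yangian_scalar c) = c"
    using l(3)[of 1 c] by simp
qed

section \<open>Gauss factorization, inverse matrix and antipode\<close>

section \<open>The inverse matrix and the Gauss factorization\<close>

abbreviation t_ser :: "2 \<Rightarrow> 2 \<Rightarrow> 'k::field yangian2 fps" where
  "t_ser i j \<equiv> series yangian_t i j"

lemma T_matrix_nth: "T_matrix $ i $ j = t_ser i j"
  by (simp add: T_matrix_def series_def)

text \<open>t_11 has constant coefficient 1 and is therefore invertible, which forces e, f and d_2;
  existence and uniqueness evaluate the definite description of the Drinfeld series.\<close>

lemma gauss:
  obtains d2 :: "'k::field yangian2 fps" and e f where
    "t_ser 1 2 = t_ser 1 1 * e" "t_ser 2 1 = f * t_ser 1 1" "t_ser 2 2 = f * t_ser 1 1 * e + d2"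
    "fps_nth e 0 = 0" "fps_nth f 0 = 0" "fps_nth d2 0 = 1"
    "e_series = e" "f_series = f" "d_series 1 = (t_ser 1 1 :: 'k yangian2 fps)" "d_series 2 = d2"
proof -
  obtain x' where x': "x' * t_ser 1 1 = (1 :: 'k yangian2 fps)" "t_ser 1 1 * x' = 1" "fps_nth x' 0 = 1"
    using fps_unit_inverse[of "t_ser 1 1"] by (auto simp: yangian_t_0)
  define e where "e = x' * t_ser 1 2"
  define f where "f = t_ser 2 1 * x'"
  define d2 where "d2 = t_ser 2 2 - f * t_ser 1 1 * e"
  have e: "t_ser 1 2 = t_ser 1 1 * e" by (simp add: e_def mult.assoc[symmetric] x')
  have f: "t_ser 2 1 = f * t_ser 1 1" by (simp add: f_def mult.assoc x')
  have d: "t_ser 2 2 = f * t_ser 1 1 * e + d2" by (simp add: d2_def)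
  have 0: "fps_nth e 0 = 0" "fps_nth f 0 = 0" "fps_nth d2 0 = 1"
    by (simp_all add: d2_def e_def f_def yangian_t_0)
  let ?P = "\<lambda>(d, e, f).
     T_matrix $ 1 $ 1 = d 1 \<and> T_matrix $ 1 $ 2 = d 1 * e \<and> T_matrix $ 2 $ 1 = f * d 1 \<and>
     T_matrix $ 2 $ 2 = f * d 1 * e + d 2 \<and> fps_nth e 0 = 0 \<and> fps_nth f (0::nat) = (0 :: 'k yangian2)"
  let ?D = "(\<lambda>i::2. if i = 1 then t_ser 1 1 else d2, e, f)"
  have two: "(2 :: 2) \<noteq> 1" by simp
  have "?P ?D" using e f d 0 two by (simp add: T_matrix_nth)
  moreover have "q = ?D" if "?P q" for q
  proof -
    obtain d' e' f' where q: "q = (d', e', f')" by (cases q)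
    have 1: "d' 1 = t_ser 1 1" using that by (simp add: q T_matrix_nth)
    have "t_ser 1 1 * e' = t_ser 1 1 * e" "f' * t_ser 1 1 = f * t_ser 1 1"
      using that e f 1 by (simp_all add: q T_matrix_nth)
    then have "x' * t_ser 1 1 * e' = x' * t_ser 1 1 * e" "f' * (t_ser 1 1 * x') = f * (t_ser 1 1 * x')"
      by (metis mult.assoc)+
    then have 2: "e' = e" "f' = f" by (simp_all add: x')
    have "d' 2 = d2" using that d 1 2 by (simp add: q T_matrix_nth)
    then have "d' = (\<lambda>i::2. if i = 1 then t_ser 1 1 else d2)"
      using 1 exhaust_2 by (intro ext) auto
    then show ?thesis by (simp add: q 2)
  qed
  ultimately have D: "(THE q. ?P q) = ?D"
    by (rule the_equality)
  have "e_series = e" "f_series = f" "d_series 1 = (t_ser 1 1 :: 'k yangian2 fps)" "d_series 2 = d2"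
    unfolding e_series_def f_series_def d_series_def drinfeld_series_def D by simp_all
  then show thesis using that e f d 0 by blast
qed

definition t_inv :: "2 \<Rightarrow> 2 \<Rightarrow> nat \<Rightarrow> 'k::field yangian2" where
  "t_inv i j r = fps_nth (matrix_inv T_matrix $ i $ j) r"

abbreviation t_inv_ser :: "2 \<Rightarrow> 2 \<Rightarrow> 'k::field yangian2 fps" where
  "t_inv_ser i j \<equiv> series t_inv i j"

lemma t_inv_ser: "t_inv_ser i j = matrix_inv T_matrix $ i $ j"
  by (rule fps_ext) (simp add: t_inv_def)

lemma inverse_matrix_gauss:
  fixes d2 :: "'k::field yangian2 fps"
  assumes e: "t_ser 1 2 = t_ser 1 1 * e" and f: "t_ser 2 1 = f * t_ser 1 1" and d: "t_ser 2 2 = f * t_ser 1 1 * e + d2"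
    and y: "y * d2 = 1" "d2 * y = 1"
  shows "t_inv_ser 2 2 = y" "t_inv_ser 2 1 = y * - f"
    and "T_matrix ** matrix_inv T_matrix = (mat 1 :: 'k yangian2 fps ^ 2 ^ 2)"
    and "matrix_inv T_matrix ** T_matrix = (mat 1 :: 'k yangian2 fps ^ 2 ^ 2)"
proof -
  let ?x = "t_ser 1 1 :: 'k yangian2 fps"
  obtain x' where x': "x' * ?x = 1" "?x * x' = 1"
    using fps_unit_inverse[of ?x] by (auto simp: yangian_t_0)
  have xl: "x' * (?x * a) = a" "?x * (x' * a) = a" "y * (d2 * a) = a" "d2 * (y * a) = a" for a
    by (simp_all add: mult.assoc[symmetric] x' y)
  \<comment> \<open>Product of the inverses, in reversed order, of the lower unitriangular, diagonal
    and upper unitriangular Gauss factors; its second row is (- y f, y).\<close>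
  define W :: "'k yangian2 fps ^ 2 ^ 2" where
    "W = (\<chi> i j. if i = 1 then if j = 1 then x' + e * y * f else - (e * y) else if j = 1 then - (y * f) else y)"
  have TW: "T_matrix ** W = mat 1" "W ** T_matrix = mat 1"
    by (simp_all add: vec_eq_iff forall_2 matrix_matrix_mult_def UNIV_2 W_def mat_def T_matrix_nth e f d
        distrib_left distrib_right mult.assoc xl x' y)
  then have "\<exists>A'. T_matrix ** A' = (mat 1 :: 'k yangian2 fps ^ 2 ^ 2) \<and> A' ** T_matrix = mat 1" by blast
  then show inv: "T_matrix ** matrix_inv T_matrix = (mat 1 :: 'k yangian2 fps ^ 2 ^ 2)"
    "matrix_inv T_matrix ** T_matrix = (mat 1 :: 'k yangian2 fps ^ 2 ^ 2)"
    unfolding matrix_inv_def by (metis (mono_tags, lifting) someI_ex)+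
  have "matrix_inv T_matrix = matrix_inv T_matrix ** (T_matrix ** W)" by (simp add: TW)
  also have "\<dots> = W" by (simp add: matrix_mul_assoc inv)
  finally show "t_inv_ser 2 2 = y" "t_inv_ser 2 1 = y * - f" by (simp_all add: t_inv_ser W_def)
qed

lemma t_inv_mult:
  "(\<Sum>k\<in>UNIV. t_ser i k * t_inv_ser k j) = (if i = j then 1 else 0 :: 'k::field yangian2 fps)"
  "(\<Sum>k\<in>UNIV. t_inv_ser i k * t_ser k j) = (if i = j then 1 else 0 :: 'k yangian2 fps)"
proof -
  obtain d2 e f :: "'k yangian2 fps" where g: "t_ser 1 2 = t_ser 1 1 * e" "t_ser 2 1 = f * t_ser 1 1" "t_ser 2 2 = f * t_ser 1 1 * e + d2"
    "fps_nth d2 0 = 1" using gauss by metis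
  obtain y where y: "y * d2 = 1" "d2 * y = 1" using fps_unit_inverse[OF g(4)] by metis
  note inv = inverse_matrix_gauss(3,4)[OF g(1-3) y]
  show "(\<Sum>k\<in>UNIV. t_ser i k * t_inv_ser k j) = (if i = j then 1 else 0 :: 'k yangian2 fps)"
    using arg_cong[OF inv(1), of "\<lambda>M. M $ i $ j"]
    by (simp only: matrix_matrix_mult_def mat_def vec_lambda_beta T_matrix_nth t_inv_ser)
  show "(\<Sum>k\<in>UNIV. t_inv_ser i k * t_ser k j) = (if i = j then 1 else 0 :: 'k yangian2 fps)"
    using arg_cong[OF inv(2), of "\<lambda>M. M $ i $ j"]
    by (simp only: matrix_matrix_mult_def mat_def vec_lambda_beta T_matrix_nth t_inv_ser)
qed

lemma rtt_t_inv: "rtt (- 1) (t_inv :: 2 \<Rightarrow> 2 \<Rightarrow> nat \<Rightarrow> 'k::field yangian2)"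
  by (rule rtt_inverse[OF rtt_yangian t_inv_mult(2)[unfolded series_def] t_inv_mult(1)[unfolded series_def]])

lemma Y2_antipode:
  "(Y2_antipode :: 'k::field yangian2 \<Rightarrow> 'k yangian2) \<in> algebra_antihoms Y2 Y2"
  "Y2_antipode (yangian_t i j r) = (t_inv i j r :: 'k yangian2)"
proof -
  let ?P = "\<lambda>h :: 'k yangian2 \<Rightarrow> 'k yangian2. h \<in> algebra_antihoms Y2 Y2 \<and>
    (\<forall>i j r. h (yangian_t i j r) = fps_nth (matrix_inv T_matrix $ i $ j) r)"
  interpret inv: rtt "- 1" "t_inv :: 2 \<Rightarrow> 2 \<Rightarrow> nat \<Rightarrow> 'k yangian2" by (rule rtt_t_inv)
  \<comment> \<open>For the opposite multiplication the relation with sign -1 becomes the defining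
    one, once \<open>commutator_swap\<close> has exchanged the factors in each summand.\<close>
  have rel: "t_inv k l s * t_inv i j r - t_inv i j r * t_inv k l s =
      (\<Sum>q<min r s. t_inv i l (r + s - 1 - q) * t_inv k j q - t_inv i l q * t_inv k j (r + s - 1 - q) :: 'k yangian2)"
    if "r > 0" "s > 0" for i j k l r s
  proof -
    have "t_inv i l m * t_inv k j q - t_inv i l q * t_inv k j m
      = (t_inv k j q * t_inv i l m - t_inv k j m * t_inv i l q :: 'k yangian2)" for m q
      using inv.commutator_swap[of k j q i l m] by (simp add: algebra_simps)
    moreover have "t_inv i j r * t_inv k l s - t_inv k l s * t_inv i j r =
      - (\<Sum>q<min r s. t_inv k j q * t_inv i l (r + s - 1 - q) - t_inv k j (r + s - 1 - q) * t_inv i l q :: 'k yangian2)"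
      using inv.commutator_sum[OF that, of i j k l] by simp
    ultimately show ?thesis
      by (metis (no_types, lifting) minus_diff_eq minus_minus sum.cong)
  qed
  have c: "x * (yangian_scalar c * y) = yangian_scalar c * (x * y)" for x y :: "'k yangian2" and c
    by (metis mult.assoc yangian_scalar_commute)
  obtain h :: "'k yangian2 \<Rightarrow> 'k yangian2" where h: "\<And>x y. h (x + y) = h x + h y" "\<And>x y. h (x * y) = h y * h x"
    "\<And>c. h (yangian_scalar c) = yangian_scalar c" "\<And>i j r. h (yangian_t i j r) = t_inv i j r"
    by (rule yangian_universal[of "\<lambda>x y :: 'k yangian2. y * x" "yangian_scalar :: 'k \<Rightarrow> 'k yangian2"
          "t_inv :: 2 \<Rightarrow> 2 \<Rightarrow> nat \<Rightarrow> 'k yangian2"])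
       (simp_all only: distrib_left distrib_right mult.assoc c yangian_scalar_add yangian_scalar_mult
          yangian_scalar_one mult_1 mult_1_right inv.t_0 rel, blast)
  have "h 1 = 1" using h(3)[of 1] by simp
  moreover have "h (yangian_scalar c * x) = yangian_scalar c * h x" for c x
    by (simp add: h(2,3) yangian_scalar_commute)
  ultimately have P: "?P h" using h by (auto simp: algebra_antihoms_def t_inv_def intro!: linear_mapsI)
  have "h' = h''" if "?P h'" "?P h''" for h' h''
    using that by (intro yangian_antihom_ext) auto
  from theI[where P = ?P, OF P this[OF _ P]] have "?P Y2_antipode" unfolding Y2_antipode_def .
  then show "(Y2_antipode :: 'k yangian2 \<Rightarrow> 'k yangian2) \<in> algebra_antihoms Y2 Y2"
    "Y2_antipode (yangian_t i j r) = (t_inv i j r :: 'k yangian2)"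
    by (auto simp: t_inv_def)
qed

lemma antipode_simps:
  "Y2_antipode (x + y) = Y2_antipode x + Y2_antipode y" "Y2_antipode (x * y) = Y2_antipode y * Y2_antipode x"
  "Y2_antipode 1 = 1" "Y2_antipode (yangian_scalar c * x) = yangian_scalar c * Y2_antipode x"
  using Y2_antipode(1) by (auto simp: algebra_antihoms_def linear_maps_def)

section \<open>The tensor square as a ring type with two commuting embeddings\<close>

section \<open>The tensor square of the Yangian\<close>

lemma tensor_product_Y2: "tensor_product (Y2 :: ('k::field, 'k yangian2) module) (Y2 :: ('k, 'k yangian2) module)"
  by (intro tensor_product.intro k_algebra_Y2)

lemmas YY_pure_closed [simp] = tensor_product.pure_closed[OF tensor_product_Y2]
lemmas YY_pure_add_left = tensor_product.pure_add_left[OF tensor_product_Y2]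
lemmas YY_pure_add_right = tensor_product.pure_add_right[OF tensor_product_Y2]
lemmas YY_pure_smult = tensor_product.pure_smult[OF tensor_product_Y2]
lemmas YY_pure_mult = tensor_product.pure_mult[OF tensor_product_Y2]
lemmas YY_one = tensor_product.T_one[OF tensor_product_Y2, simplified]
lemmas YY_induct [consumes 1, case_names pure add] = tensor_product.tensor_induct[OF tensor_product_Y2]

interpretation YY: k_algebra "tensor_algebra Y2 Y2 :: ('k::field, ('k, 'k yangian2, 'k yangian2) tensor) module"
  by (intro k_algebra_tensor k_algebra_Y2)

text \<open>The results on series and RTT families are stated for types of class
  \<open>ring_1\<close>; turning the carrier of the tensor square into such a type makes them
  applicable to the coproduct.\<close>

typedef (overloaded) 'k ytensor =
  "carrier (tensor_algebra Y2 Y2 :: ('k::field, ('k, 'k yangian2, 'k yangian2) tensor) module)"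
  morphisms rep_yt abs_yt
  using YY.zero_closed by blast

abbreviation YY :: "('k::field, ('k, 'k yangian2, 'k yangian2) tensor) module" where
  "YY \<equiv> tensor_algebra Y2 Y2"

abbreviation ypure :: "'k::field yangian2 \<Rightarrow> 'k yangian2 \<Rightarrow> ('k, 'k yangian2, 'k yangian2) tensor" where
  "ypure \<equiv> pure_tensor Y2 Y2"

instantiation ytensor :: (field) ring_1
begin

definition zero_ytensor :: "'a ytensor" where "0 = abs_yt \<zero>\<^bsub>YY\<^esub>"
definition one_ytensor :: "'a ytensor" where "1 = abs_yt \<one>\<^bsub>YY\<^esub>"
definition plus_ytensor :: "'a ytensor \<Rightarrow> 'a ytensor \<Rightarrow> 'a ytensor" where
  "x + y = abs_yt (rep_yt x \<oplus>\<^bsub>YY\<^esub> rep_yt y)"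
definition uminus_ytensor :: "'a ytensor \<Rightarrow> 'a ytensor" where
  "- x = abs_yt (\<ominus>\<^bsub>YY\<^esub> rep_yt x)"
definition minus_ytensor :: "'a ytensor \<Rightarrow> 'a ytensor \<Rightarrow> 'a ytensor" where
  "x - y = abs_yt (rep_yt x \<ominus>\<^bsub>YY\<^esub> rep_yt y)"
definition times_ytensor :: "'a ytensor \<Rightarrow> 'a ytensor \<Rightarrow> 'a ytensor" where
  "x * y = abs_yt (rep_yt x \<otimes>\<^bsub>YY\<^esub> rep_yt y)"

lemma rep_closed [simp]: "rep_yt (x :: 'a ytensor) \<in> carrier YY"
  by (rule rep_yt)

lemma rep_yt_simps:
  "rep_yt (0 :: 'a ytensor) = \<zero>\<^bsub>YY\<^esub>" "rep_yt (1 :: 'a ytensor) = \<one>\<^bsub>YY\<^esub>"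
  "rep_yt (x + y) = rep_yt x \<oplus>\<^bsub>YY\<^esub> rep_yt y" "rep_yt (- x) = \<ominus>\<^bsub>YY\<^esub> rep_yt x"
  "rep_yt (x - y) = rep_yt x \<ominus>\<^bsub>YY\<^esub> rep_yt y" "rep_yt (x * y) = rep_yt x \<otimes>\<^bsub>YY\<^esub> rep_yt y"
  for x y :: "'a ytensor"
  by (simp_all add: zero_ytensor_def one_ytensor_def plus_ytensor_def uminus_ytensor_def minus_ytensor_def
      times_ytensor_def abs_yt_inverse)

text \<open>The class \<open>ring_1\<close> demands a nonzero unit; the product of the counits on
  the two legs sends it to 1.\<close>

lemma one_neq_zero_YY: "\<one>\<^bsub>YY\<^esub> \<noteq> (\<zero>\<^bsub>YY\<^esub> :: ('a, 'a yangian2, 'a yangian2) tensor)"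
proof
  let ?\<beta> = "\<lambda>a b :: 'a yangian2. Y2_counit a * Y2_counit b"
  have bil: "bilinear Y2 Y2 scalars ?\<beta>"
    by (rule bilinearI) (simp_all add: counit_simps algebra_simps)
  note lift = tensor_lift[OF k_algebra_Y2 k_algebra_Y2 k_algebra_scalars bil]
  assume "\<one>\<^bsub>YY\<^esub> = (\<zero>\<^bsub>YY\<^esub> :: ('a, 'a yangian2, 'a yangian2) tensor)"
  then have "tensor_lift scalars ?\<beta> (ypure 1 1) = tensor_lift scalars ?\<beta> \<zero>\<^bsub>YY\<^esub>"
    by (simp add: YY_one)
  then show False
    using lift(2)[of 1 1] linear_maps_zero[OF YY.k_algebra_axioms k_algebra_scalars lift(1)]
    by (simp add: counit_simps)
qed

instance
proof
  fix x y z :: "'a ytensor"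
  note e = rep_yt_inject[symmetric] rep_yt_simps
  show "x + y + z = x + (y + z)" unfolding e by (simp add: YY.a_assoc)
  show "x + y = y + x" unfolding e by (simp add: YY.a_comm)
  show "0 + x = x" unfolding e by simp
  show "- x + x = 0" unfolding e by (simp add: YY.l_neg)
  show "x - y = x + - y" unfolding e by (simp add: YY.minus_eq)
  show "x * y * z = x * (y * z)" unfolding e by (simp add: YY.m_assoc)
  show "1 * x = x" "x * 1 = x" unfolding e by simp_all
  show "(x + y) * z = x * z + y * z" unfolding e by (simp add: YY.l_distr)
  show "x * (y + z) = x * y + x * z" unfolding e by (simp add: YY.r_distr)
  show "(0 :: 'a ytensor) \<noteq> 1" unfolding e using one_neq_zero_YY by metis
qed

end

definition leg1 :: "'k::field yangian2 \<Rightarrow> 'k ytensor" where "leg1 x = abs_yt (ypure x 1)"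
definition leg2 :: "'k::field yangian2 \<Rightarrow> 'k ytensor" where "leg2 x = abs_yt (ypure 1 x)"

lemma rep_leg: "rep_yt (leg1 x) = ypure x 1" "rep_yt (leg2 x) = ypure 1 x"
  by (simp_all add: leg1_def leg2_def abs_yt_inverse)

lemma rep_leg_mult: "rep_yt (leg1 x * leg2 y) = ypure x y" "rep_yt (leg2 y * leg1 x) = ypure x y"
  by (simp_all add: rep_yt_simps rep_leg YY_pure_mult)

lemma leg_commute: "leg1 x * leg2 y = leg2 y * leg1 x"
  by (simp add: rep_yt_inject[symmetric] rep_leg_mult)

lemma leg_add: "leg1 (x + y) = leg1 x + leg1 y" "leg2 (x + y) = leg2 x + leg2 y"
  using YY_pure_add_left[of x y 1] YY_pure_add_right[of 1 x y]
  by (simp_all add: rep_yt_inject[symmetric] rep_yt_simps rep_leg)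

lemma leg_mult: "leg1 (x * y) = leg1 x * leg1 y" "leg2 (x * y) = leg2 x * leg2 y"
  using YY_pure_mult[of x 1 y 1] YY_pure_mult[of 1 x 1 y]
  by (simp_all add: rep_yt_inject[symmetric] rep_yt_simps rep_leg)

lemma leg_one [simp]: "leg1 1 = 1" "leg2 1 = 1"
  by (simp_all add: rep_yt_inject[symmetric] rep_yt_simps rep_leg YY_one)

text \<open>Scalars act through the first leg; this is the scalar map fed into
  \<open>yangian_universal\<close>.\<close>

lemma rep_scalar_mult: "rep_yt (leg1 (yangian_scalar c) * z) = c \<odot>\<^bsub>YY\<^esub> rep_yt z"
proof -
  have "ypure (yangian_scalar c) 1 = c \<odot>\<^bsub>YY\<^esub> \<one>\<^bsub>YY\<^esub>"
    using YY_pure_smult(1)[of 1 1 c] by (simp add: YY_one)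
  then show ?thesis by (simp add: rep_yt_simps rep_leg YY.smult_mult_left)
qed

lemma ytensor_scalar_commute: "leg1 (yangian_scalar c) * z = z * leg1 (yangian_scalar c)"
  unfolding rep_yt_inject[symmetric] rep_scalar_mult
  using YY_pure_smult(1)[of 1 1 c] YY.smult_mult_right[of "rep_yt z" "\<one>\<^bsub>YY\<^esub>" c]
  by (simp add: rep_yt_simps rep_leg YY_one[symmetric])

lemma ytensor_induct [case_names legs add]:
  assumes "\<And>x y. P (leg1 x * leg2 y)" "\<And>z w. P z \<Longrightarrow> P w \<Longrightarrow> P (z + w)"
  shows "P (z :: 'k::field ytensor)"
proof -
  have "P (abs_yt \<xi>)" if "\<xi> \<in> carrier YY" for \<xi> :: "('k, 'k yangian2, 'k yangian2) tensor"
    using that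
  proof (induction \<xi> rule: YY_induct)
    case (pure a b)
    then show ?case using assms(1)[of a b] rep_leg_mult(1)[of a b] rep_yt_inverse by metis
  next
    case (add x y)
    then show ?case using assms(2)[of "abs_yt x" "abs_yt y"] by (simp add: plus_ytensor_def abs_yt_inverse)
  qed
  from this[of "rep_yt z"] show ?thesis by (simp add: rep_yt_inverse)
qed

lemma finsum_rep: "finite K \<Longrightarrow> finsum YY (\<lambda>k. rep_yt (f k)) K = rep_yt (\<Sum>k\<in>K. f k)"
  by (induction K rule: finite_induct) (simp_all add: rep_yt_simps YY.finsum_insert)

section \<open>Ring homomorphisms applied to series, and the coproduct\<close>

section \<open>The comultiplication\<close>

lemma ring_hom_of_int:
  fixes h :: "'a::ring_1 \<Rightarrow> 'b::ring_1"
  assumes add: "\<And>x y. h (x + y) = h x + h y" and one: "h 1 = 1"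
  shows "h (of_int n) = of_int n"
proof -
  have 0: "h 0 = 0" using add[of 0 0] by simp
  have neg: "h (- x) = - h x" for x using add[of x "- x"] 0 by (simp add: eq_neg_iff_add_eq_0 add.commute)
  have nat: "h (of_nat m) = of_nat m" for m by (induction m) (simp_all add: 0 add one)
  show ?thesis by (cases n rule: int_cases2) (simp_all add: nat neg)
qed

locale ring_1_hom =
  fixes h :: "'a::ring_1 \<Rightarrow> 'b::ring_1"
  assumes hom_add: "h (x + y) = h x + h y" and hom_mult: "h (x * y) = h x * h y" and hom_one: "h 1 = 1"
begin

lemma hom_zero: "h 0 = 0" using hom_add[of 0 0] by simp

lemma hom_diff: "h (x - y) = h x - h y" using hom_add[of "x - y" y] by (simp add: eq_diff_eq)

lemma hom_of_int: "h (of_int n) = of_int n" by (rule ring_hom_of_int[OF hom_add hom_one])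

lemma hom_sum: "h (\<Sum>i\<in>K. f i) = (\<Sum>i\<in>K. h (f i))"
  by (induction K rule: infinite_finite_induct) (simp_all add: hom_zero hom_add)

definition map_fps :: "'a fps \<Rightarrow> 'b fps" where "map_fps a = Abs_fps (\<lambda>n. h (fps_nth a n))"

lemma map_fps_nth [simp]: "fps_nth (map_fps a) n = h (fps_nth a n)"
  by (simp add: map_fps_def)

lemma map_fps_mult: "map_fps (a * b) = map_fps a * map_fps b"
  by (rule fps_ext) (simp add: fps_mult_nth hom_sum hom_mult)

lemma map_fps_add: "map_fps (a + b) = map_fps a + map_fps b"
  by (rule fps_ext) (simp add: hom_add)

lemma map_fps_one: "map_fps 1 = 1"
  by (rule fps_ext) (simp add: hom_one hom_zero)

lemma map_fps_zero: "map_fps 0 = 0"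
  by (rule fps_ext) (simp add: hom_zero)

lemma map_fps_power: "map_fps (a ^ n) = map_fps a ^ n"
  by (induction n) (simp_all add: map_fps_one map_fps_mult)

lemma map_fps_shift_var: "map_fps (shift_var c) = shift_var c"
proof -
  have "h (of_int c ^ n) = of_int c ^ n" for n using hom_of_int[of "c ^ n"] by simp
  then show ?thesis by (intro fps_ext) (simp add: shift_var_def hom_zero)
qed

text \<open>Ring homomorphisms fix the integer coefficients of the shift variable.\<close>

lemma map_fps_shift: "map_fps (shift c a) = shift c (map_fps a)"
proof (rule fps_ext)
  fix n
  have "h (fps_nth (shift_var c ^ i) n) = fps_nth (shift_var c ^ i) n" for i
    using arg_cong[OF map_fps_power[of "shift_var c" i], of "\<lambda>a. fps_nth a n"] by (simp add: map_fps_shift_var)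
  then show "fps_nth (map_fps (shift c a)) n = fps_nth (shift c (map_fps a)) n"
    by (simp add: shift_def fps_compose_nth hom_sum hom_mult)
qed

lemma map_fps_shift_prod: "map_fps (shift_prod \<kappa> n a) = shift_prod \<kappa> n (map_fps a)"
  by (induction n) (simp_all add: shift_prod_def map_fps_one map_fps_mult map_fps_shift)

lemma map_fps_series: "map_fps (series t i j) = series (\<lambda>i j r. h (t i j r)) i j"
  by (rule fps_ext) simp

lemma rtt_map: "rtt \<kappa> t \<Longrightarrow> rtt \<kappa> (\<lambda>i j r. h (t i j r))"
proof -
  assume "rtt \<kappa> t"
  then interpret rtt \<kappa> t .
  show ?thesis
  proof
    show "h (t i j (Suc r)) * h (t k l s) - h (t k l s) * h (t i j (Suc r))
        - (h (t i j r) * h (t k l (Suc s)) - h (t k l (Suc s)) * h (t i j r))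
      = of_int \<kappa> * (h (t k j r) * h (t i l s) - h (t k j s) * h (t i l r))" for i j r k l s
      using arg_cong[OF rel[of i j r k l s], of h] by (simp only: hom_diff hom_mult hom_of_int)
  qed (simp_all add: sign t_0 hom_one hom_zero)
qed

end

interpretation leg1: ring_1_hom leg1 by unfold_locales (simp_all add: leg_add leg_mult)
interpretation leg2: ring_1_hom leg2 by unfold_locales (simp_all add: leg_add leg_mult)

definition t_coprod :: "2 \<Rightarrow> 2 \<Rightarrow> nat \<Rightarrow> 'k::field ytensor" where
  "t_coprod i j r = (\<Sum>k\<in>UNIV. \<Sum>s\<le>r. leg1 (yangian_t i k s) * leg2 (yangian_t k j (r - s)))"

lemma rtt_t_coprod: "rtt 1 (t_coprod :: 2 \<Rightarrow> 2 \<Rightarrow> nat \<Rightarrow> 'k::field ytensor)"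
  unfolding t_coprod_def[abs_def]
  by (rule rtt_product[OF leg1.rtt_map[OF rtt_yangian] leg2.rtt_map[OF rtt_yangian] leg_commute])

lemma Y2_comult:
  "(Y2_comult :: 'k::field yangian2 \<Rightarrow> _) \<in> algebra_homs Y2 YY"
  "Y2_comult (yangian_t i j r) = rep_yt (t_coprod i j r :: 'k ytensor)"
proof -
  let ?P = "\<lambda>h :: 'k yangian2 \<Rightarrow> ('k, 'k yangian2, 'k yangian2) tensor. h \<in> algebra_homs Y2 YY \<and>
    (\<forall>i j r. h (yangian_t i j r) = (\<Oplus>\<^bsub>YY\<^esub>k\<in>UNIV. \<Oplus>\<^bsub>YY\<^esub>s\<in>{0..r}. ypure (yangian_t i k s) (yangian_t k j (r - s))))"
  interpret c: rtt 1 "t_coprod :: 2 \<Rightarrow> 2 \<Rightarrow> nat \<Rightarrow> 'k ytensor" by (rule rtt_t_coprod)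
  have sum: "(\<Oplus>\<^bsub>YY\<^esub>k\<in>UNIV. \<Oplus>\<^bsub>YY\<^esub>s\<in>{0..r}. ypure (yangian_t i k s) (yangian_t k j (r - s))) = rep_yt (t_coprod i j r :: 'k ytensor)" for i j r
    unfolding rep_leg_mult(1)[symmetric] by (simp add: finsum_rep t_coprod_def atLeast0AtMost)
  have sc: "x * (leg1 (yangian_scalar c) * y) = leg1 (yangian_scalar c) * (x * y)" for x y :: "'k ytensor" and c
    by (metis mult.assoc ytensor_scalar_commute)
  obtain h :: "'k yangian2 \<Rightarrow> 'k ytensor" where h: "\<And>x y. h (x + y) = h x + h y" "\<And>x y. h (x * y) = h x * h y"
    "\<And>c. h (yangian_scalar c) = leg1 (yangian_scalar c)" "\<And>i j r. h (yangian_t i j r) = t_coprod i j r"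
    by (rule yangian_universal[of "(*) :: 'k ytensor \<Rightarrow> _" "\<lambda>c :: 'k. leg1 (yangian_scalar c)"
          "t_coprod :: 2 \<Rightarrow> 2 \<Rightarrow> nat \<Rightarrow> 'k ytensor"])
       (simp_all only: distrib_left distrib_right mult.assoc sc yangian_scalar_add yangian_scalar_mult leg_add leg_mult leg_one
          yangian_scalar_one mult_1 mult_1_right c.t_0 c.commutator_sum of_int_1, blast)
  have "h 1 = 1" using h(3)[of 1] by simp
  then have P: "?P (\<lambda>x. rep_yt (h x))"
    using h by (auto intro!: algebra_homsI linear_mapsI simp: rep_yt_simps(2,3,6) rep_scalar_mult[symmetric] sum)
  have "h' = h''" if "?P h'" "?P h''" for h' h''
    using that by (intro yangian_hom_ext[OF YY.k_algebra_axioms]) auto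
  from theI[where P = ?P, OF P this[OF _ P]] have "?P Y2_comult" unfolding Y2_comult_def .
  then show "(Y2_comult :: 'k yangian2 \<Rightarrow> _) \<in> algebra_homs Y2 YY"
    "Y2_comult (yangian_t i j r) = rep_yt (t_coprod i j r :: 'k ytensor)"
    by (simp_all only: sum)
qed

definition delta :: "'k::field yangian2 \<Rightarrow> 'k ytensor" where "delta x = abs_yt (Y2_comult x)"

lemma rep_delta: "rep_yt (delta x) = Y2_comult x"
  using linear_mapsD(1)[OF algebra_homsD(1)[OF Y2_comult(1)], of x] by (simp add: delta_def abs_yt_inverse)

interpretation delta: ring_1_hom delta
proof
  fix x y :: "'a yangian2"
  note c = algebra_homsD[OF Y2_comult(1)]
  note l = linear_mapsD[OF c(1)]
  show "delta (x + y) = delta x + delta y" "delta (x * y) = delta x * delta y" "delta (1 :: 'a yangian2) = 1"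
    unfolding rep_yt_inject[symmetric] rep_yt_simps rep_delta using l(2)[of x y] c(2)[of x y] c(3) by simp_all
qed

lemma delta_t: "delta (yangian_t i j r) = t_coprod i j r"
  by (simp add: rep_yt_inject[symmetric] rep_delta Y2_comult(2))

section \<open>Coassociativity, counit and antipode axioms\<close>

section \<open>The Hopf algebra structure of the Yangian\<close>

context abelian_monoid
begin

lemma finsum_swap:
  assumes "finite K" "finite L" "\<And>i j. f i j \<in> carrier G"
  shows "(\<Oplus>i\<in>K. \<Oplus>j\<in>L. f i j) = (\<Oplus>j\<in>L. \<Oplus>i\<in>K. f i j)"
  using assms(1)
proof (induction K rule: finite_induct)
  case empty
  then show ?case by (simp add: finsum_zero)
next
  case (insert i K)
  have "(\<Oplus>j\<in>L. \<Oplus>i\<in>insert i K. f i j) = (\<Oplus>j\<in>L. f i j \<oplus> (\<Oplus>i\<in>K. f i j))"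
    using insert assms by (intro finsum_cong') (auto simp: finsum_insert)
  also have "\<dots> = (\<Oplus>j\<in>L. f i j) \<oplus> (\<Oplus>j\<in>L. \<Oplus>i\<in>K. f i j)"
    using assms by (intro finsum_addf) auto
  finally show ?case using insert assms by (simp add: finsum_insert)
qed

text \<open>Both sides sum over the triples a + b + c = r, grouped by a + b on the left and by a on
  the right.\<close>

lemma finsum_triangle:
  fixes f :: "nat \<Rightarrow> nat \<Rightarrow> nat \<Rightarrow> 'a"
  assumes "\<And>a b c. f a b c \<in> carrier G"
  shows "(\<Oplus>s\<in>{..r}. \<Oplus>q\<in>{..s}. f q (s - q) (r - s)) = (\<Oplus>s\<in>{..r}. \<Oplus>q\<in>{..r - s}. f s q (r - s - q))"
  using assms
proof (induction r arbitrary: f)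
  case 0
  then show ?case by simp
next
  case (Suc r)
  have "(\<Oplus>s\<in>{..Suc r}. \<Oplus>q\<in>{..s}. f q (s - q) (Suc r - s))
    = (\<Oplus>s\<in>{..r}. \<Oplus>q\<in>{..Suc s}. f q (Suc s - q) (r - s)) \<oplus> f 0 0 (Suc r)"
    using Suc.prems by (subst finsum_Suc2) auto
  also have "(\<Oplus>s\<in>{..r}. \<Oplus>q\<in>{..Suc s}. f q (Suc s - q) (r - s))
    = (\<Oplus>s\<in>{..r}. (\<Oplus>q\<in>{..s}. f (Suc q) (s - q) (r - s)) \<oplus> f 0 (Suc s) (r - s))"
  proof -
    have "(\<Oplus>q\<in>{..Suc s}. f q (Suc s - q) (r - s)) = (\<Oplus>q\<in>{..s}. f (Suc q) (s - q) (r - s)) \<oplus> f 0 (Suc s) (r - s)" for s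
      using Suc.prems by (subst finsum_Suc2) auto
    then show ?thesis by (simp only:)
  qed
  also have "\<dots> = (\<Oplus>s\<in>{..r}. \<Oplus>q\<in>{..s}. f (Suc q) (s - q) (r - s)) \<oplus> (\<Oplus>s\<in>{..r}. f 0 (Suc s) (r - s))"
    using Suc.prems by (intro finsum_addf) auto
  also have "(\<Oplus>s\<in>{..r}. \<Oplus>q\<in>{..s}. f (Suc q) (s - q) (r - s)) = (\<Oplus>s\<in>{..r}. \<Oplus>q\<in>{..r - s}. f (Suc s) q (r - s - q))"
    using Suc.IH[of "\<lambda>a. f (Suc a)"] Suc.prems by simp
  also have "\<dots> \<oplus> (\<Oplus>s\<in>{..r}. f 0 (Suc s) (r - s)) \<oplus> f 0 0 (Suc r)
    = (\<Oplus>s\<in>{..r}. \<Oplus>q\<in>{..r - s}. f (Suc s) q (r - s - q)) \<oplus> (\<Oplus>q\<in>{..Suc r}. f 0 q (Suc r - q))"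
    using Suc.prems by (subst finsum_Suc2[of _ r]) (auto simp: a_assoc)
  also have "\<dots> = (\<Oplus>s\<in>{..Suc r}. \<Oplus>q\<in>{..Suc r - s}. f s q (Suc r - s - q))"
    using Suc.prems by (subst finsum_Suc2[of _ r]) auto
  finally show ?case .
qed

end

lemma linear_finsum:
  assumes "k_algebra A" "k_algebra B" and h: "h \<in> linear_maps A B" and "finite K" "\<And>k. f k \<in> carrier A"
  shows "h (finsum A f K) = finsum B (\<lambda>k. h (f k)) K"
proof -
  interpret A: k_algebra A by fact
  interpret B: k_algebra B by fact
  note l = linear_mapsD[OF h]
  show ?thesis using \<open>finite K\<close>
  proof (induction K rule: finite_induct)
    case empty
    then show ?case by (simp add: linear_maps_zero[OF assms(1-3)])
  next
    case (insert k K)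
    have "finsum A f K \<in> carrier A" using assms(5) by (intro A.finsum_closed) auto
    then show ?case using insert assms(5) l(1) by (simp add: A.finsum_insert B.finsum_insert l(2))
  qed
qed

lemma linear_comult:
  fixes h :: "('k::field, 'k yangian2, 'k yangian2) tensor \<Rightarrow> 'b"
  assumes B: "k_algebra B" and h: "h \<in> linear_maps YY B"
  shows "h (Y2_comult (yangian_t i j r))
    = finsum B (\<lambda>k. finsum B (\<lambda>s. h (ypure (yangian_t i k s) (yangian_t k j (r - s)))) {..r}) UNIV"
proof -
  have "Y2_comult (yangian_t i j r :: 'k yangian2)
    = finsum YY (\<lambda>k. finsum YY (\<lambda>s. ypure (yangian_t i k s) (yangian_t k j (r - s))) {..r}) UNIV"
    unfolding Y2_comult(2) rep_leg_mult(1)[symmetric] by (simp add: finsum_rep t_coprod_def)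
  moreover have "finsum YY (\<lambda>s. ypure (yangian_t i k s) (yangian_t k j (r - s))) {..r} \<in> carrier (YY :: ('k, _) module)" for k
    by (rule YY.finsum_closed) auto
  ultimately show ?thesis
    by (simp add: linear_finsum[OF YY.k_algebra_axioms B h])
qed

text \<open>Both sides are algebra homomorphisms and are compared on generators, where each is the
  sum of t_il^(a) (x) t_lm^(b) (x) t_mj^(c) over l, m and a + b + c = r.\<close>

lemma Y2_coassoc:
  fixes x :: "'k::field yangian2"
  shows "tensor_assoc Y2 (tensor_map YY Y2 Y2_comult (\<lambda>a. a) (Y2_comult x)) = tensor_map Y2 YY (\<lambda>a. a) Y2_comult (Y2_comult x)"
proof -
  note k = k_algebra_Y2 and kk = YY.k_algebra_axioms
  let ?AAA = "tensor_algebra Y2 YY :: ('k, _) module"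
  interpret L: tensor_product YY "Y2 :: ('k, _) module" by (intro tensor_product.intro k kk)
  interpret R: tensor_product "Y2 :: ('k, _) module" YY by (intro tensor_product.intro k kk)
  note idh = algebra_homs_id[of "Y2 :: ('k, _) module"]
  note idl = algebra_homsD(1)[OF idh] and cl = algebra_homsD(1)[OF Y2_comult(1)]
  note LH = tensor_map_hom[OF k k kk k Y2_comult(1) idh] and RH = tensor_map_hom[OF k k k kk idh Y2_comult(1)]
  note LP = tensor_map(2)[OF k k kk k cl idl] and RP = tensor_map(2)[OF k k k kk idl cl]
  note as = tensor_assoc[OF k_algebra_Y2]
  let ?l = "\<lambda>x :: 'k yangian2. tensor_assoc Y2 (tensor_map YY Y2 Y2_comult (\<lambda>a. a) (Y2_comult x))"
    and ?r = "\<lambda>x :: 'k yangian2. tensor_map Y2 YY (\<lambda>a. a) Y2_comult (Y2_comult x)"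
  note hl = algebra_homs_comp[OF algebra_homs_comp[OF Y2_comult(1) LH] as(1)]
  note hr = algebra_homs_comp[OF Y2_comult(1) RH]
  have "?l = ?r"
  proof (rule yangian_hom_ext[OF R.T.k_algebra_axioms hl hr])
    fix i j r
    define F where "F l m a b c = R.pure (yangian_t i l a) (ypure (yangian_t l m b) (yangian_t m j c))" for l m a b c
    have F: "F l m a b c \<in> carrier ?AAA" for l m a b c by (simp add: F_def)
    have cc: "Y2_comult x \<in> carrier YY" for x :: "'k yangian2" using linear_mapsD(1)[OF cl] by simp
    have "?l (yangian_t i j r) = finsum ?AAA (\<lambda>m. finsum ?AAA (\<lambda>s.
        tensor_assoc Y2 (L.pure (Y2_comult (yangian_t i m s)) (yangian_t m j (r - s)))) {..r}) UNIV"
      using linear_comult[OF R.T.k_algebra_axioms linear_maps_comp[OF algebra_homsD(1)[OF LH] algebra_homsD(1)[OF as(1)]], of i j r]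
      by (simp add: LP)
    also have "\<dots> = finsum ?AAA (\<lambda>m. finsum ?AAA (\<lambda>s. finsum ?AAA (\<lambda>l. finsum ?AAA (\<lambda>q.
        F l m q (s - q) (r - s)) {..s}) UNIV) {..r}) UNIV"
    proof -
      have "tensor_assoc Y2 (L.pure (Y2_comult (yangian_t i m s)) b)
        = finsum ?AAA (\<lambda>l. finsum ?AAA (\<lambda>q. R.pure (yangian_t i l q) (ypure (yangian_t l m (s - q)) b)) {..s}) UNIV"
        for m s b
        using linear_comult[OF R.T.k_algebra_axioms linear_maps_comp[OF linear_pure(1)[OF kk k, of b] algebra_homsD(1)[OF as(1)]], of i m s]
        by (simp add: as(2))
      then show ?thesis by (simp add: F_def)
    qed
    also have "\<dots> = finsum ?AAA (\<lambda>m. finsum ?AAA (\<lambda>l. finsum ?AAA (\<lambda>s. finsum ?AAA (\<lambda>q.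
        F l m q (s - q) (r - s)) {..s}) {..r}) UNIV) UNIV"
      using F by (subst R.T.finsum_swap) (auto intro!: R.T.finsum_closed)
    also have "\<dots> = finsum ?AAA (\<lambda>m. finsum ?AAA (\<lambda>l. finsum ?AAA (\<lambda>s. finsum ?AAA (\<lambda>q.
        F l m s q (r - s - q)) {..r - s}) {..r}) UNIV) UNIV"
    proof -
      have "finsum ?AAA (\<lambda>s. finsum ?AAA (\<lambda>q. F l m q (s - q) (r - s)) {..s}) {..r}
        = finsum ?AAA (\<lambda>s. finsum ?AAA (\<lambda>q. F l m s q (r - s - q)) {..r - s}) {..r}" for l m
        by (rule R.T.finsum_triangle[OF F])
      then show ?thesis by (simp only:)
    qed
    also have "\<dots> = finsum ?AAA (\<lambda>l. finsum ?AAA (\<lambda>m. finsum ?AAA (\<lambda>s. finsum ?AAA (\<lambda>q.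
        F l m s q (r - s - q)) {..r - s}) {..r}) UNIV) UNIV"
      using F by (subst R.T.finsum_swap) (auto intro!: R.T.finsum_closed)
    also have "\<dots> = finsum ?AAA (\<lambda>l. finsum ?AAA (\<lambda>s. finsum ?AAA (\<lambda>m. finsum ?AAA (\<lambda>q.
        F l m s q (r - s - q)) {..r - s}) UNIV) {..r}) UNIV"
      using F by (subst R.T.finsum_swap) (auto intro!: R.T.finsum_closed)
    also have "\<dots> = finsum ?AAA (\<lambda>l. finsum ?AAA (\<lambda>s. R.pure (yangian_t i l s) (Y2_comult (yangian_t l j (r - s)))) {..r}) UNIV"
    proof -
      have "R.pure a (Y2_comult (yangian_t l j s))
        = finsum ?AAA (\<lambda>m. finsum ?AAA (\<lambda>q. R.pure a (ypure (yangian_t l m q) (yangian_t m j (s - q)))) {..s}) UNIV"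
        for l s a
        using linear_comult[OF R.T.k_algebra_axioms linear_pure(2)[OF k kk, of a], of l j s] by simp
      then show ?thesis by (simp add: F_def)
    qed
    also have "\<dots> = ?r (yangian_t i j r)"
      using linear_comult[OF R.T.k_algebra_axioms algebra_homsD(1)[OF RH], of i j r] by (simp add: RP)
    finally show "?l (yangian_t i j r) = ?r (yangian_t i j r)" .
  qed
  then show ?thesis by meson
qed

lemma bilinear_lift:
  fixes \<beta> :: "'k::field yangian2 \<Rightarrow> 'k yangian2 \<Rightarrow> 'k yangian2"
  assumes "bilinear Y2 Y2 Y2 \<beta>"
  defines "m \<equiv> \<lambda>z. tensor_lift Y2 \<beta> (rep_yt z)"
  shows "m (leg1 a * leg2 b) = \<beta> a b" "m (leg2 b * leg1 a) = \<beta> a b" "m (z + w) = m z + m w"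
    "tensor_lift Y2 \<beta> (Y2_comult x) = m (delta x)" "m (\<Sum>i\<in>K. f i) = (\<Sum>i\<in>K. m (f i))"
proof -
  note l = tensor_lift[OF k_algebra_Y2 k_algebra_Y2 k_algebra_Y2 assms(1)]
  show "m (leg1 a * leg2 b) = \<beta> a b" "m (leg2 b * leg1 a) = \<beta> a b"
    using l(2)[of a b] by (simp_all add: m_def rep_leg_mult)
  show add: "m (z + w) = m z + m w" for z w
    using linear_mapsD(2)[OF l(1)] by (simp add: m_def rep_yt_simps)
  show "tensor_lift Y2 \<beta> (Y2_comult x) = m (delta x)" by (simp add: m_def rep_delta)
  have "m 0 = 0" using add[of 0 0] by simp
  then show "m (\<Sum>i\<in>K. f i) = (\<Sum>i\<in>K. m (f i))"
    by (induction K rule: infinite_finite_induct) (simp_all add: add)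
qed

lemma bilinear_structure:
  "bilinear Y2 Y2 Y2 (\<lambda>a b. Y2_counit a \<odot>\<^bsub>Y2\<^esub> b)" "bilinear Y2 Y2 Y2 (\<lambda>a b. Y2_counit b \<odot>\<^bsub>Y2\<^esub> a)"
  "bilinear Y2 Y2 Y2 (\<lambda>a b. Y2_antipode a \<otimes>\<^bsub>Y2\<^esub> b)" "bilinear Y2 Y2 Y2 (\<lambda>a b. a \<otimes>\<^bsub>Y2\<^esub> Y2_antipode b)"
proof -
  have c: "x * (yangian_scalar c * y) = yangian_scalar c * (x * y)" for x y :: "'k::field yangian2" and c
    by (metis mult.assoc yangian_scalar_commute)
  have sc: "yangian_scalar d * (yangian_scalar c * y) = yangian_scalar c * (yangian_scalar d * y)" for y :: "'k::field yangian2" and c d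
    by (rule c)
  show "bilinear Y2 Y2 Y2 (\<lambda>a b. Y2_counit a \<odot>\<^bsub>Y2\<^esub> b)" "bilinear Y2 Y2 Y2 (\<lambda>a b. Y2_counit b \<odot>\<^bsub>Y2\<^esub> a)"
    by (rule bilinearI; simp add: counit_simps yangian_scalar_add yangian_scalar_mult sc
        distrib_left distrib_right mult.assoc)+
  show "bilinear Y2 Y2 Y2 (\<lambda>a b. Y2_antipode a \<otimes>\<^bsub>Y2\<^esub> b)" "bilinear Y2 Y2 Y2 (\<lambda>a b. a \<otimes>\<^bsub>Y2\<^esub> Y2_antipode b)"
    by (rule bilinearI; simp add: antipode_simps(1,4) c
        distrib_left distrib_right mult.assoc)+
qed

text \<open>The counit is multiplicative and its values act by central scalars, so the contraction
  is an algebra homomorphism and agreement on generators suffices.\<close>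

lemma Y2_counit_axioms:
  fixes x :: "'k::field yangian2"
  shows "tensor_lift Y2 (\<lambda>a b. Y2_counit a \<odot>\<^bsub>Y2\<^esub> b) (Y2_comult x) = x"
    and "tensor_lift Y2 (\<lambda>a b. Y2_counit b \<odot>\<^bsub>Y2\<^esub> a) (Y2_comult x) = x"
proof -
  note k = k_algebra_Y2
  have sc: "yangian_scalar c * x * (yangian_scalar d * y) = yangian_scalar (c * d) * (x * y)" for x y :: "'k yangian2" and c d
    by (metis mult.assoc yangian_scalar_commute yangian_scalar_mult)
  have h1: "tensor_lift Y2 (\<lambda>a b :: 'k yangian2. Y2_counit a \<odot>\<^bsub>Y2\<^esub> b) \<in> algebra_homs YY Y2"
    by (rule tensor_lift_algebra_hom[OF k k k bilinear_structure(1)])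
       (simp_all add: counit_simps sc)
  have h2: "tensor_lift Y2 (\<lambda>a b :: 'k yangian2. Y2_counit b \<odot>\<^bsub>Y2\<^esub> a) \<in> algebra_homs YY Y2"
    by (rule tensor_lift_algebra_hom[OF k k k bilinear_structure(2)])
       (simp_all add: counit_simps sc)
  have "(\<lambda>x. tensor_lift Y2 (\<lambda>a b :: 'k yangian2. Y2_counit a \<odot>\<^bsub>Y2\<^esub> b) (Y2_comult x)) = (\<lambda>x. x)"
  proof (rule yangian_hom_ext[OF k algebra_homs_comp[OF Y2_comult(1) h1] algebra_homs_id])
    fix i j r
    have "tensor_lift Y2 (\<lambda>a b :: 'k yangian2. Y2_counit a \<odot>\<^bsub>Y2\<^esub> b) (Y2_comult (yangian_t i j r))
      = (\<Sum>k\<in>UNIV. \<Sum>s\<le>r. if s = 0 then (if i = k then yangian_t k j r else 0) else 0)"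
      unfolding bilinear_lift(4)[OF bilinear_structure(1)] delta_t t_coprod_def bilinear_lift(5)[OF bilinear_structure(1)]
        bilinear_lift(1)[OF bilinear_structure(1)]
      by (intro sum.cong) (auto simp: Y2_counit(2))
    then show "tensor_lift Y2 (\<lambda>a b :: 'k yangian2. Y2_counit a \<odot>\<^bsub>Y2\<^esub> b) (Y2_comult (yangian_t i j r)) = yangian_t i j r"
      by (simp add: sum.delta sum.delta')
  qed
  then show "tensor_lift Y2 (\<lambda>a b. Y2_counit a \<odot>\<^bsub>Y2\<^esub> b) (Y2_comult x) = x" by meson
  have "(\<lambda>x. tensor_lift Y2 (\<lambda>a b :: 'k yangian2. Y2_counit b \<odot>\<^bsub>Y2\<^esub> a) (Y2_comult x)) = (\<lambda>x. x)"
  proof (rule yangian_hom_ext[OF k algebra_homs_comp[OF Y2_comult(1) h2] algebra_homs_id])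
    fix i j r
    have "tensor_lift Y2 (\<lambda>a b :: 'k yangian2. Y2_counit b \<odot>\<^bsub>Y2\<^esub> a) (Y2_comult (yangian_t i j r))
      = (\<Sum>k\<in>UNIV. \<Sum>s\<le>r. if s = r then (if k = j then yangian_t i k r else 0) else 0)"
      unfolding bilinear_lift(4)[OF bilinear_structure(2)] delta_t t_coprod_def bilinear_lift(5)[OF bilinear_structure(2)]
        bilinear_lift(1)[OF bilinear_structure(2)]
      by (intro sum.cong) (auto simp: Y2_counit(2))
    then show "tensor_lift Y2 (\<lambda>a b :: 'k yangian2. Y2_counit b \<odot>\<^bsub>Y2\<^esub> a) (Y2_comult (yangian_t i j r)) = yangian_t i j r"
      by (simp add: sum.delta sum.delta')
  qed
  then show "tensor_lift Y2 (\<lambda>a b. Y2_counit b \<odot>\<^bsub>Y2\<^esub> a) (Y2_comult x) = x" by meson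
qed

text \<open>The contraction m is not multiplicative, but m(z (a (x) b)) = S(a) m(z) b. If m(\<Delta>
  x) is a scalar it can be pulled out, so the identity passes from two factors to their product. The
  contraction n is treated symmetrically from the left.\<close>

lemma Y2_antipode_axioms:
  fixes x :: "'k::field yangian2"
  shows "tensor_lift Y2 (\<lambda>a b. Y2_antipode a \<otimes>\<^bsub>Y2\<^esub> b) (Y2_comult x) = Y2_counit x \<odot>\<^bsub>Y2\<^esub> \<one>\<^bsub>Y2\<^esub>"
    and "tensor_lift Y2 (\<lambda>a b. a \<otimes>\<^bsub>Y2\<^esub> Y2_antipode b) (Y2_comult x) = Y2_counit x \<odot>\<^bsub>Y2\<^esub> \<one>\<^bsub>Y2\<^esub>"
proof -
  have c: "x * (yangian_scalar c * y) = yangian_scalar c * (x * y)" for x y :: "'k yangian2" and c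
    by (metis mult.assoc yangian_scalar_commute)
  define m where "m z = tensor_lift Y2 (\<lambda>a b :: 'k yangian2. Y2_antipode a \<otimes>\<^bsub>Y2\<^esub> b) (rep_yt z)" for z
  define n where "n z = tensor_lift Y2 (\<lambda>a b :: 'k yangian2. a \<otimes>\<^bsub>Y2\<^esub> Y2_antipode b) (rep_yt z)" for z
  have M: "m (leg1 a * leg2 b) = Y2_antipode a * b" "m (z + w) = m z + m w"
    and M_sum: "m (\<Sum>i\<in>K. f i) = (\<Sum>i\<in>K. m (f i))" for a b z w and f :: "'z \<Rightarrow> _" and K
    unfolding m_def by (rule trans[OF bilinear_lift(1)[OF bilinear_structure(3)] Y2_simps(2)]
        bilinear_lift(3,5)[OF bilinear_structure(3)])+
  have N: "n (leg1 a * leg2 b) = a * Y2_antipode b" "n (z + w) = n z + n w"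
    and N_sum: "n (\<Sum>i\<in>K. f i) = (\<Sum>i\<in>K. n (f i))" for a b z w and f :: "'z \<Rightarrow> _" and K
    unfolding n_def by (rule trans[OF bilinear_lift(1)[OF bilinear_structure(4)] Y2_simps(2)]
        bilinear_lift(3,5)[OF bilinear_structure(4)])+
  have m1: "m (z * (leg1 a * leg2 b)) = Y2_antipode a * m z * b" for z a b
  proof (induction z rule: ytensor_induct)
    case (legs x y)
    have e: "leg1 x * leg2 y * (leg1 a * leg2 b) = leg1 (x * a) * leg2 (y * b)"
      unfolding leg_mult by (metis leg_commute mult.assoc)
    show ?case unfolding e by (simp add: M antipode_simps mult.assoc)
  qed (simp add: distrib_right distrib_left M)
  have m2: "m (delta x * z) = yangian_scalar (Y2_counit x) * m z" if "m (delta x) = yangian_scalar (Y2_counit x)" for x z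
    by (induction z rule: ytensor_induct) (simp_all add: m1 that M distrib_left c mult.assoc)
  have n1: "n (leg1 a * leg2 b * z) = a * n z * Y2_antipode b" for z a b
  proof (induction z rule: ytensor_induct)
    case (legs x y)
    have e: "leg1 a * leg2 b * (leg1 x * leg2 y) = leg1 (a * x) * leg2 (b * y)"
      unfolding leg_mult by (metis leg_commute mult.assoc)
    show ?case unfolding e by (simp add: N antipode_simps mult.assoc)
  qed (simp add: distrib_right distrib_left N)
  have n2: "n (z * delta y) = yangian_scalar (Y2_counit y) * n z" if "n (delta y) = yangian_scalar (Y2_counit y)" for y z
  proof (induction z rule: ytensor_induct)
    case (legs a b)
    show ?case by (simp only: n1 that N(1)) (simp only: c mult.assoc)
  qed (simp add: distrib_right distrib_left N)
  have delta_scalar: "delta (yangian_scalar c) = leg1 (yangian_scalar c) * leg2 1" for c :: 'k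
  proof -
    have "Y2_comult (yangian_scalar c) = c \<odot>\<^bsub>YY\<^esub> Y2_comult 1"
      using linear_mapsD(3)[OF algebra_homsD(1)[OF Y2_comult(1)], of 1 c] by simp
    moreover have "Y2_comult (1 :: 'k yangian2) = rep_yt 1"
      by (simp add: rep_delta[symmetric] delta.hom_one)
    ultimately show ?thesis
      using rep_scalar_mult[of c "1 :: 'k ytensor"] by (simp add: rep_yt_inject[symmetric] rep_delta)
  qed
  have "m (delta x) = yangian_scalar (Y2_counit x)"
  proof (induction x rule: yangian_induct)
    case (scalar c)
    have "Y2_antipode (yangian_scalar c) = yangian_scalar c" for c :: 'k
      using antipode_simps(4)[of c 1] by (simp add: antipode_simps(3))
    then show ?case unfolding delta_scalar M(1) by (simp add: counit_simps)
  next
    case (gen i j r)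
    have "m (delta (yangian_t i j r)) = (\<Sum>k\<in>UNIV. \<Sum>s\<le>r. t_inv i k s * yangian_t k j (r - s))"
      by (simp add: delta_t t_coprod_def M M_sum Y2_antipode(2))
    also have "\<dots> = fps_nth (\<Sum>k\<in>UNIV. t_inv_ser i k * t_ser k j) r"
      by (simp add: fps_sum_nth fps_mult_nth atLeast0AtMost)
    finally show ?case by (simp add: t_inv_mult Y2_counit(2))
  next
    case (add x y)
    then show ?case by (simp add: delta.hom_add M counit_simps yangian_scalar_add)
  next
    case (mult x y)
    then show ?case by (simp add: delta.hom_mult m2 counit_simps yangian_scalar_mult)
  qed
  then show "tensor_lift Y2 (\<lambda>a b. Y2_antipode a \<otimes>\<^bsub>Y2\<^esub> b) (Y2_comult x) = Y2_counit x \<odot>\<^bsub>Y2\<^esub> \<one>\<^bsub>Y2\<^esub>"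
    by (simp add: m_def rep_delta)
  have "n (delta x) = yangian_scalar (Y2_counit x)"
  proof (induction x rule: yangian_induct)
    case (scalar c)
    show ?case unfolding delta_scalar N(1) by (simp add: counit_simps antipode_simps(3))
  next
    case (gen i j r)
    have "n (delta (yangian_t i j r)) = (\<Sum>k\<in>UNIV. \<Sum>s\<le>r. yangian_t i k s * t_inv k j (r - s))"
      by (simp add: delta_t t_coprod_def N N_sum Y2_antipode(2))
    also have "\<dots> = fps_nth (\<Sum>k\<in>UNIV. t_ser i k * t_inv_ser k j) r"
      by (simp add: fps_sum_nth fps_mult_nth atLeast0AtMost)
    finally show ?case by (simp add: t_inv_mult Y2_counit(2))
  next
    case (add x y)
    then show ?case by (simp add: delta.hom_add N counit_simps yangian_scalar_add)
  next
    case (mult x y)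
    then show ?case
      by (simp add: delta.hom_mult n2 counit_simps) (metis yangian_scalar_mult mult.commute)
  qed
  then show "tensor_lift Y2 (\<lambda>a b. a \<otimes>\<^bsub>Y2\<^esub> Y2_antipode b) (Y2_comult x) = Y2_counit x \<odot>\<^bsub>Y2\<^esub> \<one>\<^bsub>Y2\<^esub>"
    by (simp add: n_def rep_delta)
qed

lemma hopf_algebra_Y2: "hopf_algebra (Y2 :: ('k::field, 'k yangian2) module) Y2_comult Y2_counit Y2_antipode"
proof (intro hopf_algebra.intro hopf_algebra_axioms.intro k_algebra_Y2)
  show "(Y2_antipode :: 'k yangian2 \<Rightarrow> _) \<in> linear_maps Y2 Y2"
    by (rule CollectD[OF Y2_antipode(1)[unfolded algebra_antihoms_def], THEN conjunct1])
qed (rule Y2_comult Y2_counit Y2_coassoc Y2_counit_axioms Y2_antipode_axioms)+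

section \<open>Congruences between series modulo an ideal of coefficients\<close>

section \<open>Ideals of coefficients\<close>

definition two_sided :: "'a::ring_1 set \<Rightarrow> bool" where
  "two_sided J \<longleftrightarrow> additive_set J \<and> (\<forall>x\<in>J. \<forall>a. a * x \<in> J \<and> x * a \<in> J)"

lemma two_sidedD:
  assumes "two_sided J"
  shows "additive_set J" "x \<in> J \<Longrightarrow> a * x \<in> J" "x \<in> J \<Longrightarrow> x * a \<in> J"
    "0 \<in> J" "x \<in> J \<Longrightarrow> y \<in> J \<Longrightarrow> x + y \<in> J" "x \<in> J \<Longrightarrow> y \<in> J \<Longrightarrow> x - y \<in> J" "x \<in> J \<Longrightarrow> - x \<in> J"
  using assms additive_set_zero[of J] additive_set_add[of J x y] additive_set_diff[of J x y] additive_set_uminus[of J x]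
  by (auto simp: two_sided_def)

lemma two_sidedI:
  assumes "0 \<in> J" "\<And>x y. x \<in> J \<Longrightarrow> y \<in> J \<Longrightarrow> x + y \<in> J"
    "\<And>x a. x \<in> J \<Longrightarrow> a * x \<in> J" "\<And>x a. x \<in> J \<Longrightarrow> x * a \<in> J"
  shows "two_sided J"
proof -
  have "x - y \<in> J" if "x \<in> J" "y \<in> J" for x y
    using assms(2)[OF that(1) assms(3)[OF that(2), of "- 1"]] by simp
  then show ?thesis using assms by (simp add: two_sided_def additive_set_def)
qed

lemma (in ring_1_hom) two_sided_vimage: "two_sided J \<Longrightarrow> two_sided {x. h x \<in> J}"
  by (rule two_sidedI) (simp_all add: hom_zero hom_add hom_mult two_sidedD)

definition coeffs_in :: "'a::ring_1 set \<Rightarrow> 'a fps set" where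
  "coeffs_in J = {a. \<forall>n. fps_nth a n \<in> J}"

lemma two_sided_coeffs_in: "two_sided J \<Longrightarrow> two_sided (coeffs_in J)"
  by (rule two_sidedI)
     (auto simp: coeffs_in_def fps_mult_nth two_sidedD intro!: additive_set_sum[OF two_sidedD(1)])

lemma coeffs_in_diff_one:
  assumes "0 \<in> J" "fps_nth a 0 = 1"
  shows "a - 1 \<in> coeffs_in J \<longleftrightarrow> (\<forall>n>0. fps_nth a n \<in> J)"
proof
  assume "\<forall>n>0. fps_nth a n \<in> J"
  then have "fps_nth (a - 1) n \<in> J" for n using assms by (cases n) auto
  then show "a - 1 \<in> coeffs_in J" by (simp add: coeffs_in_def)
next
  assume a: "a - 1 \<in> coeffs_in J"
  show "\<forall>n>0. fps_nth a n \<in> J"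
  proof (intro allI impI)
    fix n :: nat assume "n > 0"
    then show "fps_nth a n \<in> J" using a unfolding coeffs_in_def by (auto dest!: spec[of _ n])
  qed
qed

lemma two_sided_unit_cancel:
  assumes J: "two_sided J" and u: "fps_nth u 0 = 1"
  shows "u * a \<in> coeffs_in J \<longleftrightarrow> a \<in> coeffs_in J" "a * u \<in> coeffs_in J \<longleftrightarrow> a \<in> coeffs_in J"
proof -
  note K = two_sidedD[OF two_sided_coeffs_in[OF J]]
  obtain v where v: "v * u = 1" "u * v = 1" using fps_unit_inverse[OF u] by metis
  have "v * (u * a) = a" "a * u * v = a" by (simp_all only: mult.assoc[symmetric] v mult_1) (simp only: mult.assoc v mult_1_right)
  then show "u * a \<in> coeffs_in J \<longleftrightarrow> a \<in> coeffs_in J" "a * u \<in> coeffs_in J \<longleftrightarrow> a \<in> coeffs_in J"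
    using K(2,3) by metis+
qed

lemma two_sided_mult_diff_one:
  assumes J: "two_sided J" and "a - 1 \<in> J" "b - 1 \<in> J"
  shows "a * b - 1 \<in> J"
proof -
  have "a * b - 1 = (a - 1) * b + (b - 1)" by (simp add: left_diff_distrib)
  also have "\<dots> \<in> J" by (intro two_sidedD(5,3)[OF J] assms(2,3))
  finally show ?thesis .
qed

lemma shift_prod_zero: "n > 0 \<Longrightarrow> shift_prod \<kappa> n 0 = (0 :: 'a::ring_1 fps)"
proof -
  have "shift c 0 = (0 :: 'a fps)" for c using shift_diff[of c "0 :: 'a fps" 0] by simp
  then show "n > 0 \<Longrightarrow> shift_prod \<kappa> n 0 = (0 :: 'a fps)" by (cases n) (simp_all add: shift_prod_def)
qed

lemma shift_prod_one: "shift_prod \<kappa> n 1 = 1"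
  by (induction n) (simp_all add: shift_prod_def)

text \<open>The shifts of a commute with one another, hence also with the shifts of its inverse, so
  the factors cancel in pairs.\<close>

lemma shift_prod_inverse:
  fixes a b :: "'a::ring_1 fps"
  assumes ab: "a * b = 1" "b * a = 1" and comm: "\<And>c d. shift c a * shift d a = shift d a * shift c a"
  shows "shift_prod \<kappa> n b * shift_prod \<kappa> n a = 1"
proof (induction n)
  case 0
  then show ?case by (simp add: shift_prod_def)
next
  case (Suc n)
  let ?a = "shift (\<kappa> * int n) a" and ?b = "shift (\<kappa> * int n) b" and ?A = "shift_prod \<kappa> n a"
  have u: "?a * ?b = 1" "?b * ?a = 1" by (simp_all add: shift_mult[symmetric] ab)
  have "?a * ?A = ?A * ?a"
    unfolding shift_prod_def by (rule prod_list_commute) (auto intro: comm)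
  then have "?b * (?a * ?A) * ?b = ?b * (?A * ?a) * ?b" by simp
  then have "(?b * ?a) * ?A * ?b = ?b * ?A * (?a * ?b)" by (simp only: mult.assoc)
  then have c: "?A * ?b = ?b * ?A" by (simp add: u)
  have "shift_prod \<kappa> (Suc n) b * shift_prod \<kappa> (Suc n) a = shift_prod \<kappa> n b * (?b * ?A) * ?a"
    by (simp add: shift_prod_def mult.assoc)
  also have "\<dots> = shift_prod \<kappa> n b * ?A * (?b * ?a)" by (simp only: c[symmetric] mult.assoc)
  finally show ?case by (simp add: u Suc)
qed

lemma fps_inverse_commute: "b * a = 1 \<Longrightarrow> fps_nth a 0 = 1 \<Longrightarrow> a * b = (1 :: 'a::ring_1 fps)"
proof -
  assume ba: "b * a = 1" and "fps_nth a 0 = 1"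
  then obtain v where v: "v * a = 1" "a * v = 1" using fps_unit_inverse by metis
  have "b = b * (a * v)" by (simp add: v)
  also have "\<dots> = v" by (simp only: mult.assoc[symmetric] ba mult_1)
  finally show ?thesis by (simp add: v)
qed

lemma commute_coeffs_iff: "fps_const x * a = a * fps_const x \<longleftrightarrow> (\<forall>n. x * fps_nth a n = fps_nth a n * x)"
  for a :: "'a::ring_1 fps"
  by (simp add: fps_eq_iff)

text \<open>Strips a unit off a central product: s_11 from s_12, and s'_22 from s'_21.\<close>

lemma commute_unit_cancel:
  fixes u :: "'a::ring_1 fps"
  assumes "fps_nth u 0 = 1" and c: "z * u = u * z" "z * (u * a) = u * a * z"
  shows "z * a = a * z"
proof -
  obtain v where v: "v * u = 1" using fps_unit_inverse[OF assms(1)] by metis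
  have "u * (z * a) = u * (a * z)" by (simp only: mult.assoc[symmetric] c(1)[symmetric]) (simp only: mult.assoc c(2))
  then have "v * u * (z * a) = v * u * (a * z)" by (simp only: mult.assoc)
  then show ?thesis by (simp add: v)
qed

lemma sum_delta_mult:
  fixes f :: "2 \<Rightarrow> 'a::ring_1"
  shows "(\<Sum>k\<in>UNIV. (if i = k then 1 else 0) * f k) = f i" "(\<Sum>k\<in>UNIV. f k * (if k = j then 1 else 0)) = f j"
  using exhaust_2[of i] exhaust_2[of j] by (auto simp: UNIV_2)

lemma inverse_matrix_unique:
  fixes A B C :: "2 \<Rightarrow> 2 \<Rightarrow> 'a::ring_1"
  assumes "\<And>i j. (\<Sum>k\<in>UNIV. A i k * B k j) = (if i = j then 1 else 0)"
    and "\<And>i j. (\<Sum>k\<in>UNIV. B i k * C k j) = (if i = j then 1 else 0)"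
  shows "A i j = C i j"
proof -
  have "A i j = (\<Sum>l\<in>UNIV. A i l * (\<Sum>k\<in>UNIV. B l k * C k j))"
    by (simp only: assms(2) sum_delta_mult)
  also have "\<dots> = (\<Sum>k\<in>UNIV. (\<Sum>l\<in>UNIV. A i l * B l k) * C k j)"
    unfolding sum_distrib_left sum_distrib_right mult.assoc[symmetric] by (rule sum.swap)
  also have "\<dots> = C i j"
    by (simp only: assms(1) sum_delta_mult)
  finally show ?thesis .
qed

section \<open>Centrality of the generators and description of the ideal by entries of the two
  matrices\<close>

section \<open>The $p$-center\<close>

lemma yangian_central:
  assumes "\<And>i j r. yangian_t i j r * z = z * yangian_t i j r"
  shows "x * z = z * (x :: 'k::field yangian2)"
proof (induction x rule: yangian_induct)
  case (scalar c)
  show ?case by (rule yangian_scalar_commute)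
next
  case (mult x y)
  have "x * y * z = x * z * y" by (simp only: mult.assoc mult.IH(2))
  then show ?case by (simp only: mult.assoc mult.IH(1))
qed (simp_all add: assms distrib_left distrib_right)

text \<open>From z T^-1 = T^-1 z follows T z = z T on multiplying by T on both sides. The series s'
  are known to commute with the entries of the inverse matrix only, and this carries them to the
  generators.\<close>

lemma yangian_central_inv:
  assumes "\<And>i j r. t_inv i j r * z = z * t_inv i j r"
  shows "x * z = z * (x :: 'k::field yangian2)"
proof (rule yangian_central)
  fix i j r
  let ?z = "fps_const z"
  have c: "?z * t_inv_ser k l = t_inv_ser k l * ?z" for k l
    unfolding commute_coeffs_iff using assms by simp
  have "?z * t_ser i j = (\<Sum>l\<in>UNIV. (\<Sum>k\<in>UNIV. t_ser i k * t_inv_ser k l) * (?z * t_ser l j))"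
    by (simp only: t_inv_mult(1) sum_delta_mult)
  also have "\<dots> = (\<Sum>l\<in>UNIV. \<Sum>k\<in>UNIV. t_ser i k * (t_inv_ser k l * ?z) * t_ser l j)"
    by (simp only: sum_distrib_right mult.assoc)
  also have "\<dots> = (\<Sum>k\<in>UNIV. \<Sum>l\<in>UNIV. t_ser i k * (?z * t_inv_ser k l) * t_ser l j)"
    unfolding c by (rule sum.swap)
  also have "\<dots> = (\<Sum>k\<in>UNIV. t_ser i k * (?z * (\<Sum>l\<in>UNIV. t_inv_ser k l * t_ser l j)))"
    by (simp only: sum_distrib_left mult.assoc)
  also have "\<dots> = t_ser i j * ?z"
    by (simp only: t_inv_mult(2) sum_delta_mult mult.assoc[symmetric])
  finally show "yangian_t i j r * z = z * yangian_t i j r"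
    unfolding commute_coeffs_iff by simp
qed

text \<open>\<open>Y\<close> refers to T(u) and \<open>V\<close>, through the sublocale below, to
  its inverse with sign -1; \<open>Y.S\<close> and \<open>V.S\<close> are the series s and s' of the
  overview.\<close>

locale yangian_char = Y: rtt_char 1 "yangian_t :: 2 \<Rightarrow> 2 \<Rightarrow> nat \<Rightarrow> 'k::field yangian2" p for p +
  assumes p: "p = CHAR('k)"
begin

sublocale V: rtt_char "- 1" "t_inv :: 2 \<Rightarrow> 2 \<Rightarrow> nat \<Rightarrow> 'k yangian2" p
  by (intro rtt_char.intro rtt_t_inv rtt_char_axioms.intro Y.char Y.prime)

lemma b_series: "b_series i = shift_prod 1 p (d_series i :: 'k yangian2 fps)"
  by (simp add: b_series_def shift_prod_def p shift_series_eq_shift)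

lemma b_series_1: "b_series 1 = Y.S 1 1"
proof -
  obtain d2 e f :: "'k yangian2 fps" where "d_series 1 = (t_ser 1 1 :: 'k yangian2 fps)" using gauss by metis
  then show ?thesis by (simp add: b_series Y.S_eq_shift_prod_1)
qed

text \<open>By the Gauss factorization t'_22 = d_2^-1 and t'_21 = d_2^-1 (- f), so the factorization
  of the first row of T(u) repeats in the second row of the inverse, with root series - f.\<close>

lemma b_series_2: "b_series 2 * V.S 2 2 = 1" "V.S 2 2 * b_series 2 = 1"
  and S_12: "Y.S 1 2 = Y.S 1 1 * e_series ^ p" and S_inv_21: "V.S 2 1 = V.S 2 2 * (- f_series) ^ p"
  and e_root: "t_ser 1 2 = t_ser 1 1 * (e_series :: 'k yangian2 fps)"
  and f_root: "t_inv_ser 2 1 = t_inv_ser 2 2 * - (f_series :: 'k yangian2 fps)"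
  and e_f_nth_0: "fps_nth (e_series :: 'k yangian2 fps) 0 = 0" "fps_nth (f_series :: 'k yangian2 fps) 0 = 0"
proof -
  obtain d2 e f :: "'k yangian2 fps" where g: "t_ser 1 2 = t_ser 1 1 * e" "t_ser 2 1 = f * t_ser 1 1" "t_ser 2 2 = f * t_ser 1 1 * e + d2"
    and 0: "fps_nth e 0 = 0" "fps_nth f 0 = 0" "fps_nth d2 0 = 1" and s: "e_series = e" "f_series = f" "d_series 2 = d2"
    using gauss by metis
  obtain y where y: "y * d2 = 1" "d2 * y = 1" using fps_unit_inverse[OF 0(3)] by metis
  note inv = inverse_matrix_gauss(1,2)[OF g y]
  show "t_ser 1 2 = t_ser 1 1 * (e_series :: 'k yangian2 fps)" using g s by simp
  then show "Y.S 1 2 = Y.S 1 1 * e_series ^ p" by (rule Y.S_eq_mult_power)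
  show "t_inv_ser 2 1 = t_inv_ser 2 2 * - (f_series :: 'k yangian2 fps)" using inv s by simp
  then show "V.S 2 1 = V.S 2 2 * (- f_series) ^ p" by (rule V.S_eq_mult_power)
  show "fps_nth (e_series :: 'k yangian2 fps) 0 = 0" "fps_nth (f_series :: 'k yangian2 fps) 0 = 0" using 0 s by simp_all
  have "b_series 2 * V.S 2 2 = shift_prod 1 p d2 * shift_prod 1 p y"
    by (simp add: b_series s V.S_eq_shift_prod_1 inv)
  also have "\<dots> = 1"
    using V.shift_entry_commute[of _ 2 2] by (intro shift_prod_inverse y) (simp add: inv)
  finally show b: "b_series 2 * V.S 2 2 = 1" .
  then show "V.S 2 2 * b_series 2 = 1" by (rule fps_inverse_commute) (simp add: V.S_nth_0)
qed

lemma b_series_2_nth_0: "fps_nth (b_series 2 :: 'k yangian2 fps) 0 = 1"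
  using arg_cong[OF b_series_2(1), of "\<lambda>a. fps_nth a 0"] by (simp add: V.S_nth_0)

text \<open>For b_2 the claim is taken from its inverse s'_22, a shifted product of a single matrix
  entry, whose coefficients commute by \<open>commute_entry\<close>.\<close>

lemma shift_b_series: "shift 1 (b_series i) = (b_series i :: 'k yangian2 fps)"
proof -
  have "shift 1 (V.S 2 2) = V.S 2 2"
    unfolding V.S_eq_shift_prod_1 by (rule shift_shift_prod[OF Y.char]) (simp add: V.commute_entry)
  then have "shift 1 (b_series 2) * V.S 2 2 = b_series 2 * V.S 2 2"
    using shift_mult[of 1 "b_series 2" "V.S 2 2"] by (simp add: b_series_2)
  then have "shift 1 (b_series 2) * (V.S 2 2 * b_series 2) = b_series 2 * (V.S 2 2 * b_series 2)"
    by (simp only: mult.assoc[symmetric])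
  then have "shift 1 (b_series 2) = (b_series 2 :: 'k yangian2 fps)" by (simp add: b_series_2)
  moreover have "shift 1 (b_series 1) = (b_series 1 :: 'k yangian2 fps)"
    unfolding b_series_1 Y.S_eq_shift_prod_1 by (rule shift_shift_prod[OF Y.char]) (simp add: Y.commute_entry)
  ultimately show ?thesis using exhaust_2[of i] by auto
qed

lemma S_coeff_central: "x * fps_nth (Y.S i j) n = fps_nth (Y.S i j) n * x"
  by (rule yangian_central) (use Y.S_central in \<open>simp add: commute_coeffs_iff\<close>)

lemma S_inv_coeff_central: "x * fps_nth (V.S i j) n = fps_nth (V.S i j) n * x"
  by (rule yangian_central_inv) (use V.S_central in \<open>simp add: commute_coeffs_iff\<close>)

lemma uminus_power_in: "additive_set J \<Longrightarrow> (- x) ^ n \<in> J \<longleftrightarrow> x ^ n \<in> J" for x :: "'a::ring_1"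
  using additive_set_uminus[of J "x ^ n"] additive_set_uminus[of J "- (x ^ n)"] by (auto simp: uminus_power_if)

lemma f_root_coeffs_iff:
  assumes J: "additive_set J"
  shows "(\<forall>n. fps_nth ((- f_series) ^ p) n \<in> J) \<longleftrightarrow> (\<forall>r>0. fps_nth f_series r ^ p \<in> (J :: 'k yangian2 set))"
  using V.root_power_coeffs_iff[OF f_root _ J] by (simp add: e_f_nth_0 uminus_power_in[OF J])

lemma p_center_generators_eq:
  "(p_center_generators :: 'k yangian2 set) = {fps_nth (b_series i) (r * p) | i r. r > 0} \<union> {fps_nth e_series r ^ p | r. r > 0} \<union>
    {fps_nth f_series r ^ p | r. r > 0}"
  by (simp add: p_center_generators_def p)

lemma generators_subset_iff:
  "p_center_generators \<subseteq> J \<longleftrightarrow> (\<forall>i. \<forall>r>0. fps_nth (b_series i) (r * p) \<in> J) \<and> (\<forall>r>0. fps_nth e_series r ^ p \<in> J)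
    \<and> (\<forall>r>0. fps_nth f_series r ^ p \<in> (J :: 'k yangian2 set))"
  unfolding p_center_generators_eq by blast

text \<open>The centralizer of x is an additive set. Dividing the central s_12 by the unit s_11
  gives commutation with e(u)^p, and \<open>root_power_coeffs_iff\<close> turns this into
  commutation with the p-th powers of the coefficients; f is handled in the same way through
  s'.\<close>

lemma generators_central:
  assumes "g \<in> p_center_generators"
  shows "x * g = g * (x :: 'k yangian2)"
proof -
  let ?J = "{g. x * g = g * x}" and ?x = "fps_const x"
  have J: "additive_set ?J" by (simp add: additive_set_def left_diff_distrib right_diff_distrib)
  have S: "?x * Y.S i j = Y.S i j * ?x" "?x * V.S i j = V.S i j * ?x" for i j
    unfolding commute_coeffs_iff by (intro allI S_coeff_central S_inv_coeff_central)+
  have "?x * e_series ^ p = e_series ^ p * ?x"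
    by (rule commute_unit_cancel[of "Y.S 1 1"]) (simp_all add: S Y.S_nth_0 S_12[symmetric])
  then have e: "\<forall>r>0. fps_nth e_series r ^ p \<in> ?J"
    using Y.root_power_coeffs_iff[OF e_root e_f_nth_0(1) J] by (simp add: commute_coeffs_iff)
  have "?x * (- f_series) ^ p = (- f_series) ^ p * ?x"
    by (rule commute_unit_cancel[of "V.S 2 2"]) (simp_all add: S V.S_nth_0 S_inv_21[symmetric])
  then have f: "\<forall>r>0. fps_nth f_series r ^ p \<in> ?J"
    using f_root_coeffs_iff[OF J] by (simp add: commute_coeffs_iff)
  have "?x * b_series 2 = b_series 2 * ?x"
    by (rule commute_unit_cancel[of "V.S 2 2"]) (simp_all add: S V.S_nth_0 b_series_2)
  then have "?x * b_series i = b_series i * ?x" for i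
    using exhaust_2[of i] S by (auto simp: b_series_1)
  then have "\<forall>i. \<forall>r>0. fps_nth (b_series i) (r * p) \<in> ?J" by (simp add: commute_coeffs_iff)
  with e f have "p_center_generators \<subseteq> ?J" by (simp only: generators_subset_iff)
  with assms show ?thesis by blast
qed

text \<open>
  With this criterion no formula for the coproduct of the Drinfeld generators is needed.
\<close>

lemma generators_subset_ideal_iff:
  assumes J: "two_sided (J :: 'k yangian2 set)"
  shows "p_center_generators \<subseteq> J \<longleftrightarrow> Y.S 1 1 - 1 \<in> coeffs_in J \<and> Y.S 1 2 \<in> coeffs_in J \<and>
    V.S 2 2 - 1 \<in> coeffs_in J \<and> V.S 2 1 \<in> coeffs_in J"
proof -
  note K = two_sidedD[OF two_sided_coeffs_in[OF J]]
  have p0: "p > 0" using Y.prime prime_gt_0_nat by blast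
  \<comment> \<open>Shift invariance recovers all nonconstant coefficients of b_i from those with
    index divisible by p.\<close>
  have b: "(\<forall>r>0. fps_nth (b_series i) (r * p) \<in> J) \<longleftrightarrow> b_series i - 1 \<in> coeffs_in J" for i
  proof -
    have "fps_nth (b_series i :: 'k yangian2 fps) 0 = 1"
      using exhaust_2[of i] by (auto simp: b_series_1 Y.S_nth_0 b_series_2_nth_0)
    then show ?thesis
      using shift_invariant_coeffs[OF shift_b_series Y.char Y.prime two_sidedD(1)[OF J], of i] p0
      by (auto simp: coeffs_in_diff_one[OF two_sidedD(4)[OF J]])
  qed
  \<comment> \<open>b_2 and s'_22 are mutually inverse, so they are congruent to 1
    simultaneously.\<close>
  have "V.S 2 2 - 1 = - (V.S 2 2 * (b_series 2 - 1))" "b_series 2 - 1 = - (b_series 2 * (V.S 2 2 - 1))"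
    by (simp_all add: right_diff_distrib b_series_2)
  then have b2: "b_series 2 - 1 \<in> coeffs_in J \<longleftrightarrow> V.S 2 2 - 1 \<in> coeffs_in J"
    using K(2,7) by metis
  have e: "(\<forall>r>0. fps_nth e_series r ^ p \<in> J) \<longleftrightarrow> Y.S 1 2 \<in> coeffs_in J"
    using Y.root_power_coeffs_iff[OF e_root e_f_nth_0(1) two_sidedD(1)[OF J]] two_sided_unit_cancel(1)[OF J, of "Y.S 1 1" "e_series ^ p"]
    by (simp add: S_12 Y.S_nth_0) (simp add: coeffs_in_def)
  have f: "(\<forall>r>0. fps_nth f_series r ^ p \<in> J) \<longleftrightarrow> V.S 2 1 \<in> coeffs_in J"
    using f_root_coeffs_iff[OF two_sidedD(1)[OF J]] two_sided_unit_cancel(1)[OF J, of "V.S 2 2" "(- f_series) ^ p"]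
    by (simp add: S_inv_21 V.S_nth_0) (simp add: coeffs_in_def)
  show ?thesis
    unfolding generators_subset_iff b e f forall_2 b2 b_series_1 by blast
qed

lemma p_center_central: "z \<in> p_center \<Longrightarrow> x * z = z * (x :: 'k yangian2)"
  unfolding p_center_def
proof (induction z arbitrary: x rule: subalgebra_generated.induct)
  case (subalg_base z)
  then show ?case by (rule generators_central)
next
  case (subalg_add z w)
  then show ?case by (simp add: distrib_left distrib_right)
next
  case (subalg_mult z w)
  have "x * (z * w) = x * z * w" by (simp only: mult.assoc)
  also have "\<dots> = z * (x * w)" by (simp only: subalg_mult.IH(1)[of x] mult.assoc)
  also have "\<dots> = z * w * x" by (simp only: subalg_mult.IH(2)[of x] mult.assoc)
  finally show ?case by simp
next
  case (subalg_smult z c)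
  have "x * (yangian_scalar c * z) = yangian_scalar c * x * z"
    by (simp only: mult.assoc[symmetric] yangian_scalar_commute[of c x])
  also have "\<dots> = yangian_scalar c * z * x" by (simp only: subalg_smult.IH[of x] mult.assoc)
  finally show ?case by simp
qed simp

lemma p_center_uminus: "z \<in> p_center \<Longrightarrow> - z \<in> (p_center :: 'k yangian2 set)"
proof -
  have "yangian_scalar (- 1) = (- 1 :: 'k yangian2)"
    using yangian_scalar_add[of "- 1 :: 'k" 1] by (simp add: eq_neg_iff_add_eq_0)
  then show "z \<in> p_center \<Longrightarrow> - z \<in> (p_center :: 'k yangian2 set)"
    using subalg_smult[of z Y2 p_center_generators "- 1"] by (simp add: p_center_def)
qed

lemma Y2_uminus: "\<ominus>\<^bsub>Y2\<^esub> x = - (x :: 'k yangian2)"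
proof -
  interpret k_algebra "Y2 :: ('k, 'k yangian2) module" by (rule k_algebra_Y2)
  show ?thesis using minus_equality[of "- x" x] by simp
qed

lemma p_center_ring: "ring (Y2\<lparr>carrier := p_center\<rparr> :: ('k, 'k yangian2) module)"
proof -
  interpret k_algebra "Y2 :: ('k, 'k yangian2) module" by (rule k_algebra_Y2)
  have "subring p_center (Y2 :: ('k, 'k yangian2) module)"
    using subalg_one[of Y2 p_center_generators] subalg_add[of _ Y2 p_center_generators] subalg_mult[of _ Y2 p_center_generators]
    by (intro subringI) (simp_all add: Y2_uminus p_center_uminus p_center_def[symmetric])
  then show ?thesis by (rule subring_is_ring)
qed

lemma generators_subset_p_center: "p_center_generators \<subseteq> (p_center :: 'k yangian2 set)"
  unfolding p_center_def by (rule subsetI) (rule subalg_base)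

lemma p_center_plus:
  "p_center_generators \<subseteq> (p_center_plus :: 'k yangian2 set)" "p_center_plus \<subseteq> (p_center :: 'k yangian2 set)"
  "0 \<in> (p_center_plus :: 'k yangian2 set)"
proof -
  interpret R: ring "Y2\<lparr>carrier := p_center\<rparr> :: ('k, 'k yangian2) module" by (rule p_center_ring)
  have G: "p_center_generators \<subseteq> carrier (Y2\<lparr>carrier := p_center\<rparr> :: ('k, 'k yangian2) module)"
    using generators_subset_p_center by simp
  interpret I: ideal "p_center_plus" "Y2\<lparr>carrier := p_center\<rparr> :: ('k, 'k yangian2) module"
    unfolding p_center_plus_def by (rule R.genideal_ideal[OF G])
  show "p_center_generators \<subseteq> (p_center_plus :: 'k yangian2 set)"
    unfolding p_center_plus_def by (rule R.genideal_self[OF G])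
  show "p_center_plus \<subseteq> (p_center :: 'k yangian2 set)" using I.a_subset by simp
  show "0 \<in> (p_center_plus :: 'k yangian2 set)" using I.zero_closed by simp
qed

text \<open>Closure under left multiplication is built into the definition; on the right, a factor
  is moved past an element of the p-center.\<close>

lemma two_sided_I_p: "two_sided (I_p :: 'k yangian2 set)"
proof (rule two_sidedI)
  have prod: "a * z \<in> I_p" if "z \<in> p_center_plus" for a z :: "'k yangian2"
    unfolding I_p_def using ideal_prod.prod[of a "carrier Y2" z p_center_plus Y2] that by simp
  show sum: "x + y \<in> I_p" if "x \<in> I_p" "y \<in> I_p" for x y :: "'k yangian2"
    using ideal_prod.sum[of x Y2 "carrier Y2" p_center_plus y] that by (simp add: I_p_def)
  show "0 \<in> (I_p :: 'k yangian2 set)" using prod[OF p_center_plus(3), of 0] by simp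
  fix x a :: "'k yangian2" assume x: "x \<in> I_p"
  show "a * x \<in> I_p"
    using x[unfolded I_p_def]
  proof (induction x rule: ideal_prod.induct)
    case (prod i j)
    then show ?case using \<open>\<And>z a. z \<in> p_center_plus \<Longrightarrow> a * z \<in> I_p\<close>[of j "a * i"] by (simp add: mult.assoc)
  next
    case (sum s1 s2)
    then show ?case using \<open>\<And>x y. x \<in> I_p \<Longrightarrow> y \<in> I_p \<Longrightarrow> x + y \<in> I_p\<close> by (simp add: distrib_left)
  qed
  show "x * a \<in> I_p"
    using x[unfolded I_p_def]
  proof (induction x rule: ideal_prod.induct)
    case (prod i j)
    then have "i * j * a = i * a * j"
      using p_center_central[of j a] p_center_plus(2) by (simp add: mult.assoc subset_iff)
    then show ?case using prod \<open>\<And>z a. z \<in> p_center_plus \<Longrightarrow> a * z \<in> I_p\<close>[of j "i * a"] by simp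
  next
    case (sum s1 s2)
    then show ?case using \<open>\<And>x y. x \<in> I_p \<Longrightarrow> y \<in> I_p \<Longrightarrow> x + y \<in> I_p\<close> by (simp add: distrib_right)
  qed
qed

lemma generators_subset_I_p: "p_center_generators \<subseteq> (I_p :: 'k yangian2 set)"
proof
  fix z :: "'k yangian2" assume "z \<in> p_center_generators"
  then show "z \<in> I_p"
    unfolding I_p_def using ideal_prod.prod[of 1 "carrier Y2" z p_center_plus Y2] p_center_plus(1) by auto
qed

text \<open>\<open>C \<inter> p_center\<close> is an ideal of the p-center containing the
  generators, hence contains the augmentation ideal. Applied to preimages under the structure maps,
  this reduces the Hopf conditions to the generators.\<close>

lemma I_p_subset:
  assumes C: "two_sided C" and G: "p_center_generators \<subseteq> C"
  shows "I_p \<subseteq> (C :: 'k yangian2 set)"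
proof -
  interpret R: ring "Y2\<lparr>carrier := p_center\<rparr> :: ('k, 'k yangian2) module" by (rule p_center_ring)
  have inv: "inv\<^bsub>add_monoid (Y2\<lparr>carrier := p_center\<rparr>)\<^esub> x = - x" if "x \<in> p_center" for x :: "'k yangian2"
    using R.minus_equality[of "- x" x] that p_center_uminus by (simp add: a_inv_def)
  note cl = R.a_closed[simplified] R.m_closed[simplified] R.zero_closed[simplified]
  have "inv\<^bsub>add_monoid (Y2\<lparr>carrier := p_center\<rparr>)\<^esub> x \<in> C \<inter> p_center" if "x \<in> C \<inter> p_center" for x :: "'k yangian2"
    unfolding inv[OF IntD2[OF that]] using that by (simp add: two_sidedD[OF C] p_center_uminus)
  then have "subgroup (C \<inter> p_center) (add_monoid (Y2\<lparr>carrier := p_center\<rparr> :: ('k, 'k yangian2) module))"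
    by (intro subgroup.intro) (simp_all add: two_sidedD[OF C] cl)
  then have "ideal (C \<inter> p_center) (Y2\<lparr>carrier := p_center\<rparr> :: ('k, 'k yangian2) module)"
    by (intro idealI R.ring_axioms) (simp_all add: two_sidedD[OF C] cl)
  then have "p_center_plus \<subseteq> C \<inter> p_center"
    unfolding p_center_plus_def by (rule R.genideal_minimal) (use G generators_subset_p_center in blast)
  then have C': "z \<in> p_center_plus \<Longrightarrow> z \<in> C" for z by blast
  show ?thesis
  proof
    fix x :: "'k yangian2" assume "x \<in> I_p"
    then show "x \<in> C"
      unfolding I_p_def
      by (induction x rule: ideal_prod.induct) (simp_all add: two_sidedD[OF C] C')
  qed
qed

lemma ideal_I_p: "ideal I_p (Y2 :: ('k, 'k yangian2) module)"
proof -
  interpret k_algebra "Y2 :: ('k, 'k yangian2) module" by (rule k_algebra_Y2)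
  have inv: "inv\<^bsub>add_monoid Y2\<^esub> x = - x" for x :: "'k yangian2"
    using Y2_uminus[of x] by (simp add: a_inv_def)
  show ?thesis
    by (intro idealI ring_axioms subgroup.intro, unfold inv) (simp_all add: two_sidedD[OF two_sided_I_p])
qed

lemmas I_p_series = generators_subset_I_p[unfolded generators_subset_ideal_iff[OF two_sided_I_p]]

end

section \<open>Stability of the ideal under comultiplication, counit and antipode\<close>

section \<open>The Hopf ideal\<close>

context ring_1_hom
begin

lemma map_fps_diff: "map_fps (a - b) = map_fps a - map_fps b"
  by (rule fps_ext) (simp add: hom_diff)

lemma map_fps_sum: "map_fps (\<Sum>i\<in>K. f i) = (\<Sum>i\<in>K. map_fps (f i))"
  by (induction K rule: infinite_finite_induct) (simp_all add: map_fps_zero map_fps_add)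

lemma coeffs_in_vimage: "a \<in> coeffs_in {x. h x \<in> J} \<longleftrightarrow> map_fps a \<in> coeffs_in J"
  by (simp add: coeffs_in_def)

lemma hom_of_nat: "h (of_nat n) = of_nat n"
  using hom_of_int[of "int n"] by simp

end

text \<open>Ring homomorphisms commute with shifted products, so \<open>S_product\<close> in the
  target ring applies. The legs are parameters because the inverse matrix uses them in the opposite
  order.\<close>

lemma S_coproduct:
  assumes t: "rtt_char \<kappa> t p" and h: "ring_1_hom h" "ring_1_hom h1" "ring_1_hom h2"
    and comm: "\<And>x y. h1 x * h2 y = h2 y * h1 x"
    and c: "\<And>i j. ring_1_hom.map_fps h (series t i j)
      = (\<Sum>k\<in>UNIV. ring_1_hom.map_fps h1 (series t i k) * ring_1_hom.map_fps h2 (series t k j))"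
  shows "ring_1_hom.map_fps h (rtt_char.S \<kappa> t p i j)
    = (\<Sum>k\<in>UNIV. ring_1_hom.map_fps h1 (rtt_char.S \<kappa> t p i k) * ring_1_hom.map_fps h2 (rtt_char.S \<kappa> t p k j))"
proof -
  interpret t: rtt_char \<kappa> t p by (rule t)
  interpret h: ring_1_hom h by (rule h)
  interpret h1: ring_1_hom h1 by (rule h)
  interpret h2: ring_1_hom h2 by (rule h)
  have char: "of_nat p = (0 :: 'b)"
    using h.hom_of_nat[of p] by (simp add: t.char h.hom_zero)
  have a: "rtt_char \<kappa> (\<lambda>i j r. h1 (t i j r)) p" and b: "rtt_char \<kappa> (\<lambda>i j r. h2 (t i j r)) p"
    by (intro rtt_char.intro h1.rtt_map h2.rtt_map t.rtt_axioms rtt_char_axioms.intro char t.prime)+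
  show ?thesis
    using S_product[OF a b comm, of "\<lambda>i j r. h (t i j r)" i j] c
    by (simp add: UNIV_2 rtt_char.S_def[OF a] rtt_char.S_def[OF b] t.S_def h.map_fps_shift_prod h1.map_fps_shift_prod
        h2.map_fps_shift_prod h.map_fps_series h1.map_fps_series h2.map_fps_series)
qed

text \<open>I (x) Y_2 + Y_2 (x) I, transported to the ring type of the tensor square.\<close>

definition tensor_ideal :: "'k::field yangian2 set \<Rightarrow> 'k ytensor set" where
  "tensor_ideal I = {z. rep_yt z \<in> lin_span YY
     ({ypure a b | a b. a \<in> I \<and> b \<in> carrier Y2} \<union> {ypure a b | a b. a \<in> carrier Y2 \<and> b \<in> I})}"

lemma two_sided_tensor_ideal:
  fixes I :: "'k::field yangian2 set"
  assumes I: "two_sided I"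
  shows "two_sided (tensor_ideal I)"
proof -
  let ?B = "{ypure a b | a b. a \<in> I \<and> b \<in> carrier Y2} \<union> {ypure a b | a b. a \<in> carrier Y2 \<and> b \<in> I}"
  note D = two_sidedD[OF I]
  have closed: "\<xi> \<in> carrier YY" if "\<xi> \<in> lin_span YY ?B" for \<xi>
    using that by (induction \<xi> rule: lin_span.induct) auto
  have mult: "ypure x y \<otimes>\<^bsub>YY\<^esub> \<xi> \<in> lin_span YY ?B \<and> \<xi> \<otimes>\<^bsub>YY\<^esub> ypure x y \<in> lin_span YY ?B"
    if "\<xi> \<in> lin_span YY ?B" for x y \<xi>
    using that
  proof (induction \<xi> rule: lin_span.induct)
    case span_zero
    show ?case by (simp add: lin_span.span_zero)
  next
    case (span_base \<xi>)
    then obtain a b where ab: "\<xi> = ypure a b" "a \<in> I \<or> b \<in> I" by auto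
    have "ypure (x * a) (y * b) \<in> ?B" "ypure (a * x) (b * y) \<in> ?B" using ab(2) D(2)[of a x] D(2)[of b y] D(3)[of a x] D(3)[of b y]
      unfolding Un_iff mem_Collect_eq Y2_simps(1) by blast+
    then show ?case
      unfolding ab(1) using lin_span.span_base[of _ ?B YY] by (simp add: YY_pure_mult)
  next
    case (span_add \<xi> \<eta>)
    then show ?case by (simp add: closed YY.r_distr YY.l_distr lin_span.span_add)
  next
    case (span_smult \<xi> c)
    then show ?case by (simp add: closed YY.smult_mult_left YY.smult_mult_right lin_span.span_smult)
  qed
  have m: "a * z \<in> tensor_ideal I \<and> z * a \<in> tensor_ideal I" if z: "z \<in> tensor_ideal I" for a z
  proof (induction a rule: ytensor_induct)
    case (legs x y)
    then show ?case
      using mult[of "rep_yt z" x y] z unfolding tensor_ideal_def mem_Collect_eq rep_yt_simps(6)[of _ z] rep_yt_simps(6)[of z]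
      by (simp only: rep_leg_mult)
  next
    case (add a b)
    then show ?case unfolding tensor_ideal_def by (simp add: distrib_left distrib_right rep_yt_simps(3) lin_span.span_add)
  qed
  show ?thesis
    by (rule two_sidedI) (use m in \<open>auto simp: tensor_ideal_def rep_yt_simps(1,3) lin_span.span_zero lin_span.span_add\<close>)
qed

lemma leg_in_tensor_ideal:
  assumes "x \<in> I"
  shows "leg1 x \<in> tensor_ideal I" "leg2 x \<in> tensor_ideal I"
  unfolding tensor_ideal_def mem_Collect_eq rep_leg using assms by (auto intro!: lin_span.span_base)

lemma delta_series:
  "delta.map_fps (t_ser i j) = (\<Sum>k\<in>UNIV. leg1.map_fps (t_ser i k) * leg2.map_fps (t_ser k j))"
  by (rule fps_ext) (simp add: delta_t t_coprod_def fps_sum_nth fps_mult_nth atLeast0AtMost)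

lemma leg_series_commute: "leg1.map_fps a * leg2.map_fps b = leg2.map_fps b * leg1.map_fps a"
  by (rule fps_commute_of_coeffs) (simp add: leg_commute)

text \<open>The matrix with reversed legs is a left inverse of the coproduct of T(u), and the
  coproduct of the inverse matrix is a right inverse.\<close>

lemma delta_inv_series:
  "delta.map_fps (t_inv_ser i j) = (\<Sum>k\<in>UNIV. leg2.map_fps (t_inv_ser i k) * leg1.map_fps (t_inv_ser k j :: 'k::field yangian2 fps))"
proof -
  define Q where "Q i j = (\<Sum>k\<in>UNIV. leg2.map_fps (t_inv_ser i k) * leg1.map_fps (t_inv_ser k j :: 'k yangian2 fps))" for i j
  have inv1: "(\<Sum>k\<in>UNIV. leg1.map_fps (t_inv_ser i k) * leg1.map_fps (t_ser k j)) = (if i = j then 1 else 0 :: 'k ytensor fps)" for i j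
    unfolding leg1.map_fps_mult[symmetric] leg1.map_fps_sum[symmetric] t_inv_mult
    by (simp add: leg1.map_fps_one leg1.map_fps_zero)
  have inv2: "(\<Sum>k\<in>UNIV. leg2.map_fps (t_inv_ser i k) * leg2.map_fps (t_ser k j)) = (if i = j then 1 else 0 :: 'k ytensor fps)" for i j
    unfolding leg2.map_fps_mult[symmetric] leg2.map_fps_sum[symmetric] t_inv_mult
    by (simp add: leg2.map_fps_one leg2.map_fps_zero)
  have "Q i j = delta.map_fps (t_inv_ser i j)"
  proof (rule inverse_matrix_unique)
    fix i j
    have "(\<Sum>k\<in>UNIV. Q i k * delta.map_fps (t_ser k j))
      = (\<Sum>k\<in>UNIV. \<Sum>l\<in>UNIV. \<Sum>m\<in>UNIV. leg2.map_fps (t_inv_ser i l) * (leg1.map_fps (t_inv_ser l k) * leg1.map_fps (t_ser k m)) * leg2.map_fps (t_ser m j))"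
      by (simp only: Q_def delta_series sum_distrib_left sum_distrib_right mult.assoc)
         (rule sum.cong[OF refl], rule sum.swap)
    also have "\<dots> = (\<Sum>l\<in>UNIV. \<Sum>m\<in>UNIV. \<Sum>k\<in>UNIV. leg2.map_fps (t_inv_ser i l) * (leg1.map_fps (t_inv_ser l k) * leg1.map_fps (t_ser k m)) * leg2.map_fps (t_ser m j))"
      by (subst sum.swap) (rule sum.cong[OF refl], rule sum.swap)
    also have "\<dots> = (\<Sum>l\<in>UNIV. \<Sum>m\<in>UNIV. leg2.map_fps (t_inv_ser i l) * (if l = m then 1 else 0) * leg2.map_fps (t_ser m j))"
      by (simp only: inv1[symmetric] sum_distrib_left sum_distrib_right)
    also have "\<dots> = (\<Sum>l\<in>UNIV. leg2.map_fps (t_inv_ser i l) * leg2.map_fps (t_ser l j))"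
      by (simp only: mult.assoc sum_distrib_left[symmetric] sum_delta_mult)
    finally show "(\<Sum>k\<in>UNIV. Q i k * delta.map_fps (t_ser k j)) = (if i = j then 1 else 0)"
      by (simp only: inv2)
    show "(\<Sum>k\<in>UNIV. delta.map_fps (t_ser i k) * delta.map_fps (t_inv_ser k j)) = (if i = j then 1 else 0)"
      unfolding delta.map_fps_mult[symmetric] delta.map_fps_sum[symmetric] t_inv_mult
      by (simp add: delta.map_fps_one delta.map_fps_zero)
  qed
  then show ?thesis by (simp add: Q_def)
qed

context yangian_char
begin

lemma delta_S: "delta.map_fps (Y.S i j) = (\<Sum>k\<in>UNIV. leg1.map_fps (Y.S i k) * leg2.map_fps (Y.S k j))"
  by (rule S_coproduct[OF Y.rtt_char_axioms delta.ring_1_hom_axioms leg1.ring_1_hom_axioms leg2.ring_1_hom_axioms leg_commute delta_series])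

lemma delta_S_inv: "delta.map_fps (V.S i j) = (\<Sum>k\<in>UNIV. leg1.map_fps (V.S k j) * leg2.map_fps (V.S i k))"
  unfolding leg_series_commute
  by (rule S_coproduct[OF V.rtt_char_axioms delta.ring_1_hom_axioms leg2.ring_1_hom_axioms leg1.ring_1_hom_axioms leg_commute[symmetric] delta_inv_series])

lemma counit_S:
  "Y2_counit (fps_nth (Y.S i j) n) = (if i = j \<and> n = 0 then 1 else 0 :: 'k)"
  "Y2_counit (fps_nth (V.S i j) n) = (if i = j \<and> n = 0 then 1 else 0 :: 'k)"
proof -
  interpret c: ring_1_hom "Y2_counit :: 'k yangian2 \<Rightarrow> 'k" by unfold_locales (simp_all add: counit_simps)
  have p0: "p > 0" using Y.prime prime_gt_0_nat by blast
  have \<delta>: "shift_prod \<kappa> p (if i = j then 1 else 0) = (if i = j then 1 else 0 :: 'k fps)" for \<kappa> and i j :: 2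
    using p0 by (simp add: shift_prod_one shift_prod_zero)
  have t: "c.map_fps (t_ser i j) = (if i = j then 1 else 0)" for i j
    by (rule fps_ext) (simp add: Y2_counit(2))
  have "(\<Sum>k\<in>UNIV. c.map_fps (t_ser i k) * c.map_fps (t_inv_ser k j)) = (if i = j then 1 else 0)" for i j
    unfolding c.map_fps_mult[symmetric] c.map_fps_sum[symmetric] t_inv_mult
    by (simp add: c.map_fps_one c.map_fps_zero)
  then have ti: "c.map_fps (t_inv_ser i j) = (if i = j then 1 else 0)" for i j
    by (simp only: t sum_delta_mult)
  have S: "c.map_fps (Y.S i j) = (if i = j then 1 else 0)" "c.map_fps (V.S i j) = (if i = j then 1 else 0)"
    by (simp_all only: Y.S_def V.S_def c.map_fps_shift_prod t ti \<delta>)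
  show "Y2_counit (fps_nth (Y.S i j) n) = (if i = j \<and> n = 0 then 1 else 0 :: 'k)"
    "Y2_counit (fps_nth (V.S i j) n) = (if i = j \<and> n = 0 then 1 else 0 :: 'k)"
    using S[THEN arg_cong, of "\<lambda>a. fps_nth a n"] by simp_all
qed

lemma counit_I_p: "x \<in> I_p \<Longrightarrow> Y2_counit x = (0 :: 'k)"
proof -
  interpret c: ring_1_hom "Y2_counit :: 'k yangian2 \<Rightarrow> 'k" by unfold_locales (simp_all add: counit_simps)
  have J: "two_sided {x. Y2_counit x \<in> {0 :: 'k}}"
    by (rule c.two_sided_vimage) (auto intro: two_sidedI)
  have "p_center_generators \<subseteq> {x. Y2_counit x \<in> {0 :: 'k}}"
    unfolding generators_subset_ideal_iff[OF J]
    by (auto simp: coeffs_in_def c.hom_diff counit_S c.hom_one c.hom_zero)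
  from I_p_subset[OF J this] show "x \<in> I_p \<Longrightarrow> Y2_counit x = (0 :: 'k)" by blast
qed

text \<open>Modulo the tensor ideal the first row of (s_ij) is (1, 0) on both legs, so the first row
  of the product matrix is (1, 0) again, whatever its second row is; likewise for the second row (0,
  1) of (s'_ij).\<close>

lemma delta_I_p: "x \<in> I_p \<Longrightarrow> delta x \<in> tensor_ideal (I_p :: 'k yangian2 set)"
proof -
  let ?K = "tensor_ideal (I_p :: 'k yangian2 set)"
  note K = two_sided_tensor_ideal[OF two_sided_I_p]
  note F = two_sided_coeffs_in[OF K]
  have l1: "leg1.map_fps a \<in> coeffs_in ?K" and l2: "leg2.map_fps a \<in> coeffs_in ?K" if "a \<in> coeffs_in I_p" for a :: "'k yangian2 fps"
    using that by (simp_all add: coeffs_in_def leg_in_tensor_ideal)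
  have l1': "leg1.map_fps a - 1 \<in> coeffs_in ?K" and l2': "leg2.map_fps a - 1 \<in> coeffs_in ?K"
    if "a - 1 \<in> coeffs_in I_p" for a :: "'k yangian2 fps"
    using l1[OF that] l2[OF that] by (simp_all add: leg1.map_fps_diff leg2.map_fps_diff leg1.map_fps_one leg2.map_fps_one)
  note s = I_p_series[THEN conjunct1] I_p_series[THEN conjunct2, THEN conjunct1]
    I_p_series[THEN conjunct2, THEN conjunct2, THEN conjunct1] I_p_series[THEN conjunct2, THEN conjunct2, THEN conjunct2]
  have J: "two_sided {x. delta x \<in> ?K}" by (rule delta.two_sided_vimage[OF K])
  have "p_center_generators \<subseteq> {x. delta x \<in> ?K}"
    unfolding generators_subset_ideal_iff[OF J] delta.coeffs_in_vimage delta.map_fps_diff delta.map_fps_one delta_S delta_S_inv UNIV_2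
  proof (intro conjI; simp)
    have "leg1.map_fps (Y.S 1 1) * leg2.map_fps (Y.S 1 1) - 1 + leg1.map_fps (Y.S 1 2) * leg2.map_fps (Y.S 2 1) \<in> coeffs_in ?K"
      by (intro two_sidedD(5)[OF F] two_sided_mult_diff_one[OF F] two_sidedD(3)[OF F] l1 l1' l2' s)
    then show "leg1.map_fps (Y.S 1 1) * leg2.map_fps (Y.S 1 1) + leg1.map_fps (Y.S 1 2) * leg2.map_fps (Y.S 2 1) - 1 \<in> coeffs_in ?K"
      by (simp only: diff_add_eq)
    show "leg1.map_fps (Y.S 1 1) * leg2.map_fps (Y.S 1 2) + leg1.map_fps (Y.S 1 2) * leg2.map_fps (Y.S 2 2) \<in> coeffs_in ?K"
      by (intro two_sidedD(5)[OF F] two_sidedD(2)[OF F l2[OF s(2)]] two_sidedD(3)[OF F l1[OF s(2)]])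
    have "leg1.map_fps (V.S 1 2) * leg2.map_fps (V.S 2 1) + (leg1.map_fps (V.S 2 2) * leg2.map_fps (V.S 2 2) - 1) \<in> coeffs_in ?K"
      by (intro two_sidedD(5)[OF F] two_sided_mult_diff_one[OF F] two_sidedD(2)[OF F] l2 l1' l2' s)
    then show "leg1.map_fps (V.S 1 2) * leg2.map_fps (V.S 2 1) + leg1.map_fps (V.S 2 2) * leg2.map_fps (V.S 2 2) - 1 \<in> coeffs_in ?K"
      by (simp only: add_diff_eq)
    show "leg1.map_fps (V.S 1 1) * leg2.map_fps (V.S 2 1) + leg1.map_fps (V.S 2 1) * leg2.map_fps (V.S 2 2) \<in> coeffs_in ?K"
      by (intro two_sidedD(5)[OF F] two_sidedD(2)[OF F l2[OF s(4)]] two_sidedD(3)[OF F l1[OF s(4)]])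
  qed
  from I_p_subset[OF J this] show "x \<in> I_p \<Longrightarrow> delta x \<in> ?K" by blast
qed

definition antipode_fps :: "'k yangian2 fps \<Rightarrow> 'k yangian2 fps" where
  "antipode_fps a = Abs_fps (\<lambda>n. Y2_antipode (fps_nth a n))"

text \<open>The antipode axiom coefficientwise: a matrix coproduct becomes the statement that the
  antipode yields an inverse matrix.\<close>

lemma antipode_convolution:
  assumes "delta.map_fps s = (\<Sum>k\<in>UNIV. leg1.map_fps (a k) * leg2.map_fps (b k))"
  shows "(\<Sum>k\<in>(UNIV :: 2 set). antipode_fps (a k) * b k) = Abs_fps (\<lambda>n. yangian_scalar (Y2_counit (fps_nth s n)))"
proof (rule fps_ext)
  fix n
  note bl = bilinear_structure(3)
  have "yangian_scalar (Y2_counit (fps_nth s n))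
    = tensor_lift Y2 (\<lambda>a b. Y2_antipode a \<otimes>\<^bsub>Y2\<^esub> b) (rep_yt (delta (fps_nth s n)))"
    using Y2_antipode_axioms(1)[of "fps_nth s n"] unfolding bilinear_lift(4)[OF bl] by (simp only: Y2_simps(3,6) mult_1_right)
  also have "delta (fps_nth s n) = (\<Sum>k\<in>UNIV. \<Sum>r=0..n. leg1 (fps_nth (a k) r) * leg2 (fps_nth (b k) (n - r)))"
    using arg_cong[OF assms, of "\<lambda>a. fps_nth a n"] by (simp add: fps_sum_nth fps_mult_nth)
  also have "tensor_lift Y2 (\<lambda>a b. Y2_antipode a \<otimes>\<^bsub>Y2\<^esub> b) (rep_yt \<dots>)
    = (\<Sum>k\<in>UNIV. \<Sum>r=0..n. Y2_antipode (fps_nth (a k) r) * fps_nth (b k) (n - r))"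
    unfolding bilinear_lift(5)[OF bl] bilinear_lift(1)[OF bl] by (simp only: Y2_simps(2))
  finally show "fps_nth (\<Sum>k\<in>UNIV. antipode_fps (a k) * b k) n = fps_nth (Abs_fps (\<lambda>n. yangian_scalar (Y2_counit (fps_nth s n)))) n"
    by (simp add: fps_sum_nth fps_mult_nth antipode_fps_def)
qed

lemma antipode_S:
  "antipode_fps (Y.S i 1) * Y.S 1 j + antipode_fps (Y.S i 2) * Y.S 2 j = (if i = j then 1 else 0)"
  "antipode_fps (V.S 1 j) * V.S i 1 + antipode_fps (V.S 2 j) * V.S i 2 = (if i = j then 1 else 0)"
proof -
  have "Abs_fps (\<lambda>n. yangian_scalar (if i = j \<and> n = 0 then 1 else 0 :: 'k)) = (if i = j then 1 else 0)"
    by (rule fps_ext) simp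
  then show "antipode_fps (Y.S i 1) * Y.S 1 j + antipode_fps (Y.S i 2) * Y.S 2 j = (if i = j then 1 else 0)"
    "antipode_fps (V.S 1 j) * V.S i 1 + antipode_fps (V.S 2 j) * V.S i 2 = (if i = j then 1 else 0)"
    using antipode_convolution[OF delta_S[of i j]] antipode_convolution[OF delta_S_inv[of i j]]
    by (simp_all add: counit_S UNIV_2)
qed

text \<open>The images S(s_ij) form a left inverse of (s_ij). Modulo \<open>I_p\<close> the relation
  S(s_11) s_12 + S(s_12) s_22 = 0 gives S(s_12) = 0, as s_12 vanishes and s_22 is a unit; then
  S(s_11) s_11 + S(s_12) s_21 = 1 gives S(s_11) = 1. The entries s'_21 and s'_22 follow in the same
  way, with the matrix factors in the order dictated by the reversed coproduct.\<close>

lemma antipode_I_p: "x \<in> I_p \<Longrightarrow> Y2_antipode x \<in> (I_p :: 'k yangian2 set)"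
proof -
  note I = two_sidedD[OF two_sided_I_p] and F = two_sidedD[OF two_sided_coeffs_in[OF two_sided_I_p]]
  note s = I_p_series[THEN conjunct1] I_p_series[THEN conjunct2, THEN conjunct1]
    I_p_series[THEN conjunct2, THEN conjunct2, THEN conjunct1] I_p_series[THEN conjunct2, THEN conjunct2, THEN conjunct2]
  let ?C = "{x. Y2_antipode x \<in> (I_p :: 'k yangian2 set)}"
  have S0: "Y2_antipode 0 = (0 :: 'k yangian2)" using antipode_simps(1)[of 0 0] by simp
  have J: "two_sided ?C"
    by (rule two_sidedI) (simp_all add: antipode_simps(1,2) S0 I)
  have C: "a \<in> coeffs_in ?C \<longleftrightarrow> antipode_fps a \<in> coeffs_in I_p" for a
    by (simp add: coeffs_in_def antipode_fps_def)
  have S1: "antipode_fps (a - 1) = antipode_fps a - 1" for a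
  proof -
    have "Y2_antipode (x - y) = Y2_antipode x - Y2_antipode y" for x y :: "'k yangian2"
      using antipode_simps(1)[of "x - y" y] by (simp add: eq_diff_eq)
    then show ?thesis by (intro fps_ext) (simp add: antipode_fps_def antipode_simps(3) S0)
  qed
  have unit: "x - 1 \<in> coeffs_in I_p" if "x * u + y = 1" "u - 1 \<in> coeffs_in I_p" "y \<in> coeffs_in I_p" for x y u :: "'k yangian2 fps"
  proof -
    have "x - 1 = x - (x * u + y)" by (simp only: that(1))
    also have "\<dots> = - (x * (u - 1)) - y" by (simp add: right_diff_distrib)
    also have "\<dots> \<in> coeffs_in I_p" by (rule F(6)[OF F(7)[OF F(2)[OF that(2)]] that(3)])
    finally show ?thesis .
  qed
  have zero: "x \<in> coeffs_in I_p" if "x * u + y = 0" "fps_nth u 0 = 1" "y \<in> coeffs_in I_p" for x y u :: "'k yangian2 fps"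
  proof -
    have "x * u = - y" using that(1) by (simp only: eq_neg_iff_add_eq_0)
    then have "x * u \<in> coeffs_in I_p" using F(7)[OF that(3)] by simp
    then show ?thesis using two_sided_unit_cancel(2)[OF two_sided_I_p that(2)] by blast
  qed
  have Y12: "antipode_fps (Y.S 1 2) \<in> coeffs_in I_p"
    using antipode_S(1)[of 1 2]
    by (intro zero[OF _ _ F(2)[OF s(2), of "antipode_fps (Y.S 1 1)"], of _ "Y.S 2 2"]) (simp_all add: Y.S_nth_0 add.commute)
  have Y11: "antipode_fps (Y.S 1 1) - 1 \<in> coeffs_in I_p"
    using antipode_S(1)[of 1 1] by (intro unit[OF _ s(1) F(3)[OF Y12]]) simp
  have V21: "antipode_fps (V.S 2 1) \<in> coeffs_in I_p"
    using antipode_S(2)[of 1 2]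
    by (intro zero[OF _ _ F(2)[OF s(4), of "antipode_fps (V.S 1 1)"], of _ "V.S 2 2"]) (simp_all add: V.S_nth_0 add.commute)
  have V22: "antipode_fps (V.S 2 2) - 1 \<in> coeffs_in I_p"
    using antipode_S(2)[of 2 2] by (intro unit[OF _ s(3) F(2)[OF s(4), of "antipode_fps (V.S 1 2)"]]) (simp add: add.commute)
  have "p_center_generators \<subseteq> ?C"
    unfolding generators_subset_ideal_iff[OF J] C S1 using Y12 Y11 V21 V22 by blast
  from I_p_subset[OF J this] show "x \<in> I_p \<Longrightarrow> Y2_antipode x \<in> (I_p :: 'k yangian2 set)" by blast
qed

lemma hopf_ideal_I_p: "hopf_ideal (Y2 :: ('k, 'k yangian2) module) Y2_comult Y2_counit Y2_antipode I_p"
proof (intro hopf_ideal.intro hopf_algebra_Y2 ideal_I_p hopf_ideal_axioms.intro)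
  fix x :: "'k yangian2" assume x: "x \<in> I_p"
  show "Y2_comult x \<in> lin_span YY
      ({ypure a b | a b. a \<in> I_p \<and> b \<in> carrier Y2} \<union> {ypure a b | a b. a \<in> carrier Y2 \<and> b \<in> I_p})"
    using delta_I_p[OF x] unfolding tensor_ideal_def mem_Collect_eq rep_delta .
  show "Y2_counit x = 0" "Y2_antipode x \<in> I_p" using counit_I_p[OF x] antipode_I_p[OF x] .
qed

end

theorem theorem2p8:
  assumes "CHAR('k::alg_closed_field) > 0"
  shows "hopf_ideal (Y2 :: ('k, 'k yangian2) module) Y2_comult Y2_counit Y2_antipode I_p \<and>
    (\<exists>\<Delta> \<epsilon> S.
       hopf_algebra (restricted_yangian :: ('k, 'k yangian2 set) module) \<Delta> \<epsilon> S \<and>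
       hopf_hom Y2 Y2_comult Y2_counit Y2_antipode restricted_yangian \<Delta> \<epsilon> S
         (\<lambda>x. I_p +>\<^bsub>Y2\<^esub> x))"
proof -
  \<comment> \<open>Scalars embed the integers of the field compatibly, so p is 0 in the Yangian as
    well.\<close>
  have "yangian_scalar (of_nat n) = (of_nat n :: 'k yangian2)" for n
    by (induction n) (simp_all add: yangian_scalar_add)
  from this[of "CHAR('k)"] have char: "of_nat CHAR('k) = (0 :: 'k yangian2)" by simp
  have "prime CHAR('k)" using assms by (rule prime_CHAR_semidom)
  with char have "yangian_char TYPE('k) CHAR('k)"
    by (intro yangian_char.intro rtt_char.intro rtt_yangian rtt_char_axioms.intro yangian_char_axioms.intro refl)
  note ideal = yangian_char.hopf_ideal_I_p[OF this]
  show ?thesis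
    using ideal hopf_ideal.quotient_hopf[OF ideal] unfolding restricted_yangian_def by blast
qed

end
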